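(* Let $d$, $\ell$, $q$ be positive integers with $q \geq d$, and set $\eta = \eta(d,\ell,q)$. The $(d,\ell,q)$-Uniformly Rainbow Free Coloring problem parameterized by the number of vertices $n$ admits a kernel with $O(n^{\eta})$ constraints, while for any real $\varepsilon > 0$, it does not admit a compression of size $O(n^{\eta-\varepsilon})$ unless $\mathsf{NP} \subseteq \mathsf{coNP}/\mathsf{poly}$.
   Context: For a coloring $c$ of a vertex set $V$, a set $A\subseteq V$ is rainbow if its vertices receive pairwise distinct colors. An $\ell$-tuple $(F_1,\dots,F_\ell)$ of $d$-subsets of $V$ is uniformly rainbow w.r.t. $c$ if the sets $\{c(v): v\in F_j\}$, $j\in[\ell]$, are all equal and of size $d$. The $(d,\ell,q)$-Uniformly Rainbow Free Coloring problem (for $q\ge d$): input is a graph $G=(V,E)$ and a collection $\mathcal{F}$ of $\ell$-tuples of $d$-subsets of $V$; decide whether there is a proper coloring $c:V\to[q]$ of $G$ such that no tuple of $\mathcal{F}$ is uniformly rainbow w.r.t. $c$. The number of constraints of an instance is $|E|+|\mathcal{F}|$; the parameter is $n=|V|$. $\eta(d,\ell,q)$ is defined as: $d\ell$ if $\ell\ge2$ and $q\ge d+2$; $d\ell-1$ if $\ell\ge2$, $q=d+1$ and $(d,\ell)\ne(1,2)$; $(d-1)\ell$ if ($\ell\ge2$ and $q=d\ge2$) or ($\ell=1$ and $d\ge3$); $2$ if $\ell=1$, $d\le2$ and $q\ge3$; $0$ if ($q=2$ and $d\ell\le2$) or $q=1$. A parameterized problem is a set $Q\subseteq\Sigma^*\times\mathbb{N}$.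 A compression of $Q$ into $Q'$ is a polynomial-time algorithm mapping $(x,k)$ to $(x',k')$ with $(x,k)\in Q\iff(x',k')\in Q'$ and $|x'|+k'\le h(k)$ for a computable $h$ (the size); $Q$ admits a compression of size $h$ if one exists into some parameterized problem. A kernel is a compression of a problem into itself; "a kernel with $O(n^\eta)$ constraints" means a kernelization whose output instance has $O(n^\eta)$ constraints. *)

theory Defs
  imports
    "HOL-Library.FuncSet"
    "HOL-Library.Landau_Symbols"
    "HOL-Computational_Algebra.Polynomial"
begin

section \<open>Turing machines and polynomial time\<close>

type_synonym word = "bool list"

text \<open>
  Deterministic multi-tape machines with two-way infinite tapes. States are the numbers below
  \<open>nstates\<close>, with start state 0; tape symbols are the numbers below \<open>nsyms\<close>, where 0 is the
  blank and 1, 2 stand for the bits. The machine halts where the transition function is \<open>None\<close>.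
\<close>

datatype move = Left | Stay | Right

fun offset :: "move \<Rightarrow> int" where
  "offset Left = -1"
| "offset Stay = 0"
| "offset Right = 1"

record tm =
  ntapes :: nat
  nsyms :: nat
  nstates :: nat
  delta :: "nat \<Rightarrow> nat list \<Rightarrow> (nat \<times> (nat \<times> move) list) option"

definition valid_tm :: "tm \<Rightarrow> bool" where
  "valid_tm M \<longleftrightarrow> ntapes M \<ge> 1 \<and> nsyms M \<ge> 3 \<and> nstates M \<ge> 1 \<and>
     (\<forall>s rs s' as. s < nstates M \<and> length rs = ntapes M \<and> set rs \<subseteq> {..<nsyms M} \<and>
        delta M s rs = Some (s', as) \<longrightarrow>
        s' < nstates M \<and> length as = ntapes M \<and> fst ` set as \<subseteq> {..<nsyms M})"

text \<open>A configuration is the state together with the content and head position of each tape.\<close>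

type_synonym config = "nat \<times> ((int \<Rightarrow> nat) \<times> int) list"

definition action :: "tm \<Rightarrow> config \<Rightarrow> (nat \<times> (nat \<times> move) list) option" where
  "action M c = delta M (fst c) (map (\<lambda>(t, p). t p) (snd c))"

definition step :: "tm \<Rightarrow> config \<Rightarrow> config" where
  "step M c = (case action M c of
       None \<Rightarrow> c
     | Some (s, as) \<Rightarrow> (s, map2 (\<lambda>(t, p) (a, m). (t(p := a), p + offset m)) (snd c) as))"

definition bit_sym :: "bool \<Rightarrow> nat" where
  "bit_sym b = (if b then 2 else 1)"

definition input_tape :: "word \<Rightarrow> int \<Rightarrow> nat" where
  "input_tape x i = (if 0 \<le> i \<and> i < int (length x) then bit_sym (x ! nat i) else 0)"

definition init_config :: "tm \<Rightarrow> word \<Rightarrow> config" where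
  "init_config M x = (0, (input_tape x, 0) # replicate (ntapes M - 1) (\<lambda>_. 0, 0))"

text \<open>The output is the word on the first tape from cell 0 up to the first blank.\<close>

definition has_output :: "config \<Rightarrow> word \<Rightarrow> bool" where
  "has_output c y \<longleftrightarrow>
     (\<forall>i < length y. fst (hd (snd c)) (int i) = bit_sym (y ! i)) \<and>
     fst (hd (snd c)) (int (length y)) = 0"

definition tm_computes :: "tm \<Rightarrow> word \<Rightarrow> nat \<Rightarrow> word \<Rightarrow> bool" where
  "tm_computes M x t y \<longleftrightarrow>
     (let c = (step M ^^ t) (init_config M x) in action M c = None \<and> has_output c y)"

definition polytime :: "('a \<Rightarrow> word) \<Rightarrow> ('b \<Rightarrow> word) \<Rightarrow> ('a \<Rightarrow> 'b) \<Rightarrow> bool" where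
  "polytime enc_in enc_out f \<longleftrightarrow>
     (\<exists>M (p :: nat poly). valid_tm M \<and>
        (\<forall>a. \<exists>t \<le> poly p (length (enc_in a)). tm_computes M (enc_in a) t (enc_out (f a))))"

definition enc_unary :: "nat \<Rightarrow> word" where
  "enc_unary k = replicate k True"

definition computable_fun :: "(nat \<Rightarrow> nat) \<Rightarrow> bool" where
  "computable_fun h \<longleftrightarrow>
     (\<exists>M. valid_tm M \<and> (\<forall>k. \<exists>t. tm_computes M (enc_unary k) t (enc_unary (h k))))"

text \<open>Pairing: the bits of the first word are doubled, and \<open>01\<close> acts as separator.\<close>

definition enc_pair :: "word \<times> word \<Rightarrow> word" where
  "enc_pair = (\<lambda>(x, y). concat (map (\<lambda>b. [b, b]) x) @ [False, True] @ y)"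


section \<open>Complexity classes\<close>

definition NP :: "word set set" where
  "NP = {L. \<exists>(R :: word \<times> word \<Rightarrow> bool) (p :: nat poly).
              polytime enc_pair (\<lambda>b. [b]) R \<and>
              (\<forall>x. x \<in> L \<longleftrightarrow> (\<exists>y. length y \<le> poly p (length x) \<and> R (x, y)))}"

definition coNP :: "word set set" where
  "coNP = {L. - L \<in> NP}"

definition with_poly_advice :: "word set set \<Rightarrow> word set set" where
  "with_poly_advice C =
     {L. \<exists>L' \<in> C. \<exists>(adv :: nat \<Rightarrow> word) (p :: nat poly).
           (\<forall>n. length (adv n) \<le> poly p n) \<and>
           (\<forall>x. x \<in> L \<longleftrightarrow> enc_pair (x, adv (length x)) \<in> L')}"


section \<open>Parameterized problems and compressions\<close>

type_synonym param_problem = "(word \<times> nat) set"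

text \<open>The parameter is written in unary, so running times are polynomial in \<open>|x| + k\<close>.\<close>

definition enc_param :: "word \<times> nat \<Rightarrow> word" where
  "enc_param = (\<lambda>(x, k). enc_pair (x, enc_unary k))"

definition is_compression ::
  "param_problem \<Rightarrow> param_problem \<Rightarrow> (nat \<Rightarrow> nat) \<Rightarrow> (word \<times> nat \<Rightarrow> word \<times> nat) \<Rightarrow> bool" where
  "is_compression Q Q' h f \<longleftrightarrow>
     polytime enc_param enc_param f \<and> computable_fun h \<and>
     (\<forall>x k. ((x, k) \<in> Q \<longleftrightarrow> f (x, k) \<in> Q') \<and>
            length (fst (f (x, k))) + snd (f (x, k)) \<le> h k)"

definition admits_compression :: "param_problem \<Rightarrow> (nat \<Rightarrow> nat) \<Rightarrow> bool" where
  "admits_compression Q h \<longleftrightarrow> (\<exists>Q' f. is_compression Q Q' h f)"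

definition admits_compression_of_size_O :: "param_problem \<Rightarrow> (nat \<Rightarrow> real) \<Rightarrow> bool" where
  "admits_compression_of_size_O Q g \<longleftrightarrow>
     (\<exists>h. admits_compression Q h \<and> (\<lambda>n. real (h n)) \<in> O(g))"

definition is_kernel :: "param_problem \<Rightarrow> (nat \<Rightarrow> nat) \<Rightarrow> (word \<times> nat \<Rightarrow> word \<times> nat) \<Rightarrow> bool" where
  "is_kernel Q h f \<longleftrightarrow> is_compression Q Q h f"


section \<open>Uniformly rainbow free coloring\<close>

definition uniformly_rainbow :: "nat \<Rightarrow> ('v \<Rightarrow> nat) \<Rightarrow> 'v set list \<Rightarrow> bool" where
  "uniformly_rainbow d c Fs \<longleftrightarrow>
     (\<forall>F \<in> set Fs. \<forall>F' \<in> set Fs. c ` F = c ` F') \<and> (\<forall>F \<in> set Fs. card (c ` F) = d)"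

record 'v urf_instance =
  verts :: "'v set"
  edges :: "'v set set"
  tuples :: "'v set list set"

definition valid_instance :: "nat \<Rightarrow> nat \<Rightarrow> 'v urf_instance \<Rightarrow> bool" where
  "valid_instance d l I \<longleftrightarrow> finite (verts I) \<and>
     (\<forall>e \<in> edges I. e \<subseteq> verts I \<and> card e = 2) \<and>
     (\<forall>Fs \<in> tuples I. length Fs = l \<and> (\<forall>F \<in> set Fs. F \<subseteq> verts I \<and> card F = d))"

definition num_constraints :: "'v urf_instance \<Rightarrow> nat" where
  "num_constraints I = card (edges I) + card (tuples I)"

definition proper_coloring :: "nat \<Rightarrow> 'v urf_instance \<Rightarrow> ('v \<Rightarrow> nat) \<Rightarrow> bool" where
  "proper_coloring q I c \<longleftrightarrow>
     c \<in> verts I \<rightarrow> {1..q} \<and> (\<forall>u v. {u, v} \<in> edges I \<longrightarrow> c u \<noteq> c v)"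

definition yes_instance :: "nat \<Rightarrow> nat \<Rightarrow> 'v urf_instance \<Rightarrow> bool" where
  "yes_instance d q I \<longleftrightarrow>
     (\<exists>c. proper_coloring q I c \<and> (\<forall>Fs \<in> tuples I. \<not> uniformly_rainbow d c Fs))"

text \<open>
  Instances on the vertex set \<open>{0, \<dots>, n - 1}\<close> are written as words by means of prefix-free codes
  for numbers (in unary), pairs and lists. Edges, tuples and \<open>d\<close>-subsets are listed in any
  order, but without repetition.
\<close>

definition enc_nat :: "nat \<Rightarrow> word" where
  "enc_nat n = replicate n True @ [False]"

definition enc_list :: "('a \<Rightarrow> word) \<Rightarrow> 'a list \<Rightarrow> word" where
  "enc_list e xs = concat (map (\<lambda>x. True # e x) xs) @ [False]"

definition encodes :: "word \<Rightarrow> nat urf_instance \<Rightarrow> bool" where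
  "encodes x I \<longleftrightarrow>
     (\<exists>n (es :: (nat \<times> nat) list) (fs :: nat list list list).
        x = enc_nat n @ enc_list (\<lambda>(u, v). enc_nat u @ enc_nat v) es
              @ enc_list (enc_list (enc_list enc_nat)) fs \<and>
        distinct (map (\<lambda>(u, v). {u, v}) es) \<and>
        distinct (map (map set) fs) \<and>
        (\<forall>Fs \<in> set fs. \<forall>F \<in> set Fs. distinct F) \<and>
        verts I = {..<n} \<and>
        edges I = set (map (\<lambda>(u, v). {u, v}) es) \<and>
        tuples I = set (map (map set) fs))"

definition URF_coloring :: "nat \<Rightarrow> nat \<Rightarrow> nat \<Rightarrow> param_problem" where
  "URF_coloring d l q =
     {(x, n). \<exists>I. encodes x I \<and> valid_instance d l I \<and> n = card (verts I) \<and> yes_instance d q I}"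

definition URF_admits_kernel_with_O_constraints ::
  "nat \<Rightarrow> nat \<Rightarrow> nat \<Rightarrow> (nat \<Rightarrow> real) \<Rightarrow> bool" where
  "URF_admits_kernel_with_O_constraints d l q g \<longleftrightarrow>
     (\<exists>h f m. is_kernel (URF_coloring d l q) h f \<and> (\<lambda>n. real (m n)) \<in> O(g) \<and>
        (\<forall>x I. encodes x I \<and> valid_instance d l I \<longrightarrow>
           (\<exists>x' I'. f (x, card (verts I)) = (x', card (verts I')) \<and>
              encodes x' I' \<and> valid_instance d l I' \<and>
              num_constraints I' \<le> m (card (verts I)))))"

definition eta :: "nat \<Rightarrow> nat \<Rightarrow> nat \<Rightarrow> nat" where
  "eta d l q =
     (if l \<ge> 2 \<and> q \<ge> d + 2 then d * l
      else if l \<ge> 2 \<and> q = d + 1 \<and> (d, l) \<noteq> (1, 2) then d * l - 1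
      else if (l \<ge> 2 \<and> q = d \<and> d \<ge> 2) \<or> (l = 1 \<and> d \<ge> 3) then (d - 1) * l
      else if l = 1 \<and> d \<le> 2 \<and> q \<ge> 3 then 2
      else if (q = 2 \<and> d * l \<le> 2) \<or> q = 1 then 0
      else undefined)"

end

theory Submission
  imports Defs "HOL-Combinatorics.Permutations" "HOL-Library.Z2"
begin

text \<open>
  Kernels: a constraint is violated by a coloring exactly if a certain product of Vandermonde
  determinants over the two-element field, evaluated at the colors, does not vanish. For \<open>q = d\<close>,
  \<open>q = d + 1\<close> or \<open>l = 1\<close> its Leibniz expansion involves only terms that miss one entry of each block
  or of some block, so the constraints span a space of dimension \<open>O(n\<^sup>\<eta>)\<close>, and it suffices to keep
  those that form a basis. For two colors and \<open>dl \<le> 2\<close> all constraints are affine, and elimination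
  decides the problem.

  Lower bounds: the constraints of the composed instance forbid that \<open>\<eta>\<close> chosen vertices all have
  their bad color. With \<open>O(T)\<close> vertices for each of the \<open>\<eta>\<close> positions, such constraints can encode
  \<open>T\<^sup>\<eta>\<close> independent words of a language in \<open>NP\<close> on \<open>T\<close> times polynomially many vertices, so that
  the instance is solvable exactly if one of the words is in the language. Compressing it
  below \<open>T\<^sup>\<eta>\<close> bits puts the complement into \<open>NP/poly\<close> by the counting argument of Fortnow and
  Santhanam: some output on tuples of no-instances covers half of the no-instances at some position,
  so linearly many outputs, given as advice, certify all of them.
\<close>

section \<open>Stack programs\<close>

text \<open>The vector of a constraint does not depend on the coloring, which enters only as a
  weight on its coordinates. A relation over the two-element field between vectors thus holds for
  all colorings at once. The weights are polynomials over that field and not its elements: distinct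
  colors must give a nonzero determinant, while characteristic 2 makes signs disappear and keeps the
  elimination on bits. For q = d + 1 one determinant is taken for every color r that may be missing,
  with nonzero coefficients of sum 0; this cancels the one term that contains all dl entries. The
  compression is an arbitrary Turing machine and must be run by the verifier, so machines are not
  only compiled from stack programs but also simulated by them. The composed instance is not
  computed by a reduction. Up to the choice of one of two words per bit it depends on the length s
  alone, so its parts may be supplied as advice. With T = (s + 2)^b the number of words is T^eta,
  the compressed size is T^(eta - eps) times a polynomial in s, and b is taken so large that T^eps
  beats the polynomial.\<close>

text \<open>
  \<open>Pop\<close> branches on the removed top element and takes its last branch on the empty stack;
  \<open>Loop\<close> pops and runs the corresponding body until the stack is empty.
\<close>

datatype 'r prog =
   Nop
  | Put 'r bool
  | Then "'r prog" "'r prog"  (infixl ";;" 60)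
  | Pop 'r "'r prog" "'r prog" "'r prog"
  | Loop 'r "'r prog" "'r prog"

inductive exec :: "'r prog => ('r => word) => nat => ('r => word) => bool" where
  Nop: "exec Nop s 1 s"
| Put: "exec (Put r b) s 1 (s(r := b # s r))"
| Then: "exec p s t s' ==> exec p' s' t' s'' ==> exec (p ;; p') s (Suc (t + t')) s''"
| PopE: "s r = [] ==> exec e s t s' ==> exec (Pop r f g e) s (Suc t) s'"
| PopB: "s r = b # w ==> exec (if b then g else f) (s(r := w)) t s' ==> exec (Pop r f g e) s (Suc t) s'"
| LoopE: "s r = [] ==> exec (Loop r f g) s 1 s"
| LoopB: "s r = b # w ==> exec (if b then g else f) (s(r := w)) t s' ==>
   exec (Loop r f g) s' t' s'' ==> exec (Loop r f g) s (Suc (t + t')) s''"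

text \<open>Every step pushes at most one letter. This bounds an output by input length plus time,
  which is what closes \<open>pt\<close> under composition.\<close>

lemma exec_length: "exec p s t s' ==> length (s' r) <= length (s r) + t"
proof (induction rule: exec.induct)
  case (PopB s r' b w g f t s' e)
  then show ?case by (cases "r = r'") auto
next
  case (LoopB s r' b w g f t s' t' s'')
  then show ?case by (cases "r = r'") auto
qed auto

text \<open>The registers below \<open>m\<close> are frozen at \<open>u\<close>, so that a shifted
  program can be called as a subroutine without touching the data of its caller.\<close>

definition lift_store :: "nat => (nat => word) => (nat => word) => nat => word" where
  "lift_store m u s j = (if j < m then u j else s (j - m))"

lemma lift_store_upd: "(lift_store m u s)(m + r := w) = lift_store m u (s(r := w))"
  by (auto simp: lift_store_def fun_eq_iff)

lemma lift_store_at: "lift_store m u s (m + r) = s r"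
  by (simp add: lift_store_def)

abbreviation shift :: "nat => nat prog => nat prog" where
  "shift m \<equiv> map_prog (%r. m + r)"

lemma exec_shift: "exec p s t s' ==> exec (shift m p) (lift_store m u s) t (lift_store m u s')"
proof (induction rule: exec.induct)
  case (Nop s)
  then show ?case using exec.Nop by simp
next
  case (Put r b s)
  show ?case using exec.Put[of "m + r" b "lift_store m u s"] unfolding lift_store_upd lift_store_at
   by (simp add: fun_upd_def)
next
  case (Then p s t s' p' t' s'')
  then show ?case by (auto intro: exec.Then)
next
  case (PopE s r e t s' f g)
  then show ?case by (auto intro: exec.PopE simp: lift_store_at)
next
  case (PopB s r b w g f t s' e)
  have "exec (if b then shift m g else shift m f) ((lift_store m u s)(m + r := w)) t (lift_store m u s')"
   unfolding lift_store_upd using PopB.IH by (cases b) (auto simp: fun_upd_def)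
  then show ?case using exec.PopB[of "lift_store m u s" "m + r" b w] PopB.hyps
   by (simp add: lift_store_at)
next
  case (LoopE s r f g)
  then show ?case using exec.LoopE[of "lift_store m u s" "m + r"] by (simp add: lift_store_at)
next
  case (LoopB s r b w g f t s' t' s'')
  have "exec (if b then shift m g else shift m f) ((lift_store m u s)(m + r := w)) t (lift_store m u s')"
   unfolding lift_store_upd using LoopB.IH(1) by (cases b) (auto simp: fun_upd_def)
  then show ?case using exec.LoopB[of "lift_store m u s" "m + r" b w] LoopB
   by (simp add: lift_store_at)
qed

subsection \<open>Compilation to Turing machines\<close>

text \<open>
  A control state of the machine is the list of programs that remain to be run. One small step
  determines how the control state changes; only finitely many control states are reachable.
\<close>

datatype act = Halt | Go "nat prog list" | APut nat bool "nat prog list"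
  | APop nat "nat prog list" "nat prog list" "nat prog list"

fun view :: "nat prog list => act" where
  "view [] = Halt"
| "view (Nop # K) = Go K"
| "view (Put r b # K) = APut r b K"
| "view ((p ;; p') # K) = Go (p # p' # K)"
| "view (Pop r f g e # K) = APop r (f # K) (g # K) (e # K)"
| "view (Loop r f g # K) = APop r (f # Loop r f g # K) (g # Loop r f g # K) K"

fun succs :: "act => nat prog list set" where
  "succs Halt = {}"
| "succs (Go K) = {K}"
| "succs (APut r b K) = {K}"
| "succs (APop r F G E) = {F, G, E}"

fun sstep :: "nat prog list \<times> (nat => word) => nat prog list \<times> (nat => word)" where
  "sstep (K, s) = (case view K of
    Halt => (K, s)
   | Go K' => (K', s)
   | APut r b K' => (K', s(r := b # s r))
   | APop r F G E => (case s r of [] => (E, s) | b # w => (if b then G else F, s(r := w))))"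

text \<open>The times in \<open>exec\<close> are chosen to count small steps exactly: each rule
  costs one unit for unfolding the head of the control list. \<open>K\<close> is arbitrary so that a
  subprogram can be run in front of its continuation.\<close>

lemma exec_sstep: "exec p s t s' ==> (sstep ^^ t) (p # K, s) = (K, s')"
proof (induction arbitrary: K rule: exec.induct)
  case (Then p s t s' p' t' s'')
  have "(sstep ^^ (t' + t)) (p # p' # K, s) = (K, s'')"
   by (simp add: funpow_add Then.IH del: sstep.simps)
  then show ?case by (simp add: funpow_Suc_right add.commute del: funpow.simps)
next
  case (PopB s r b w g f t s' e)
  then show ?case by (cases b) (simp_all add: funpow_Suc_right fun_upd_def del: funpow.simps)
next
  case (LoopB s r b w g f t s' t' s'')
  have "(sstep ^^ (t' + t)) ((if b then g else f) # Loop r f g # K, s(r := w)) = (K, s'')"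
   by (simp add: funpow_add LoopB.IH del: sstep.simps)
  then show ?case using LoopB.hyps
   by (cases b) (simp_all add: funpow_Suc_right add.commute del: funpow.simps)
qed (simp_all add: funpow_Suc_right del: funpow.simps)

text \<open>Control lists that occur while \<open>p\<close> is being run in front of
  \<open>K\<close>; the list \<open>K\<close> itself is left to the caller. A loop merely reappears
  in the continuation of its bodies, so the recursion stays structural and the set finite.\<close>

fun reach :: "nat prog => nat prog list => nat prog list set" where
  "reach Nop K = {Nop # K}"
| "reach (Put r b) K = {Put r b # K}"
| "reach (p ;; p') K = insert ((p ;; p') # K) (reach p (p' # K) \<union> reach p' K)"
| "reach (Pop r f g e) K = insert (Pop r f g e # K) (reach f K \<union> reach g K \<union> reach e K)"
| "reach (Loop r f g) K = insert (Loop r f g # K) (reach f (Loop r f g # K) \<union> reach g (Loop r f g # K))"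

lemma reach_head: "p # K \<in> reach p K"
  by (cases p) auto

lemma finite_reach: "finite (reach p K)"
  by (induction p arbitrary: K) auto

lemma succs_reach: "K' \<in> reach p K ==> succs (view K') <= insert K (reach p K)"
proof (induction p arbitrary: K)
  case (Then p1 p2)
  from Then.prems have "K' = (p1 ;; p2) # K \<or> K' \<in> reach p1 (p2 # K) \<or> K' \<in> reach p2 K" by simp
  then show ?case using reach_head[of p1 "p2 # K"] reach_head[of p2 K] Then.IH(1)[of "p2 # K"] Then.IH(2)[of K]
   by (elim disjE) auto
next
  case (Pop r f g e)
  from Pop.prems have "K' = Pop r f g e # K \<or> K' \<in> reach f K \<or> K' \<in> reach g K \<or> K' \<in> reach e K" by simp
  then show ?case using reach_head[of f K] reach_head[of g K] reach_head[of e K] Pop.IH[of K]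
   by (elim disjE) auto
next
  case (Loop r f g)
  from Loop.prems have "K' = Loop r f g # K \<or> K' \<in> reach f (Loop r f g # K) \<or> K' \<in> reach g (Loop r f g # K)"
   by simp
  then show ?case using reach_head[of f "Loop r f g # K"] reach_head[of g "Loop r f g # K"]
   Loop.IH[of "Loop r f g # K"] by (elim disjE) auto
qed auto

fun act_reg :: "act => nat set" where
  "act_reg (APut r b K) = {r}"
| "act_reg (APop r F G E) = {r}"
| "act_reg _ = {}"

definition act_states :: "nat prog => nat prog list set" where
  "act_states p = insert [] (reach p [])"

definition state_num :: "nat prog => nat prog list => nat" where
  "state_num p = (SOME g. inj_on g (act_states p) & g ` act_states p = {..<card (act_states p)})"

definition state_of :: "nat prog => nat => nat prog list" where
  "state_of p = the_inv_into (act_states p) (state_num p)"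

definition prog_tapes :: "nat prog => nat" where
  "prog_tapes p = Suc (Max (insert 0 (\<Union>K \<in> act_states p. act_reg (view K))))"

text \<open>
  State 0 moves the first head to the end of the input, so that each tape holds a stack with its
  bottom in cell 0 and the head just above its top. The control state number \<open>i\<close> is \<open>2i + 1\<close>; in
  \<open>2i + 2\<close> the head has moved down to the top element.
\<close>

definition prog_delta :: "nat prog => nat => nat list => (nat \<times> (nat \<times> move) list) option" where
  "prog_delta p z rs = (let st = (%K. 2 * state_num p K + 1); keep = map (%a. (a, Stay)) rs in
    if z = 0 then
     (if rs ! 0 = 0 then Some (st [p], keep) else Some (0, keep[0 := (rs ! 0, Right)]))
    else case view (state_of p ((z - 1) div 2)) of
      Halt => None
     | Go K => Some (st K, keep)
     | APut r b K => Some (st K, keep[r := (bit_sym b, Right)])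
     | APop r F G E =>
       if odd z then Some (z + 1, keep[r := (rs ! r, Left)])
       else if rs ! r = 0 then Some (st E, keep[r := (0, Right)])
       else Some (st (if rs ! r = 1 then F else G), keep[r := (0, Stay)]))"

definition prog_tm :: "nat prog => tm" where
  "prog_tm p = \<lparr>ntapes = prog_tapes p, nsyms = 3, nstates = 2 * card (act_states p) + 1,
    delta = prog_delta p\<rparr>"

section \<open>Well-formedness of the compiled machine\<close>

lemma finite_act_states: "finite (act_states p)"
  by (simp add: act_states_def finite_reach)

lemma state_num: "inj_on (state_num p) (act_states p)"
   "state_num p ` act_states p = {..<card (act_states p)}"
proof -
  obtain g where "bij_betw g (act_states p) {0..<card (act_states p)}"
   using ex_bij_betw_finite_nat[OF finite_act_states] by blast
  then have "inj_on g (act_states p) & g ` act_states p = {..<card (act_states p)}"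
   by (auto simp: bij_betw_def lessThan_atLeast0)
  then have "EX g. inj_on g (act_states p) & g ` act_states p = {..<card (act_states p)}" by blast
  from someI_ex[OF this] have "inj_on (state_num p) (act_states p) &
    state_num p ` act_states p = {..<card (act_states p)}"
   unfolding state_num_def .
  then show "inj_on (state_num p) (act_states p)"
   "state_num p ` act_states p = {..<card (act_states p)}" by auto
qed

lemma state_num_less: "K \<in> act_states p ==> state_num p K < card (act_states p)"
  using state_num(2) by blast

lemma state_of_num: "K \<in> act_states p ==> state_of p (state_num p K) = K"
  unfolding state_of_def by (rule the_inv_into_f_f[OF state_num(1)])

lemma state_of_in: "i < card (act_states p) ==> state_of p i \<in> act_states p"
  unfolding state_of_def by (rule the_inv_into_into[OF state_num(1)]) (auto simp: state_num(2))

lemma succs_act_states: "K \<in> act_states p ==> succs (view K) <= act_states p"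
  using succs_reach[of K p "[]"] by (auto simp: act_states_def)

lemma start_act_states: "[p] \<in> act_states p"
  by (simp add: act_states_def reach_head)

lemma act_reg_less: "K \<in> act_states p ==> r \<in> act_reg (view K) ==> r < prog_tapes p"
proof -
  assume "K \<in> act_states p" "r \<in> act_reg (view K)"
  moreover have "finite (act_reg (view K))" for K by (cases "view K") auto
  ultimately show ?thesis unfolding prog_tapes_def less_Suc_eq_le
   by (intro Max_ge) (auto simp: finite_act_states)
qed

lemma valid_prog_tm: "valid_tm (prog_tm p)"
proof -
  have "s' < 2 * card (act_states p) + 1 & length as = prog_tapes p & fst ` set as <= {..<3}"
   if s: "s < 2 * card (act_states p) + 1" and rs: "length rs = prog_tapes p" "set rs <= {..<3}"
    and d: "prog_delta p s rs = Some (s', as)" for s rs s' as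
  proof -
   have st: "K \<in> act_states p ==> 2 * state_num p K + 1 < 2 * card (act_states p) + 1" for K
    using state_num_less[of K p] by simp
   have keep: "fst ` set ((map (%a. (a, Stay)) rs)[r := (a, m)]) <= {..<3}" if "a < 3" for r a m
   proof -
    have "set ((map (%a. (a, Stay)) rs)[r := (a, m)]) <= insert (a, m) (set (map (%a. (a, Stay)) rs))"
     by (rule set_update_subset_insert)
    then have "fst ` set ((map (%a. (a, Stay)) rs)[r := (a, m)]) <= insert a (set rs)" by force
    then show ?thesis using rs that by auto
   qed
   have keep0: "fst ` set (map (%a. (a, Stay)) rs) <= {..<3}" using rs by auto
   have sym: "bit_sym b < 3" for b by (simp add: bit_sym_def)
   have nth: "rs ! r < 3" if "r < prog_tapes p" for r
    by (metis lessThan_iff nth_mem subsetD rs that)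
   have pos: "0 < prog_tapes p" by (simp add: prog_tapes_def)
   show ?thesis
   proof (cases "s = 0")
    case True
    then show ?thesis using d s st[OF start_act_states] keep[OF nth[OF pos]] keep0 rs
     by (auto simp: prog_delta_def Let_def split: if_splits)
   next
    case False
    let ?K = "state_of p ((s - 1) div 2)"
    have K: "?K \<in> act_states p" using s False by (intro state_of_in) auto
    note succ = succs_act_states[OF K]
    show ?thesis
    proof (cases "view ?K")
     case Halt
     then show ?thesis using d False by (simp add: prog_delta_def)
    next
     case (Go K')
     then show ?thesis using d False succ st[of K'] keep0 rs by (auto simp: prog_delta_def Let_def)
    next
     case (APut r b K')
     then show ?thesis using d False succ st[of K'] keep[OF sym[of b]] rs
      by (auto simp: prog_delta_def Let_def)
    next
     case (APop r F G E)
     then have "r < prog_tapes p" using act_reg_less[OF K] by simp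
     then have kr: "fst ` set ((map (%a. (a, Stay)) rs)[r := (rs ! r, m)]) <= {..<3}" for m
      using keep nth by blast
     have k0: "fst ` set ((map (%a. (a, Stay)) rs)[r := (0, m)]) <= {..<3}" for m
      using keep[of 0] by simp
     have st': "2 * state_num p F + 1 < 2 * card (act_states p) + 1"
      "2 * state_num p G + 1 < 2 * card (act_states p) + 1"
      "2 * state_num p E + 1 < 2 * card (act_states p) + 1"
      using succ APop st by auto
     show ?thesis
     proof (cases "odd s")
      case True
      then have "s + 1 < 2 * card (act_states p) + 1" using s by (elim oddE) simp
      then show ?thesis using d False APop True kr rs by (auto simp: prog_delta_def Let_def)
     next
      case nodd: False
      then show ?thesis using d False APop st' k0 rs
       by (auto simp: prog_delta_def Let_def split: if_splits)
     qed
    qed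
   qed
  qed
  moreover have "1 <= prog_tapes p" by (simp add: prog_tapes_def)
  ultimately show ?thesis unfolding valid_tm_def prog_tm_def by simp blast
qed

section \<open>Correctness of the compiled machine\<close>

definition stack_tape :: "word => (int => nat) \<times> int" where
  "stack_tape w = (input_tape (rev w), int (length w))"

definition store_tapes :: "nat => (nat => word) => ((int => nat) \<times> int) list" where
  "store_tapes k s = map (%r. stack_tape (s r)) [0..<k]"

lemma input_tape_top: "input_tape (rev w) (int (length w)) = 0"
  by (simp add: input_tape_def)

lemma input_tape_push: "(input_tape (rev w))(int (length w) := bit_sym b) = input_tape (rev (b # w))"
  by (auto simp: input_tape_def fun_eq_iff nth_append)

lemma input_tape_below: "input_tape (rev (b # w)) (int (length w)) = bit_sym b"
  by (simp add: input_tape_def nth_append)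

lemma input_tape_pop: "(input_tape (rev (b # w)))(int (length w) := 0) = input_tape (rev w)"
  by (auto simp: input_tape_def fun_eq_iff nth_append)

lemma input_tape_neg: "i < 0 ==> input_tape w i = 0"
  by (simp add: input_tape_def)

definition cconf :: "nat prog => nat prog list \<times> (nat => word) => config" where
  "cconf p = (%(K, s). (2 * state_num p K + 1, store_tapes (prog_tapes p) s))"

definition heads :: "((int => nat) \<times> int) list => nat list" where
  "heads = map (%(t, i). t i)"

lemma heads_store: "heads (store_tapes k s) = replicate k 0"
  by (simp add: heads_def store_tapes_def stack_tape_def input_tape_top comp_def map_replicate_const)

lemma step_some:
  assumes "delta M z (heads ts) = Some (z', as)"
  shows "step M (z, ts) = (z', map2 (%(t, i) (a, m). (t(i := a), i + offset m)) ts as)"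
  using assms by (simp add: step_def action_def heads_def)

lemma map2_keep:
  "map2 (%(t, i) (a, m). (t(i := a), i + offset m)) ts (map (%a. (a, Stay)) (heads ts)) = ts"
  by (induction ts) (auto simp: heads_def)

lemma map2_keep_upd:
  assumes "r < length ts"
  shows "map2 (%(t, i) (a, m). (t(i := a), i + offset m)) ts ((map (%a. (a, Stay)) (heads ts))[r := (a, m)])
   = ts[r := ((fst (ts ! r))(snd (ts ! r) := a), snd (ts ! r) + offset m)]"
proof (rule nth_equalityI)
  fix i assume "i < length (map2 (%(t, i) (a, m). (t(i := a), i + offset m)) ts
   ((map (%a. (a, Stay)) (heads ts))[r := (a, m)]))"
  then show "map2 (%(t, i) (a, m). (t(i := a), i + offset m)) ts
    ((map (%a. (a, Stay)) (heads ts))[r := (a, m)]) ! i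
   = ts[r := ((fst (ts ! r))(snd (ts ! r) := a), snd (ts ! r) + offset m)] ! i"
   using assms by (cases "ts ! i") (auto simp: heads_def nth_list_update)
qed (simp add: heads_def)

lemma store_tapes_upd: "r < k ==> (store_tapes k s)[r := stack_tape w] = store_tapes k (s(r := w))"
  by (auto simp: store_tapes_def list_eq_iff_nth_eq nth_list_update)

lemma store_tapes_nth: "r < k ==> store_tapes k s ! r = stack_tape (s r)"
  by (simp add: store_tapes_def)

text \<open>Only a pop takes two machine steps: the head first moves onto the top cell and then
  reads and erases it. On an empty stack it reads the blank in cell -1 and moves back to cell
  0.\<close>

lemma step_cconf:
  assumes K: "K \<in> act_states p"
  shows "EX n <= 2. (step (prog_tm p) ^^ n) (cconf p (K, s)) = cconf p (sstep (K, s))"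
proof -
  let ?k = "prog_tapes p" and ?M = "prog_tm p"
  define z where "z = 2 * state_num p K + 1"
  have z: "z ~= 0" "odd z" "state_of p ((z - 1) div 2) = K"
   using state_of_num[OF K] by (simp_all add: z_def)
  have z2: "state_of p ((z + 1 - 1) div 2) = K"
   using state_of_num[OF K] by (simp add: z_def)
  have d: "delta ?M = prog_delta p" by (simp add: prog_tm_def)
  have c: "cconf p (K, s) = (z, store_tapes ?k s)" by (simp add: cconf_def z_def)
  show ?thesis
  proof (cases "view K")
   case Halt
   then show ?thesis by (intro exI[of _ 0]) simp
  next
   case (Go K')
   have "prog_delta p z (heads (store_tapes ?k s)) =
     Some (2 * state_num p K' + 1, map (%a. (a, Stay)) (heads (store_tapes ?k s)))"
    using z Go by (simp add: prog_delta_def Let_def)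
   from step_some[of ?M, unfolded d, OF this] show ?thesis
    by (intro exI[of _ 1]) (simp add: c Go map2_keep, simp add: cconf_def)
  next
   case (APut r b K')
   have r: "r < ?k" using act_reg_less[OF K] APut by simp
   have "prog_delta p z (heads (store_tapes ?k s)) =
     Some (2 * state_num p K' + 1, (map (%a. (a, Stay)) (heads (store_tapes ?k s)))[r := (bit_sym b, Right)])"
    using z APut by (simp add: prog_delta_def Let_def)
   from step_some[of ?M, unfolded d, OF this]
   have "step ?M (cconf p (K, s)) = (2 * state_num p K' + 1, (store_tapes ?k s)[r := stack_tape (b # s r)])"
    using r input_tape_push[of "s r" b]
    by (simp add: c map2_keep_upd store_tapes_nth store_tapes_def stack_tape_def add.commute)
   then show ?thesis
    by (intro exI[of _ 1]) (simp add: APut store_tapes_upd r cconf_def)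
  next
   case (APop r F G E)
   have r: "r < ?k" using act_reg_less[OF K] APop by simp
   define ts where "ts = (store_tapes ?k s)[r := (input_tape (rev (s r)), int (length (s r)) - 1)]"
   have "prog_delta p z (heads (store_tapes ?k s)) =
     Some (z + 1, (map (%a. (a, Stay)) (heads (store_tapes ?k s)))[r := (0, Left)])"
    using z APop r by (simp add: prog_delta_def Let_def heads_store)
   from step_some[of ?M, unfolded d, OF this]
   have s1: "step ?M (cconf p (K, s)) = (z + 1, ts)"
    using r by (simp add: c map2_keep_upd store_tapes_nth store_tapes_def stack_tape_def ts_def
     fun_upd_idem input_tape_top)
   have len: "length ts = ?k" by (simp add: ts_def store_tapes_def)
   have tsr: "ts ! r = (input_tape (rev (s r)), int (length (s r)) - 1)"
    using r by (simp add: ts_def store_tapes_def)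
   have hr: "heads ts ! r = input_tape (rev (s r)) (int (length (s r)) - 1)"
    using r len tsr by (simp add: heads_def)
   have upd: "ts[r := u] = (store_tapes ?k s)[r := u]" for u by (simp add: ts_def)
   have "step ?M (z + 1, ts) = cconf p (sstep (K, s))"
   proof (cases "s r")
    case Nil
    have "prog_delta p (z + 1) (heads ts) =
      Some (2 * state_num p E + 1, (map (%a. (a, Stay)) (heads ts))[r := (0, Right)])"
     using z z2 APop hr Nil by (simp add: prog_delta_def Let_def input_tape_neg)
    from step_some[of ?M, unfolded d, OF this] show ?thesis
     using r len by (simp add: map2_keep_upd tsr upd APop Nil cconf_def fun_upd_idem input_tape_neg)
      (use store_tapes_upd[OF r, of s "s r"] Nil in \<open>simp add: stack_tape_def fun_upd_idem\<close>)
   next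
    case (Cons b w)
    have h: "heads ts ! r = bit_sym b" using hr Cons input_tape_below[of b w] by simp
    have "prog_delta p (z + 1) (heads ts) =
      Some (2 * state_num p (if b then G else F) + 1, (map (%a. (a, Stay)) (heads ts))[r := (0, Stay)])"
     using z z2 APop h by (simp add: prog_delta_def Let_def bit_sym_def)
    from step_some[of ?M, unfolded d, OF this] show ?thesis
     using r len input_tape_pop[of b w] store_tapes_upd[OF r, of s w]
     by (simp add: map2_keep_upd tsr upd APop Cons cconf_def stack_tape_def)
   qed
   then show ?thesis using s1 by (intro exI[of _ 2]) (simp add: numeral_2_eq_2)
  qed
qed

lemma sstep_act_states: "K \<in> act_states p ==> fst (sstep (K, s)) \<in> act_states p"
  using succs_act_states[of K p] by (auto split: act.splits list.splits)

lemma steps_cconf: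
  assumes "K \<in> act_states p"
  shows "EX n <= 2 * t. (step (prog_tm p) ^^ n) (cconf p (K, s)) = cconf p ((sstep ^^ t) (K, s))"
  using assms
proof (induction t arbitrary: K s)
  case (Suc t)
  obtain K' s' where Ks: "sstep (K, s) = (K', s')" by fastforce
  obtain n where n: "n <= 2" "(step (prog_tm p) ^^ n) (cconf p (K, s)) = cconf p (K', s')"
   using step_cconf[OF Suc.prems, of s] Ks by metis
  have "K' \<in> act_states p" using sstep_act_states[OF Suc.prems, of s] by (simp del: sstep.simps add: Ks)
  from Suc.IH[OF this, of s'] obtain n' where n': "n' <= 2 * t"
   "(step (prog_tm p) ^^ n') (cconf p (K', s')) = cconf p ((sstep ^^ t) (K', s'))" by blast
  have "(step (prog_tm p) ^^ (n' + n)) (cconf p (K, s)) = cconf p ((sstep ^^ Suc t) (K, s))"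
   by (simp add: funpow_add n n' Ks funpow_Suc_right del: sstep.simps funpow.simps)
  then show ?case using n(1) n'(1) by (intro exI[of _ "n' + n"]) simp
qed simp

lemma init_scan:
  assumes "j <= length x"
  shows "(step (prog_tm p) ^^ j) (init_config (prog_tm p) x)
   = (0, (input_tape x, int j) # replicate (prog_tapes p - 1) (%_. 0, 0))"
  using assms
proof (induction j)
  case 0
  then show ?case by (simp add: init_config_def prog_tm_def)
next
  case (Suc j)
  let ?ts = "(input_tape x, int j) # replicate (prog_tapes p - 1) (%_. 0, 0)"
  have "input_tape x (int j) ~= 0" using Suc.prems by (simp add: input_tape_def bit_sym_def)
  then have "delta (prog_tm p) 0 (heads ?ts) =
    Some (0, (map (%a. (a, Stay)) (heads ?ts))[0 := (input_tape x (int j), Right)])"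
   by (simp add: prog_tm_def prog_delta_def Let_def heads_def)
  from step_some[OF this] show ?case using Suc
   by (simp add: map2_keep_upd fun_upd_idem)
qed

text \<open>Once the head stands behind the input, the last letter is on top of the stack, hence
  \<open>rev x\<close>; the output is read from cell 0 upwards, that is from the bottom, hence
  \<open>rev y\<close>.\<close>

lemma prog_tm_computes:
  assumes "exec p ((%_. [])(0 := rev x)) t s'" "s' 0 = rev y"
  shows "EX n <= length x + 1 + 2 * t. tm_computes (prog_tm p) x n y"
proof -
  let ?M = "prog_tm p" and ?s = "(%_. [])(0 := rev x)"
  let ?ts = "(input_tape x, int (length x)) # replicate (prog_tapes p - 1) (%_. 0, 0)"
  have pos: "prog_tapes p = Suc (prog_tapes p - 1)" by (simp add: prog_tapes_def)
  have ts: "?ts = store_tapes (prog_tapes p) ?s"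
  proof (rule nth_equalityI)
   show "length ?ts = length (store_tapes (prog_tapes p) ?s)" using pos by (simp add: store_tapes_def)
   fix i assume "i < length ?ts"
   then show "?ts ! i = store_tapes (prog_tapes p) ?s ! i"
    using pos by (cases i) (auto simp: store_tapes_def stack_tape_def input_tape_def fun_eq_iff)
  qed
  have "delta ?M 0 (heads ?ts) = Some (2 * state_num p [p] + 1, map (%a. (a, Stay)) (heads ?ts))"
   by (simp add: prog_tm_def prog_delta_def Let_def heads_def input_tape_def)
  from step_some[OF this] have "step ?M (0, ?ts) = cconf p ([p], ?s)"
   by (simp only: map2_keep) (simp add: cconf_def ts[simplified])
  then have s1: "(step ?M ^^ Suc (length x)) (init_config ?M x) = cconf p ([p], ?s)"
   using init_scan[of "length x" x p] by simp
  obtain n where n: "n <= 2 * t" "(step ?M ^^ n) (cconf p ([p], ?s)) = cconf p ([], s')"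
   using steps_cconf[where K = "[p]" and p = p and t = t and s = ?s, OF start_act_states] exec_sstep[OF assms(1), of "[]"] by auto
  have fin: "(step ?M ^^ (n + Suc (length x))) (init_config ?M x) = cconf p ([], s')"
   by (simp only: funpow_add comp_apply s1 n)
  have e: "[] \<in> act_states p" by (simp add: act_states_def)
  have "action ?M (cconf p ([], s')) = None"
   using state_of_num[OF e] by (simp add: action_def cconf_def prog_tm_def prog_delta_def)
  moreover have "hd (store_tapes (Suc k) s') = stack_tape (s' 0)" for k
   by (simp add: store_tapes_def upt_conv_Cons del: upt_Suc)
  then have "hd (snd (cconf p ([], s'))) = stack_tape (rev y)"
   using assms(2) pos by (metis cconf_def case_prod_conv snd_conv)
  then have "has_output (cconf p ([], s')) y"
   by (simp add: has_output_def stack_tape_def input_tape_def)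
  ultimately have "tm_computes ?M x (n + Suc (length x)) y"
   unfolding tm_computes_def Let_def fin by simp
  then show ?thesis using n(1) by (intro exI[of _ "n + Suc (length x)"]) simp
qed

section \<open>Polynomial-time functions\<close>

lemma fun_upd_fold [simp]: "(%a. if a = r then w else s a) = s(r := w)"
  by (simp add: fun_upd_def)

subsection \<open>Polynomial bounds\<close>

text \<open>The base is at least 2, so that a larger exponent absorbs constants and sums and no
  separate coefficient is needed.\<close>

definition polyb :: "('a => nat) => ('a => nat) => bool" where
  "polyb c g \<longleftrightarrow> (EX k. ALL x. g x <= (c x + 2) ^ k)"

lemma polyb_mono: "polyb c h ==> (!!x. g x <= h x) ==> polyb c g"
  unfolding polyb_def by (meson order_trans)

lemma polyb_id: "polyb c c"
  unfolding polyb_def by (intro exI[of _ 1]) simp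

lemma polyb_const: "polyb c (%_. m)"
  unfolding polyb_def
proof (intro exI[of _ m] allI)
  fix x
  have "m <= 2 ^ m" by (simp add: less_imp_le)
  also have "... <= (c x + 2) ^ m" by (rule power_mono) auto
  finally show "m <= (c x + 2) ^ m" .
qed

lemma polyb_mult: "polyb c g ==> polyb c h ==> polyb c (%x. g x * h x)"
  unfolding polyb_def
proof (elim exE)
  fix k j assume "ALL x. g x <= (c x + 2) ^ k" "ALL x. h x <= (c x + 2) ^ j"
  then show "EX k. ALL x. g x * h x <= (c x + 2) ^ k"
   by (intro exI[of _ "k + j"]) (simp add: power_add mult_mono)
qed

lemma polyb_add: "polyb c g ==> polyb c h ==> polyb c (%x. g x + h x)"
  unfolding polyb_def
proof (elim exE)
  fix k j assume kj: "ALL x. g x <= (c x + 2) ^ k" "ALL x. h x <= (c x + 2) ^ j"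
  have "g x + h x <= (c x + 2) ^ Suc (k + j)" for x
  proof -
   let ?a = "(c x + 2) ^ k" and ?b = "(c x + 2) ^ j"
   have "1 <= ?a" "1 <= ?b" by simp_all
   then have "?a <= ?a * ?b" "?b <= ?a * ?b" by simp_all
   then have "?a + ?b <= 2 * (?a * ?b)" by linarith
   also have "... <= (c x + 2) * (?a * ?b)" by (rule mult_right_mono) auto
   finally show ?thesis using kj[rule_format, of x] by (simp add: power_add algebra_simps)
  qed
  then show "EX k. ALL x. g x + h x <= (c x + 2) ^ k" by blast
qed

lemma polyb_Suc: "polyb c g ==> polyb c (%x. Suc (g x))"
  using polyb_add[OF _ polyb_const[of c 1], of g] by simp

lemma polyb_power: "polyb c g ==> polyb c (%x. g x ^ m)"
  by (induction m) (auto intro: polyb_const[of c 1, simplified] polyb_const polyb_mult)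

lemmas polyb_intros = polyb_add polyb_mult polyb_Suc polyb_power polyb_const polyb_id

lemma polyb_comp: "polyb c h ==> polyb c' (%x. c (g x)) ==> polyb c' (%x. h (g x))"
proof -
  assume "polyb c h" and g: "polyb c' (%x. c (g x))"
  then obtain k where k: "!!x. h x <= (c x + 2) ^ k" by (auto simp: polyb_def)
  show ?thesis
   by (rule polyb_mono[OF _ k]) (intro polyb_intros g)
qed

subsection \<open>Running times of stack programs\<close>

definition runs :: "nat prog => (nat => word) => nat => (nat => word) => bool" where
  "runs p s T s' \<longleftrightarrow> (EX t <= T. exec p s t s')"

lemma runs_mono: "runs p s T s' ==> T <= T' ==> runs p s T' s'"
  unfolding runs_def by (meson order_trans)

lemma runs_exec: "exec p s t s' ==> runs p s t s'"
  unfolding runs_def by (rule exI[of _ t]) simp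

lemmas runs_Nop = runs_exec[OF exec.Nop]
lemmas runs_Put = runs_exec[OF exec.Put]
lemmas runs_LoopE = runs_exec[OF exec.LoopE]

lemma runs_Then [trans]:
  assumes "runs p s T s'" "runs p' s' T' s''"
  shows "runs (p ;; p') s (T + T' + 1) s''"
proof -
  obtain t t' where "t <= T" "t' <= T'" "exec p s t s'" "exec p' s' t' s''"
   using assms unfolding runs_def by blast
  then show ?thesis using runs_mono[OF runs_exec[OF exec.Then]] by simp
qed

lemma runs_PopE: 
  assumes "s r = []" "runs e s T s'"
  shows "runs (Pop r f g e) s (T + 1) s'"
proof -
  obtain t where "t <= T" "exec e s t s'" using assms unfolding runs_def by blast
  then show ?thesis using runs_mono[OF runs_exec[OF exec.PopE[of s r, OF assms(1)]]] by simp
qed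

lemma runs_PopB:
  assumes "s r = b # w" "runs (if b then g else f) (s(r := w)) T s'"
  shows "runs (Pop r f g e) s (T + 1) s'"
proof -
  obtain t where "t <= T" "exec (if b then g else f) (s(r := w)) t s'" using assms unfolding runs_def by blast
  then show ?thesis using runs_mono[OF runs_exec[OF exec.PopB[of s r, OF assms(1)]]] by simp
qed

lemma runs_LoopB:
  assumes "s r = b # w" "runs (if b then g else f) (s(r := w)) T s'" "runs (Loop r f g) s' T' s''"
  shows "runs (Loop r f g) s (T + T' + 1) s''"
proof -
  obtain t t' where "t <= T" "t' <= T'" "exec (if b then g else f) (s(r := w)) t s'" "exec (Loop r f g) s' t' s''"
   using assms unfolding runs_def by blast
  then show ?thesis using runs_mono[OF runs_exec[OF exec.LoopB[of s r, OF assms(1)]]] by simp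
qed

definition store0 :: "word => nat => word" where
  "store0 w = (%_. [])(0 := w)"

text \<open>Five working registers; subprograms are shifted so that they use the registers from 5 on.\<close>

definition St :: "word => word => word => word => word => word => nat => word" where
  "St a b c d e x = (%_. [])(0 := a, 1 := b, 2 := c, 3 := d, 4 := e, 5 := x)"

lemma St_upd [simp]:
  "(St a b c d e x)(0 := w) = St w b c d e x"
  "(St a b c d e x)(Suc 0 := w) = St a w c d e x"
  "(St a b c d e x)(2 := w) = St a b w d e x"
  "(St a b c d e x)(3 := w) = St a b c w e x"
  "(St a b c d e x)(4 := w) = St a b c d w x"
  "(St a b c d e x)(5 := w) = St a b c d e w"
  by (auto simp: St_def fun_eq_iff)

lemma St_at [simp]:
  "St a b c d e x 0 = a" "St a b c d e x (Suc 0) = b" "St a b c d e x 2 = c"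
  "St a b c d e x 3 = d" "St a b c d e x 4 = e" "St a b c d e x 5 = x"
  by (auto simp: St_def)

lemma store0_St: "store0 w = St w [] [] [] [] []"
  by (auto simp: St_def store0_def fun_eq_iff)

lemma store0_at: "store0 w 0 = w"
  by (simp add: store0_def)

text \<open>Subroutine call: register 5 of the caller is register 0 of the shifted program.\<close>

lemma runs_bank:
  assumes "runs p (store0 x) T (store0 y)"
  shows "runs (shift 5 p) (St a b c d e x) T (St a b c d e y)"
proof -
  have "St a b c d e w = lift_store 5 (St a b c d e w) (store0 w)" for w
   by (auto simp: St_def lift_store_def store0_def fun_eq_iff)
  moreover have "lift_store 5 (St a b c d e x) s = lift_store 5 (St a b c d e y) s" for s
   by (auto simp: St_def lift_store_def fun_eq_iff)
  ultimately show ?thesis using assms exec_shift[of p _ _ _ 5 "St a b c d e y"]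
   unfolding runs_def by metis
qed

lemma runs_length: "runs p (store0 x) T (store0 y) ==> length y <= length x + T"
  unfolding runs_def using exec_length[of p "store0 x" _ "store0 y" 0] by (force simp: store0_at)

definition dbl :: "word => word" where
  "dbl w = concat (map (%b. [b, b]) w)"

lemma dbl_simps [simp]: "dbl [] = []" "dbl (b # w) = b # b # dbl w" "dbl (u @ v) = dbl u @ dbl v"
  by (auto simp: dbl_def)

lemma length_dbl [simp]: "length (dbl w) = 2 * length w"
  by (induction w) auto

lemma enc_pair_dbl: "enc_pair (x, y) = dbl x @ False # True # y"
  by (simp add: enc_pair_def dbl_def)

lemma length_enc_pair [simp]: "length (enc_pair (x, y)) = 2 * length x + length y + 2"
  by (simp add: enc_pair_dbl)

text \<open>A total inverse of \<open>enc_pair\<close>: letters are read in pairs, and the first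
  pair of unequal letters is taken as the separator.\<close>

fun usplit :: "word => word \<times> word" where
  "usplit (b # b' # w) = (if b = b' then (b # fst (usplit w), snd (usplit w)) else ([], w))"
| "usplit _ = ([], [])"

lemma usplit_enc_pair [simp]: "usplit (enc_pair (x, y)) = (x, y)"
  unfolding enc_pair_dbl by (induction x) auto

fun puts :: "nat => word => nat prog" where
  "puts r [] = Nop"
| "puts r (b # w) = puts r w ;; Put r b"

lemma runs_puts: "runs (puts r w) s (2 * length w + 1) (s(r := w @ s r))"
proof (induction w)
  case Nil
  then show ?case using runs_Nop by simp
next
  case (Cons b w)
  from runs_Then[OF Cons runs_Put[of r b]] show ?case by (simp add: numeral_2_eq_2)
qed

definition xl1 :: "nat => nat => (bool => word) => nat prog" where
  "xl1 r a h = Loop r (puts a (h False)) (puts a (h True))"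

definition xl2 :: "nat => nat => (bool => word) => nat => (bool => word) => nat prog" where
  "xl2 r a h b k = Loop r (puts a (h False) ;; puts b (k False)) (puts a (h True) ;; puts b (k True))"

lemma runs_xl1:
  assumes "r ~= a"
  shows "runs (xl1 r a h) s (length (s r) * (2 * (length (h False) + length (h True)) + 4) + 1)
   (s(r := [], a := concat (map h (rev (s r))) @ s a))"
proof (induction "s r" arbitrary: s)
  case Nil
  then show ?case using runs_LoopE[of s r] by (simp add: xl1_def fun_upd_idem)
next
  case (Cons c w)
  let ?s = "s(r := w, a := h c @ s a)"
  have "runs (if c then puts a (h True) else puts a (h False)) (s(r := w)) (2 * length (h c) + 1) ?s"
   using runs_puts[of a "h c" "s(r := w)"] assms by (cases c) auto
  moreover have w: "w = ?s r" using assms by simp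
  have "runs (xl1 r a h) ?s (length w * (2 * (length (h False) + length (h True)) + 4) + 1)
    (s(r := [], a := concat (map h (rev w)) @ h c @ s a))"
   using Cons.hyps(1)[of ?s, OF w] assms by (simp add: fun_upd_twist)
  ultimately have "runs (xl1 r a h) s (2 * length (h c) + 1
    + (length w * (2 * (length (h False) + length (h True)) + 4) + 1) + 1)
    (s(r := [], a := concat (map h (rev w)) @ h c @ s a))"
   using runs_LoopB[of s r c w "puts a (h True)" "puts a (h False)"] Cons.hyps(2)[symmetric]
   unfolding xl1_def by blast
  then show ?case unfolding Cons.hyps(2)[symmetric] by (cases c) (auto elim!: runs_mono)
qed

lemma runs_xl2:
  assumes "r ~= a" "r ~= b" "a ~= b"
  shows "runs (xl2 r a h b k) s
   (length (s r) * (2 * (length (h False) + length (h True) + length (k False) + length (k True)) + 4) + 1)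
   (s(r := [], a := concat (map h (rev (s r))) @ s a, b := concat (map k (rev (s r))) @ s b))"
proof (induction "s r" arbitrary: s)
  case Nil
  then show ?case using runs_LoopE[of s r] by (simp add: xl2_def fun_upd_idem)
next
  case (Cons c w)
  let ?s = "s(r := w, a := h c @ s a, b := k c @ s b)"
  have "runs (puts a (h c) ;; puts b (k c)) (s(r := w)) (2 * length (h c) + 1 + (2 * length (k c) + 1) + 1) ?s"
   using runs_Then[OF runs_puts[of a "h c" "s(r := w)"] runs_puts[of b "k c"]] assms by simp
  then have "runs (if c then puts a (h True) ;; puts b (k True) else puts a (h False) ;; puts b (k False))
    (s(r := w)) (2 * length (h c) + 1 + (2 * length (k c) + 1) + 1) ?s"
   by (cases c) auto
  moreover have w: "w = ?s r" using assms by simp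
  have "runs (xl2 r a h b k) ?s
    (length w * (2 * (length (h False) + length (h True) + length (k False) + length (k True)) + 4) + 1)
    (s(r := [], a := concat (map h (rev w)) @ h c @ s a, b := concat (map k (rev w)) @ k c @ s b))"
   using Cons.hyps(1)[of ?s, OF w] assms by (simp add: fun_upd_twist)
  ultimately have "runs (xl2 r a h b k) s (2 * length (h c) + 1 + (2 * length (k c) + 1) + 1
    + (length w * (2 * (length (h False) + length (h True) + length (k False) + length (k True)) + 4) + 1) + 1)
    (s(r := [], a := concat (map h (rev w)) @ h c @ s a, b := concat (map k (rev w)) @ k c @ s b))"
   using runs_LoopB[of s r c w "puts a (h True) ;; puts b (k True)" "puts a (h False) ;; puts b (k False)"]
    Cons.hyps(2)[symmetric]
   unfolding xl2_def by blast
  then show ?case unfolding Cons.hyps(2)[symmetric] by (cases c) (auto elim!: runs_mono)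
qed

definition "clear r = Loop r Nop Nop"
definition "mv r s = xl1 r s (%b. [b])"
definition "mvd r s = xl1 r s (%b. [b, b])"

lemma runs_clear: "runs (clear r) s (2 * length (s r) + 1) (s(r := []))"
proof (induction "s r" arbitrary: s)
  case Nil
  then show ?case using runs_LoopE[of s r] by (simp add: clear_def fun_upd_idem)
next
  case (Cons b w)
  have "runs (clear r) (s(r := w)) (2 * length w + 1) (s(r := []))"
   using Cons.hyps(1)[of "s(r := w)"] by simp
  moreover have "runs (if b then Nop else Nop) (s(r := w)) 1 (s(r := w))" using runs_Nop by simp
  ultimately have "runs (clear r) s (1 + (2 * length w + 1) + 1) (s(r := []))"
   using runs_LoopB[of s r b w Nop Nop 1] Cons.hyps(2)[symmetric] unfolding clear_def by blast
  then show ?case unfolding Cons.hyps(2)[symmetric] by (rule runs_mono) simp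
qed

lemma concat_map_single [simp]: "concat (map (%b. [b]) w) = w"
  by (induction w) auto

lemma runs_mv: "r ~= a ==> runs (mv r a) s (8 * length (s r) + 1) (s(r := [], a := rev (s r) @ s a))"
  using runs_mono[OF runs_xl1[of r a "%b. [b]" s], of "8 * length (s r) + 1"] by (simp add: mv_def)

lemma runs_mvd: "r ~= a ==> runs (mvd r a) s (12 * length (s r) + 1) (s(r := [], a := dbl (rev (s r)) @ s a))"
  unfolding mvd_def dbl_def by (rule runs_mono[OF runs_xl1]) simp_all

text \<open>\<open>spl\<close> splits the pair in register 0 into its reversed components in registers 1 and 2.\<close>

definition spl :: "nat prog" where
  "spl = Loop 0 (Pop 0 (Put 1 False) (mv 0 2) Nop) (Pop 0 (mv 0 2) (Put 1 True) Nop)"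

lemma runs_spl:
  "runs spl (St w a [] d e x) (10 * length w + 5) (St [] (rev (fst (usplit w)) @ a) (rev (snd (usplit w))) d e x)"
proof (induction w arbitrary: a rule: usplit.induct)
  case (1 b b' w)
  show ?case
  proof (cases "b = b'")
   case True
   have "runs (Put 1 b) (St w a [] d e x) 1 (St w (b # a) [] d e x)"
    using runs_Put[of 1 b "St w a [] d e x"] by simp
   then have "runs (if b then Pop 0 (mv 0 2) (Put 1 True) Nop else Pop 0 (Put 1 False) (mv 0 2) Nop)
     (St (b' # w) a [] d e x) 2 (St w (b # a) [] d e x)"
    using runs_PopB[of "St (b' # w) a [] d e x" 0 b' w "Put 1 True" "mv 0 2" 1 "St w (b # a) [] d e x" Nop]
     runs_PopB[of "St (b' # w) a [] d e x" 0 b' w "mv 0 2" "Put 1 False" 1 "St w (b # a) [] d e x" Nop] True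
    by (cases b) (auto simp: numeral_2_eq_2)
   then have "runs spl (St (b # b' # w) a [] d e x) (2 + (10 * length w + 5) + 1)
     (St [] (rev (fst (usplit w)) @ b # a) (rev (snd (usplit w))) d e x)"
    unfolding spl_def using 1[OF True, of "b # a", unfolded spl_def]
    by (intro runs_LoopB[of _ 0 b "b' # w"]) auto
   then show ?thesis using True by (auto elim!: runs_mono)
  next
   case False
   have "runs (mv 0 2) (St w a [] d e x) (8 * length w + 1) (St [] a (rev w) d e x)"
    using runs_mv[of 0 2 "St w a [] d e x"] by simp
   then have "runs (if b then Pop 0 (mv 0 2) (Put 1 True) Nop else Pop 0 (Put 1 False) (mv 0 2) Nop)
     (St (b' # w) a [] d e x) (8 * length w + 1 + 1) (St [] a (rev w) d e x)"
    using runs_PopB[of "St (b' # w) a [] d e x" 0 b' w "Put 1 True" "mv 0 2"]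
     runs_PopB[of "St (b' # w) a [] d e x" 0 b' w "mv 0 2" "Put 1 False"] False
    by (cases b) auto
   then have "runs spl (St (b # b' # w) a [] d e x) (8 * length w + 1 + 1 + 1 + 1) (St [] a (rev w) d e x)"
    unfolding spl_def using runs_LoopE[of "St [] a (rev w) d e x" 0]
    by (intro runs_LoopB[of _ 0 b "b' # w"]) auto
   then show ?thesis using False by (auto elim!: runs_mono)
  qed
next
  case "2_1"
  then show ?case using runs_LoopE[of "St [] a [] d e x" 0] by (auto simp: spl_def intro!: runs_mono[OF runs_LoopE])
next
  case ("2_2" b)
  have "runs (if b then Pop 0 (mv 0 2) (Put 1 True) Nop else Pop 0 (Put 1 False) (mv 0 2) Nop)
    (St [] a [] d e x) 2 (St [] a [] d e x)"
   using runs_PopE[of "St [] a [] d e x" 0 Nop 1] runs_Nop[of "St [] a [] d e x"]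
   by (cases b) (auto simp: numeral_2_eq_2)
  then have "runs spl (St [b] a [] d e x) (2 + 1 + 1) (St [] a [] d e x)"
   unfolding spl_def using runs_LoopE[of "St [] a [] d e x" 0]
   by (intro runs_LoopB[of _ 0 b "[]"]) auto
  then show ?case by (auto elim!: runs_mono)
qed

subsection \<open>Functions between encoded types\<close>

text \<open>All registers except 0 must be empty at the end, so that programs can be chained without
  cleaning up in between.\<close>

definition pt :: "('a => word) => ('b => word) => ('a => 'b) => bool" where
  "pt e e' f \<longleftrightarrow> (EX p k. ALL x. runs p (store0 (e x)) ((length (e x) + 2) ^ k) (store0 (e' (f x))))"

lemma ptI:
  assumes "!!x. runs p (store0 (e x)) (T x) (store0 (e' (f x)))" "polyb (%x. length (e x)) T"
  shows "pt e e' f"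
  using assms runs_mono unfolding pt_def polyb_def by meson

lemma ptE:
  assumes "pt e e' f"
  obtains p T where "!!x. runs p (store0 (e x)) (T x) (store0 (e' (f x)))" "polyb (%x. length (e x)) T"
proof -
  from assms obtain p k where p: "!!x. runs p (store0 (e x)) ((length (e x) + 2) ^ k) (store0 (e' (f x)))"
   unfolding pt_def by blast
  show thesis by (rule that[OF p]) (intro polyb_intros)
qed

lemma pt_length: "pt e e' f ==> polyb (%x. length (e x)) (%x. length (e' (f x)))"
proof (elim ptE)
  fix p T assume p: "!!x. runs p (store0 (e x)) (T x) (store0 (e' (f x)))" and T: "polyb (%x. length (e x)) T"
  show ?thesis
   by (rule polyb_mono[of _ "%x. length (e x) + T x"]) (auto intro!: polyb_intros T runs_length[OF p])
qed

lemma pt_cast: "pt e e' f ==> (!!x. e2 (g x) = e' (f x)) ==> pt e e2 g"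
  unfolding pt_def by simp

lemma pt_cong_in: "pt e e' f ==> (!!x. e2 x = e (h x)) ==> (!!x. e3 (g x) = e' (f (h x))) ==> pt e2 e3 g"
  unfolding pt_def by metis

lemma pt_id: "pt e e (%x. x)"
  by (rule ptI[OF runs_Nop]) (rule polyb_const)

lemma pt_comp: "pt e2 e3 g ==> pt e1 e2 f ==> pt e1 e3 (%x. g (f x))"
proof -
  assume g: "pt e2 e3 g" and f: "pt e1 e2 f"
  obtain p T where p: "!!x. runs p (store0 (e1 x)) (T x) (store0 (e2 (f x)))" "polyb (%x. length (e1 x)) T"
   using f by (elim ptE) blast
  obtain p' T' where p': "!!x. runs p' (store0 (e2 x)) (T' x) (store0 (e3 (g x)))" "polyb (%x. length (e2 x)) T'"
   using g by (elim ptE) blast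
  show ?thesis
  proof (rule ptI)
   show "runs (p ;; p') (store0 (e1 x)) (T x + T' (f x) + 1) (store0 (e3 (g (f x))))" for x
    by (rule runs_Then[OF p(1) p'(1)])
   show "polyb (%x. length (e1 x)) (%x. T x + T' (f x) + 1)"
    by (intro polyb_intros p(2) polyb_comp[OF p'(2)] pt_length[OF f])
  qed
qed

section \<open>Encodings of types and the basic combinators\<close>

definition raw :: "word => word" where "raw w = w"
definition bool_e :: "bool => word" where "bool_e b = [b]"
definition nat_e :: "nat => word" where "nat_e n = replicate n True"

definition prod_e :: "('a => word) => ('b => word) => 'a \<times> 'b => word" where
  "prod_e e e' p = enc_pair (e (fst p), e' (snd p))"

fun list_e :: "('a => word) => 'a list => word" where
  "list_e e [] = []"
| "list_e e (x # xs) = enc_pair (e x, list_e e xs)"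

lemma pt_pair: "pt c a f ==> pt c b g ==> pt c (prod_e a b) (%x. (f x, g x))"
proof -
  assume f: "pt c a f" and g: "pt c b g"
  obtain p T where p: "!!x. runs p (store0 (c x)) (T x) (store0 (a (f x)))" "polyb (%x. length (c x)) T"
   using f by (elim ptE) blast
  obtain p' T' where p': "!!x. runs p' (store0 (c x)) (T' x) (store0 (b (g x)))" "polyb (%x. length (c x)) T'"
   using g by (elim ptE) blast
  show ?thesis
  proof (rule ptI)
   fix x
   let ?X = "c x" and ?A = "a (f x)" and ?B = "b (g x)" and ?R = "enc_pair (a (f x), b (g x))"
   have "runs (mv 0 1) (store0 ?X) (8 * length ?X + 1) (St [] (rev ?X) [] [] [] [])"
    using runs_mv[of 0 1 "store0 ?X"] by (simp add: store0_St)
   also have "runs (xl2 1 0 (%b. [b]) 5 (%b. [b])) (St [] (rev ?X) [] [] [] []) (12 * length ?X + 1) (St ?X [] [] [] [] ?X)"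
    using runs_mono[OF runs_xl2[of 1 0 5 "%b. [b]" "%b. [b]" "St [] (rev ?X) [] [] [] []"], of "12 * length ?X + 1"]
    by simp
   also have "runs (shift 5 p) (St ?X [] [] [] [] ?X) (T x) (St ?X [] [] [] [] ?A)"
    by (rule runs_bank[OF p(1)])
   also have "runs (mv 5 1) (St ?X [] [] [] [] ?A) (8 * length ?A + 1) (St ?X (rev ?A) [] [] [] [])"
    using runs_mv[of 5 1 "St ?X [] [] [] [] ?A"] by simp
   also have "runs (mv 0 2) (St ?X (rev ?A) [] [] [] []) (8 * length ?X + 1) (St [] (rev ?A) (rev ?X) [] [] [])"
    using runs_mv[of 0 2 "St ?X (rev ?A) [] [] [] []"] by simp
   also have "runs (mv 2 5) (St [] (rev ?A) (rev ?X) [] [] []) (8 * length ?X + 1) (St [] (rev ?A) [] [] [] ?X)"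
    using runs_mv[of 2 5 "St [] (rev ?A) (rev ?X) [] [] []"] by simp
   also have "runs (shift 5 p') (St [] (rev ?A) [] [] [] ?X) (T' x) (St [] (rev ?A) [] [] [] ?B)"
    by (rule runs_bank[OF p'(1)])
   also have "runs (puts 5 [False, True]) (St [] (rev ?A) [] [] [] ?B) 5 (St [] (rev ?A) [] [] [] ([False, True] @ ?B))"
    using runs_puts[of 5 "[False, True]" "St [] (rev ?A) [] [] [] ?B"] by simp
   also have "runs (mvd 1 5) (St [] (rev ?A) [] [] [] ([False, True] @ ?B)) (12 * length ?A + 1) (St [] [] [] [] [] ?R)"
    using runs_mvd[of 1 5 "St [] (rev ?A) [] [] [] ([False, True] @ ?B)"] by (simp add: enc_pair_dbl)
   also have "runs (mv 5 1) (St [] [] [] [] [] ?R) (8 * length ?R + 1) (St [] (rev ?R) [] [] [] [])"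
    using runs_mv[of 5 1 "St [] [] [] [] [] ?R"] by simp
   also have "runs (mv 1 0) (St [] (rev ?R) [] [] [] []) (8 * length ?R + 1) (store0 ?R)"
    using runs_mv[of 1 0 "St [] (rev ?R) [] [] [] []"] by (simp add: store0_St)
   finally show "runs (mv 0 1 ;; xl2 1 0 (%b. [b]) 5 (%b. [b]) ;; shift 5 p ;; mv 5 1 ;; mv 0 2 ;; mv 2 5 ;;
     shift 5 p' ;; puts 5 [False, True] ;; mvd 1 5 ;; mv 5 1 ;; mv 1 0) (store0 ?X)
     (20 * length ?X + T x + 16 * length ?X + T' x + 20 * length ?A + 16 * length ?R + 30)
     (store0 (prod_e a b (f x, g x)))"
    unfolding prod_e_def fst_conv snd_conv by (rule runs_mono) simp
  next
   show "polyb (%x. length (c x)) (%x. 20 * length (c x) + T x + 16 * length (c x) + T' x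
     + 20 * length (a (f x)) + 16 * length (enc_pair (a (f x), b (g x))) + 30)"
    unfolding length_enc_pair by (intro polyb_intros p p' pt_length[OF f] pt_length[OF g])
  qed
qed

lemma length_usplit: "2 * length (fst (usplit w)) + length (snd (usplit w)) <= length w"
  by (induction w rule: usplit.induct) auto

lemma pt_usplit: "pt raw raw (%w. fst (usplit w))" (is ?thesis1)
   "pt raw raw (%w. snd (usplit w))" (is ?thesis2)
   "pt raw raw (%w. fst (usplit w) @ snd (usplit w))" (is ?thesis3)
proof -
  have s: "runs spl (store0 w) (10 * length w + 5) (St [] (rev (fst (usplit w))) (rev (snd (usplit w))) [] [] [])" for w
   using runs_spl[of w "[]" "[]" "[]" "[]"] by (simp add: store0_St)
  have l1: "length (fst (usplit w)) <= length w" and l2: "length (snd (usplit w)) <= length w" for w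
   using length_usplit[of w] by auto
  show ?thesis1
  proof (rule ptI)
   fix w
   let ?a = "fst (usplit w)" and ?b = "snd (usplit w)"
   note s[of w]
   also have "runs (clear 2) (St [] (rev ?a) (rev ?b) [] [] []) (2 * length ?b + 1) (St [] (rev ?a) [] [] [] [])"
    using runs_clear[of 2 "St [] (rev ?a) (rev ?b) [] [] []"] by simp
   also have "runs (mv 1 0) (St [] (rev ?a) [] [] [] []) (8 * length ?a + 1) (store0 ?a)"
    using runs_mv[of 1 0 "St [] (rev ?a) [] [] [] []"] by (simp add: store0_St)
   finally show "runs (spl ;; clear 2 ;; mv 1 0) (store0 (raw w)) (20 * length (raw w) + 20) (store0 (raw ?a))"
    using l1[of w] l2[of w] unfolding raw_def by (elim runs_mono) linarith
  qed (intro polyb_intros)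
  show ?thesis2
  proof (rule ptI)
   fix w
   let ?a = "fst (usplit w)" and ?b = "snd (usplit w)"
   note s[of w]
   also have "runs (clear 1) (St [] (rev ?a) (rev ?b) [] [] []) (2 * length ?a + 1) (St [] [] (rev ?b) [] [] [])"
    using runs_clear[of 1 "St [] (rev ?a) (rev ?b) [] [] []"] by simp
   also have "runs (mv 2 0) (St [] [] (rev ?b) [] [] []) (8 * length ?b + 1) (store0 ?b)"
    using runs_mv[of 2 0 "St [] [] (rev ?b) [] [] []"] by (simp add: store0_St)
   finally show "runs (spl ;; clear 1 ;; mv 2 0) (store0 (raw w)) (20 * length (raw w) + 20) (store0 (raw ?b))"
    using l1[of w] l2[of w] unfolding raw_def by (elim runs_mono) linarith
  qed (intro polyb_intros)
  show ?thesis3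
  proof (rule ptI)
   fix w
   let ?a = "fst (usplit w)" and ?b = "snd (usplit w)"
   note s[of w]
   also have "runs (mv 2 0) (St [] (rev ?a) (rev ?b) [] [] []) (8 * length ?b + 1) (St ?b (rev ?a) [] [] [] [])"
    using runs_mv[of 2 0 "St [] (rev ?a) (rev ?b) [] [] []"] by simp
   also have "runs (mv 1 0) (St ?b (rev ?a) [] [] [] []) (8 * length ?a + 1) (store0 (?a @ ?b))"
    using runs_mv[of 1 0 "St ?b (rev ?a) [] [] [] []"] by (simp add: store0_St)
   finally show "runs (spl ;; mv 2 0 ;; mv 1 0) (store0 (raw w)) (30 * length (raw w) + 20) (store0 (raw (?a @ ?b)))"
    using l1[of w] l2[of w] unfolding raw_def by (elim runs_mono) linarith
  qed (intro polyb_intros)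
qed

lemma pt_fst0: "pt (prod_e a b) a fst"
  by (rule pt_cong_in[OF pt_usplit(1), where h = "prod_e a b"]) (auto simp: raw_def prod_e_def)

lemma pt_snd0: "pt (prod_e a b) b snd"
  by (rule pt_cong_in[OF pt_usplit(2), where h = "prod_e a b"]) (auto simp: raw_def prod_e_def)

lemma pt_fst: "pt c (prod_e a b) f ==> pt c a (%x. fst (f x))"
  by (rule pt_comp[OF pt_fst0])

lemma pt_snd: "pt c (prod_e a b) f ==> pt c b (%x. snd (f x))"
  by (rule pt_comp[OF pt_snd0])

lemma pt_append_raw: "pt c raw f ==> pt c raw g ==> pt c raw (%x. f x @ g x)"
proof -
  assume "pt c raw f" "pt c raw g"
  from pt_pair[OF this] have "pt c raw (%x. enc_pair (f x, g x))"
   by (rule pt_cast) (simp add: raw_def prod_e_def)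
  from pt_comp[OF pt_usplit(3) this] show ?thesis by simp
qed

lemma pt_const: "pt c b (%_. y)"
proof (rule ptI)
  fix x
  have "runs (clear 0) (store0 (c x)) (2 * length (c x) + 1) (store0 [])"
   using runs_clear[of 0 "store0 (c x)"] by (simp add: store0_St)
  also have "runs (puts 0 (b y)) (store0 []) (2 * length (b y) + 1) (store0 (b y))"
   using runs_puts[of 0 "b y" "store0 []"] by (simp add: store0_St)
  finally show "runs (clear 0 ;; puts 0 (b y)) (store0 (c x)) (2 * length (c x) + 1 + (2 * length (b y) + 1) + 1)
   (store0 (b y))" .
qed (intro polyb_intros)

lemma pt_expand: "pt raw raw (%w. concat (map h w))"
proof (rule ptI)
  fix w
  have "runs (mv 0 1) (store0 w) (8 * length w + 1) (St [] (rev w) [] [] [] [])"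
   using runs_mv[of 0 1 "store0 w"] by (simp add: store0_St)
  also have "runs (xl1 1 0 h) (St [] (rev w) [] [] [] [])
    (length w * (2 * (length (h False) + length (h True)) + 4) + 1) (store0 (concat (map h w)))"
   using runs_xl1[of 1 0 h "St [] (rev w) [] [] [] []"] by (simp add: store0_St)
  finally show "runs (mv 0 1 ;; xl1 1 0 h) (store0 (raw w))
   (8 * length (raw w) + 1 + (length (raw w) * (2 * (length (h False) + length (h True)) + 4) + 1) + 1)
   (store0 (raw (concat (map h w))))" by (simp only: raw_def)
qed (intro polyb_intros)

lemma pt_branch:
  assumes f: "pt c d f" and g: "pt c d g" and h: "pt c d h"
  shows "pt c d (%x. case c x of [] => f x | b # w => if b then g x else h x)"
proof -
  obtain p T where p: "!!x. runs p (store0 (c x)) (T x) (store0 (d (f x)))" "polyb (%x. length (c x)) T"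
   using f by (elim ptE) blast
  obtain p' T' where p': "!!x. runs p' (store0 (c x)) (T' x) (store0 (d (g x)))" "polyb (%x. length (c x)) T'"
   using g by (elim ptE) blast
  obtain p'' T'' where p'': "!!x. runs p'' (store0 (c x)) (T'' x) (store0 (d (h x)))" "polyb (%x. length (c x)) T''"
   using h by (elim ptE) blast
  show ?thesis
  proof (rule ptI)
   fix x
   let ?k = "%x. case c x of [] => f x | b # w => if b then g x else h x"
   \<comment> \<open>The letter that was popped for the test is pushed back, because each branch
     expects the whole input.\<close>
   have "runs (Pop 0 (Put 0 False ;; p'') (Put 0 True ;; p') p) (store0 (c x)) (T x + T' x + T'' x + 5) (store0 (d (?k x)))"
   proof (cases "c x")
    case Nil
    then have "runs (Pop 0 (Put 0 False ;; p'') (Put 0 True ;; p') p) (store0 (c x)) (T x + 1) (store0 (d (?k x)))"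
     using p(1)[of x] by (intro runs_PopE) (auto simp: store0_at)
    then show ?thesis by (rule runs_mono) simp
   next
    case (Cons b w)
    have P: "runs (Put 0 b) (store0 w) 1 (store0 (c x))"
     using runs_Put[of 0 b "store0 w"] Cons by (simp add: store0_St)
    have "runs (if b then Put 0 True ;; p' else Put 0 False ;; p'') (store0 w) (T' x + T'' x + 3) (store0 (d (?k x)))"
    proof (cases b)
     case True
     then show ?thesis using runs_Then[OF P p'(1)[of x]] Cons by (auto elim: runs_mono)
    next
     case False
     then show ?thesis using runs_Then[OF P p''(1)[of x]] Cons by (auto elim: runs_mono)
    qed
    then have "runs (Pop 0 (Put 0 False ;; p'') (Put 0 True ;; p') p) (store0 (c x)) (T' x + T'' x + 3 + 1) (store0 (d (?k x)))"
     using Cons by (intro runs_PopB[of _ 0 b w]) (auto simp: store0_St)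
    then show ?thesis by (rule runs_mono) simp
   qed
   then show "runs (Pop 0 (Put 0 False ;; p'') (Put 0 True ;; p') p) (store0 (c x)) (T x + T' x + T'' x + 5) (store0 (d (?k x)))" .
  qed (intro polyb_intros p(2) p'(2) p''(2))
qed

text \<open>Pairing the condition with the input makes its bit the first letter of the encoding, on
  which \<open>pt_branch\<close> dispatches; each branch then drops the condition again.\<close>

lemma pt_if:
  assumes "pt c bool_e b" "pt c d f" "pt c d g"
  shows "pt c d (%x. if b x then f x else g x)"
proof -
  have "pt (prod_e bool_e c) d (%p. f (snd p))" "pt (prod_e bool_e c) d (%p. g (snd p))"
   using assms pt_comp pt_snd0 by blast+
  from pt_comp[OF pt_branch[OF this(1) this] pt_pair[OF assms(1) pt_id]]
  show ?thesis by (rule pt_cast) (simp add: prod_e_def bool_e_def enc_pair_dbl)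
qed

lemma pt_null: "pt (list_e a) bool_e (%xs. xs = [])"
  by (rule pt_cast[OF pt_branch[OF pt_const[of _ bool_e True] pt_const[of _ bool_e False] pt_const[of _ bool_e False]]])
   (case_tac x, auto simp: enc_pair_dbl split: list.split)

lemma pt_zero: "pt nat_e bool_e (%n. n = 0)"
  by (rule pt_cast[OF pt_branch[OF pt_const[of _ bool_e True] pt_const[of _ bool_e False] pt_const[of _ bool_e False]]])
   (case_tac x, auto simp: nat_e_def)

subsection \<open>Iteration over a list\<close>

text \<open>Register 0 holds the context, 1 the unread part of the list, 2 the current element in
  reverse, 3 the accumulator; 4 is scratch space, and 5 passes the triple to the subroutine.\<close>

definition fold_step :: "nat prog => nat prog" where
  "fold_step p = mv 2 5 ;; puts 5 [False, True] ;; mv 3 4 ;; mvd 4 5 ;; puts 5 [False, True] ;; mv 0 4 ;;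
    xl2 4 5 (%b. [b, b]) 0 (%b. [b]) ;; shift 5 p ;; mv 5 4 ;; mv 4 3"

text \<open>Letters are consumed in pairs: two equal letters extend the element in register 2, and
  the separator \<open>False\<close>, \<open>True\<close> completes it and triggers a fold
  step.\<close>

definition fold_loop :: "nat prog => nat prog" where
  "fold_loop p = Loop 1 (Pop 1 (Put 2 False) (fold_step p) Nop) (Pop 1 Nop (Put 2 True) Nop)"

lemma runs_fold_step:
  assumes "runs p (store0 (enc_pair (x, enc_pair (u, w)))) t (store0 u')"
  shows "runs (fold_step p) (St x l (rev w) u [] [])
   (8 * length w + 20 * length u + 24 * length x + 16 * length u' + 40 + t) (St x l [] u' [] [])"
proof -
  have "runs (mv 2 5) (St x l (rev w) u [] []) (8 * length w + 1) (St x l [] u [] w)"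
   using runs_mv[of 2 5 "St x l (rev w) u [] []"] by simp
  also have "runs (puts 5 [False, True]) (St x l [] u [] w) 5 (St x l [] u [] ([False, True] @ w))"
   using runs_puts[of 5 "[False, True]" "St x l [] u [] w"] by simp
  also have "runs (mv 3 4) (St x l [] u [] ([False, True] @ w)) (8 * length u + 1) (St x l [] [] (rev u) ([False, True] @ w))"
   using runs_mv[of 3 4 "St x l [] u [] ([False, True] @ w)"] by simp
  also have "runs (mvd 4 5) (St x l [] [] (rev u) ([False, True] @ w)) (12 * length u + 1) (St x l [] [] [] (enc_pair (u, w)))"
   using runs_mvd[of 4 5 "St x l [] [] (rev u) ([False, True] @ w)"] by (simp add: enc_pair_dbl)
  also have "runs (puts 5 [False, True]) (St x l [] [] [] (enc_pair (u, w))) 5 (St x l [] [] [] ([False, True] @ enc_pair (u, w)))"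
   using runs_puts[of 5 "[False, True]" "St x l [] [] [] (enc_pair (u, w))"] by simp
  also have "runs (mv 0 4) (St x l [] [] [] ([False, True] @ enc_pair (u, w))) (8 * length x + 1)
    (St [] l [] [] (rev x) ([False, True] @ enc_pair (u, w)))"
   using runs_mv[of 0 4 "St x l [] [] [] ([False, True] @ enc_pair (u, w))"] by simp
  also have "runs (xl2 4 5 (%b. [b, b]) 0 (%b. [b])) (St [] l [] [] (rev x) ([False, True] @ enc_pair (u, w)))
    (16 * length x + 1) (St x l [] [] [] (enc_pair (x, enc_pair (u, w))))"
   using runs_mono[OF runs_xl2[of 4 5 0 "%b. [b, b]" "%b. [b]"
     "St [] l [] [] (rev x) ([False, True] @ enc_pair (u, w))"], of "16 * length x + 1"]
   by (simp add: enc_pair_dbl[of x] flip: dbl_def)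
  also have "runs (shift 5 p) (St x l [] [] [] (enc_pair (x, enc_pair (u, w)))) t (St x l [] [] [] u')"
   by (rule runs_bank[OF assms])
  also have "runs (mv 5 4) (St x l [] [] [] u') (8 * length u' + 1) (St x l [] [] (rev u') [])"
   using runs_mv[of 5 4 "St x l [] [] [] u'"] by simp
  also have "runs (mv 4 3) (St x l [] [] (rev u') []) (8 * length u' + 1) (St x l [] u' [] [])"
   using runs_mv[of 4 3 "St x l [] [] (rev u') []"] by simp
  finally show ?thesis unfolding fold_step_def by (rule runs_mono) simp
qed

lemma runs_fold_elem:
  assumes "runs (fold_step p) (St x l (rev w @ v) u [] []) t (St x l [] u' [] [])"
   "runs (fold_loop p) (St x l [] u' [] []) t' s'"
  shows "runs (fold_loop p) (St x (enc_pair (w, l)) v u [] []) (4 * length w + t + t' + 4) s'"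
  using assms(1) unfolding enc_pair_dbl
proof (induction w arbitrary: v)
  case Nil
  have *: "runs (if False then Pop 1 Nop (Put 2 True) Nop else Pop 1 (Put 2 False) (fold_step p) Nop)
    (St x (True # l) v u [] []) (t + 1) (St x l [] u' [] [])"
   using Nil runs_PopB[of "St x (True # l) v u [] []" 1 True l "fold_step p" "Put 2 False" t "St x l [] u' [] []" Nop]
   by simp
  have "runs (fold_loop p) (St x (False # True # l) v u [] []) (t + 1 + t' + 1) s'"
   unfolding fold_loop_def
   by (rule runs_LoopB[where b = False and w = "True # l" and s' = "St x l [] u' [] []"])
    (use * assms(2) in \<open>simp_all add: fold_loop_def\<close>)
  then show ?case by (auto elim!: runs_mono)
next
  case (Cons b w)
  let ?l = "dbl w @ False # True # l"
  have "runs (Put 2 b) (St x ?l v u [] []) 1 (St x ?l (b # v) u [] [])"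
   using runs_Put[of 2 b "St x ?l v u [] []"] by simp
  then have *: "runs (if b then Pop 1 Nop (Put 2 True) Nop else Pop 1 (Put 2 False) (fold_step p) Nop)
    (St x (b # ?l) v u [] []) 2 (St x ?l (b # v) u [] [])"
   using runs_PopB[of "St x (b # ?l) v u [] []" 1 b ?l "Put 2 True" Nop 1 _ Nop]
    runs_PopB[of "St x (b # ?l) v u [] []" 1 b ?l "fold_step p" "Put 2 False" 1 _ Nop]
   by (cases b) (auto simp: numeral_2_eq_2)
  have **: "runs (fold_loop p) (St x ?l (b # v) u [] []) (4 * length w + t + t' + 4) s'"
   using Cons.IH[of "b # v"] Cons.prems by simp
  have "runs (fold_loop p) (St x (b # b # ?l) v u [] []) (2 + (4 * length w + t + t' + 4) + 1) s'"
   unfolding fold_loop_def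
   by (rule runs_LoopB[where b = b and w = "b # ?l" and s' = "St x ?l (b # v) u [] []"])
    (use * ** in \<open>simp_all add: fold_loop_def\<close>)
  then show ?case by (auto elim!: runs_mono)
qed

lemma length_list_e_mem: "y \<in> set ys ==> length (e y) <= length (list_e e ys)"
  by (induction ys) auto

lemma length_list_e_len: "length ys <= length (list_e e ys)"
  by (induction ys) auto

lemma runs_fold_loop:
  assumes stp: "!!u y. runs p (store0 (enc_pair (x, enc_pair (b u, a y))))
    ((length (enc_pair (x, enc_pair (b u, a y))) + 2) ^ k) (store0 (b (stp u y)))"
   and bd: "!!j. j <= length ys ==> length (b (foldl stp u (take j ys))) <= M"
   and N: "!!y. y \<in> set ys ==> length (a y) <= N"
  shows "runs (fold_loop p) (St x (list_e a ys) [] (b u) [] [])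
   (length ys * (12 * N + 36 * M + 24 * length x + 44 + (2 * length x + 2 * M + N + 6) ^ k) + 1)
   (St x [] [] (b (foldl stp u ys)) [] [])"
  using bd N
proof (induction ys arbitrary: u)
  case Nil
  then show ?case using runs_LoopE[of "St x [] [] (b u) [] []" 1] by (simp add: fold_loop_def)
next
  case (Cons y ys)
  let ?Q = "12 * N + 36 * M + 24 * length x + 44 + (2 * length x + 2 * M + N + 6) ^ k"
  have u: "length (b u) <= M" using Cons.prems(1)[of 0] by simp
  have u': "length (b (stp u y)) <= M" using Cons.prems(1)[of 1] by simp
  have y: "length (a y) <= N" using Cons.prems(2) by simp
  have IH: "runs (fold_loop p) (St x (list_e a ys) [] (b (stp u y)) [] []) (length ys * ?Q + 1)
    (St x [] [] (b (foldl stp (stp u y) ys)) [] [])"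
   by (rule Cons.IH) (use Cons.prems(1)[of "Suc _"] Cons.prems(2) in auto)
  have "(length (enc_pair (x, enc_pair (b u, a y))) + 2) ^ k <= (2 * length x + 2 * M + N + 6) ^ k"
   using u y by (intro power_mono) auto
  then have t: "8 * length (a y) + 20 * length (b u) + 24 * length x + 16 * length (b (stp u y)) + 40
    + (length (enc_pair (x, enc_pair (b u, a y))) + 2) ^ k
    <= 8 * N + 36 * M + 24 * length x + 40 + (2 * length x + 2 * M + N + 6) ^ k"
   using u u' y by linarith
  have "runs (fold_loop p) (St x (enc_pair (a y, list_e a ys)) [] (b u) [] [])
    (4 * length (a y) + (8 * N + 36 * M + 24 * length x + 40 + (2 * length x + 2 * M + N + 6) ^ k)
     + (length ys * ?Q + 1) + 4) (St x [] [] (b (foldl stp (stp u y) ys)) [] [])"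
   by (rule runs_fold_elem[OF _ IH]) (use runs_mono[OF runs_fold_step[OF stp] t] in simp)
  then show ?case using y by (auto elim!: runs_mono)
qed

text \<open>Iterating a polynomial-time step may grow values exponentially, so a polynomial bound
  \<open>G\<close> on all intermediate accumulators has to be supplied. With it, each of the
  polynomially many steps is polynomial in the original input.\<close>

lemma pt_foldl:
  assumes st: "pt (prod_e c (prod_e b a)) b (%p. stp (fst p) (fst (snd p)) (snd (snd p)))"
   and i: "pt c b init" and l: "pt c (list_e a) xs"
   and G: "polyb (%x. length (c x)) G"
   and bd: "!!x j. j <= length (xs x) ==> length (b (foldl (stp x) (init x) (take j (xs x)))) <= G x"
  shows "pt c b (%x. foldl (stp x) (init x) (xs x))"
proof -
  obtain p k where p: "!!q. runs p (store0 (prod_e c (prod_e b a) q)) ((length (prod_e c (prod_e b a) q) + 2) ^ k)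
    (store0 (b (stp (fst q) (fst (snd q)) (snd (snd q)))))"
   using st unfolding pt_def by blast
  have p': "runs p (store0 (enc_pair (c x, enc_pair (b u, a y)))) ((length (enc_pair (c x, enc_pair (b u, a y))) + 2) ^ k)
    (store0 (b (stp x u y)))" for x u y
   using p[of "(x, u, y)"] by (simp add: prod_e_def)
  have pr: "pt c (prod_e c (prod_e b (list_e a))) (%x. (x, init x, xs x))"
   by (intro pt_pair pt_id i l)
  obtain p0 T0 where p0: "!!x. runs p0 (store0 (c x)) (T0 x) (store0 (prod_e c (prod_e b (list_e a)) (x, init x, xs x)))"
   "polyb (%x. length (c x)) T0"
   using pr by (elim ptE) blast
  let ?N = "%x. length (list_e a (xs x))"
  let ?L = "%x. ?N x * (12 * ?N x + 36 * G x + 24 * length (c x) + 44 + (2 * length (c x) + 2 * G x + ?N x + 6) ^ k) + 1"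
  show ?thesis
  proof (rule ptI)
   fix x
   let ?X = "c x" and ?I = "b (init x)" and ?L' = "list_e a (xs x)"
   let ?F = "b (foldl (stp x) (init x) (xs x))"
   note p0(1)[of x]
   also have "runs spl (store0 (prod_e c (prod_e b (list_e a)) (x, init x, xs x)))
     (10 * length (enc_pair (?X, enc_pair (?I, ?L'))) + 5) (St [] (rev ?X) (rev (enc_pair (?I, ?L'))) [] [] [])"
    using runs_spl[of "enc_pair (?X, enc_pair (?I, ?L'))" "[]" "[]" "[]" "[]"] by (simp add: store0_St prod_e_def)
   also have "runs (mv 1 3) (St [] (rev ?X) (rev (enc_pair (?I, ?L'))) [] [] []) (8 * length ?X + 1)
     (St [] [] (rev (enc_pair (?I, ?L'))) ?X [] [])"
    using runs_mv[of 1 3 "St [] (rev ?X) (rev (enc_pair (?I, ?L'))) [] [] []"] by simp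
   also have "runs (mv 2 0) (St [] [] (rev (enc_pair (?I, ?L'))) ?X [] []) (8 * length (enc_pair (?I, ?L')) + 1)
     (St (enc_pair (?I, ?L')) [] [] ?X [] [])"
    using runs_mv[of 2 0 "St [] [] (rev (enc_pair (?I, ?L'))) ?X [] []"] by simp
   also have "runs spl (St (enc_pair (?I, ?L')) [] [] ?X [] []) (10 * length (enc_pair (?I, ?L')) + 5)
     (St [] (rev ?I) (rev ?L') ?X [] [])"
    using runs_spl[of "enc_pair (?I, ?L')" "[]" ?X "[]" "[]"] by simp
   also have "runs (mv 3 4) (St [] (rev ?I) (rev ?L') ?X [] []) (8 * length ?X + 1) (St [] (rev ?I) (rev ?L') [] (rev ?X) [])"
    using runs_mv[of 3 4 "St [] (rev ?I) (rev ?L') ?X [] []"] by simp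
   also have "runs (mv 4 0) (St [] (rev ?I) (rev ?L') [] (rev ?X) []) (8 * length ?X + 1) (St ?X (rev ?I) (rev ?L') [] [] [])"
    using runs_mv[of 4 0 "St [] (rev ?I) (rev ?L') [] (rev ?X) []"] by simp
   also have "runs (mv 1 3) (St ?X (rev ?I) (rev ?L') [] [] []) (8 * length ?I + 1) (St ?X [] (rev ?L') ?I [] [])"
    using runs_mv[of 1 3 "St ?X (rev ?I) (rev ?L') [] [] []"] by simp
   also have "runs (mv 2 1) (St ?X [] (rev ?L') ?I [] []) (8 * length ?L' + 1) (St ?X ?L' [] ?I [] [])"
    using runs_mv[of 2 1 "St ?X [] (rev ?L') ?I [] []"] by simp
   also have "runs (fold_loop p) (St ?X ?L' [] ?I [] []) (?L x) (St ?X [] [] ?F [] [])"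
    by (rule runs_mono[OF runs_fold_loop[where M = "G x" and N = "?N x", OF p' bd length_list_e_mem]])
     (auto intro!: mult_right_mono length_list_e_len)
   also have "runs (clear 0) (St ?X [] [] ?F [] []) (2 * length ?X + 1) (St [] [] [] ?F [] [])"
    using runs_clear[of 0 "St ?X [] [] ?F [] []"] by simp
   also have "runs (mv 3 4) (St [] [] [] ?F [] []) (8 * length ?F + 1) (St [] [] [] [] (rev ?F) [])"
    using runs_mv[of 3 4 "St [] [] [] ?F [] []"] by simp
   also have "runs (mv 4 0) (St [] [] [] [] (rev ?F) []) (8 * length ?F + 1) (store0 ?F)"
    using runs_mv[of 4 0 "St [] [] [] [] (rev ?F) []"] by (simp add: store0_St)
   finally show "runs (p0 ;; spl ;; mv 1 3 ;; mv 2 0 ;; spl ;; mv 3 4 ;; mv 4 0 ;; mv 1 3 ;; mv 2 1 ;; fold_loop p ;;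
     clear 0 ;; mv 3 4 ;; mv 4 0) (store0 (c x))
     (T0 x + 100 * length (enc_pair (?X, enc_pair (?I, ?L'))) + 200 + ?L x + 16 * G x) (store0 ?F)"
    using bd[of "length (xs x)" x] by (elim runs_mono) simp
  next
   show "polyb (%x. length (c x)) (%x. T0 x + 100 * length (enc_pair (c x, enc_pair (b (init x), list_e a (xs x))))
     + 200 + ?L x + 16 * G x)"
    unfolding length_enc_pair by (intro polyb_intros p0 G pt_length[OF i] pt_length[OF l])
  qed
qed

lemma polyb_poly: "poly ([:2, 1:] ^ k) n = (n + 2 :: nat) ^ k"
  by (simp add: add.commute)

lemma polytime_of_pt:
  assumes "pt e e' f"
  shows "polytime e e' f"
proof -
  obtain p T where p: "!!x. runs p (store0 (e x)) (T x) (store0 (e' (f x)))" "polyb (%x. length (e x)) T"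
   using assms by (elim ptE) blast
  \<comment> \<open>The machine presents its input as a stack with the last letter on top and
    expects the output in the same order; a reversal on both sides compensates for this.\<close>
  define r where "r = mv 0 1 ;; mv 1 2 ;; mv 2 0"
  have r: "runs r (store0 w) (24 * length w + 5) (store0 (rev w))" for w
  proof -
   have "runs (mv 0 1) (store0 w) (8 * length w + 1) (St [] (rev w) [] [] [] [])"
    using runs_mv[of 0 1 "store0 w"] by (simp add: store0_St)
   also have "runs (mv 1 2) (St [] (rev w) [] [] [] []) (8 * length w + 1) (St [] [] w [] [] [])"
    using runs_mv[of 1 2 "St [] (rev w) [] [] [] []"] by simp
   also have "runs (mv 2 0) (St [] [] w [] [] []) (8 * length w + 1) (store0 (rev w))"
    using runs_mv[of 2 0 "St [] [] w [] [] []"] by (simp add: store0_St)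
   finally show ?thesis unfolding r_def by (rule runs_mono) simp
  qed
  let ?T = "%x. length (e x) + 1 + 2 * (24 * length (e x) + 5 + T x + 1 + (24 * length (e' (f x)) + 5) + 1)"
  have "EX n <= ?T x. tm_computes (prog_tm (r ;; p ;; r)) (e x) n (e' (f x))" for x
  proof -
   have "runs (r ;; p ;; r) (store0 (rev (e x)))
     (24 * length (e x) + 5 + T x + 1 + (24 * length (e' (f x)) + 5) + 1) (store0 (rev (e' (f x))))"
    by (rule runs_Then[OF runs_Then[OF _ p(1)[of x]] r[of "e' (f x)"]]) (use r[of "rev (e x)"] in simp)
   then obtain t where t: "t <= 24 * length (e x) + 5 + T x + 1 + (24 * length (e' (f x)) + 5) + 1"
    "exec (r ;; p ;; r) (store0 (rev (e x))) t (store0 (rev (e' (f x))))"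
    unfolding runs_def by blast
   obtain n where n: "n <= length (e x) + 1 + 2 * t" "tm_computes (prog_tm (r ;; p ;; r)) (e x) n (e' (f x))"
    using prog_tm_computes[OF t(2)[unfolded store0_def]] by auto
   show ?thesis by (rule exI[of _ n]) (use n t(1) in auto)
  qed
  moreover have "polyb (%x. length (e x)) ?T"
   by (intro polyb_intros p pt_length[OF assms])
  then obtain k where "!!x. ?T x <= (length (e x) + 2) ^ k" unfolding polyb_def by blast
  ultimately have "!!x. EX t <= poly ([:2, 1:] ^ k) (length (e x)). tm_computes (prog_tm (r ;; p ;; r)) (e x) t (e' (f x))"
   unfolding polyb_poly by (meson order_trans)
  then show ?thesis unfolding polytime_def using valid_prog_tm by blast
qed

lemma enc_unary_nat_e: "enc_unary = nat_e"
  by (simp add: fun_eq_iff enc_unary_def nat_e_def)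

lemma computable_of_pt: "pt nat_e nat_e h ==> computable_fun h"
  using polytime_of_pt unfolding polytime_def computable_fun_def enc_unary_nat_e by meson

lemma enc_param_prod_e: "enc_param = prod_e raw nat_e"
  by (auto simp: fun_eq_iff enc_param_def prod_e_def raw_def enc_unary_nat_e)

subsection \<open>Booleans, lists and numbers\<close>

lemma inj_raw: "inj raw"
  by (simp add: raw_def inj_def)

lemma inj_bool_e: "inj bool_e"
  by (simp add: bool_e_def inj_def)

lemma inj_nat_e: "inj nat_e"
  by (metis injI length_replicate nat_e_def)

lemma enc_pair_inj: "enc_pair (x, y) = enc_pair (x', y') \<longleftrightarrow> x = x' & y = y'"
  using usplit_enc_pair[of x y] usplit_enc_pair[of x' y'] by (metis prod.inject)

lemma enc_pair_neq_Nil: "enc_pair (x, y) ~= []"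
  by (simp add: enc_pair_dbl)

lemma inj_prod_e: "inj a ==> inj b ==> inj (prod_e a b)"
  by (auto simp: inj_def prod_e_def enc_pair_inj)

lemma list_e_inj: "inj a ==> list_e a xs = list_e a ys \<longleftrightarrow> xs = ys"
proof (induction xs arbitrary: ys)
  case Nil
  then show ?case using enc_pair_neq_Nil by (cases ys) (auto simp: eq_commute[of "[]"])
next
  case (Cons x xs)
  then show ?case using enc_pair_neq_Nil by (cases ys) (auto simp: enc_pair_inj inj_eq)
qed

lemma inj_list_e: "inj a ==> inj (list_e a)"
  by (rule injI) (simp add: list_e_inj)

lemmas inj_intros = inj_raw inj_bool_e inj_nat_e inj_prod_e inj_list_e

lemma list_e_append: "list_e a (xs @ ys) = list_e a xs @ list_e a ys"
  by (induction xs) (auto simp: enc_pair_dbl)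

lemma pt_raw: "pt c e f ==> pt c raw (%x. e (f x))"
  by (erule pt_cast) (simp add: raw_def)

lemma pt_cong: "pt c e f ==> (!!x. g x = f x) ==> pt c e g"
  by (erule pt_cast) simp

lemma pt_cons: "pt c a f ==> pt c (list_e a) g ==> pt c (list_e a) (%x. f x # g x)"
  by (drule (1) pt_pair, erule pt_cast) (simp add: prod_e_def)

lemma pt_append:
  assumes "pt c (list_e a) f" "pt c (list_e a) g"
  shows "pt c (list_e a) (%x. f x @ g x)"
proof -
  have "pt c raw (%x. list_e a (f x))" "pt c raw (%x. list_e a (g x))"
   using assms by (auto intro: pt_raw)
  from pt_append_raw[OF this] show ?thesis by (rule pt_cast) (simp add: raw_def list_e_append)
qed

lemma pt_null': "pt c (list_e a) f ==> pt c bool_e (%x. f x = [])"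
  by (rule pt_comp[OF pt_null])

lemma pt_zero': "pt c nat_e f ==> pt c bool_e (%x. f x = 0)"
  by (rule pt_comp[OF pt_zero])

lemma pt_not: "pt c bool_e f ==> pt c bool_e (%x. ~ f x)"
  by (rule pt_cast[OF pt_if[OF _ pt_const[of _ bool_e False] pt_const[of _ bool_e True]]]) auto

lemma pt_conj: "pt c bool_e f ==> pt c bool_e g ==> pt c bool_e (%x. f x & g x)"
  by (rule pt_cong[OF pt_if[OF _ _ pt_const[of _ bool_e False], of c f g]]) auto

lemma pt_disj: "pt c bool_e f ==> pt c bool_e g ==> pt c bool_e (%x. f x \<or> g x)"
  by (rule pt_cong[OF pt_if[OF _ pt_const[of _ bool_e True], of c f g]]) auto

lemma pt_imp: "pt c bool_e f ==> pt c bool_e g ==> pt c bool_e (%x. f x --> g x)"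
  by (rule pt_cong[OF pt_if[OF _ _ pt_const[of _ bool_e True], of c f g]]) auto

lemma pt_iff: "pt c bool_e f ==> pt c bool_e g ==> pt c bool_e (%x. f x = g x)"
  by (rule pt_cong[OF pt_if[OF _ _ pt_not, of c f g g]]) auto

lemma pt_tl: "pt c (list_e a) f ==> pt c (list_e a) (%x. tl (f x))"
proof (rule pt_comp[where f = f])
  show "pt (list_e a) (list_e a) tl"
   by (rule pt_cong_in[OF pt_usplit(2), where h = "list_e a"])
    (auto simp: raw_def, case_tac x, auto)
qed

text \<open>The default is explicit because a program has to deliver a definite encoding on every
  input, also on the empty list.\<close>

definition hdd :: "'a => 'a list => 'a" where
  "hdd d xs = (case xs of [] => d | x # _ => x)"

lemma hdd_simps [simp]: "hdd d [] = d" "hdd d (x # xs) = x"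
  by (simp_all add: hdd_def)

lemma pt_hdd: "pt c (list_e a) f ==> pt c a (%x. hdd d (f x))"
proof (rule pt_comp[where f = f])
  have "pt (list_e a) raw (%xs. fst (usplit (list_e a xs)))"
   by (rule pt_cong_in[OF pt_usplit(1), where h = "list_e a"]) (auto simp: raw_def)
  from pt_if[OF pt_null pt_const[of _ raw "a d"] this] show "pt (list_e a) a (hdd d)"
   by (rule pt_cast) (case_tac x, auto simp: raw_def)
qed

lemma concat_replicate_list_e: "list_e bool_e (w :: word) = concat (map (%b. [b, b, False, True]) w)"
  by (induction w) (auto simp: enc_pair_dbl bool_e_def)

text \<open>Makes a word available as a list of bits, so that the list operations can process its
  single letters.\<close>

lemma pt_bools: "pt c raw f ==> pt c (list_e bool_e) f"
  by (rule pt_cast[OF pt_comp[OF pt_expand[where h = "%b. [b, b, False, True]"]]])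
   (auto simp: raw_def concat_replicate_list_e)

lemma pt_units: "pt c nat_e f ==> pt c (list_e bool_e) (%x. replicate (f x) True)"
  by (rule pt_bools) (erule pt_cast, simp add: raw_def nat_e_def)

lemma polyb_len: "pt c a f ==> polyb (%x. length (c x)) (%x. length (a (f x)))"
  by (rule pt_length)

lemma length_nat_e [simp]: "length (nat_e n) = n"
  by (simp add: nat_e_def)

lemma pt_Suc: "pt c nat_e f ==> pt c nat_e (%x. Suc (f x))"
proof -
  assume "pt c nat_e f"
  then have "pt c raw (%x. nat_e (f x))" by (rule pt_cast) (simp add: raw_def)
  from pt_append_raw[OF this pt_const[of c raw "[True]"]] show ?thesis
   by (rule pt_cast) (simp add: raw_def nat_e_def replicate_append_same)
qed

lemma pt_add: "pt c nat_e f ==> pt c nat_e g ==> pt c nat_e (%x. f x + g x)"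
proof -
  assume "pt c nat_e f" "pt c nat_e g"
  then have "pt c raw (%x. nat_e (f x))" "pt c raw (%x. nat_e (g x))"
   by (auto intro: pt_raw)
  from pt_append_raw[OF this] show ?thesis
   by (rule pt_cast) (simp add: raw_def nat_e_def replicate_add)
qed

lemma pt_length_list: "pt c (list_e a) f ==> pt c nat_e (%x. length (f x))"
proof -
  assume f: "pt c (list_e a) f"
  have len: "foldl (%n _. Suc n) m ys = m + length ys" for m and ys :: "'b list"
   by (induction ys arbitrary: m) auto
  have "pt c nat_e (%x. foldl (%n _. Suc n) 0 (f x))"
   by (rule pt_foldl[OF _ pt_const f polyb_len[OF f]])
    (use length_list_e_len[of "f _" a] in \<open>auto intro!: pt_Suc pt_fst pt_snd pt_id simp: len[simplified] intro: le_trans\<close>)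
  then show ?thesis by (simp add: len)
qed

lemma pt_pred: "pt c nat_e f ==> pt c nat_e (%x. f x - 1)"
  by (rule pt_cast[OF pt_length_list[OF pt_tl[OF pt_units]]]) auto

lemma foldl_replicate_pred: "foldl (%a _. a - Suc 0) m (replicate n True) = m - n"
  by (induction n arbitrary: m) auto

lemma take_replicate_le: "j <= n ==> take j (replicate n x) = replicate j x"
  by (simp add: min_def)

lemma pt_diff: "pt c nat_e f ==> pt c nat_e g ==> pt c nat_e (%x. f x - g x)"
proof -
  assume f: "pt c nat_e f" and g: "pt c nat_e g"
  have "pt c nat_e (%x. foldl (%a _. a - Suc 0) (f x) (replicate (g x) True))"
   by (rule pt_foldl[OF _ f pt_units[OF g] polyb_len[OF f]])
    (auto intro!: pt_pred[simplified] pt_fst pt_snd pt_id simp: take_replicate_le foldl_replicate_pred)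
  then show ?thesis by (simp add: foldl_replicate_pred)
qed

lemma pt_le: "pt c nat_e f ==> pt c nat_e g ==> pt c bool_e (%x. f x <= g x)"
  by (rule pt_cast[OF pt_zero'[OF pt_diff]]) auto

lemma pt_less: "pt c nat_e f ==> pt c nat_e g ==> pt c bool_e (%x. f x < g x)"
  by (rule pt_cong[OF pt_not[OF pt_le[of c g f]]]) auto

lemma foldl_replicate_add: "foldl (%a _. a + m) u (replicate n True) = u + n * (m::nat)"
  by (induction n arbitrary: u) auto

lemma pt_mult: "pt c nat_e f ==> pt c nat_e g ==> pt c nat_e (%x. f x * g x)"
proof -
  assume f: "pt c nat_e f" and g: "pt c nat_e g"
  have *: "polyb (%x. length (c x)) (%x. f x * g x)"
   using polyb_mult[OF polyb_len[OF f] polyb_len[OF g]] by simp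
  have "pt c nat_e (%x. foldl (%a _. a + g x) 0 (replicate (f x) True))"
   by (rule pt_foldl[OF _ pt_const pt_units[OF f] *])
    (auto intro!: pt_add pt_fst pt_snd pt_id pt_comp[OF g, of _ fst] simp: take_replicate_le foldl_replicate_add)
  then show ?thesis by (simp add: foldl_replicate_add)
qed

lemma pt_power: "pt c nat_e f ==> pt c nat_e (%x. f x ^ k)"
  by (induction k) (auto intro: pt_mult pt_const)

lemma pt_concat_map:
  assumes g: "pt (prod_e c a) (list_e b) (%p. g (fst p) (snd p))" and f: "pt c (list_e a) f"
  shows "pt c (list_e b) (%x. concat (map (g x) (f x)))"
proof -
  have fold: "foldl (%acc y. acc @ h y) u ys = u @ concat (map h ys)" for h u ys
   by (induction ys arbitrary: u) auto
  obtain k where k: "!!p. length (list_e b (g (fst p) (snd p))) <= (length (prod_e c a p) + 2) ^ k"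
   using pt_length[OF g] unfolding polyb_def by blast
  let ?n = "%x. length (list_e a (f x))"
  let ?G = "%x. ?n x * (2 * length (c x) + ?n x + 4) ^ k"
  have "length (list_e b (concat (map (g x) ys))) <= length ys * (2 * length (c x) + ?n x + 4) ^ k"
   if "set ys <= set (f x)" for x ys
   using that
  proof (induction ys)
   case (Cons y ys)
   have "length (list_e b (g x y)) <= (length (prod_e c a (x, y)) + 2) ^ k" using k[of "(x, y)"] by simp
   also have "... <= (2 * length (c x) + ?n x + 4) ^ k"
    using length_list_e_mem[of y "f x" a] Cons.prems by (intro power_mono) (auto simp: prod_e_def)
   finally show ?case using Cons by (simp add: list_e_append)
  qed simp
  moreover have "length (take j (f x)) * m <= ?n x * m" for j x m
   using length_list_e_len[of "f x" a] by (intro mult_right_mono) auto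
  ultimately have bd: "length (list_e b (concat (map (g x) (take j (f x))))) <= ?G x" for x j
   by (meson order_trans set_take_subset)
  have "pt c (list_e b) (%x. foldl (%acc y. acc @ g x y) [] (f x))"
  proof (rule pt_foldl[OF _ pt_const f, where G = ?G])
   show "pt (prod_e c (prod_e (list_e b) a)) (list_e b) (%p. fst (snd p) @ g (fst p) (snd (snd p)))"
   proof (rule pt_append)
    have "pt (prod_e c (prod_e (list_e b) a)) (prod_e c a) (%p. (fst p, snd (snd p)))"
     by (rule pt_pair pt_fst pt_snd pt_id)+
    from pt_comp[OF g this] show "pt (prod_e c (prod_e (list_e b) a)) (list_e b) (%p. g (fst p) (snd (snd p)))"
     by simp
    show "pt (prod_e c (prod_e (list_e b) a)) (list_e b) (%p. fst (snd p))"
     by (rule pt_fst pt_snd pt_id)+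
   qed
   show "polyb (%x. length (c x)) ?G" by (intro polyb_intros polyb_len[OF f])
  qed (use bd in \<open>simp add: fold\<close>)
  then show ?thesis by (simp add: fold)
qed

lemma pt_map:
  assumes "pt (prod_e c a) b (%p. g (fst p) (snd p))" "pt c (list_e a) f"
  shows "pt c (list_e b) (%x. map (g x) (f x))"
  using pt_concat_map[of c a b "%x y. [g x y]" f, OF pt_cons[OF assms(1) pt_const] assms(2)] by simp

lemma filter_conv_concat: "filter P xs = concat (map (%y. if P y then [y] else []) xs)"
  by (induction xs) auto

lemma pt_filter:
  assumes "pt (prod_e c a) bool_e (%p. g (fst p) (snd p))" "pt c (list_e a) f"
  shows "pt c (list_e a) (%x. filter (g x) (f x))"
proof -
  have "pt (prod_e c a) (list_e a) (%p. if g (fst p) (snd p) then [snd p] else [])"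
   by (intro pt_if assms pt_cons pt_const pt_snd0)
  from pt_concat_map[OF this assms(2)] show ?thesis
   by (rule pt_cong) (simp add: filter_conv_concat)
qed

lemma pt_list_ex:
  assumes "pt (prod_e c a) bool_e (%p. g (fst p) (snd p))" "pt c (list_e a) f"
  shows "pt c bool_e (%x. EX y:set (f x). g x y)"
  by (rule pt_cast[OF pt_not[OF pt_null'[OF pt_filter[OF assms]]]]) (auto simp: filter_empty_conv)

lemma pt_list_all:
  assumes "pt (prod_e c a) bool_e (%p. g (fst p) (snd p))" "pt c (list_e a) f"
  shows "pt c bool_e (%x. ALL y:set (f x). g x y)"
  using pt_not[OF pt_list_ex[of c a "%x y. ~ g x y" f, OF pt_not[OF assms(1)] assms(2)]] by simp

lemma pt_concat: "pt c (list_e (list_e a)) f ==> pt c (list_e a) (%x. concat (f x))"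
  using pt_concat_map[of c "list_e a" a "%x y. y" f] by (simp add: pt_snd0)

lemma length_list_e_take_drop:
  "length (list_e a (take j xs)) + length (list_e a (drop j xs)) = length (list_e a xs)"
  by (metis append_take_drop_id length_append list_e_append)

lemma foldl_tl: "foldl (%xs _. tl xs) xs (replicate n True) = drop n xs"
  by (induction n arbitrary: xs) (auto simp: drop_Suc)

lemma pt_drop:
  assumes n: "pt c nat_e n" and f: "pt c (list_e a) f"
  shows "pt c (list_e a) (%x. drop (n x) (f x))"
proof -
  have "length (list_e a (drop j ys)) <= length (list_e a ys)" for j ys
   using length_list_e_take_drop[of a j ys] by simp
  then have "pt c (list_e a) (%x. foldl (%xs _. tl xs) (f x) (replicate (n x) True))"
   by (intro pt_foldl[OF _ f pt_units[OF n] polyb_len[OF f]])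
    (auto intro!: pt_tl pt_fst pt_snd pt_id simp: take_replicate_le foldl_tl)
  then show ?thesis by (simp add: foldl_tl)
qed

definition nthd :: "'a => 'a list => nat => 'a" where
  "nthd d xs n = hdd d (drop n xs)"

lemma nthd_nth: "n < length xs ==> nthd d xs n = xs ! n"
  by (simp add: nthd_def flip: Cons_nth_drop_Suc)

lemma pt_nthd: "pt c nat_e n ==> pt c (list_e a) f ==> pt c a (%x. nthd d (f x) (n x))"
  unfolding nthd_def by (intro pt_hdd pt_drop)

lemma foldl_upt: "foldl (%acc _. acc @ [length acc]) [0..<m] (replicate n True) = [0..<m + n]"
proof (induction n arbitrary: m)
  case (Suc n)
  then show ?case using Suc.IH[of "Suc m"] by simp
qed simp

lemma length_list_e_le: "(!!y. y \<in> set ys ==> length (a y) <= N) ==> length (list_e a ys) <= length ys * (2 * N + 2)"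
  by (induction ys) (auto, fastforce)

lemma pt_upt0: "pt c nat_e n ==> pt c (list_e nat_e) (%x. [0..<n x])"
proof -
  assume n: "pt c nat_e n"
  have len: "length (list_e nat_e [0..<j]) <= m * (2 * m + 2)" if "j <= m" for j m
  proof -
   have "length (list_e nat_e [0..<j]) <= length [0..<j] * (2 * j + 2)"
    by (rule length_list_e_le) auto
   also have "... <= m * (2 * m + 2)" using that by (intro mult_mono) auto
   finally show ?thesis .
  qed
  have "polyb (%x. length (c x)) (%x. n x * (2 * n x + 2))"
   by (intro polyb_intros polyb_len[OF n, simplified])
  moreover have fu: "foldl (%acc _. acc @ [length acc]) [] (replicate n True) = [0..<n]" for n
   using foldl_upt[of 0 n] by simp
  ultimately have "pt c (list_e nat_e) (%x. foldl (%acc _. acc @ [length acc]) [] (replicate (n x) True))"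
   by (intro pt_foldl[OF _ pt_const pt_units[OF n], where G = "%x. n x * (2 * n x + 2)"])
    (auto intro!: pt_append pt_cons pt_length_list pt_const pt_fst pt_snd pt_id len[OF _, simplified]
     simp: take_replicate_le fu)
  then show ?thesis by (simp add: fu)
qed

lemma foldl_eq_words:
  "foldl (%s b. (tl (fst s), snd s & fst s ~= [] & hdd True (fst s) = b)) (v, ok) w
   = (drop (length w) v, ok & length w <= length v & take (length w) v = w)"
proof (induction w arbitrary: v ok)
  case (Cons b w)
  show ?case by (cases v) (auto simp: Cons.IH)
qed simp

text \<open>The encodings are compared letter by letter; injectivity turns their equality into
  equality of the values.\<close>

lemma pt_eq:
  assumes "inj e" and f: "pt c e f" and g: "pt c e g"
  shows "pt c bool_e (%x. f x = g x)"
proof -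
  have f': "pt c (list_e bool_e) (%x. e (f x))" and g': "pt c (list_e bool_e) (%x. e (g x))"
   by (rule pt_bools[OF pt_raw], fact)+
  let ?st = "%s b. (tl (fst s), snd s & fst s ~= [] & hdd True (fst s) = b)"
  let ?e = "prod_e (list_e bool_e) bool_e"
  have st: "pt (prod_e c (prod_e ?e bool_e)) ?e (%p. ?st (fst (snd p)) (snd (snd p)))"
   by (rule pt_pair pt_tl pt_conj pt_not pt_null' pt_iff pt_hdd pt_fst pt_snd pt_id)+
  have "pt c ?e (%x. foldl ?st (e (g x), True) (e (f x)))"
  proof (rule pt_foldl[OF st _ f', where G = "%x. 2 * length (list_e bool_e (e (g x))) + 3"])
   show "pt c ?e (%x. (e (g x), True))" by (intro pt_pair g' pt_const)
   show "polyb (%x. length (c x)) (%x. 2 * length (list_e bool_e (e (g x))) + 3)"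
    by (intro polyb_intros polyb_len[OF g'])
   show "length (?e (foldl ?st (e (g x), True) (take j (e (f x))))) <= 2 * length (list_e bool_e (e (g x))) + 3" for x j
    using length_list_e_take_drop[of bool_e "length (take j (e (f x)))" "e (g x)"]
    by (simp add: foldl_eq_words prod_e_def bool_e_def)
  qed
  then have P: "pt c ?e (%x. (drop (length (e (f x))) (e (g x)),
    length (e (f x)) <= length (e (g x)) & take (length (e (f x))) (e (g x)) = e (f x)))"
   by (simp add: foldl_eq_words)
  have eq: "(f x = g x) = (drop (length (e (f x))) (e (g x)) = []
    & length (e (f x)) <= length (e (g x)) & take (length (e (f x))) (e (g x)) = e (f x))" for x
  proof -
   have "u = v \<longleftrightarrow> drop (length u) v = [] & length u <= length v & take (length u) v = u" for u v :: word
    by auto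
   then show ?thesis using inj_eq[OF assms(1)] by metis
  qed
  show ?thesis unfolding eq
   using pt_conj[OF pt_null'[OF pt_fst[OF P]] pt_snd[OF P]] by simp
qed

lemma pt_raw_of_bools: "pt c (list_e bool_e) f ==> pt c raw f"
proof -
  assume f: "pt c (list_e bool_e) f"
  have fold: "foldl (%acc b. acc @ [b]) u w = u @ w" for u w :: word
   by (induction w arbitrary: u) auto
  have "pt c raw (%x. foldl (%acc b. acc @ [b]) [] (f x))"
  proof (rule pt_foldl[OF _ pt_const f polyb_len[OF f]])
   have "pt (prod_e c (prod_e raw bool_e)) raw (%p. [snd (snd p)])"
    by (rule pt_cast[OF pt_snd[OF pt_snd[OF pt_id]]]) (simp add: raw_def bool_e_def)
   from pt_append_raw[OF pt_fst[OF pt_snd[OF pt_id]] this]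
   show "pt (prod_e c (prod_e raw bool_e)) raw (%p. fst (snd p) @ [snd (snd p)])" .
  qed (use length_list_e_len in \<open>auto simp: fold raw_def intro: le_trans\<close>)
  then show ?thesis by (simp add: fold)
qed


section \<open>Simulating Turing machines\<close>

definition updl :: "nat list => nat => nat => nat list" where
  "updl xs i a = map (%j. if j = i then a else nthd 0 xs j) [0..<length xs]"

lemma updl_nth: "updl xs i a = xs[i := a]"
  by (rule nth_equalityI) (auto simp: updl_def nth_list_update nthd_nth)

fun move_num :: "move => nat" where
  "move_num Left = 0"
| "move_num Stay = 1"
| "move_num Right = 2"

text \<open>The guard restricts the transition function to a finite domain, where it can be
  evaluated by table lookup (\<open>pt_finite\<close>). The empty list stands for halting.\<close>

definition tm_table :: "tm => nat \<times> nat list => (nat \<times> (nat \<times> nat) list) list" where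
  "tm_table M q = (if fst q < nstates M & length (snd q) = ntapes M & set (snd q) <= {..<nsyms M}
    then (case delta M (fst q) (snd q) of None => []
     | Some (s, as) => [(s, map (%(a, m). (a, move_num m)) as)]) else [])"

text \<open>Moves are numbered 0, 1, 2, so the new head position is the old one plus the number
  minus 1, within the natural numbers.\<close>

definition sim_step :: "tm => nat \<times> (nat list \<times> nat) list => nat \<times> (nat list \<times> nat) list" where
  "sim_step M c = (let r = tm_table M (fst c, map (%tp. nthd 0 (fst tp) (snd tp)) (snd c)) in
    if r = [] then c else (fst (hdd (0, []) r), map (%i.
     (let tp = nthd ([], 0) (snd c) i; am = nthd (0, 0) (snd (hdd (0, []) r)) i in
      (updl (fst tp) (snd tp) (fst am), snd tp + snd am - 1))) [0..<length (snd c)]))"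

text \<open>A window of the two-way infinite tape whose index 0 is cell \<open>- T\<close>; heads
  that start in cell 0 cannot leave it within \<open>T\<close> steps if
  \<open>2 * T < L\<close>.\<close>

definition rep_tape :: "nat => nat => (int => nat) \<times> int => nat list \<times> nat" where
  "rep_tape T L tp = (map (%i. fst tp (int i - int T)) [0..<L], nat (snd tp + int T))"

definition rep_conf :: "nat => nat => config => nat \<times> (nat list \<times> nat) list" where
  "rep_conf T L c = (fst c, map (rep_tape T L) (snd c))"

definition good_conf :: "tm => nat => config => bool" where
  "good_conf M j c \<longleftrightarrow> fst c < nstates M & length (snd c) = ntapes M &
    (ALL tp:set (snd c). (ALL i. fst tp i < nsyms M) & \<bar>snd tp\<bar> <= int j)"

lemma action_heads: "action M c = delta M (fst c) (heads (snd c))"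
  by (simp add: action_def heads_def)

lemma good_conf_step:
  assumes "valid_tm M" "good_conf M j c"
  shows "good_conf M (Suc j) (step M c)"
proof (cases "action M c")
  case None
  then show ?thesis using assms(2) by (auto simp: step_def good_conf_def)
next
  case (Some sas)
  obtain s as where sas: "sas = (s, as)" by fastforce
  have "length (heads (snd c)) = ntapes M" "set (heads (snd c)) <= {..<nsyms M}"
   using assms(2) by (auto simp: good_conf_def heads_def)
  then have v: "s < nstates M" "length as = ntapes M" "fst ` set as <= {..<nsyms M}"
   using assms Some[unfolded sas action_heads] unfolding valid_tm_def good_conf_def by blast+
  have "(ALL i. fst tp i < nsyms M) & \<bar>snd tp\<bar> <= int (Suc j)"
   if tp: "tp \<in> set (map2 (%(t, p) (a, m). (t(p := a), p + offset m)) (snd c) as)" for tp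
  proof -
   from tp obtain t p a m where tpam: "((t, p), (a, m)) \<in> set (zip (snd c) as)" "tp = (t(p := a), p + offset m)"
    by auto
   then have "(t, p) \<in> set (snd c)" "(a, m) \<in> set as" by (auto dest: set_zip_leftD set_zip_rightD)
   then have "ALL i. t i < nsyms M" "\<bar>p\<bar> <= int j" "a < nsyms M"
    using assms(2) v(3) by (auto simp: good_conf_def)
   moreover have "\<bar>offset m\<bar> <= 1" by (cases m) auto
   ultimately show ?thesis using tpam(2) by auto
  qed
  then show ?thesis using v assms(2) by (auto simp: step_def Some sas good_conf_def)
qed

lemma sim_step_rep:
  assumes M: "valid_tm M" and g: "good_conf M j c" and j: "j < T" and L: "2 * T < L"
  shows "sim_step M (rep_conf T L c) = rep_conf T L (step M c)"
proof -
  have pos: "nat (p + int T) < L" "int (nat (p + int T)) = p + int T" if "(t, p) \<in> set (snd c)" for t p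
   using g that j L by (auto simp: good_conf_def)
  have rd: "nthd 0 (fst (rep_tape T L tp)) (snd (rep_tape T L tp)) = fst tp (snd tp)" if "tp \<in> set (snd c)" for tp
   using pos[of "fst tp" "snd tp"] that by (simp add: rep_tape_def nthd_nth)
  have heads: "map (%tp. nthd 0 (fst tp) (snd tp)) (snd (rep_conf T L c)) = heads (snd c)"
   using rd by (auto simp: rep_conf_def heads_def)
  have dom: "fst c < nstates M" "length (heads (snd c)) = ntapes M" "set (heads (snd c)) <= {..<nsyms M}"
   using g by (auto simp: good_conf_def heads_def)
  show ?thesis
  proof (cases "delta M (fst c) (heads (snd c))")
   case None
   then show ?thesis using dom unfolding sim_step_def heads
    by (simp add: tm_table_def step_def action_heads) (simp add: rep_conf_def)
  next
   case (Some sas)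
   obtain s as where sas: "sas = (s, as)" by fastforce
   have len: "length as = length (snd c)"
    using M dom Some[unfolded sas] g unfolding valid_tm_def good_conf_def by metis
   have tab: "tm_table M (fst (rep_conf T L c), heads (snd c)) = [(s, map (%(a, m). (a, move_num m)) as)]"
    using dom Some sas by (simp add: tm_table_def rep_conf_def)
   have "map (%i. (let tp = nthd ([], 0) (map (rep_tape T L) (snd c)) i;
      am = nthd (0, 0) (map (%(a, m). (a, move_num m)) as) i in
      (updl (fst tp) (snd tp) (fst am), snd tp + snd am - 1))) [0..<length (snd c)]
     = map (rep_tape T L) (map2 (%(t, p) (a, m). (t(p := a), p + offset m)) (snd c) as)" (is "?l = ?r")
   proof (rule nth_equalityI)
    show "length ?l = length ?r" using len by simp
    fix i assume "i < length ?l"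
    then have i: "i < length (snd c)" "i < length as" using len by auto
    obtain t p where tp: "snd c ! i = (t, p)" by fastforce
    obtain a m where am: "as ! i = (a, m)" by fastforce
    have mem: "(t, p) \<in> set (snd c)" using i tp by (metis nth_mem)
    have bd: "\<bar>p\<bar> <= int j" using g mem by (auto simp: good_conf_def)
    have h: "nat (p + int T) + move_num m - 1 = nat (p + offset m + int T)"
     using bd j by (cases m) auto
    have "(map (%i. t (int i - int T)) [0..<L])[nat (p + int T) := a]
      = map (%i. (t(p := a)) (int i - int T)) [0..<L]"
     using bd j L by (intro nth_equalityI) (auto simp: nth_list_update)
    then show "?l ! i = ?r ! i" using i tp am h
     by (simp add: nthd_nth updl_nth rep_tape_def Let_def)
   qed
   then show ?thesis unfolding sim_step_def heads tab
    by (simp add: rep_conf_def step_def action_heads Some sas Let_def)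
  qed
qed

lemma sim_steps_rep:
  assumes M: "valid_tm M" and g: "good_conf M 0 c" and j: "j <= T" and L: "2 * T < L"
  shows "good_conf M j ((step M ^^ j) c)" "(sim_step M ^^ j) (rep_conf T L c) = rep_conf T L ((step M ^^ j) c)"
  using j
proof (induction j)
  case (Suc j)
  {
   case 1
   then show ?case using Suc good_conf_step[OF M] by simp
  next
   case 2
   then show ?case using Suc sim_step_rep[OF M _ _ L] by simp
  }
qed (use g in auto)

lemma pt_finite:
  assumes "finite D" "inj e"
  shows "pt e e' (%x. if x \<in> D then g x else d)"
  using assms(1)
proof (induction D rule: finite_induct)
  case empty
  then show ?case by (simp add: pt_const)
next
  case (insert a D)
  have "pt e e' (%x. if x = a then g a else if x \<in> D then g x else d)"
   by (intro pt_if insert pt_eq[OF assms(2)] pt_id pt_const)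
  then show ?case by (rule pt_cong) auto
qed

abbreviation "conf_e \<equiv> prod_e nat_e (list_e (prod_e (list_e nat_e) nat_e))"

lemma pt_tm_table: "pt (prod_e nat_e (list_e nat_e)) (list_e (prod_e nat_e (list_e (prod_e nat_e nat_e)))) (tm_table M)"
proof -
  let ?D = "{..<nstates M} \<times> {rs. set rs <= {..<nsyms M} & length rs = ntapes M}"
  have "finite ?D" using finite_lists_length_eq by blast
  from pt_finite[OF this, of "prod_e nat_e (list_e nat_e)" _ "tm_table M" "[]"]
  have "pt (prod_e nat_e (list_e nat_e)) (list_e (prod_e nat_e (list_e (prod_e nat_e nat_e))))
    (%x. if x \<in> ?D then tm_table M x else [])"
   by (auto intro: inj_intros)
  then show ?thesis by (rule pt_cong) (auto simp: tm_table_def)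
qed

lemma pt_updl: "pt c (list_e nat_e) f ==> pt c nat_e g ==> pt c nat_e h ==>
   pt c (list_e nat_e) (%x. updl (f x) (g x) (h x))"
proof -
  assume a: "pt c (list_e nat_e) f" "pt c nat_e g" "pt c nat_e h"
  note b = pt_comp[OF a(1) pt_fst0] pt_comp[OF a(2) pt_fst0] pt_comp[OF a(3) pt_fst0]
  show ?thesis unfolding updl_def
   by (rule b a pt_eq[OF inj_nat_e] pt_map pt_if pt_nthd pt_upt0 pt_length_list pt_snd pt_id)+
qed

lemma pt_Let: "pt c a f ==> pt (prod_e c a) b (%p. g (fst p) (snd p)) ==> pt c b (%x. Let (f x) (g x))"
  unfolding Let_def by (drule (1) pt_comp[OF _ pt_pair[OF pt_id], rotated]) simp

lemma pt_sim_step: "pt conf_e conf_e (sim_step M)"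
proof -
  have eq: "sim_step M = (%c. let r = tm_table M (fst c, map (%tp. nthd 0 (fst tp) (snd tp)) (snd c)) in
    if r = [] then c else (fst (hdd (0, []) r), map (%i.
     (let tp = nthd ([], 0) (snd c) i; am = nthd (0, 0) (snd (hdd (0, []) r)) i in
      (updl (fst tp) (snd tp) (fst am), snd tp + snd am - 1))) [0..<length (snd c)]))"
   by (simp add: fun_eq_iff sim_step_def)
  show ?thesis unfolding eq
   by (rule pt_Let pt_comp[OF pt_tm_table] pt_updl pt_pred pt_if pt_null' pt_pair pt_map pt_nthd pt_hdd
     pt_upt0 pt_length_list pt_add pt_fst pt_snd pt_id)+
qed

section \<open>From Turing machines back to stack programs\<close>

lemma polyb_poly_bound: "polyb (%n. n) (%n. poly p n)" for p :: "nat poly"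
  by (induction p) (auto intro!: polyb_intros)

definition sim_init :: "tm => nat => word => nat \<times> (nat list \<times> nat) list" where
  "sim_init M T w = (0, (map (%i. if T <= i & i < T + length w then (if nthd False w (i - T) then 2 else 1) else 0)
     [0..<2 * T + length w + 2], T)
    # map (%_. (map (%_. 0) [0..<2 * T + length w + 2], T)) [0..<ntapes M - 1])"

lemma sim_init_rep: "sim_init M T w = rep_conf T (2 * T + length w + 2) (init_config M w)"
  by (auto simp: sim_init_def rep_conf_def init_config_def rep_tape_def input_tape_def bit_sym_def
    nthd_nth nat_diff_distrib' map_replicate_const of_nat_diff)

definition sim_out :: "nat => nat list => word" where
  "sim_out T cs = map (%i. nthd 0 cs (T + i) = 2)
    (filter (%i. ALL j:set [0..<Suc i]. nthd 0 cs (T + j) ~= 0) [0..<length cs - T])"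

text \<open>After \<open>j\<close> steps the head has moved at most \<open>j\<close> cells, so the
  written part grows by at most one cell per step. This bounds the length of the output, which must
  fit into the simulated window.\<close>

lemma tape_blank_beyond:
  assumes "good_conf M 0 c" "valid_tm M" "!!i. i >= int n ==> fst (hd (snd c)) i = 0"
  shows "ALL i >= int (n + j). fst (hd (snd ((step M ^^ j) c))) i = 0"
proof (induction j)
  case 0
  then show ?case using assms(3) by simp
next
  case (Suc j)
  let ?c = "(step M ^^ j) c"
  have g: "good_conf M j ?c" using sim_steps_rep(1)[OF assms(2,1), of j j "2 * j + 1"] by simp
  show ?case
  proof (cases "action M ?c")
   case None
   then have "step M ?c = ?c" by (simp add: step_def)
   then show ?thesis using Suc by simp
  next
   case (Some sas)
   obtain s as where sas: "sas = (s, as)" by fastforce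
   have len: "length (snd ?c) = ntapes M" "ntapes M >= 1" using g assms(2) by (auto simp: good_conf_def valid_tm_def)
   have "length (heads (snd ?c)) = ntapes M" "set (heads (snd ?c)) <= {..<nsyms M}"
    using g by (auto simp: good_conf_def heads_def)
   then have "length as = ntapes M"
    using assms(2) g Some[unfolded sas action_heads] unfolding valid_tm_def good_conf_def by metis
   then obtain tp tps am ams where tp: "snd ?c = tp # tps" "as = am # ams"
    using len by (cases "snd ?c"; cases as) auto
   obtain t p a m where [simp]: "tp = (t, p)" "am = (a, m)" by fastforce
   have "\<bar>p\<bar> <= int j" using g tp by (auto simp: good_conf_def)
   moreover have "fst (hd (snd (step M ?c))) = t(p := a)"
    using tp by (simp add: step_def Some sas)
   ultimately show ?thesis using Suc tp by auto
  qed
qed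

lemma halted_stays: "action M c = None ==> (step M ^^ j) c = c"
  by (induction j) (auto simp: step_def)

lemma sim_out_correct:
  assumes "has_output c y" "length y <= T + n"
   "hd (snd c) = (t, p)" "cs = map (%i. t (int i - int T)) [0..<2 * T + n + 2]"
  shows "sim_out T cs = y"
proof -
  have out: "t (int i) = bit_sym (y ! i)" if "i < length y" for i using assms that by (auto simp: has_output_def)
  have z: "t (int (length y)) = 0" using assms by (auto simp: has_output_def)
  have c: "nthd 0 cs (T + i) = t (int i)" if "i < T + n + 2" for i
  proof -
   have "nthd 0 (map h [0..<L]) i = h i" if "i < L" for h :: "nat => nat" and i L
    using that by (simp add: nthd_nth)
   from this[of "T + i" "2 * T + n + 2" "%i. t (int i - int T)"] that show ?thesis
    unfolding assms(4) by simp
  qed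
  have eq: "(ALL j:set [0..<Suc i]. nthd 0 cs (T + j) ~= 0) \<longleftrightarrow> i < length y" if "i < T + n + 2" for i
  proof
   assume *: "ALL j:set [0..<Suc i]. nthd 0 cs (T + j) ~= 0"
   show "i < length y"
   proof (rule ccontr)
    assume "~ i < length y"
    then have "length y \<in> set [0..<Suc i]" by auto
    with * have "nthd 0 cs (T + length y) ~= 0" by blast
    then show False using c[of "length y"] z assms(2) by simp
   qed
  next
   assume "i < length y"
   then show "ALL j:set [0..<Suc i]. nthd 0 cs (T + j) ~= 0"
    using c out that by (auto simp: bit_sym_def)
  qed
  have lcs: "length cs - T = T + n + 2" using assms(4) by simp
  have "filter (%i. ALL j:set [0..<Suc i]. nthd 0 cs (T + j) ~= 0) [0..<length cs - T]
    = filter (%i. i < length y) [0..<T + n + 2]"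
   unfolding lcs by (rule filter_cong[OF refl], rule eq) (simp only: set_upt atLeastLessThan_iff)
  also have "... = [0..<length y]"
  proof -
   obtain k where k: "T + n + 2 = length y + k" using assms(2) nat_le_iff_add by (metis le_add1 le_trans)
   have "[0..<T + n + 2] = [0..<length y] @ [length y..<T + n + 2]"
    unfolding k by (rule upt_add_eq_append) simp
   then show ?thesis by (simp only: filter_append) (simp add: filter_empty_conv filter_id_conv del: upt_Suc)
  qed
  finally show ?thesis unfolding sim_out_def
   using assms(2) by (intro nth_equalityI) (auto simp: c out bit_sym_def)
qed

text \<open>Needed for the compression, which is given only by some machine but has to become part
  of the verifier.\<close>

theorem pt_of_polytime:
  assumes "polytime e e' f"
  shows "pt e e' f"
proof -
  obtain M p where M: "valid_tm M"
   and run: "!!a. EX t <= poly p (length (e a)). tm_computes M (e a) t (e' (f a))"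
   using assms unfolding polytime_def by blast
  obtain k where k: "!!n. poly p n <= (n + 2) ^ k"
   using polyb_poly_bound[of p] unfolding polyb_def by blast
  define T where "T w = (length w + 2) ^ k" for w :: word
  define S where "S w = foldl (%c _. sim_step M c) (sim_init M (T w) w) (replicate (T w) True)" for w
  have fold: "foldl (%c _. h c) c (replicate j True) = (h ^^ j) c" for h :: "'z => 'z" and c j
   by (induction j arbitrary: c) (auto simp: funpow_swap1)
  have g0: "good_conf M 0 (init_config M w)" for w
   using M by (auto simp: good_conf_def init_config_def valid_tm_def input_tape_def bit_sym_def)
  have S: "foldl (%c _. sim_step M c) (sim_init M (T w) w) (replicate j True)
    = rep_conf (T w) (2 * T w + length w + 2) ((step M ^^ j) (init_config M w))" if "j <= T w" for w j
   unfolding fold sim_init_rep by (rule sim_steps_rep(2)[OF M g0 that]) simp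
  have len: "pt raw nat_e length" using pt_length_list[OF pt_bools[OF pt_id]] .
  have T: "pt raw nat_e T"
   unfolding T_def by (intro pt_power pt_add len pt_const)
  let ?L = "%w. 2 * T w + length w + 2"
  have L: "pt raw nat_e ?L"
   by (intro pt_add pt_mult T len pt_const)
  have init: "pt raw conf_e (%w. sim_init M (T w) w)"
  proof -
   note b = pt_comp[OF T pt_fst0] pt_comp[OF len pt_fst0] pt_comp[OF pt_bools[OF pt_id] pt_fst0]
    pt_comp[OF L pt_fst0]
   show ?thesis unfolding sim_init_def
    by (rule b L T pt_pair pt_cons pt_map pt_if pt_conj pt_nthd pt_le pt_less pt_add pt_diff pt_upt0
      pt_const pt_snd pt_id)+
  qed
  let ?G = "%w. 2 * nstates M + 2 + ntapes M * (2 * (2 * (?L w * (2 * nsyms M + 2)) + 2 + 2 * T w) + 2)"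
  have bd: "length (conf_e (rep_conf (T w) (?L w) ((step M ^^ j) (init_config M w)))) <= ?G w" if "j <= T w" for w j
  proof -
   let ?c = "(step M ^^ j) (init_config M w)"
   have g: "good_conf M j ?c" using sim_steps_rep(1)[OF M g0, of j j "2 * j + 1"] by simp
   have "length (list_e (prod_e (list_e nat_e) nat_e) (map (rep_tape (T w) (?L w)) (snd ?c)))
     <= length (map (rep_tape (T w) (?L w)) (snd ?c)) * (2 * (2 * (?L w * (2 * nsyms M + 2)) + 2 + 2 * T w) + 2)"
   proof (rule length_list_e_le)
    fix y assume "y \<in> set (map (rep_tape (T w) (?L w)) (snd ?c))"
    then obtain t p where tp: "(t, p) \<in> set (snd ?c)" "y = rep_tape (T w) (?L w) (t, p)" by auto
    have t: "t i < nsyms M" for i using g tp by (auto simp: good_conf_def)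
    have p: "nat (p + int (T w)) <= 2 * T w" using g tp that by (fastforce simp: good_conf_def)
    have "length (list_e nat_e (fst y)) <= length (fst y) * (2 * nsyms M + 2)"
     using t by (intro length_list_e_le) (auto simp: tp rep_tape_def less_imp_le)
    then show "length (prod_e (list_e nat_e) nat_e y) <= 2 * (?L w * (2 * nsyms M + 2)) + 2 + 2 * T w"
     using p by (simp add: prod_e_def tp rep_tape_def)
   qed
   then show ?thesis using g by (simp add: prod_e_def rep_conf_def good_conf_def)
  qed
  have "pt raw conf_e S"
   unfolding S_def
  proof (rule pt_foldl[OF _ init pt_units[OF T], where G = ?G])
   show "pt (prod_e raw (prod_e conf_e bool_e)) conf_e (%p. sim_step M (fst (snd p)))"
    by (rule pt_comp[OF pt_sim_step]) (rule pt_fst pt_snd pt_id)+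
   show "polyb (%x. length (raw x)) ?G"
    using polyb_len[OF T] polyb_len[OF len] by (intro polyb_intros) auto
   show "length (conf_e (foldl (%c _. sim_step M c) (sim_init M (T w) w) (take j (replicate (T w) True)))) <= ?G w"
    if "j <= length (replicate (T w) True)" for w j
    using that bd[of j w] by (simp add: take_replicate_le S)
  qed
  moreover have "pt conf_e (list_e nat_e) (%c. fst (hdd ([], 0) (snd c)))"
   by (rule pt_fst pt_snd pt_hdd pt_id)+
  ultimately have cells: "pt raw (list_e nat_e) (%w. fst (hdd ([], 0) (snd (S w))))" (is "pt _ _ ?cells")
   by (rule pt_comp[rotated])
  have out: "pt raw raw (%w. sim_out (T w) (?cells w))"
  proof (rule pt_raw_of_bools)
   note b = pt_comp[OF T pt_fst0] pt_comp[OF cells pt_fst0]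
    pt_comp[OF T pt_fst[OF pt_fst0]] pt_comp[OF cells pt_fst[OF pt_fst0]]
   show "pt raw (list_e bool_e) (%w. sim_out (T w) (?cells w))"
    unfolding sim_out_def
    by (rule b T cells pt_map pt_filter pt_list_all pt_nthd pt_not pt_zero' pt_eq[OF inj_nat_e] pt_add pt_diff
      pt_length_list pt_upt0 pt_Suc pt_const pt_snd pt_id)+
  qed
  have "sim_out (T (e a)) (?cells (e a)) = e' (f a)" for a
  proof -
   let ?w = "e a" and ?c = "(step M ^^ T (e a)) (init_config M (e a))"
   obtain t where t: "t <= poly p (length ?w)" "tm_computes M ?w t (e' (f a))" using run by blast
   then have "t <= T ?w" using k[of "length ?w"] by (simp add: T_def)
   \<comment> \<open>The simulation always runs for \<open>T\<close> steps; a halted configuration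
     repeats itself, so the surplus does no harm.\<close>
   then obtain j where j: "T ?w = j + t" by (metis le_add_diff_inverse2)
   have c: "?c = (step M ^^ t) (init_config M ?w)"
    using halted_stays[of M "(step M ^^ t) (init_config M ?w)" j] t(2)
    by (simp add: j funpow_add tm_computes_def Let_def)
   then have o: "has_output ?c (e' (f a))" using t(2) by (simp add: tm_computes_def Let_def)
   have g: "good_conf M (T ?w) ?c" using sim_steps_rep(1)[OF M g0, of "T ?w" "T ?w" "2 * T ?w + 1"] by simp
   have ne: "snd ?c ~= []" using g M by (auto simp: good_conf_def valid_tm_def)
   have blank: "ALL i >= int (length ?w + T ?w). fst (hd (snd ?c)) i = 0"
    by (rule tape_blank_beyond[OF g0 M]) (auto simp: init_config_def input_tape_def)
   have len: "length (e' (f a)) <= T ?w + length ?w"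
   proof (rule ccontr)
    assume "~ ?thesis"
    then have "fst (hd (snd ?c)) (int (T ?w + length ?w)) = bit_sym (e' (f a) ! (T ?w + length ?w))"
     using o[unfolded has_output_def, THEN conjunct1, rule_format, of "T ?w + length ?w"] by simp
    then show False using blank by (auto simp: bit_sym_def add.commute split: if_splits)
   qed
   obtain u q where uq: "hd (snd ?c) = (u, q)" by fastforce
   have "?cells ?w = map (%i. u (int i - int (T ?w))) [0..<2 * T ?w + length ?w + 2]"
    using ne uq by (cases "snd ?c") (auto simp: S_def S rep_conf_def rep_tape_def)
   from sim_out_correct[OF o len uq this] show ?thesis .
  qed
  then show ?thesis using pt_cong_in[OF out, of e e e' f] by (simp add: raw_def)
qed

section \<open>Encoded instances\<close>

definition enc_inst :: "nat => (nat \<times> nat) list => nat list list list => word" where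
  "enc_inst n es fs = enc_nat n @ enc_list (%(u, v). enc_nat u @ enc_nat v) es
    @ enc_list (enc_list (enc_list enc_nat)) fs"

definition ok_inst :: "nat => nat => nat => (nat \<times> nat) list => nat list list list => bool" where
  "ok_inst d l n es fs \<longleftrightarrow>
    distinct (map (%(u, v). {u, v}) es) & distinct (map (map set) fs) &
    (ALL (u, v):set es. u < n & v < n & u ~= v) &
    (ALL Fs:set fs. length Fs = l & (ALL F:set Fs. distinct F & length F = d & (ALL u:set F. u < n)))"

definition inst :: "nat => (nat \<times> nat) list => nat list list list => nat urf_instance" where
  "inst n es fs = \<lparr>verts = {..<n}, edges = set (map (%(u, v). {u, v}) es), tuples = set (map (map set) fs)\<rparr>"

lemma inst_simps [simp]: "verts (inst n es fs) = {..<n}"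
   "edges (inst n es fs) = (%(u, v). {u, v}) ` set es" "tuples (inst n es fs) = map set ` set fs"
  by (simp_all add: inst_def)

lemma valid_inst: "ok_inst d l n es fs ==> valid_instance d l (inst n es fs)"
  by (force simp: ok_inst_def valid_instance_def card_insert_if distinct_card)

lemma encodes_inst: "ok_inst d l n es fs ==> encodes (enc_inst n es fs) (inst n es fs)"
  unfolding encodes_def ok_inst_def enc_inst_def inst_def by (intro exI[of _ n] exI[of _ es] exI[of _ fs]) auto

lemma encodesE:
  assumes "encodes x I" "valid_instance d l I"
  obtains n es fs where "x = enc_inst n es fs" "ok_inst d l n es fs" "I = inst n es fs"
proof -
  from assms(1) obtain n es fs where x: "x = enc_inst n es fs"
   and dist: "distinct (map (%(u, v). {u, v}) es)" "distinct (map (map set) fs)"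
    "ALL Fs:set fs. ALL F:set Fs. distinct F"
   and I: "verts I = {..<n}" "edges I = set (map (%(u, v). {u, v}) es)" "tuples I = set (map (map set) fs)"
   unfolding encodes_def enc_inst_def by blast
  have e: "u < n & v < n & u ~= v" if "(u, v) \<in> set es" for u v
  proof -
   have "{u, v} \<in> edges I" using that I by force
   then have "{u, v} <= verts I" "card {u, v} = 2" using assms(2) by (auto simp: valid_instance_def)
   then show ?thesis using I by (auto split: if_splits)
  qed
  have f: "length Fs = l & (ALL F:set Fs. length F = d & (ALL u:set F. u < n))" if "Fs \<in> set fs" for Fs
  proof -
   have "map set Fs \<in> tuples I" using that I by force
   then have "length (map set Fs) = l" "ALL F:set (map set Fs). F <= verts I & card F = d"
    using assms(2) unfolding valid_instance_def by blast+
   then show ?thesis using I dist(3) that by (auto simp: distinct_card)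
  qed
  show thesis
  proof (rule that[OF x])
   show "ok_inst d l n es fs" using dist e f by (auto simp: ok_inst_def)
   show "I = inst n es fs" using I by (cases I) (simp add: inst_def)
  qed
qed

lemma URF_iff: "(x, k) \<in> URF_coloring d l q \<longleftrightarrow>
   (EX es fs. x = enc_inst k es fs & ok_inst d l k es fs & yes_instance d q (inst k es fs))"
proof
  assume "(x, k) \<in> URF_coloring d l q"
  then obtain I where "encodes x I" "valid_instance d l I" "k = card (verts I)" "yes_instance d q I"
   by (auto simp: URF_coloring_def)
  then show "EX es fs. x = enc_inst k es fs & ok_inst d l k es fs & yes_instance d q (inst k es fs)"
   by (elim encodesE) auto
next
  assume "EX es fs. x = enc_inst k es fs & ok_inst d l k es fs & yes_instance d q (inst k es fs)"
  then show "(x, k) \<in> URF_coloring d l q"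
   unfolding URF_coloring_def using encodes_inst valid_inst by fastforce
qed

lemma num_constraints_inst: "ok_inst d l n es fs ==> num_constraints (inst n es fs) = length es + length fs"
  unfolding ok_inst_def num_constraints_def inst_def by (simp add: distinct_card del: set_map)

lemma ok_inst_counts:
  assumes "ok_inst d l n es fs"
  shows "length es <= n ^ 2" "length fs <= n ^ (d * l)"
proof -
  have "distinct es" using assms by (auto simp: ok_inst_def distinct_map)
  then have "length es = card (set es)" by (simp add: distinct_card)
  also have "... <= card ({..<n} \<times> {..<n})"
   using assms by (intro card_mono) (auto simp: ok_inst_def)
  finally show "length es <= n ^ 2" by (simp add: power2_eq_square)
  have "distinct fs" using assms by (auto simp: ok_inst_def distinct_map)
  then have "length fs = card (set fs)" by (simp add: distinct_card)
  also have "... <= card {Fs. set Fs <= {F. set F <= {..<n} & length F = d} & length Fs = l}"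
   using assms by (intro card_mono finite_lists_length_eq) (auto simp: ok_inst_def)
  also have "... = n ^ (d * l)"
   by (simp add: card_lists_length_eq finite_lists_length_eq power_mult)
  finally show "length fs <= n ^ (d * l)" .
qed

section \<open>Length of encodings and a criterion for kernels\<close>

lemma length_enc_list:
  "(!!x. x \<in> set xs ==> length (e x) <= B) ==> length (enc_list e xs) <= length xs * (B + 1) + 1"
proof (induction xs)
  case (Cons x xs)
  then have "length (enc_list e xs) <= length xs * (B + 1) + 1" "length (e x) <= B" by auto
  then show ?case by (simp add: enc_list_def)
qed (simp add: enc_list_def)

definition inst_bound :: "nat => nat => nat => nat" where
  "inst_bound d l n = n + 3 + n ^ 2 * (2 * n + 3) + n ^ (d * l) * (l * (d * (n + 2) + 2) + 2)"

lemma length_enc_inst: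
  assumes "ok_inst d l n es fs"
  shows "length (enc_inst n es fs) <= inst_bound d l n"
proof -
  have N: "length (enc_nat u) = u + 1" for u by (simp add: enc_nat_def)
  have "length (enc_list (%(u, v). enc_nat u @ enc_nat v) es) <= length es * (2 * n + 2 + 1) + 1"
   using assms by (intro length_enc_list) (auto simp: ok_inst_def N)
  also have "... <= n ^ 2 * (2 * n + 2 + 1) + 1"
   by (intro add_right_mono mult_right_mono ok_inst_counts(1)[OF assms]) simp
  finally have 1: "length (enc_list (%(u, v). enc_nat u @ enc_nat v) es) <= n ^ 2 * (2 * n + 3) + 1"
   by (simp only: add.assoc numeral_plus_numeral one_plus_numeral numeral_plus_one semiring_norm)
  have "length (enc_list enc_nat F) <= d * (n + 1 + 1) + 1" if "Fs \<in> set fs" "F \<in> set Fs" for Fs F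
   using length_enc_list[of F enc_nat "n + 1"] assms that by (auto simp: ok_inst_def N less_imp_le)
  then have "length (enc_list (enc_list enc_nat) Fs) <= l * (d * (n + 1 + 1) + 1 + 1) + 1" if "Fs \<in> set fs" for Fs
   using length_enc_list[of Fs "enc_list enc_nat" "d * (n + 1 + 1) + 1"] assms that by (auto simp: ok_inst_def)
  then have "length (enc_list (enc_list (enc_list enc_nat)) fs) <= length fs * (l * (d * (n + 1 + 1) + 1 + 1) + 1 + 1) + 1"
   by (intro length_enc_list) auto
  also have "... <= n ^ (d * l) * (l * (d * (n + 1 + 1) + 1 + 1) + 1 + 1) + 1"
   by (intro add_right_mono mult_right_mono ok_inst_counts(2)[OF assms]) simp
  finally show ?thesis using 1 by (simp add: enc_inst_def inst_bound_def N)
qed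

lemma pt_inst_bound: "pt c nat_e f ==> pt c nat_e (%x. inst_bound d l (f x))"
  unfolding inst_bound_def by (intro pt_add pt_mult pt_power pt_const)

lemma URF_length: "(x, k) \<in> URF_coloring d l q ==> length x <= inst_bound d l k"
  using length_enc_inst by (auto simp: URF_iff)

lemma nil_not_URF: "([], k) \<notin> URF_coloring d l q"
  by (auto simp: URF_iff enc_inst_def enc_nat_def)

text \<open>
  Every word that is too long to encode an instance on \<open>k\<close> vertices is a no-instance; hence a
  kernel for the short words suffices.
\<close>

lemma kernelI:
  assumes g: "pt (prod_e raw nat_e) (prod_e raw nat_e) g"
   and H: "pt nat_e nat_e H"
   and correct: "!!x k. length x <= inst_bound d l k ==> g (x, k) \<in> URF_coloring d l q \<longleftrightarrow> (x, k) \<in> URF_coloring d l q"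
   and size: "!!x k. length x <= inst_bound d l k ==> length (fst (g (x, k))) + snd (g (x, k)) <= H k"
   and out: "!!n es fs. ok_inst d l n es fs ==> EX n' es' fs'. g (enc_inst n es fs, n) = (enc_inst n' es' fs', n') &
     ok_inst d l n' es' fs' & length es' + length fs' <= m n"
   and m: "(%n. real (m n)) \<in> O(r)"
  shows "URF_admits_kernel_with_O_constraints d l q r"
proof -
  \<comment> \<open>The empty word encodes no instance, so \<open>([], 0)\<close> is a fixed
    no-instance.\<close>
  define f where "f p = (if length (fst p) <= inst_bound d l (snd p) then g p else ([], 0))" for p
  have len: "pt (prod_e raw nat_e) nat_e (%p. length (fst p))"
   by (rule pt_length_list[OF pt_bools[OF pt_fst0]])
  have "pt (prod_e raw nat_e) (prod_e raw nat_e) f"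
   unfolding f_def by (intro pt_if pt_le len pt_inst_bound pt_snd0 g pt_const)
  then have "polytime enc_param enc_param f" unfolding enc_param_prod_e by (rule polytime_of_pt)
  moreover have "computable_fun H" by (rule computable_of_pt[OF H])
  moreover have "(x, k) \<in> URF_coloring d l q \<longleftrightarrow> f (x, k) \<in> URF_coloring d l q" for x k
   using correct[of x k] URF_length[of x k d l q] nil_not_URF[of 0 d l q] by (auto simp: f_def)
  moreover have "length (fst (f (x, k))) + snd (f (x, k)) <= H k" for x k
   using size by (auto simp: f_def)
  ultimately have k: "is_kernel (URF_coloring d l q) H f"
   by (simp add: is_kernel_def is_compression_def)
  have "EX x' I'. f (x, card (verts I)) = (x', card (verts I')) & encodes x' I' & valid_instance d l I' &
    num_constraints I' <= m (card (verts I))" if xI: "encodes x I & valid_instance d l I" for x I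
  proof -
   from xI obtain n es fs where *: "x = enc_inst n es fs" "ok_inst d l n es fs" "I = inst n es fs"
    by (metis encodesE)
   obtain n' es' fs' where **: "g (enc_inst n es fs, n) = (enc_inst n' es' fs', n')"
    "ok_inst d l n' es' fs'" "length es' + length fs' <= m n"
    using out[OF *(2)] by blast
   have "f (x, card (verts I)) = (enc_inst n' es' fs', n')"
    using * ** length_enc_inst by (simp add: f_def)
   then show ?thesis
    using ** encodes_inst[OF **(2)] valid_inst[OF **(2)] num_constraints_inst[OF **(2)] *
    by (intro exI[of _ "enc_inst n' es' fs'"] exI[of _ "inst n' es' fs'"]) simp
  qed
  then show ?thesis unfolding URF_admits_kernel_with_O_constraints_def using k m by blast
qed

lemma bigo_const_power:
  assumes "!!n. n >= 1 ==> m n <= C * n ^ k"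
  shows "(%n. real (m n)) \<in> O(%n. real n ^ k)"
proof (rule bigoI)
  show "\<forall>\<^sub>F n in at_top. norm (real (m n)) <= real C * norm (real n ^ k)"
   using eventually_ge_at_top[of 1]
  proof eventually_elim
   case (elim n)
   then show ?case using of_nat_mono[OF assms[of n], where 'a = real] by simp
  qed
qed

text \<open>There are at most \<open>n ^ 2\<close> edges and \<open>n ^ (d * l)\<close> tuples, so
  the identity is already a kernel of the required size.\<close>

theorem kernel_trivial:
  assumes "2 <= k" "d * l <= k"
  shows "URF_admits_kernel_with_O_constraints d l q (%n. real n ^ k)"
proof (rule kernelI[where g = "%p. p" and H = "%k. inst_bound d l k + k" and m = "%n. n ^ 2 + n ^ (d * l)"])
  show "pt (prod_e raw nat_e) (prod_e raw nat_e) (%p. p)" by (rule pt_id)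
  show "pt nat_e nat_e (%k. inst_bound d l k + k)" by (intro pt_add pt_inst_bound pt_id)
  show "EX n' es' fs'. (enc_inst n es fs, n) = (enc_inst n' es' fs', n') &
     ok_inst d l n' es' fs' & length es' + length fs' <= n ^ 2 + n ^ (d * l)" if "ok_inst d l n es fs" for n es fs
   using that ok_inst_counts[OF that] add_mono by blast
  show "(%n. real (n ^ 2 + n ^ (d * l))) \<in> O(%n. real n ^ k)"
  proof (rule bigo_const_power[where C = 2])
   fix n :: nat assume "1 <= n"
   then have "n ^ 2 <= n ^ k" "n ^ (d * l) <= n ^ k" using assms by (auto intro: power_increasing)
   then show "n ^ 2 + n ^ (d * l) <= 2 * n ^ k" by simp
  qed
qed auto

section \<open>Rainbow polynomials in characteristic two\<close>

lemma bit_poly_double: "(x :: bit poly) + x = 0"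
proof (rule poly_eqI)
  have "b + b = 0" for b :: bit by (cases b) simp_all
  then show "coeff (x + x) n = coeff 0 n" for n by (simp only: coeff_add coeff_0)
qed

text \<open>Uniqueness of digits in base \<open>N\<close>, by remainder and quotient. It serves to
  recover a permutation from the exponent of its Leibniz term.\<close>

lemma digits_unique:
  fixes f g :: "nat => nat"
  assumes "!!a. f a < N" "!!a. g a < N" "(\<Sum>a<k. f a * N ^ a) = (\<Sum>a<k. g a * N ^ a)" "a < k"
  shows "f a = g a"
  using assms
proof (induction k arbitrary: f g a)
  case (Suc k)
  have s: "(\<Sum>a<Suc k. h a * N ^ a) = h 0 + N * (\<Sum>a<k. h (Suc a) * N ^ a)" for h
   by (simp add: sum.lessThan_Suc_shift sum_distrib_left mult_ac del: sum.lessThan_Suc)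
  have eq: "f 0 + N * (\<Sum>a<k. f (Suc a) * N ^ a) = g 0 + N * (\<Sum>a<k. g (Suc a) * N ^ a)"
   using Suc.prems(3) unfolding s .
  have "(f 0 + N * (\<Sum>a<k. f (Suc a) * N ^ a)) mod N = f 0" "(g 0 + N * (\<Sum>a<k. g (Suc a) * N ^ a)) mod N = g 0"
   using Suc.prems(1,2) by auto
  then have 0: "f 0 = g 0" using eq by simp
  then have "(\<Sum>a<k. f (Suc a) * N ^ a) = (\<Sum>a<k. g (Suc a) * N ^ a)"
   using eq Suc.prems(1)[of 0] by simp
  from Suc.IH[of "%a. f (Suc a)" "%a. g (Suc a)", OF _ _ this] have "a' < k ==> f (Suc a') = g (Suc a')" for a'
   using Suc.prems(1,2) by blast
  then show ?case using 0 Suc.prems(4) by (cases a) auto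
qed simp

definition dropn :: "nat => 'a list => 'a list" where
  "dropn i xs = take i xs @ drop (Suc i) xs"

lemma dropn_nth: "i < length xs ==> k < length xs ==> k ~= i ==> dropn i xs ! (if k < i then k else k - 1) = xs ! k"
  by (auto simp: dropn_def nth_append min_def)

lemma dropn_map: "dropn i (map f xs) = map f (dropn i xs)"
  by (simp add: dropn_def take_map drop_map)

lemma length_dropn: "i < length xs ==> length (dropn i xs) = length xs - 1"
  by (simp add: dropn_def)

text \<open>
  The Leibniz expansion of a Vandermonde determinant at the elements \<open>X ^ (N ^ b)\<close>, where signs are
  irrelevant. In each term one entry has exponent 0, so the term does not depend on it.
\<close>

definition vterm :: "nat => nat list => (nat => nat) => bit poly" where
  "vterm m b s = monom 1 (\<Sum>i<m. s i * Suc m ^ (b ! i))"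

definition vdm :: "nat => nat list => bit poly" where
  "vdm m b = (\<Sum>s | s permutes {..<m}. vterm m b s)"

text \<open>Composition with the transposition of two equal entries leaves the term unchanged and
  matches even with odd permutations. In characteristic 2 the two halves of the sum cancel.\<close>

lemma vdm_not_distinct:
  assumes "length b = m" "~ distinct b"
  shows "vdm m b = 0"
proof -
  obtain u v where uv: "u < m" "v < m" "u ~= v" "b ! u = b ! v"
   using assms by (auto simp: distinct_conv_nth)
  let ?P = "{s. s permutes {..<m}}" and ?t = "transpose u v"
  have t: "?t permutes {..<m}" using uv by (intro permutes_swap_id) auto
  have fin: "finite ?P" by (rule finite_permutations) simp
  have perm: "permutation s" if "s \<in> ?P" for s using that by (auto simp: permutation_permutes)
  have tt: "?t \<circ> ?t = id" by (simp add: fun_eq_iff)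
  have inv: "vterm m b (s \<circ> ?t) = vterm m b s" for s
  proof -
   have "(\<Sum>i<m. (s \<circ> ?t) i * Suc m ^ (b ! i)) = (\<Sum>i<m. s i * Suc m ^ (b ! ?t i))"
    using sum.reindex_bij_betw[OF permutes_imp_bij[OF t], of "%i. s (?t i) * Suc m ^ (b ! i)"] by simp
   moreover have "b ! ?t i = b ! i" for i using uv by (auto simp: transpose_def)
   ultimately show ?thesis by (simp add: vterm_def)
  qed
  have ev: "evenperm (s \<circ> ?t) \<longleftrightarrow> ~ evenperm s" if "s \<in> ?P" for s
   using evenperm_comp[OF perm[OF that], of ?t] uv by (simp add: evenperm_swap permutation_swap_id)
  have bij: "bij_betw (%s. s \<circ> ?t) {s \<in> ?P. evenperm s} {s \<in> ?P. ~ evenperm s}"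
  proof (rule bij_betw_byWitness[where f' = "%s. s \<circ> ?t"])
   show "(%s. s \<circ> ?t) ` {s \<in> ?P. evenperm s} <= {s \<in> ?P. ~ evenperm s}"
    "(%s. s \<circ> ?t) ` {s \<in> ?P. ~ evenperm s} <= {s \<in> ?P. evenperm s}"
    using ev permutes_compose[OF t] by auto
  qed (auto simp: comp_assoc tt)
  have "vdm m b = (\<Sum>s \<in> {s \<in> ?P. evenperm s}. vterm m b s) + (\<Sum>s \<in> {s \<in> ?P. ~ evenperm s}. vterm m b s)"
   unfolding vdm_def by (subst sum.union_disjoint[symmetric]) (auto intro!: sum.cong finite_subset[OF _ fin])
  also have "(\<Sum>s \<in> {s \<in> ?P. ~ evenperm s}. vterm m b s) = (\<Sum>s \<in> {s \<in> ?P. evenperm s}. vterm m b s)"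
   using sum.reindex_bij_betw[OF bij, of "vterm m b"] by (simp add: inv)
  finally show ?thesis by (simp add: bit_poly_double)
qed

text \<open>In base \<open>Suc m\<close> the exponent of a term has the digit \<open>s i\<close> at
  place \<open>b ! i\<close>. Distinct entries give distinct places, so different permutations have
  different exponents, and the monomial of the identity survives.\<close>

lemma vdm_distinct:
  assumes "length b = m" "distinct b"
  shows "vdm m b ~= 0"
proof -
  let ?N = "Suc m"
  let ?ex = "%s. \<Sum>i<m. s i * ?N ^ (b ! i)"
  obtain k where k: "!!i. i < m ==> b ! i < k"
   using assms(1) by (metis finite_set finite_nat_set_iff_bounded nth_mem)
  have inj: "inj_on ((!) b) {..<m}" using assms by (auto simp: inj_on_nth)
  have uniq: "s = id" if s: "s permutes {..<m}" and e: "?ex s = ?ex id" for s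
  proof -
   define dg where "dg s a = (if a \<in> (!) b ` {..<m} then s (the_inv_into {..<m} ((!) b) a) else 0)" for s :: "nat => nat" and a
   have dgb: "dg s (b ! i) = s i" if "i < m" for s i
    using that inj by (simp add: dg_def the_inv_into_f_f)
   have ex: "(\<Sum>a<k. dg s a * ?N ^ a) = ?ex s" for s
   proof -
    have "(\<Sum>a<k. dg s a * ?N ^ a) = (\<Sum>a \<in> (!) b ` {..<m}. dg s a * ?N ^ a)"
     using k by (intro sum.mono_neutral_right) (auto simp: dg_def)
    also have "... = ?ex s" by (subst sum.reindex[OF inj]) (simp add: dgb)
    finally show ?thesis .
   qed
   have lt: "dg s a < ?N" if "s permutes {..<m}" for s a
   proof (cases "a \<in> (!) b ` {..<m}")
    case True
    then obtain i where "i < m" "a = b ! i" by auto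
    then show ?thesis using dgb permutes_in_image[OF that, of i] by simp
   qed (simp add: dg_def)
   have "s i = i" if "i < m" for i
    using digits_unique[of "dg s" ?N "dg id" k "b ! i"] lt[OF s] lt[OF permutes_id] ex[of s] ex[of id] e k that
    by (simp add: dgb)
   then show ?thesis using s by (auto simp: fun_eq_iff permutes_def)
  qed
  have "coeff (vdm m b) (?ex id) = (\<Sum>s | s permutes {..<m}. if s = id then 1 else 0)"
   unfolding vdm_def coeff_sum using uniq by (intro sum.cong) (auto simp: vterm_def)
  also have "... = 1" by (simp add: permutes_id finite_permutations)
  finally show ?thesis by auto
qed

text \<open>The part of the expansion in which entry \<open>i\<close> is the one with exponent 0, as
  a function of the list \<open>c\<close> from which this entry has been dropped; the index shift
  closes the gap.\<close>

definition vpart :: "nat => nat => nat list => bit poly" where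
  "vpart m i c = (\<Sum>s | s permutes {..<m} & s i = 0.
    monom 1 (\<Sum>k \<in> {..<m} - {i}. s k * Suc m ^ (c ! (if k < i then k else k - 1))))"

lemma vdm_split:
  assumes "length b = m" "m > 0"
  shows "vdm m b = (\<Sum>i<m. vpart m i (dropn i b))"
proof -
  let ?P = "{s. s permutes {..<m}}"
  have fin: "finite ?P" by (rule finite_permutations) simp
  \<comment> \<open>The permutations are grouped by \<open>inv s 0\<close>, the entry that receives
    exponent 0.\<close>
  have "vdm m b = (\<Sum>i<m. \<Sum>s \<in> {s \<in> ?P. inv s 0 = i}. vterm m b s)"
   unfolding vdm_def
   using fin permutes_in_image[OF permutes_inv, of _ "{..<m}" 0] assms(2) by (intro sum.group[symmetric]) auto
  also have "... = (\<Sum>i<m. vpart m i (dropn i b))"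
  proof (rule sum.cong[OF refl])
   fix i assume i: "i \<in> {..<m}"
   have "{s \<in> ?P. inv s 0 = i} = {s. s permutes {..<m} & s i = 0}"
    using permutes_inverses permutes_inv_eq by fastforce
   moreover have "vterm m b s = monom 1 (\<Sum>k \<in> {..<m} - {i}. s k * Suc m ^ (dropn i b ! (if k < i then k else k - 1)))"
    if "s i = 0" for s
   proof -
    have "(\<Sum>k<m. s k * Suc m ^ (b ! k)) = (\<Sum>k \<in> {..<m} - {i}. s k * Suc m ^ (b ! k))"
     using i that by (intro sum.mono_neutral_right) auto
    also have "... = (\<Sum>k \<in> {..<m} - {i}. s k * Suc m ^ (dropn i b ! (if k < i then k else k - 1)))"
     using i assms(1) dropn_nth[of i b] by (intro sum.cong) auto
    finally show ?thesis by (simp add: vterm_def)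
   qed
   ultimately show "(\<Sum>s \<in> {s \<in> ?P. inv s 0 = i}. vterm m b s) = vpart m i (dropn i b)"
    unfolding vpart_def by (auto intro!: sum.cong)
  qed
  finally show ?thesis .
qed

subsection \<open>Keys and weights\<close>

text \<open>
  A key records, for each of the \<open>l\<close> blocks, either all \<open>d\<close> entries (mark 0) or all but the entry
  number \<open>i\<close> (mark \<open>i + 1\<close>).
\<close>

definition mark :: "nat => 'a list => nat \<times> 'a list" where
  "mark i F = (i, if i = 0 then F else dropn (i - 1) F)"

lemma sum_list_map_concat: "sum_list (map f (concat xss)) = (\<Sum>xs \<leftarrow> xss. sum_list (map f xs))"
  by (induction xss) auto

text \<open>The distributive law: expanding the product picks one summand per block, and these picks
  are the choices of marks.\<close>

lemma sum_list_n_lists_prod: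
  fixes f :: "nat => 'a => 'b :: comm_semiring_1"
  shows "(\<Sum>ch \<leftarrow> List.n_lists (length Fs) js. \<Prod>p \<leftarrow> zip ch Fs. f (fst p) (snd p)) = (\<Prod>F \<leftarrow> Fs. \<Sum>i \<leftarrow> js. f i F)"
proof (induction Fs)
  case (Cons F Fs)
  have "(\<Sum>ch \<leftarrow> List.n_lists (Suc (length Fs)) js. \<Prod>p \<leftarrow> zip ch (F # Fs). f (fst p) (snd p))
    = (\<Sum>ch \<leftarrow> List.n_lists (length Fs) js. \<Sum>i \<leftarrow> js. f i F * (\<Prod>p \<leftarrow> zip ch Fs. f (fst p) (snd p)))"
   by (simp add: sum_list_map_concat comp_def)
  also have "... = (\<Sum>i \<leftarrow> js. f i F) * (\<Sum>ch \<leftarrow> List.n_lists (length Fs) js. \<Prod>p \<leftarrow> zip ch Fs. f (fst p) (snd p))"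
   by (simp add: sum_list_mult_const sum_list_const_mult)
  finally show ?case using Cons by simp
qed simp


definition keyc :: "nat list => nat list list => (nat \<times> nat list) list" where
  "keyc ch Fs = map (%p. mark (fst p) (snd p)) (zip ch Fs)"

lemma keyc_fst: "length ch = length Fs ==> map fst (keyc ch Fs) = ch"
  by (simp add: keyc_def mark_def comp_def)

lemma prod_list_keyc:
  "(\<Prod>p \<leftarrow> keyc ch Fs. h (fst p) (snd p))
   = (\<Prod>p \<leftarrow> zip ch Fs. h (fst p) (if fst p = 0 then snd p else dropn (fst p - 1) (snd p)))"
  by (simp add: keyc_def mark_def comp_def)

lemma sum_list_choices:
  fixes h :: "nat => nat list => 'b :: comm_semiring_1"
  assumes "length Fs = l"
  shows "(\<Sum>ch \<leftarrow> List.n_lists l js. \<Prod>p \<leftarrow> keyc ch Fs. h (fst p) (snd p))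
   = (\<Prod>F \<leftarrow> Fs. \<Sum>i \<leftarrow> js. h i (if i = 0 then F else dropn (i - 1) F))"
  unfolding prod_list_keyc
  using sum_list_n_lists_prod[where Fs = Fs and js = js and f = "%i F. h i (if i = 0 then F else dropn (i - 1) F)"] assms by simp

definition full_choices :: "nat => nat => nat list list" where
  "full_choices d l = List.n_lists l [1..<d + 1]"

definition some_choices :: "nat => nat => nat list list" where
  "some_choices d l = filter (%ch. EX i:set ch. i ~= 0) (List.n_lists l [0..<d + 1])"

lemma card_image_distinct_map: "distinct F ==> card (c ` set F) = length F \<longleftrightarrow> distinct (map c F)"
  by (metis card_distinct distinct_card length_map set_map)

lemma uniformly_rainbow_lists:
  assumes "!!F. F \<in> set Fs ==> distinct F & length F = d"
  shows "uniformly_rainbow d c (map set Fs) \<longleftrightarrow>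
   (ALL F:set Fs. ALL F':set Fs. c ` set F = c ` set F') & (ALL F:set Fs. distinct (map c F))"
proof -
  have "card (c ` set F) = d \<longleftrightarrow> distinct (map c F)" if "F \<in> set Fs" for F
   using card_image_distinct_map[of F c] assms[OF that] by auto
  then show ?thesis by (simp add: uniformly_rainbow_def)
qed

lemma prod_list_map_zero:
  fixes f :: "'a => 'b :: {semiring_no_zero_divisors, monoid_mult, zero_neq_one}"
  shows "(\<Prod>x \<leftarrow> xs. f x) = 0 \<longleftrightarrow> (EX x:set xs. f x = 0)"
  by (induction xs) auto

text \<open>If \<open>l = 1\<close> or \<open>q = d\<close>, rainbow blocks automatically have the
  same color set, so the constraint is violated exactly if all block determinants are nonzero, that
  is if their product is. Expanding every block by its free entry leaves keys with
  \<open>d - 1\<close> vertices per block.\<close>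

lemma weights_full:
  assumes d: "d >= 1" and q: "l = 1 \<or> q = d"
  shows "EX w :: (nat \<times> nat list) list => bit poly. ALL Fs. length Fs = l -->
   (ALL F:set Fs. distinct F & length F = d & c ` set F <= {1..q}) -->
   ((\<Sum>ch \<leftarrow> full_choices d l. w (keyc ch Fs)) = 0 \<longleftrightarrow> ~ uniformly_rainbow d c (map set Fs))"
proof (intro exI allI impI)
  fix Fs :: "nat list list"
  assume l: "length Fs = l" and Fs: "ALL F:set Fs. distinct F & length F = d & c ` set F <= {1..q}"
  have "(\<Sum>i \<leftarrow> [1..<d + 1]. vpart d (i - 1) (map c (if i = 0 then F else dropn (i - 1) F))) = vdm d (map c F)"
   if "F \<in> set Fs" for F
  proof -
   have "(\<Sum>i \<leftarrow> [1..<d + 1]. vpart d (i - 1) (map c (if i = 0 then F else dropn (i - 1) F)))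
     = (\<Sum>i \<in> {1..<d + 1}. vpart d (i - 1) (map c (if i = 0 then F else dropn (i - 1) F)))"
    by (simp only: interv_sum_list_conv_sum_set_nat set_upt)
   also have "... = (\<Sum>i<d. vpart d i (map c (dropn i F)))"
    by (rule sum.reindex_bij_witness[of _ Suc "%i. i - 1"]) auto
   also have "... = vdm d (map c F)"
    using vdm_split[of "map c F" d] Fs that d by (simp add: dropn_map)
   finally show ?thesis .
  qed
  then have "(\<Prod>F \<leftarrow> Fs. \<Sum>i \<leftarrow> [1..<d + 1]. vpart d (i - 1) (map c (if i = 0 then F else dropn (i - 1) F)))
    = (\<Prod>F \<leftarrow> Fs. vdm d (map c F))"
   by (metis (mono_tags, lifting) map_cong)
  then have "(\<Sum>ch \<leftarrow> full_choices d l. \<Prod>p \<leftarrow> keyc ch Fs. vpart d (fst p - 1) (map c (snd p))) = (\<Prod>F \<leftarrow> Fs. vdm d (map c F))"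
   unfolding full_choices_def sum_list_choices[OF l, of "%i b. vpart d (i - 1) (map c b)"] by simp
  moreover have "(\<Prod>F \<leftarrow> Fs. vdm d (map c F)) = 0 \<longleftrightarrow> (EX F:set Fs. ~ distinct (map c F))"
  proof -
   have "vdm d (map c F) = 0 \<longleftrightarrow> ~ distinct (map c F)" if "F \<in> set Fs" for F
    using Fs that vdm_distinct[of "map c F" d] vdm_not_distinct[of "map c F" d] by auto
   then show ?thesis unfolding prod_list_map_zero by blast
  qed
  moreover have "uniformly_rainbow d c (map set Fs) \<longleftrightarrow> (ALL F:set Fs. distinct (map c F))"
  proof -
   have "c ` set F = c ` set F'" if "ALL F:set Fs. distinct (map c F)" "F \<in> set Fs" "F' \<in> set Fs" for F F'
    using q
   proof
    assume "l = 1"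
    then show ?thesis using l that by (auto simp: length_Suc_conv)
   next
    assume "q = d"
    have "c ` set F = {1..d}" if "F \<in> set Fs" for F
    proof (rule card_subset_eq)
     show "c ` set F <= {1..d}" using Fs that \<open>q = d\<close> by auto
     show "card (c ` set F) = card {1..d}"
      using card_image_distinct_map[of F c] Fs that \<open>ALL F:set Fs. distinct (map c F)\<close> by auto
    qed simp
    then show ?thesis using that by metis
   qed
   then show ?thesis using uniformly_rainbow_lists[of Fs d c] Fs by blast
  qed
  ultimately show "((\<Sum>ch \<leftarrow> full_choices d l. \<Prod>p \<leftarrow> keyc ch Fs. vpart d (fst p - 1) (map c (snd p))) = 0)
    = (~ uniformly_rainbow d c (map set Fs))" by auto
qed

text \<open>The first \<open>d\<close> coefficients are distinct monomials; the last one is their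
  sum, which is nonzero and cancels them in characteristic 2.\<close>

lemma zero_sum_coeffs:
  assumes "d >= 1"
  obtains lam :: "nat => bit poly" where "!!r. r \<in> {1..d + 1} ==> lam r ~= 0" "(\<Sum>r \<in> {1..d + 1}. lam r) = 0"
proof
  define S :: "bit poly" where "S = (\<Sum>r \<in> {1..d}. monom 1 r)"
  have "coeff S 1 = (\<Sum>r \<in> {1..d}. if r = 1 then 1 else 0)" unfolding S_def coeff_sum by (rule sum.cong) auto
  then have "coeff S 1 = 1" using assms by simp
  then have S: "S ~= 0" by auto
  show "(if r = d + 1 then S else monom 1 r) ~= 0" for r using S by (simp add: monom_eq_0_iff)
  have "{1..d + 1} = insert (d + 1) {1..d}" by auto
  then have "(\<Sum>r \<in> {1..d + 1}. if r = d + 1 then S else monom 1 r) = S + (\<Sum>r \<in> {1..d}. if r = d + 1 then S else monom 1 r)"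
   by simp
  also have "(\<Sum>r \<in> {1..d}. if r = d + 1 then S else monom 1 r) = S" unfolding S_def by (rule sum.cong) auto
  finally show "(\<Sum>r \<in> {1..d + 1}. if r = d + 1 then S else monom 1 r) = 0" by (simp add: bit_poly_double)
qed

lemma sum_list_sum_swap:
  fixes P :: "'a => 'b => 'c :: comm_semiring_1"
  shows "(\<Sum>y \<leftarrow> ys. \<Sum>r \<in> R. a r * P r y) = (\<Sum>r \<in> R. a r * (\<Sum>y \<leftarrow> ys. P r y))"
  by (induction ys) (auto simp: sum.distrib distrib_left)

text \<open>With \<open>d + 1\<close> colors a tuple is uniformly rainbow exactly if there is a
  color \<open>r\<close> missing in every block such that each block extended by \<open>r\<close> is
  rainbow. This \<open>r\<close> is unique, so in the weighted sum over \<open>r\<close> of the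
  products of determinants at most one summand is nonzero. The term in which \<open>r\<close> is the
  free entry of every block does not depend on \<open>r\<close>; its coefficients add up to 0, so no
  key with all \<open>d * l\<close> vertices is needed.\<close>

lemma weights_some:
  assumes d: "d >= 1" and l1: "l >= 1"
  shows "EX w :: (nat \<times> nat list) list => bit poly. ALL Fs. length Fs = l -->
   (ALL F:set Fs. distinct F & length F = d & c ` set F <= {1..d + 1}) -->
   ((\<Sum>ch \<leftarrow> some_choices d l. w (keyc ch Fs)) = 0 \<longleftrightarrow> ~ uniformly_rainbow d c (map set Fs))"
proof -
  obtain lam :: "nat => bit poly" where lam: "!!r. r \<in> {1..d + 1} ==> lam r ~= 0" "(\<Sum>r \<in> {1..d + 1}. lam r) = 0"
   using zero_sum_coeffs[OF d] by blast
  \<comment> \<open>Mark 0 says that the prefixed color \<open>r\<close> is the free entry, so that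
    all \<open>d\<close> vertices of the block remain.\<close>
  define G where "G r i b = (if i = 0 then vpart (d + 1) 0 (map c b) else vpart (d + 1) i (r # map c b))" for r i b
  define w where "w key = (\<Sum>r \<in> {1..d + 1}. lam r * (\<Prod>p \<leftarrow> key. G r (fst p) (snd p)))" for key
  show ?thesis
  proof (intro exI[of _ w] allI impI)
   fix Fs :: "nat list list"
   assume l: "length Fs = l" and Fs: "ALL F:set Fs. distinct F & length F = d & c ` set F <= {1..d + 1}"
   let ?V = "%r. \<Prod>F \<leftarrow> Fs. vdm (d + 1) (r # map c F)"
   have one: "(\<Sum>i \<leftarrow> [0..<d + 1]. G r i (if i = 0 then F else dropn (i - 1) F)) = vdm (d + 1) (r # map c F)"
    if "F \<in> set Fs" for r F
   proof -
    have "(\<Sum>i \<leftarrow> [0..<d + 1]. G r i (if i = 0 then F else dropn (i - 1) F))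
      = (\<Sum>i<d + 1. G r i (if i = 0 then F else dropn (i - 1) F))"
     by (simp only: interv_sum_list_conv_sum_set_nat set_upt atLeast0LessThan)
    also have "... = (\<Sum>i<d + 1. vpart (d + 1) i (dropn i (r # map c F)))"
    proof (rule sum.cong[OF refl])
     fix i show "G r i (if i = 0 then F else dropn (i - 1) F) = vpart (d + 1) i (dropn i (r # map c F))"
      by (cases i) (auto simp: G_def dropn_def take_map drop_map)
    qed
    also have "... = vdm (d + 1) (r # map c F)"
     using vdm_split[of "r # map c F" "d + 1"] Fs that by simp
    finally show ?thesis .
   qed
   have all: "(\<Sum>ch \<leftarrow> List.n_lists l [0..<d + 1]. w (keyc ch Fs)) = (\<Sum>r \<in> {1..d + 1}. lam r * ?V r)"
   proof -
    have "(\<Sum>ch \<leftarrow> List.n_lists l [0..<d + 1]. w (keyc ch Fs))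
      = (\<Sum>r \<in> {1..d + 1}. lam r * (\<Sum>ch \<leftarrow> List.n_lists l [0..<d + 1]. \<Prod>p \<leftarrow> keyc ch Fs. G r (fst p) (snd p)))"
     unfolding w_def by (rule sum_list_sum_swap)
    also have "... = (\<Sum>r \<in> {1..d + 1}. lam r * ?V r)"
     unfolding sum_list_choices[OF l] using one by (intro sum.cong arg_cong2[of _ _ _ _ "(*)"] arg_cong[of _ _ prod_list] map_cong) auto
    finally show ?thesis .
   qed
   have zero: "w (keyc ch Fs) = 0" if "ch \<in> set (List.n_lists l [0..<d + 1])" "~ (EX i:set ch. i ~= 0)" for ch
   proof -
    have "length ch = l" using that(1) by (simp add: set_n_lists)
    then have "ch = replicate l 0" using that(2) by (metis replicate_eqI)
    then have "(\<Prod>p \<leftarrow> keyc ch Fs. G r (fst p) (snd p)) = (\<Prod>F \<leftarrow> Fs. vpart (d + 1) 0 (map c F))" for r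
     unfolding prod_list_keyc using l by (intro arg_cong[of _ _ prod_list] nth_equalityI) (auto simp: G_def)
    then have "w (keyc ch Fs) = (\<Sum>r \<in> {1..d + 1}. lam r) * (\<Prod>F \<leftarrow> Fs. vpart (d + 1) 0 (map c F))"
     by (simp only: w_def sum_distrib_right)
    then show ?thesis using lam(2) by simp
   qed
   have flt: "(\<Sum>ch \<leftarrow> xs. w (keyc ch Fs)) = (\<Sum>ch \<leftarrow> filter (%ch. EX i:set ch. i ~= 0) xs. w (keyc ch Fs))"
    if "set xs <= set (List.n_lists l [0..<d + 1])" for xs
    using that zero by (induction xs) auto
   have S: "(\<Sum>ch \<leftarrow> some_choices d l. w (keyc ch Fs)) = (\<Sum>r \<in> {1..d + 1}. lam r * ?V r)"
    unfolding some_choices_def flt[OF order_refl, symmetric] by (rule all)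
   have V: "?V r = 0 \<longleftrightarrow> (EX F:set Fs. ~ (distinct (map c F) & r \<notin> c ` set F))" for r
   proof -
    have "vdm (d + 1) (r # map c F) = 0 \<longleftrightarrow> ~ (distinct (map c F) & r \<notin> c ` set F)" if "F \<in> set Fs" for F
     using vdm_distinct[of "r # map c F" "d + 1"] vdm_not_distinct[of "r # map c F" "d + 1"] Fs that by auto
    then show ?thesis unfolding prod_list_map_zero by blast
   qed
   have img: "c ` set F = {1..d + 1} - {r}" if "F \<in> set Fs" "distinct (map c F)" "r \<notin> c ` set F" "r \<in> {1..d + 1}" for F r
   proof (rule card_subset_eq)
    show "c ` set F <= {1..d + 1} - {r}" using Fs that by auto
    show "card (c ` set F) = card ({1..d + 1} - {r})" using card_image_distinct_map[of F c] Fs that by auto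
   qed simp
   have "(\<Sum>r \<in> {1..d + 1}. lam r * ?V r) ~= 0 \<longleftrightarrow> uniformly_rainbow d c (map set Fs)"
   proof
    assume "(\<Sum>r \<in> {1..d + 1}. lam r * ?V r) ~= 0"
    then obtain r where r: "r \<in> {1..d + 1}" "lam r * ?V r ~= 0" by (meson sum.not_neutral_contains_not_neutral)
    then have "?V r ~= 0" by auto
    then have "ALL F:set Fs. distinct (map c F) & r \<notin> c ` set F" using V by blast
    then show "uniformly_rainbow d c (map set Fs)"
     using uniformly_rainbow_lists[of Fs d c] Fs img[OF _ _ _ r(1)] by blast
   next
    assume u: "uniformly_rainbow d c (map set Fs)"
    then have dist: "ALL F:set Fs. distinct (map c F)" and same: "ALL F:set Fs. ALL F':set Fs. c ` set F = c ` set F'"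
     using uniformly_rainbow_lists[of Fs d c] Fs by blast+
    obtain F0 where F0: "F0 \<in> set Fs" using l l1 by (metis length_greater_0_conv less_le_trans zero_less_one nth_mem)
    have "card (c ` set F0) = d" using F0 Fs dist card_image_distinct_map[of F0 c] by auto
    then have "card (c ` set F0) ~= card {1..d + 1}" by simp
    then have "c ` set F0 ~= {1..d + 1}" by (rule contrapos_nn) (rule arg_cong)
    then obtain r where r: "r \<in> {1..d + 1}" "r \<notin> c ` set F0" using Fs F0 by blast
    have Vr: "?V r ~= 0" using V dist same F0 r by blast
    have "?V r' = 0" if "r' \<in> {1..d + 1}" "r' ~= r" for r'
     using V img[OF F0 _ r(2,1)] dist F0 that by blast
    then have "(\<Sum>r \<in> {1..d + 1}. lam r * ?V r) = (\<Sum>r' \<in> {1..d + 1}. if r' = r then lam r * ?V r else 0)"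
     by (intro sum.cong) auto
    also have "... = lam r * ?V r" using r by simp
    finally show "(\<Sum>r \<in> {1..d + 1}. lam r * ?V r) ~= 0" using lam(1)[OF r(1)] Vr by simp
   qed
   then show "((\<Sum>ch \<leftarrow> some_choices d l. w (keyc ch Fs)) = 0) = (~ uniformly_rainbow d c (map set Fs))"
    using S by auto
  qed
qed

section \<open>Elimination over the two-element field\<close>

text \<open>A vector is the list of the keys at which it is 1.\<close>

definition lxor :: "'k list => 'k list => 'k list" where
  "lxor a b = filter (%x. x \<notin> set b) a @ filter (%x. x \<notin> set a) b"

definition reduce :: "'k => 'k list list => 'k list => 'k list" where
  "reduce k0 B v = foldl (%v b. if hdd k0 b \<in> set v then lxor v b else v) v B"

definition elim_step :: "'k => 'k list list \<times> 'i list => 'i \<times> 'k list => 'k list list \<times> 'i list" where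
  "elim_step k0 s p = (let v = reduce k0 (fst s) (snd p) in
    if v = [] then s else (fst s @ [v], snd s @ [fst p]))"

definition elim :: "'k => ('i \<times> 'k list) list => 'k list list \<times> 'i list" where
  "elim k0 ps = foldl (elim_step k0) ([], []) ps"

text \<open>Echelon form with the first key of a vector as its pivot. The pivot is absent from all
  later vectors, so a reduction in list order never brings a removed pivot back.\<close>

fun ech :: "'k => 'k list list => bool" where
  "ech k0 [] = True"
| "ech k0 (b # B) = (b ~= [] & distinct b & (ALL b':set B. hdd k0 b \<notin> set b') & ech k0 B)"

lemma set_lxor: "set (lxor a b) = (set a - set b) \<union> (set b - set a)"
  by (auto simp: lxor_def)

lemma distinct_lxor: "distinct a ==> distinct b ==> distinct (lxor a b)"
  by (auto simp: lxor_def)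

lemma sum_lxor:
  fixes w :: "'k => 'r :: comm_ring_1"
  assumes "!!x :: 'r. x + x = 0"
  shows "sum w (set (lxor a b)) = sum w (set a) + sum w (set b)"
proof -
  have "sum w (set a) = sum w (set a - set b) + sum w (set a \<inter> set b)"
   "sum w (set b) = sum w (set b - set a) + sum w (set a \<inter> set b)"
   by (metis sum.Int_Diff List.finite_set add.commute, metis sum.Int_Diff List.finite_set add.commute inf_commute)
  moreover have "sum w (set (lxor a b)) = sum w (set a - set b) + sum w (set b - set a)"
   unfolding set_lxor by (rule sum.union_disjoint) auto
  ultimately show ?thesis using assms[of "sum w (set a \<inter> set b)"] by (simp add: algebra_simps)
qed

lemma reduce_Cons: "reduce k0 (b # B) v = reduce k0 B (if hdd k0 b \<in> set v then lxor v b else v)"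
  by (simp add: reduce_def)

lemma reduce_distinct: "distinct v ==> (!!b. b \<in> set B ==> distinct b) ==> distinct (reduce k0 B v)"
  by (induction B arbitrary: v) (auto simp: reduce_Cons distinct_lxor reduce_def[of _ "[]"])

lemma reduce_subset: "set (reduce k0 B v) <= set v \<union> (\<Union>b \<in> set B. set b)"
proof (induction B arbitrary: v)
  case (Cons b B)
  show ?case using Cons[of "if hdd k0 b \<in> set v then lxor v b else v"] by (auto simp: reduce_Cons set_lxor split: if_splits)
qed (simp add: reduce_def)

lemma reduce_avoids: "x \<notin> set v ==> (!!b. b \<in> set B ==> x \<notin> set b) ==> x \<notin> set (reduce k0 B v)"
  using reduce_subset[of k0 B v] by auto

lemma hdd_in: "b ~= [] ==> hdd k0 b \<in> set b"
  by (cases b) auto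

lemma reduce_pivots: "ech k0 B ==> b \<in> set B ==> hdd k0 b \<notin> set (reduce k0 B v)"
proof (induction B arbitrary: v)
  case (Cons b' B)
  let ?v = "if hdd k0 b' \<in> set v then lxor v b' else v"
  have "hdd k0 b' \<notin> set ?v" using hdd_in[of b' k0] Cons.prems(1) by (auto simp: set_lxor)
  then have "hdd k0 b' \<notin> set (reduce k0 B ?v)" using Cons.prems(1) by (intro reduce_avoids) auto
  then show ?case using Cons by (auto simp: reduce_Cons)
qed simp

lemma reduce_sum:
  fixes w :: "'k => 'r :: comm_ring_1"
  assumes "!!x :: 'r. x + x = 0" "!!b. b \<in> set B ==> sum w (set b) = 0"
  shows "sum w (set (reduce k0 B v)) = sum w (set v)"
  using assms(2)
proof (induction B arbitrary: v)
  case (Cons b B)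
  have "sum w (set (lxor v b)) = sum w (set v)" using sum_lxor[OF assms(1), of w v b] Cons.prems[of b] by simp
  then show ?case using Cons by (simp add: reduce_Cons)
qed (simp add: reduce_def)

lemma ech_snoc:
  "ech k0 B ==> v ~= [] ==> distinct v ==> (!!b. b \<in> set B ==> hdd k0 b \<notin> set v) ==> ech k0 (B @ [v])"
  by (induction B) auto

lemma ech_distinct: "ech k0 B ==> b \<in> set B ==> distinct b"
  by (induction B) auto

text \<open>The pivots are pairwise distinct elements of \<open>U\<close>.\<close>

lemma ech_length:
  assumes "ech k0 B" "!!b. b \<in> set B ==> set b <= U" "finite U"
  shows "length B <= card U"
proof -
  have "distinct (map (hdd k0) B)" using assms(1)
  proof (induction B)
   case (Cons b B)
   have "hdd k0 b' \<in> set b'" if "b' \<in> set B" for b'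
    using Cons.prems that by (intro hdd_in) (induction B, auto)
   then show ?case using Cons by auto
  qed simp
  moreover have "set (map (hdd k0) B) <= U"
  proof -
   have "b ~= []" if "b \<in> set B" for b using assms(1) that by (induction B) auto
   then show ?thesis using assms(2) hdd_in[of _ k0] by fastforce
  qed
  ultimately show ?thesis using card_mono[OF assms(3)] by (metis distinct_card length_map)
qed

text \<open>Back substitution: the later vectors are solved first, and changing the weight of the
  first pivot then repairs the first equation without affecting them.\<close>

lemma ech_solve:
  assumes "ech k0 B" "length t = length B"
  shows "EX w :: 'k => bit. ALL i < length B. sum w (set (B ! i)) = t ! i"
  using assms
proof (induction B arbitrary: t)
  case (Cons b B)
  obtain t0 t' where t: "t = t0 # t'" using Cons.prems by (cases t) auto
  obtain w :: "'k => bit" where w: "ALL i < length B. sum w (set (B ! i)) = t' ! i"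
   using Cons.IH[of t'] Cons.prems t by auto
  let ?x = "hdd k0 b"
  define w' where "w' = w(?x := t0 + sum w (set b - {?x}))"
  have x: "?x \<in> set b" using Cons.prems by (intro hdd_in) auto
  have dbl: "u + u = 0" for u :: bit by (cases u) simp_all
  have "sum w' (set b) = w' ?x + sum w' (set b - {?x})" using x by (simp add: sum.remove)
  also have "sum w' (set b - {?x}) = sum w (set b - {?x})" by (rule sum.cong) (auto simp: w'_def)
  finally have 0: "sum w' (set b) = t0" by (simp only: w'_def fun_upd_same add.assoc dbl add_0_right)
  have "sum w' (set (B ! i)) = t' ! i" if "i < length B" for i
  proof -
   have "?x \<notin> set (B ! i)" using Cons.prems that by auto
   then have "sum w' (set (B ! i)) = sum w (set (B ! i))" by (intro sum.cong) (auto simp: w'_def)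
   then show ?thesis using w that by simp
  qed
  then show ?case using 0 t by (intro exI[of _ w']) (auto simp: less_Suc_eq_0_disj)
qed simp

text \<open>The weights may lie in any commutative ring in which doubling gives 0, because the
  elimination only adds vectors. The same algorithm thus serves for polynomial weights in the
  kernels and for bits in the affine systems. The last two implications together say that weight 0
  on the kept items \<open>K\<close> forces weight 0 on all items.\<close>

lemma elim_correct0:
  fixes vf :: "'i => 'k list" and w :: "'k => 'r :: comm_ring_1"
  assumes r: "!!x :: 'r. x + x = 0"
   and "ALL F:set items. distinct (vf F)" "elim k0 (map (%F. (F, vf F)) items) = (B, K)"
  shows "ech k0 B & length K = length B & set K <= set items &
   (ALL b:set B. set b <= (\<Union>F \<in> set items. set (vf F))) &
   (distinct (map g items) --> distinct (map g K)) &
   ((ALL F:set K. sum w (set (vf F)) = 0) --> (ALL b:set B. sum w (set b) = 0)) &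
   ((ALL b:set B. sum w (set b) = 0) --> (ALL F:set items. sum w (set (vf F)) = 0))"
  using assms(2,3)
proof (induction items arbitrary: B K rule: rev_induct)
  case Nil
  then show ?case by (simp add: elim_def)
next
  case (snoc F items)
  obtain B0 K0 where e0: "elim k0 (map (%F. (F, vf F)) items) = (B0, K0)" by fastforce
  define v where "v = reduce k0 B0 (vf F)"
  have BK: "(B, K) = (if v = [] then (B0, K0) else (B0 @ [v], K0 @ [F]))"
   using snoc.prems(2) e0 by (auto simp: elim_def elim_step_def v_def Let_def)
  have "ALL F:set items. distinct (vf F)" using snoc.prems(1) by simp
  note IH = snoc.IH[OF this e0]
  have e: "ech k0 B0" using IH by blast
  have dv: "distinct v" unfolding v_def
   using snoc.prems(1) ech_distinct[OF e] by (intro reduce_distinct) auto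
  have pv: "hdd k0 b \<notin> set v" if "b \<in> set B0" for b
   unfolding v_def by (rule reduce_pivots[OF e that])
  have sv: "set v <= set (vf F) \<union> (\<Union>b \<in> set B0. set b)" unfolding v_def by (rule reduce_subset)
  have sumv: "sum w (set v) = sum w (set (vf F))" if "ALL b:set B0. sum w (set b) = 0"
   unfolding v_def using that by (intro reduce_sum[OF r]) auto
  show ?case
  proof (cases "v = []")
   case True
   then have BK': "B = B0" "K = K0" using BK by auto
   show ?thesis unfolding BK' using IH sumv True by auto
  next
   case False
   then have BK': "B = B0 @ [v]" "K = K0 @ [F]" using BK by auto
   from IH have i2: "length K0 = length B0" and i3: "set K0 <= set items"
    and i4: "ALL b:set B0. set b <= (\<Union>F \<in> set items. set (vf F))"
    and i5: "distinct (map g items) --> distinct (map g K0)"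
    and i6: "(ALL F:set K0. sum w (set (vf F)) = 0) --> (ALL b:set B0. sum w (set b) = 0)"
    and i7: "(ALL b:set B0. sum w (set b) = 0) --> (ALL F:set items. sum w (set (vf F)) = 0)"
    by blast+
   have v': "set v <= set (vf F) \<union> (\<Union>F \<in> set items. set (vf F))"
    using sv i4 by blast
   show ?thesis unfolding BK'
   proof (intro conjI)
    show "ech k0 (B0 @ [v])" by (rule ech_snoc[OF e False dv pv])
    show "length (K0 @ [F]) = length (B0 @ [v])" using i2 by simp
    show "set (K0 @ [F]) <= set (items @ [F])" using i3 by auto
    show "ALL b:set (B0 @ [v]). set b <= (\<Union>F \<in> set (items @ [F]). set (vf F))"
     using i4 v' by simp blast
    show "distinct (map g (items @ [F])) --> distinct (map g (K0 @ [F]))" using i3 i5 by auto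
    show "(ALL F:set (K0 @ [F]). sum w (set (vf F)) = 0) --> (ALL b:set (B0 @ [v]). sum w (set b) = 0)"
     using i6 sumv by simp
    show "(ALL b:set (B0 @ [v]). sum w (set b) = 0) --> (ALL F:set (items @ [F]). sum w (set (vf F)) = 0)"
     using i7 sumv[symmetric] by simp
   qed
  qed
qed

lemma elim_correct:
  fixes vf :: "'i => 'k list"
  assumes "!!F. F \<in> set items ==> distinct (vf F)" "elim k0 (map (%F. (F, vf F)) items) = (B, K)"
  shows "ech k0 B" "length K = length B" "set K <= set items"
   "!!b. b \<in> set B ==> set b <= (\<Union>F \<in> set items. set (vf F))"
   "distinct (map g items) ==> distinct (map g K)"
proof -
  have "b + b = 0" for b :: bit by (cases b) simp_all
  note e = elim_correct0[OF this _ assms(2), where w = "%_. 0" and g = g]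
  show "ech k0 B" "length K = length B" "set K <= set items"
   "!!b. b \<in> set B ==> set b <= (\<Union>F \<in> set items. set (vf F))"
   "distinct (map g items) ==> distinct (map g K)"
   using e assms(1) by blast+
qed

subsection \<open>Running time\<close>

lemma pt_mem: "inj e ==> pt c e f ==> pt c (list_e e) g ==> pt c bool_e (%x. f x \<in> set (g x))"
proof -
  assume e: "inj e" and f: "pt c e f" and g: "pt c (list_e e) g"
  have "pt c bool_e (%x. EX y:set (g x). y = f x)"
   by (rule pt_list_ex[OF pt_eq[OF e pt_snd0 pt_comp[OF f pt_fst0]] g])
  then show ?thesis by (rule pt_cong) auto
qed

lemma pt_lxor:
  assumes e: "inj e" and f: "pt c (list_e e) f" and g: "pt c (list_e e) g"
  shows "pt c (list_e e) (%x. lxor (f x) (g x))"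
  unfolding lxor_def
  by (intro pt_append pt_filter f g) (rule pt_not[OF pt_mem[OF e pt_snd0 pt_comp[OF f pt_fst0]]]
    pt_not[OF pt_mem[OF e pt_snd0 pt_comp[OF g pt_fst0]]])+

lemma length_list_e_filter: "length (list_e e (filter P xs)) <= length (list_e e xs)"
  by (induction xs) auto

lemma length_list_e_lxor: "length (list_e e (lxor a b)) <= length (list_e e a) + length (list_e e b)"
  unfolding lxor_def list_e_append length_append by (intro add_mono length_list_e_filter)

lemma length_list_e_reduce:
  "length (list_e e (reduce k0 B v)) <= length (list_e e v) + length (list_e (list_e e) B)"
proof (induction B arbitrary: v)
  case (Cons b B)
  have "length (list_e e (if hdd k0 b \<in> set v then lxor v b else v)) <= length (list_e e v) + length (list_e e b)"
   using length_list_e_lxor[of e v b] by auto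
  then show ?case using Cons[of "if hdd k0 b \<in> set v then lxor v b else v"] by (simp add: reduce_Cons)
qed (simp add: reduce_def)

lemma pt_reduce:
  assumes e: "inj e" and B: "pt c (list_e (list_e e)) B" and v: "pt c (list_e e) v"
  shows "pt c (list_e e) (%x. reduce k0 (B x) (v x))"
  unfolding reduce_def
proof (rule pt_foldl[OF _ v B, where G = "%x. length (list_e e (v x)) + length (list_e (list_e e) (B x))"])
  show "pt (prod_e c (prod_e (list_e e) (list_e e))) (list_e e)
    (%p. if hdd k0 (snd (snd p)) \<in> set (fst (snd p)) then lxor (fst (snd p)) (snd (snd p)) else fst (snd p))"
   by (rule pt_if pt_mem[OF e] pt_lxor[OF e] pt_hdd pt_fst pt_snd pt_id)+
  show "polyb (%x. length (c x)) (%x. length (list_e e (v x)) + length (list_e (list_e e) (B x)))"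
   by (intro polyb_intros polyb_len v B)
  show "length (list_e e (foldl (%v b. if hdd k0 b \<in> set v then lxor v b else v) (v x) (take j (B x))))
    <= length (list_e e (v x)) + length (list_e (list_e e) (B x))" for x j
   using length_list_e_reduce[of e k0 "take j (B x)" "v x"] length_list_e_take_drop[of "list_e e" j "B x"]
   by (simp add: reduce_def)
qed

text \<open>The intermediate bases stay small: an item adds at most one vector, and each vector is a
  list without repetition of keys that already occur in the input.\<close>

lemma pt_elim:
  assumes e: "inj e" and it: "pt c (list_e i) items" and vf: "pt (prod_e c i) (list_e e) (%p. vf (fst p) (snd p))"
   and dist: "!!x F. distinct (vf x F)"
  shows "pt c (prod_e (list_e (list_e e)) (list_e i)) (%x. elim k0 (map (%F. (F, vf x F)) (items x)))"
proof -
  have ps: "pt c (list_e (prod_e i (list_e e))) (%x. map (%F. (F, vf x F)) (items x))"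
   by (rule pt_map[OF pt_pair[OF pt_snd0 vf] it])
  let ?ps = "%x. map (%F. (F, vf x F)) (items x)"
  let ?N = "%x. length (list_e (prod_e i (list_e e)) (?ps x))"
  let ?G = "%x. 2 * (?N x * (2 * (?N x * ?N x * (2 * ?N x + 2)) + 2)) + 2 + ?N x * (2 * ?N x + 2)"
  show ?thesis unfolding elim_def
  proof (rule pt_foldl[OF _ pt_const ps, where G = ?G])
   show "pt (prod_e c (prod_e (prod_e (list_e (list_e e)) (list_e i)) (prod_e i (list_e e))))
     (prod_e (list_e (list_e e)) (list_e i)) (%p. elim_step k0 (fst (snd p)) (snd (snd p)))"
    unfolding elim_step_def
    by (rule pt_Let pt_if pt_null' pt_reduce[OF e] pt_pair pt_append pt_cons pt_fst pt_snd pt_id pt_const)+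
   show "polyb (%x. length (c x)) ?G" by (intro polyb_intros polyb_len[OF ps])
   show "length (prod_e (list_e (list_e e)) (list_e i) (foldl (elim_step k0) ([], []) (take j (?ps x)))) <= ?G x"
    if "j <= length (?ps x)" for x j
   proof -
    let ?it = "take j (items x)"
    obtain B K where BK: "elim k0 (map (%F. (F, vf x F)) ?it) = (B, K)" by fastforce
    note ec = elim_correct[OF dist BK]
    have mem: "length (i F) <= ?N x & length (list_e e (vf x F)) <= ?N x" if "F \<in> set (items x)" for F
    proof -
     have "(F, vf x F) \<in> set (?ps x)" using that by auto
     then have "length (prod_e i (list_e e) (F, vf x F)) <= ?N x" by (rule length_list_e_mem)
     then show ?thesis by (simp add: prod_e_def)
    qed
    have U: "card (\<Union>F \<in> set ?it. set (vf x F)) <= ?N x * ?N x"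
    proof -
     have "card (\<Union>F \<in> set ?it. set (vf x F)) <= (\<Sum>F \<in> set ?it. card (set (vf x F)))"
      by (rule card_UN_le) simp
     also have "... <= (\<Sum>F \<in> set ?it. ?N x)"
      using mem set_take_subset[of j "items x"] length_list_e_len[of "vf x _" e]
      by (intro sum_mono) (meson card_length le_trans subsetD)
     also have "... <= ?N x * ?N x"
     proof -
      have "card (set ?it) <= length (items x)" by (metis card_length length_take le_trans min.cobounded1)
      also have "... <= ?N x" using length_list_e_len[of "?ps x" "prod_e i (list_e e)"] by simp
      finally show ?thesis by simp
     qed
     finally show ?thesis .
    qed
    have lenB: "length B <= ?N x"
    proof -
     have "length B' <= length its" if "elim k0 (map (%F. (F, vf x F)) its) = (B', K')" for its B' K'
      using that
     proof (induction its arbitrary: B' K' rule: rev_induct)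
      case (snoc F its)
      obtain B0 K0 where "elim k0 (map (%F. (F, vf x F)) its) = (B0, K0)" by fastforce
      then show ?case using snoc.IH[of B0 K0] snoc.prems
       by (auto simp: elim_def elim_step_def Let_def split: if_splits)
     qed (simp add: elim_def)
     from this[OF BK] have "length B <= length (items x)" by simp
     also have "... <= ?N x" using length_list_e_len[of "?ps x" "prod_e i (list_e e)"] by simp
     finally show ?thesis .
    qed
    have "length (list_e e b) <= ?N x * ?N x * (2 * ?N x + 2)" if b: "b \<in> set B" for b
    proof -
     have sub: "set b <= (\<Union>F \<in> set ?it. set (vf x F))" by (rule ec(4)[OF b])
     have "length (list_e e b) <= length b * (2 * ?N x + 2)"
     proof (rule length_list_e_le)
      fix y assume "y \<in> set b"
      then obtain F where "F \<in> set (items x)" "y \<in> set (vf x F)" using sub set_take_subset[of j "items x"] by blast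
      then show "length (e y) <= ?N x" using mem length_list_e_mem[of y "vf x F" e] by (meson le_trans)
     qed
     moreover have "length b <= ?N x * ?N x"
     proof -
      have "card (set b) <= card (\<Union>F \<in> set ?it. set (vf x F))" by (rule card_mono[OF _ sub]) simp
      then show ?thesis using U distinct_card[OF ech_distinct[OF ec(1) b]] by linarith
     qed
     ultimately show ?thesis by (meson le_trans mult_le_mono1)
    qed
    then have "length (list_e (list_e e) B) <= length B * (2 * (?N x * ?N x * (2 * ?N x + 2)) + 2)"
     by (rule length_list_e_le)
    also have "... <= ?N x * (2 * (?N x * ?N x * (2 * ?N x + 2)) + 2)"
     using lenB by (rule mult_right_mono) simp
    finally have 1: "length (list_e (list_e e) B) <= ?N x * (2 * (?N x * ?N x * (2 * ?N x + 2)) + 2)" .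
    have "length (list_e i K) <= length K * (2 * ?N x + 2)"
     using ec(3) mem set_take_subset[of j "items x"] by (intro length_list_e_le) blast
    also have "... <= ?N x * (2 * ?N x + 2)" using lenB ec(2) by (intro mult_right_mono) auto
    finally have 2: "length (list_e i K) <= ?N x * (2 * ?N x + 2)" .
    have "foldl (elim_step k0) ([], []) (take j (?ps x)) = (B, K)"
     using BK by (simp add: elim_def take_map)
    then show ?thesis using 1 2 by (simp add: prod_e_def)
   qed
  qed
qed

section \<open>Parsing instances\<close>

text \<open>Lengths of the runs of \<open>True\<close> that are closed by a \<open>False\<close>.
  The list markers \<open>True\<close> of the encoding are thereby merged into the number that
  follows; for fixed \<open>d\<close> and \<open>l\<close> they shift it by a known amount.\<close>

fun runs0 :: "nat => word => nat list" where
  "runs0 c [] = []"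
| "runs0 c (True # w) = runs0 (Suc c) w"
| "runs0 c (False # w) = c # runs0 0 w"

definition run_step :: "nat \<times> nat list => bool => nat \<times> nat list" where
  "run_step s b = (if b then (Suc (fst s), snd s) else (0, snd s @ [fst s]))"

lemma foldl_run_step: "snd (foldl run_step (c, acc) w) = acc @ runs0 c w"
proof (induction w arbitrary: c acc)
  case (Cons b w)
  then show ?case by (cases b) (auto simp: run_step_def)
qed simp

lemma run_step_bound:
  "fst (foldl run_step (0, []) w) <= length w & length (snd (foldl run_step (0, []) w)) <= length w &
   (ALL y:set (snd (foldl run_step (0, []) w)). y <= length w)"
  by (induction w rule: rev_induct) (auto simp: run_step_def)

lemma pt_runs0: "pt raw (list_e nat_e) (runs0 0)"
proof -
  let ?e = "prod_e nat_e (list_e nat_e)"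
  have "pt raw ?e (%w. foldl run_step (0, []) w)"
  proof (rule pt_foldl[OF _ pt_const pt_bools[OF pt_id], where G = "%w. 2 * length w + 2 + length w * (2 * length w + 2)"])
   show "pt (prod_e raw (prod_e ?e bool_e)) ?e (%p. run_step (fst (snd p)) (snd (snd p)))"
    unfolding run_step_def
    by (rule pt_if pt_pair pt_Suc pt_append pt_cons pt_fst pt_snd pt_id pt_const)+
   show "polyb (%x. length (raw x)) (%w. 2 * length w + 2 + length w * (2 * length w + 2))"
    unfolding raw_def by (intro polyb_intros)
   fix w :: word and j assume "j <= length w"
   let ?s = "foldl run_step (0, []) (take j w)"
   have b: "fst ?s <= length w" "length (snd ?s) <= length w" "ALL y:set (snd ?s). y <= length w"
    using run_step_bound[of "take j w"] \<open>j <= length w\<close> by auto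
   have "length (list_e nat_e (snd ?s)) <= length (snd ?s) * (2 * length w + 2)"
    using b by (intro length_list_e_le) simp
   also have "... <= length w * (2 * length w + 2)" using b by (intro mult_right_mono) auto
   finally show "length (?e ?s) <= 2 * length w + 2 + length w * (2 * length w + 2)"
    using b by (simp add: prod_e_def)
  qed
  from pt_snd[OF this] show ?thesis by (rule pt_cong) (simp add: foldl_run_step)
qed

lemma runs0_enc_nat: "runs0 c (enc_nat u @ w) = (c + u) # runs0 0 w"
  by (induction u arbitrary: c) (auto simp: enc_nat_def)

text \<open>\<open>c\<close> counts the markers \<open>True\<close> read so far that still wait for
  a \<open>False\<close>; they are credited to the first entry, or to the closing run if the list is
  empty.\<close>

definition frun :: "nat => nat list => nat list" where
  "frun c F = (case F of [] => [c] | x # xs => (Suc c + x) # map Suc xs @ [0])"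

definition trun :: "nat list list => nat list" where
  "trun Fs = (case Fs of [] => [1] | F # Fs => frun 2 F @ concat (map (frun 1) Fs) @ [0])"

lemma enc_list_simps: "enc_list e [] @ w = False # w" "enc_list e (x # xs) @ w = True # e x @ enc_list e xs @ w"
  by (simp_all add: enc_list_def)

lemma runs0_enc_nats0: "runs0 0 (enc_list enc_nat F @ w) = map Suc F @ 0 # runs0 0 w"
  by (induction F) (auto simp: enc_list_simps runs0_enc_nat)

lemma runs0_enc_nats: "runs0 c (enc_list enc_nat F @ w) = frun c F @ runs0 0 w"
  by (cases F) (auto simp: enc_list_simps runs0_enc_nat runs0_enc_nats0 frun_def)

lemma runs0_enc_sets0: "runs0 0 (enc_list (enc_list enc_nat) Fs @ w) = concat (map (frun 1) Fs) @ 0 # runs0 0 w"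
  by (induction Fs) (auto simp: enc_list_simps runs0_enc_nats)

lemma runs0_enc_tuple: "runs0 1 (enc_list (enc_list enc_nat) Fs @ w) = trun Fs @ runs0 0 w"
  by (cases Fs) (auto simp: enc_list_simps runs0_enc_nats runs0_enc_sets0 trun_def numeral_2_eq_2)

lemma runs0_enc_tuples: "runs0 0 (enc_list (enc_list (enc_list enc_nat)) fs @ w) = concat (map trun fs) @ 0 # runs0 0 w"
  by (induction fs) (auto simp: enc_list_simps runs0_enc_tuple[simplified])

lemma runs0_enc_edges: "runs0 0 (enc_list (%(u, v). enc_nat u @ enc_nat v) es @ w)
   = concat (map (%(u, v). [Suc u, v]) es) @ 0 # runs0 0 w"
  by (induction es) (auto simp: enc_list_simps runs0_enc_nat)

lemma runs0_enc_inst: "runs0 0 (enc_inst n es fs)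
   = n # concat (map (%(u, v). [Suc u, v]) es) @ 0 # concat (map trun fs) @ [0]"
  using runs0_enc_tuples[of fs "[]"] by (simp add: enc_inst_def runs0_enc_nat runs0_enc_edges)

text \<open>Behind the vertex number each edge occupies two runs, the first being
  \<open>Suc u\<close>; hence the first 0 at an odd index closes the edge list.\<close>

definition num_edges :: "nat list => nat" where
  "num_edges R = length (filter (%i. ALL j:set [0..<Suc i]. nthd 0 R (2 * j + 1) ~= 0) [0..<length R])"

text \<open>A tuple takes exactly \<open>l * (d + 1) + 1\<close> runs: \<open>d\<close> entries and
  a closing run for each set, and a final closing run. The number of tuples therefore follows from
  the length alone.\<close>

definition num_tuples :: "nat => nat => nat list => nat" where
  "num_tuples d l R = length (filter (%i. 2 * num_edges R + 2 + Suc i * (l * (d + 1) + 1) + 1 <= length R) [0..<length R])"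

definition dec_edges :: "nat list => (nat \<times> nat) list" where
  "dec_edges R = map (%j. (nthd 0 R (2 * j + 1) - 1, nthd 0 R (2 * j + 2))) [0..<num_edges R]"

text \<open>The subtracted numbers count the markers merged into an entry: 3 at the start of a
  tuple, 2 at the start of a later set, and 1 elsewhere.\<close>

definition dec_tuples :: "nat => nat => nat list => nat list list list" where
  "dec_tuples d l R = map (%i. map (%j. map (%k.
     nthd 0 R (2 * num_edges R + 2 + i * (l * (d + 1) + 1) + (j * (d + 1) + k)) - (if k = 0 then if j = 0 then 3 else 2 else 1))
    [0..<d]) [0..<l]) [0..<num_tuples d l R]"

lemma filter_less_upt: "m <= n ==> filter (%i. i < m) [0..<n] = [0..<m]"
proof -
  assume "m <= n"
  then obtain k where n: "n = m + k" using nat_le_iff_add by blast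
  have "[0..<n] = [0..<m] @ [m..<n]" unfolding n by (rule upt_add_eq_append) simp
  then show ?thesis by (simp add: filter_empty_conv)
qed

lemma nth_concat_chunks:
  assumes "!!x. x \<in> set xs ==> length (f x) = w" "i < length xs" "r < w"
  shows "(concat (map f xs) @ ys) ! (i * w + r) = f (xs ! i) ! r"
  using assms
proof (induction xs arbitrary: i)
  case (Cons x xs)
  then show ?case by (cases i) (auto simp: nth_append add.assoc)
qed simp

lemma length_concat_chunks: "(!!x. x \<in> set xs ==> length (f x) = w) ==> length (concat (map f xs)) = length xs * w"
  by (induction xs) auto

lemma length_frun: "length (frun c F) = Suc (length F)"
  by (cases F) (auto simp: frun_def)

lemma trun_conv:
  assumes "Fs ~= []"
  shows "trun Fs = concat (map (%j. frun (if j = 0 then 2 else 1) (Fs ! j)) [0..<length Fs]) @ [0]"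
proof -
  obtain F Fs' where Fs: "Fs = F # Fs'" using assms by (cases Fs) auto
  have "map (%j. frun (if j = 0 then 2 else 1) (Fs ! j)) [0..<length Fs] = frun 2 F # map (frun 1) Fs'"
   unfolding Fs by (rule nth_equalityI) (auto simp: nth_Cons' simp del: upt_Suc)
  then show ?thesis by (simp add: trun_def Fs)
qed

lemma frun_nth: "k < length F ==> frun c F ! k = (if k = 0 then Suc c else 1) + F ! k"
  by (cases F) (auto simp: frun_def nth_Cons' nth_append)

lemma map_upt0_eqI: "length xs = n ==> (!!i. i < n ==> f i = xs ! i) ==> map f [0..<n] = xs"
  by (rule nth_equalityI) auto

lemma decode_correct:
  assumes l: "l >= 1" and ok: "ok_inst d l n es fs" and R: "R = runs0 0 (enc_inst n es fs)"
  shows "hdd 0 R = n" "dec_edges R = es" "dec_tuples d l R = fs"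
proof -
  let ?E = "concat (map (%(u, v). [Suc u, v]) es)" and ?T = "concat (map trun fs)" and ?w = "l * (d + 1) + 1"
  have R: "R = n # ?E @ 0 # ?T @ [0]" unfolding R runs0_enc_inst by simp
  show "hdd 0 R = n" by (simp add: R)
  have lE: "length ?E = length es * 2" by (rule length_concat_chunks) auto
  have Fs: "length Fs = l & Fs ~= [] & (ALL F:set Fs. length F = d)" if "Fs \<in> set fs" for Fs
   using ok that l by (auto simp: ok_inst_def)
  have lt: "length (trun Fs) = ?w" if "Fs \<in> set fs" for Fs
  proof -
   have "length (concat (map (%j. frun (if j = 0 then 2 else 1) (Fs ! j)) [0..<length Fs])) = length [0..<length Fs] * Suc d"
    using Fs[OF that] by (intro length_concat_chunks) (auto simp: length_frun)
   then show ?thesis using Fs[OF that] by (simp add: trun_conv)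
  qed
  have lT: "length ?T = length fs * ?w" by (rule length_concat_chunks) (rule lt)
  have lR: "length R = 2 * length es + 2 + length fs * ?w + 1" using lE lT by (simp add: R)
  have e1: "nthd 0 R (2 * j + 1) = Suc (fst (es ! j))" and e2: "nthd 0 R (2 * j + 2) = snd (es ! j)" if "j < length es" for j
  proof -
   have "(?E @ 0 # ?T @ [0]) ! (j * 2 + r) = (case es ! j of (u, v) => [Suc u, v]) ! r" if "r < 2" for r
    using that \<open>j < length es\<close> by (intro nth_concat_chunks) auto
   from this[of 0] this[of 1] show "nthd 0 R (2 * j + 1) = Suc (fst (es ! j))" "nthd 0 R (2 * j + 2) = snd (es ! j)"
    using that lR by (auto simp: nthd_nth R mult.commute split: prod.splits)
  qed
  have e3: "nthd 0 R (2 * length es + 1) = 0"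
   using lR lE by (simp add: nthd_nth R nth_append)
  have "(ALL j:set [0..<Suc i]. nthd 0 R (2 * j + 1) ~= 0) \<longleftrightarrow> i < length es" for i
  proof
   assume *: "ALL j:set [0..<Suc i]. nthd 0 R (2 * j + 1) ~= 0"
   show "i < length es"
   proof (rule ccontr)
    assume "~ i < length es"
    then have "length es \<in> set [0..<Suc i]" by auto
    then show False using * e3 by blast
   qed
  next
   assume "i < length es"
   then show "ALL j:set [0..<Suc i]. nthd 0 R (2 * j + 1) ~= 0" using e1 by auto
  qed
  then have nE: "num_edges R = length es"
   unfolding num_edges_def using filter_less_upt[of "length es" "length R"] lR by simp
  show "dec_edges R = es"
   unfolding dec_edges_def nE by (rule nth_equalityI) (use e1 e2 in auto)
  have "2 * num_edges R + 2 + Suc i * ?w + 1 <= length R \<longleftrightarrow> i < length fs" for i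
  proof -
   have "Suc i * ?w <= length fs * ?w \<longleftrightarrow> Suc i <= length fs" by (subst mult_le_cancel2) auto
   then show ?thesis unfolding lR nE by linarith
  qed
  moreover have "length fs <= length R" unfolding lR by simp
  ultimately have nT: "num_tuples d l R = length fs"
   unfolding num_tuples_def using filter_less_upt[of "length fs" "length R"] by simp
  have t: "nthd 0 R (2 * num_edges R + 2 + i * ?w + (j * (d + 1) + k)) = (if k = 0 then if j = 0 then 3 else 2 else 1) + fs ! i ! j ! k"
   if i: "i < length fs" and j: "j < l" and k: "k < d" for i j k
  proof -
   have Fi: "fs ! i \<in> set fs" using i by simp
   have Fj: "length (fs ! i ! j) = d" using Fs[OF Fi] j by auto
   have "j * (d + 1) + k < l * (d + 1)"
   proof -
    have "j * (d + 1) + k < Suc j * (d + 1)" using k by simp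
    also have "... <= l * (d + 1)" using j by (intro mult_right_mono) auto
    finally show ?thesis .
   qed
   then have lt': "j * (d + 1) + k < ?w" by simp
   have pos: "2 * num_edges R + 2 + i * ?w + (j * (d + 1) + k) < length R"
   proof -
    have "i * ?w + (j * (d + 1) + k) < Suc i * ?w" using lt' by simp
    also have "... <= length fs * ?w" using i by (intro mult_right_mono) auto
    finally show ?thesis unfolding lR nE by linarith
   qed
   have "R = (n # ?E @ [0]) @ (?T @ [0])" by (simp add: R)
   then have "R ! (length (n # ?E @ [0]) + m) = (?T @ [0]) ! m" for m by (simp only: nth_append_length_plus)
   moreover have "length (n # ?E @ [0]) = 2 * num_edges R + 2" using lE nE by simp
   ultimately have "R ! (2 * num_edges R + 2 + m) = (?T @ [0]) ! m" for m by simp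
   then have "nthd 0 R (2 * num_edges R + 2 + i * ?w + (j * (d + 1) + k)) = (?T @ [0]) ! (i * ?w + (j * (d + 1) + k))"
    unfolding nthd_nth[OF pos] by (metis add.assoc)
   also have "... = trun (fs ! i) ! (j * (d + 1) + k)"
    by (rule nth_concat_chunks[OF lt i lt'])
   also have "... = frun (if j = 0 then 2 else 1) (fs ! i ! j) ! k"
   proof -
    have "(concat (map (%j. frun (if j = 0 then 2 else 1) (fs ! i ! j)) [0..<length (fs ! i)]) @ [0]) ! (j * (d + 1) + k)
      = frun (if [0..<length (fs ! i)] ! j = 0 then 2 else 1) (fs ! i ! ([0..<length (fs ! i)] ! j)) ! k"
     using Fs[OF Fi] j k by (intro nth_concat_chunks) (auto simp: length_frun)
    then show ?thesis using Fs[OF Fi] j by (simp add: trun_conv)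
   qed
   also have "... = (if k = 0 then if j = 0 then 3 else 2 else 1) + fs ! i ! j ! k"
    using Fj k by (simp add: frun_nth)
   finally show ?thesis .
  qed
  have inner: "map (%k. nthd 0 R (2 * num_edges R + 2 + i * ?w + (j * (d + 1) + k)) - (if k = 0 then if j = 0 then 3 else 2 else 1)) [0..<d]
    = fs ! i ! j" if "i < length fs" "j < l" for i j
  proof -
   have "fs ! i \<in> set fs" using that by simp
   from Fs[OF this] have "length (fs ! i ! j) = d" using that by auto
   then show ?thesis by (rule map_upt0_eqI) (simp only: t[OF that] diff_add_inverse)
  qed
  have mid: "map (%j. map (%k. nthd 0 R (2 * num_edges R + 2 + i * ?w + (j * (d + 1) + k)) - (if k = 0 then if j = 0 then 3 else 2 else 1)) [0..<d]) [0..<l]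
    = fs ! i" if i: "i < length fs" for i
  proof -
   have "length (fs ! i) = l" using Fs[of "fs ! i"] i by simp
   then show ?thesis by (rule map_upt0_eqI) (rule inner[OF i])
  qed
  show "dec_tuples d l R = fs" unfolding dec_tuples_def nT
   by (rule map_upt0_eqI[OF refl]) (rule mid)
qed

abbreviation "tup_e \<equiv> list_e (list_e nat_e)"
abbreviation "edge_e \<equiv> prod_e nat_e nat_e"
abbreviation "inst_e \<equiv> prod_e nat_e (prod_e (list_e edge_e) (list_e tup_e))"

lemma pt_num_edges: "pt (list_e nat_e) nat_e num_edges"
proof -
  have "pt (list_e nat_e) nat_e (%R. num_edges R)" unfolding num_edges_def
   by (rule pt_const pt_length_list pt_filter pt_list_all pt_not pt_zero' pt_nthd pt_add pt_mult pt_upt0 pt_Suc pt_fst pt_snd pt_id)+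
  then show ?thesis by simp
qed

lemma pt_num_tuples: "pt (list_e nat_e) nat_e (num_tuples d l)"
proof -
  have "pt (list_e nat_e) nat_e (%R. num_tuples d l R)" unfolding num_tuples_def
   by (rule pt_const pt_comp[OF pt_num_edges] pt_length_list pt_filter pt_le pt_add pt_mult pt_upt0 pt_Suc pt_fst pt_snd pt_id)+
  then show ?thesis by simp
qed

lemma pt_dec_edges: "pt (list_e nat_e) (list_e edge_e) dec_edges"
proof -
  have "pt (list_e nat_e) (list_e edge_e) (%R. dec_edges R)" unfolding dec_edges_def
   by (rule pt_const pt_comp[OF pt_num_edges] pt_map pt_pair pt_pred pt_nthd pt_add pt_mult pt_upt0 pt_fst pt_snd pt_id)+
  then show ?thesis by simp
qed

lemma pt_dec_tuples: "pt (list_e nat_e) (list_e tup_e) (dec_tuples d l)"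
proof -
  have "pt (list_e nat_e) (list_e tup_e) (%R. dec_tuples d l R)" unfolding dec_tuples_def
   by (rule pt_const pt_comp[OF pt_num_edges] pt_comp[OF pt_num_tuples] pt_map pt_if pt_zero' pt_diff pt_nthd pt_add pt_mult
     pt_upt0 pt_fst pt_snd pt_id)+
  then show ?thesis by simp
qed

subsection \<open>Validity\<close>

lemma distinct_map_index:
  "distinct (map f xs) \<longleftrightarrow> (ALL i:set [0..<length xs]. ALL j:set [0..<length xs]. i ~= j --> f (nthd z xs i) ~= f (nthd z xs j))"
  by (auto simp: distinct_conv_nth nthd_nth)

definition same_sets :: "nat list list => nat list list => bool" where
  "same_sets Fs Gs \<longleftrightarrow> length Fs = length Gs & (ALL j:set [0..<length Fs].
    (ALL x:set (nthd [] Fs j). x \<in> set (nthd [] Gs j)) & (ALL x:set (nthd [] Gs j). x \<in> set (nthd [] Fs j)))"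

lemma same_sets_iff: "same_sets Fs Gs \<longleftrightarrow> map set Fs = map set Gs"
proof
  assume s: "same_sets Fs Gs"
  show "map set Fs = map set Gs"
   by (rule nth_equalityI) (use s in \<open>fastforce simp: same_sets_def nthd_nth\<close>)+
next
  assume *: "map set Fs = map set Gs"
  then have l: "length Fs = length Gs" by (rule map_eq_imp_length_eq)
  have "set (Fs ! j) = set (Gs ! j)" if "j < length Fs" for j
   using arg_cong[OF *, of "%xs. xs ! j"] that l by simp
  then show "same_sets Fs Gs" using l by (simp add: same_sets_def nthd_nth)
qed

lemma pt_same_sets: "pt c tup_e f ==> pt c tup_e g ==> pt c bool_e (%x. same_sets (f x) (g x))"
proof -
  have "pt (prod_e tup_e tup_e) bool_e (%p. same_sets (fst p) (snd p))" unfolding same_sets_def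
   by (rule pt_const pt_conj pt_eq[OF inj_nat_e] pt_list_all pt_mem[OF inj_nat_e] pt_nthd pt_length_list pt_upt0 pt_fst pt_snd pt_id)+
  from pt_comp[OF this pt_pair] show "pt c tup_e f ==> pt c tup_e g ==> pt c bool_e (%x. same_sets (f x) (g x))" by simp
qed

text \<open>Only quantifiers over explicit lists remain, so that validity can be decided by the
  rules for \<open>pt\<close>.\<close>

lemma ok_inst_alt: "ok_inst d l n es fs \<longleftrightarrow>
   (ALL i:set [0..<length es]. ALL j:set [0..<length es]. i ~= j -->
    ~ (fst (nthd (0, 0) es i) = fst (nthd (0, 0) es j) & snd (nthd (0, 0) es i) = snd (nthd (0, 0) es j) \<or>
      fst (nthd (0, 0) es i) = snd (nthd (0, 0) es j) & snd (nthd (0, 0) es i) = fst (nthd (0, 0) es j))) &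
   (ALL i:set [0..<length fs]. ALL j:set [0..<length fs]. i ~= j --> ~ same_sets (nthd [] fs i) (nthd [] fs j)) &
   (ALL p:set es. fst p < n & snd p < n & fst p ~= snd p) &
   (ALL Fs:set fs. length Fs = l & (ALL F:set Fs.
    (ALL i:set [0..<length F]. ALL j:set [0..<length F]. i ~= j --> nthd 0 F i ~= nthd 0 F j) &
    length F = d & (ALL u:set F. u < n)))"
proof -
  have 1: "(case p of (u, v) => {u, v}) = (case p' of (u, v) => {u, v}) \<longleftrightarrow>
    fst p = fst p' & snd p = snd p' \<or> fst p = snd p' & snd p = fst p'" for p p' :: "nat \<times> nat"
   by (auto simp: doubleton_eq_iff split: prod.splits)
  have 2: "distinct F \<longleftrightarrow> (ALL i:set [0..<length F]. ALL j:set [0..<length F]. i ~= j --> nthd 0 F i ~= nthd 0 F j)" for F :: "nat list"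
   using distinct_map_index[of id F 0] by simp
  have 3: "(ALL (u, v):set es. u < n & v < n & u ~= v) \<longleftrightarrow> (ALL p:set es. fst p < n & snd p < n & fst p ~= snd p)"
   by auto
  show ?thesis
   unfolding ok_inst_def distinct_map_index[of _ es "(0, 0)"] distinct_map_index[of _ fs "[]"] 1 same_sets_iff 2 3 ..
qed

lemma pt_ok_inst: "pt inst_e bool_e (%I. ok_inst d l (fst I) (fst (snd I)) (snd (snd I)))"
  unfolding ok_inst_alt
  by (rule pt_const pt_conj pt_disj pt_not pt_imp pt_list_all pt_eq[OF inj_nat_e] pt_same_sets pt_less pt_nthd pt_length_list
    pt_upt0 pt_fst pt_snd pt_id)+

lemma pt_enc_nat: "pt nat_e (list_e bool_e) enc_nat"
  using pt_append[OF pt_units[OF pt_id] pt_const[of nat_e "list_e bool_e" "[False]"]]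
  by (rule pt_cong) (simp add: enc_nat_def)

lemma pt_enc_list: "pt a (list_e bool_e) e ==> pt (list_e a) (list_e bool_e) (enc_list e)"
proof -
  assume e: "pt a (list_e bool_e) e"
  have "pt (list_e a) (list_e bool_e) (%xs. concat (map (%x. True # e x) xs) @ [False])"
   by (rule pt_append pt_concat_map pt_cons pt_const pt_comp[OF e pt_snd0] pt_id)+
  then show ?thesis by (rule pt_cong) (simp add: enc_list_def)
qed

lemma pt_enc_inst: "pt inst_e raw (%I. enc_inst (fst I) (fst (snd I)) (snd (snd I)))"
proof -
  have e: "pt edge_e (list_e bool_e) (%(u, v). enc_nat u @ enc_nat v)"
   using pt_append[OF pt_comp[OF pt_enc_nat pt_fst0[of nat_e nat_e]] pt_comp[OF pt_enc_nat pt_snd0[of nat_e nat_e]]]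
   by (rule pt_cong) (simp add: split_beta)
  show ?thesis unfolding enc_inst_def
   by (rule pt_raw_of_bools pt_append pt_comp[OF pt_enc_nat] pt_comp[OF pt_enc_list[OF e]]
     pt_comp[OF pt_enc_list[OF pt_enc_list[OF pt_enc_list[OF pt_enc_nat]]]] pt_fst pt_snd pt_id)+
qed

lemma inst_bound_mono: "n <= m ==> inst_bound d l n <= inst_bound d l m"
  unfolding inst_bound_def by (intro add_mono mult_mono power_mono) auto

text \<open>Reduces a kernel to a transformation of decoded valid instances. The slack
  \<open>C\<close> allows a constant no-instance with more vertices than the input.\<close>

theorem kernel_by_parsing:
  assumes l: "l >= 1" and Tr: "pt inst_e inst_e Tr"
   and ok: "!!n es fs n' es' fs'. ok_inst d l n es fs ==> Tr (n, es, fs) = (n', es', fs') ==>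
     ok_inst d l n' es' fs' & (yes_instance d q (inst n' es' fs') \<longleftrightarrow> yes_instance d q (inst n es fs)) &
     length es' + length fs' <= m n & n' <= n + C"
   and m: "(%n. real (m n)) \<in> O(r)"
  shows "URF_admits_kernel_with_O_constraints d l q r"
proof -
  define dec where "dec x = (let R = runs0 0 x in (hdd 0 R, dec_edges R, dec_tuples d l R))" for x
  \<comment> \<open>The decoder returns something on every word. Encoding the result again and
    comparing it with the input recognizes the words that encode valid instances; all others are
    returned unchanged.\<close>
  define good where "good I p \<longleftrightarrow> enc_inst (fst I) (fst (snd I)) (snd (snd I)) = fst p &
    ok_inst d l (fst I) (fst (snd I)) (snd (snd I)) & fst I = snd p" for I and p :: "word \<times> nat"
  define g where "g p = (let I = dec (fst p) in if good I p then
    (enc_inst (fst (Tr I)) (fst (snd (Tr I))) (snd (snd (Tr I))), fst (Tr I)) else p)" for p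
  have dec: "pt raw inst_e dec"
   unfolding dec_def
   by (rule pt_Let pt_runs0 pt_pair pt_hdd pt_comp[OF pt_dec_edges] pt_comp[OF pt_dec_tuples] pt_snd pt_id)+
  have dec_enc: "dec (enc_inst n es fs) = (n, es, fs)" if "ok_inst d l n es fs" for n es fs
   using decode_correct[OF l that refl] by (simp add: dec_def Let_def)
  have Q: "(x, k) \<in> URF_coloring d l q \<longleftrightarrow> yes_instance d q (inst k es fs)" if "x = enc_inst k es fs" "ok_inst d l k es fs" for x k es fs
   unfolding URF_iff using that dec_enc by (metis Pair_inject)
  have goodD: "EX es fs. dec (fst p) = (snd p, es, fs) & fst p = enc_inst (snd p) es fs & ok_inst d l (snd p) es fs"
   if "good (dec (fst p)) p" for p
   using that unfolding good_def by (metis prod.collapse)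
  show ?thesis
  proof (rule kernelI[where g = g and H = "%k. inst_bound d l (k + C) + k + C" and m = m])
   have good: "pt (prod_e (prod_e raw nat_e) inst_e) bool_e (%p. good (snd p) (fst p))"
    unfolding good_def
    by (rule pt_conj pt_eq[OF inj_raw] pt_eq[OF inj_nat_e] pt_comp[OF pt_enc_inst] pt_comp[OF pt_ok_inst] pt_fst pt_snd pt_id)+
   show "pt (prod_e raw nat_e) (prod_e raw nat_e) g"
    unfolding g_def
    by (rule pt_Let pt_comp[OF dec] pt_if good pt_pair pt_comp[OF pt_enc_inst] pt_comp[OF Tr] pt_fst pt_snd pt_id)+
   show "pt nat_e nat_e (%k. inst_bound d l (k + C) + k + C)"
    by (intro pt_add pt_inst_bound pt_id pt_const)
   show "g (x, k) \<in> URF_coloring d l q \<longleftrightarrow> (x, k) \<in> URF_coloring d l q" for x k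
   proof (cases "good (dec x) (x, k)")
    case True
    then obtain es fs where *: "dec x = (k, es, fs)" "x = enc_inst k es fs" "ok_inst d l k es fs"
     using goodD[of "(x, k)"] by auto
    obtain n' es' fs' where T: "Tr (k, es, fs) = (n', es', fs')" by (metis prod.collapse)
    have "g (x, k) = (enc_inst n' es' fs', n')" using True * T by (simp add: g_def)
    then show ?thesis using ok[OF *(3) T] Q[OF *(2,3)] Q[of "enc_inst n' es' fs'" n' es' fs'] by simp
   qed (simp add: g_def)
   show "length (fst (g (x, k))) + snd (g (x, k)) <= inst_bound d l (k + C) + k + C" if "length x <= inst_bound d l k" for x k
   proof (cases "good (dec x) (x, k)")
    case True
    then obtain es fs where *: "dec x = (k, es, fs)" "x = enc_inst k es fs" "ok_inst d l k es fs"
     using goodD[of "(x, k)"] by auto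
    obtain n' es' fs' where T: "Tr (k, es, fs) = (n', es', fs')" by (metis prod.collapse)
    have "g (x, k) = (enc_inst n' es' fs', n')" using True * T by (simp add: g_def)
    moreover have "length (enc_inst n' es' fs') <= inst_bound d l (k + C)"
     using ok[OF *(3) T] length_enc_inst[of d l n' es' fs'] inst_bound_mono[of n' "k + C" d l] by linarith
    ultimately show ?thesis using ok[OF *(3) T] by simp
   next
    case False
    then show ?thesis using that inst_bound_mono[of k "k + C" d l] by (simp add: g_def)
   qed
   show "EX n' es' fs'. g (enc_inst n es fs, n) = (enc_inst n' es' fs', n') & ok_inst d l n' es' fs' & length es' + length fs' <= m n"
    if "ok_inst d l n es fs" for n es fs
   proof -
    obtain n' es' fs' where T: "Tr (n, es, fs) = (n', es', fs')" by (metis prod.collapse)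
    have "g (enc_inst n es fs, n) = (enc_inst n' es' fs', n')"
     using dec_enc[OF that] T that by (simp add: g_def good_def)
    then show ?thesis using ok[OF that T] by blast
   qed
  qed (rule m)
qed

section \<open>Kernels by elimination\<close>

lemma dropn_conv: "map (%k. nthd z F k) (filter (%k. k ~= i) [0..<length F]) = dropn i F"
proof (induction F arbitrary: i)
  case (Cons x F)
  have u: "[0..<length (x # F)] = 0 # map Suc [0..<length F]"
   by (simp add: upt_conv_Cons map_Suc_upt del: upt_Suc)
  have n: "nthd z (x # F) (Suc k) = nthd z F k" "nthd z (x # F) 0 = x" for k by (simp_all add: nthd_def)
  have m: "map (nthd z F) [0..<length F] = F" by (rule nth_equalityI) (auto simp: nthd_nth)
  show ?case
  proof (cases i)
   case 0
   then show ?thesis unfolding u by (simp add: n comp_def filter_map m dropn_def)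
  next
   case (Suc i')
   then show ?thesis unfolding u using Cons[of i'] by (simp add: n comp_def filter_map dropn_def)
  qed
qed (simp add: dropn_def)

lemma pt_dropn:
  assumes f: "pt c (list_e nat_e) f" and g: "pt c nat_e g"
  shows "pt c (list_e nat_e) (%x. dropn (g x) (f x))"
  unfolding dropn_conv[of 0, symmetric]
  by (rule pt_map pt_nthd pt_filter pt_not pt_eq[OF inj_nat_e] pt_comp[OF f pt_fst0] pt_comp[OF g pt_fst0] f
    pt_upt0 pt_length_list pt_snd0)+

definition vecf :: "nat list list => nat => nat list list => (nat \<times> nat list) list list" where
  "vecf chs l Fs = map (%ch. map (%j. mark (nthd 0 ch j) (nthd [] Fs j)) [0..<l]) chs"

abbreviation "key_e \<equiv> list_e (prod_e nat_e (list_e nat_e))"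

lemma inj_key_e: "inj key_e"
  by (intro inj_intros)

lemma pt_vecf: "pt tup_e (list_e key_e) (vecf chs l)"
proof -
  have "pt tup_e (list_e key_e) (%Fs. vecf chs l Fs)"
   unfolding vecf_def mark_def
   by (rule pt_const[of _ _ chs] pt_const[of _ nat_e] pt_map pt_pair pt_if pt_zero' pt_dropn pt_pred pt_nthd pt_upt0 pt_fst pt_snd pt_id)+
  then show ?thesis by simp
qed

lemma vecf_keyc:
  assumes "!!ch. ch \<in> set chs ==> length ch = l" "length Fs = l"
  shows "vecf chs l Fs = map (%ch. keyc ch Fs) chs"
  unfolding vecf_def
proof (rule map_cong[OF refl])
  fix ch assume "ch \<in> set chs"
  then have l: "length ch = l" using assms by simp
  show "map (%j. mark (nthd 0 ch j) (nthd [] Fs j)) [0..<l] = keyc ch Fs"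
   using l assms(2) by (intro nth_equalityI) (auto simp: keyc_def nthd_nth)
qed

text \<open>The marks inside a key give back the choice that produced it, so the keys of one
  constraint are pairwise different and none cancels.\<close>

lemma distinct_vecf:
  assumes "!!ch. ch \<in> set chs ==> length ch = l" "distinct chs"
  shows "distinct (vecf chs l Fs)"
proof -
  have "map fst (map (%j. mark (nthd 0 ch j) (nthd [] Fs j)) [0..<l]) = ch" if "ch \<in> set chs" for ch
   using assms(1)[OF that] by (intro nth_equalityI) (auto simp: mark_def nthd_nth)
  then have "inj_on (%ch. map (%j. mark (nthd 0 ch j) (nthd [] Fs j)) [0..<l]) (set chs)"
   by (intro inj_on_inverseI[where g = "map fst"]) blast
  then show ?thesis unfolding vecf_def distinct_map using assms(2) by blast
qed

definition key_lens :: "nat => nat list => nat list" where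
  "key_lens d ch = map (%i. if i = 0 then d else d - 1) ch"

text \<open>For a fixed choice the lengths of all blocks are known, so a key is determined by the
  concatenation of its blocks, a list of \<open>sum_list (key_lens d ch)\<close> vertices.\<close>

lemma card_keys:
  "card {kk :: (nat \<times> nat list) list. map fst kk = ch & map (length \<circ> snd) kk = key_lens d ch & (ALL p:set kk. set (snd p) <= {..<n})}
    <= n ^ sum_list (key_lens d ch)" (is "card ?A <= _")
   "finite {kk :: (nat \<times> nat list) list. map fst kk = ch & map (length \<circ> snd) kk = key_lens d ch & (ALL p:set kk. set (snd p) <= {..<n})}"
proof -
  let ?L = "{xs. set xs <= {..<n} & length xs = sum_list (key_lens d ch)}"
  have fin: "finite ?L" by (rule finite_lists_length_eq) simp
  have inj: "inj_on (%kk. concat (map snd kk)) ?A"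
  proof (rule inj_onI)
   fix k1 k2 assume a: "k1 \<in> ?A" "k2 \<in> ?A" "concat (map snd k1) = concat (map snd k2)"
   have len: "length k1 = length k2" using a by (metis (mono_tags, lifting) length_map mem_Collect_eq)
   have lens: "map (length \<circ> snd) k1 = map (length \<circ> snd) k2" using a by simp
   have "map snd k1 = map snd k2"
   proof (rule concat_injective[OF a(3)])
    show "length (map snd k1) = length (map snd k2)" using len by simp
    show "ALL (x, y):set (zip (map snd k1) (map snd k2)). length x = length y"
     using lens len by (auto simp: set_zip list_eq_iff_nth_eq)
   qed
   moreover have "map fst k1 = map fst k2" using a by simp
   ultimately show "k1 = k2" by (metis zip_map_fst_snd)
  qed
  have img: "(%kk. concat (map snd kk)) ` ?A <= ?L"
   by (rule image_subsetI) (force simp: length_concat comp_def)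
  show "finite ?A" by (rule finite_imageD[OF finite_subset[OF img fin] inj])
  show "card ?A <= n ^ sum_list (key_lens d ch)"
   using card_inj_on_le[OF inj img fin] by (simp add: card_lists_length_eq)
qed

definition lin_tr :: "nat list list => nat => nat \<times> (nat \<times> nat) list \<times> nat list list list => nat \<times> (nat \<times> nat) list \<times> nat list list list" where
  "lin_tr chs l I = (fst I, fst (snd I), snd (elim [] (map (%F. (F, vecf chs l F)) (snd (snd I)))))"

lemma yes_instance_inst: "yes_instance d q (inst n es fs) \<longleftrightarrow>
   (EX c. (ALL v < n. c v \<in> {1..q}) & (ALL (u, v):set es. c u ~= c v) & (ALL Fs:set fs. ~ uniformly_rainbow d c (map set Fs)))"
proof -
  have "(ALL u v. {u, v} \<in> (%(u, v). {u, v}) ` set es --> c u ~= c v) \<longleftrightarrow> (ALL (u, v):set es. c u ~= c v)" for c :: "nat => nat"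
   by (force simp: doubleton_eq_iff)
  then show ?thesis unfolding yes_instance_def proper_coloring_def by (auto simp: Pi_iff)
qed

text \<open>The number of kept constraints is at most the number of keys, which is at most
  \<open>n ^ k\<close> for each choice. All edges are kept; \<open>k >= 2\<close> makes the bound
  absorb them.\<close>

theorem kernel_linear:
  assumes l: "l >= 1" and d: "d >= 1" and k: "k >= 2"
   and chs: "distinct chs" "!!ch. ch \<in> set chs ==> length ch = l & set ch <= {0..d} & sum_list (key_lens d ch) <= k"
   and w: "!!c. EX w :: (nat \<times> nat list) list => bit poly. ALL Fs. length Fs = l -->
    (ALL F:set Fs. distinct F & length F = d & c ` set F <= {1..q}) -->
    ((\<Sum>ch \<leftarrow> chs. w (keyc ch Fs)) = 0 \<longleftrightarrow> ~ uniformly_rainbow d c (map set Fs))"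
  shows "URF_admits_kernel_with_O_constraints d l q (%n. real n ^ k)"
proof (rule kernel_by_parsing[OF l, where Tr = "lin_tr chs l" and C = 0 and m = "%n. n ^ 2 + length chs * n ^ k"])
  have dist: "distinct (vecf chs l F)" for F using distinct_vecf chs by blast
  have pe: "pt inst_e (prod_e (list_e (list_e key_e)) (list_e tup_e))
    (%I. elim [] (map (%F. (F, vecf chs l F)) (snd (snd I))))"
   by (rule pt_elim[OF inj_key_e pt_snd[OF pt_snd[OF pt_id]] pt_comp[OF pt_vecf pt_snd0] dist])
  have "pt inst_e inst_e (%I. lin_tr chs l I)" unfolding lin_tr_def
   by (rule pt_pair pt_snd[OF pe] pt_fst pt_snd pt_id)+
  then show "pt inst_e inst_e (lin_tr chs l)" by simp
next
  fix n es fs n' es' fs'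
  assume ok: "ok_inst d l n es fs" and T: "lin_tr chs l (n, es, fs) = (n', es', fs')"
  have n': "n' = n" "es' = es" using T by (auto simp: lin_tr_def)
  obtain B where el: "elim [] (map (%F. (F, vecf chs l F)) fs) = (B, fs')"
   using T by (auto simp: lin_tr_def) (metis prod.collapse)
  have dist: "distinct (vecf chs l F)" for F using distinct_vecf chs by blast
  note ec = elim_correct[OF dist el]
  have ok': "ok_inst d l n es fs'"
   using ok ec(3,5) unfolding ok_inst_def by blast
  have "yes_instance d q (inst n es fs') \<longleftrightarrow> yes_instance d q (inst n es fs)"
  proof
   assume "yes_instance d q (inst n es fs')"
   then obtain c where c: "ALL v < n. c v \<in> {1..q}" "ALL (u, v):set es. c u ~= c v"
    "ALL Fs:set fs'. ~ uniformly_rainbow d c (map set Fs)"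
    unfolding yes_instance_inst by blast
   obtain w :: "(nat \<times> nat list) list => bit poly" where w: "ALL Fs. length Fs = l -->
    (ALL F:set Fs. distinct F & length F = d & c ` set F <= {1..q}) -->
    ((\<Sum>ch \<leftarrow> chs. w (keyc ch Fs)) = 0 \<longleftrightarrow> ~ uniformly_rainbow d c (map set Fs))"
    using assms(6) by blast
   have s: "sum w (set (vecf chs l Fs)) = 0 \<longleftrightarrow> ~ uniformly_rainbow d c (map set Fs)" if "Fs \<in> set fs" for Fs
   proof -
    have Fs: "length Fs = l" "ALL F:set Fs. distinct F & length F = d & c ` set F <= {1..q}"
     using ok that c(1) unfolding ok_inst_def by blast+
    have "sum w (set (vecf chs l Fs)) = sum_list (map w (vecf chs l Fs))"
     using dist by (simp add: sum_list_distinct_conv_sum_set)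
    also have "... = (\<Sum>ch \<leftarrow> chs. w (keyc ch Fs))"
     using vecf_keyc[of chs l Fs] chs Fs by (simp add: comp_def)
    finally show ?thesis using w Fs by simp
   qed
   note e0 = elim_correct0[OF bit_poly_double _ el, where w = w and g = "map set"]
   have "ALL F:set fs'. sum w (set (vecf chs l F)) = 0" using s c(3) ec(3) by blast
   then have "ALL F:set fs. sum w (set (vecf chs l F)) = 0" using e0 dist by blast
   then show "yes_instance d q (inst n es fs)" unfolding yes_instance_inst using c s by blast
  next
   assume "yes_instance d q (inst n es fs)"
   then show "yes_instance d q (inst n es fs')" unfolding yes_instance_inst using ec(3) by blast
  qed
  moreover have "length fs' <= length chs * n ^ k"
  proof (cases "n = 0")
   \<comment> \<open>With no vertices a key may still be an empty list, and
     \<open>0 ^ 0 = 1\<close>; the tuples are therefore counted directly.\<close>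
   case True
   have "length fs' <= n ^ (d * l)" using ok_inst_counts(2)[OF ok'] .
   then show ?thesis using True d l by (simp add: power_0_left)
  next
   case False
   let ?A = "%ch. {kk :: (nat \<times> nat list) list. map fst kk = ch & map (length \<circ> snd) kk = key_lens d ch & (ALL p:set kk. set (snd p) <= {..<n})}"
   have sub: "set (vecf chs l Fs) <= (\<Union>ch \<in> set chs. ?A ch)" if "Fs \<in> set fs" for Fs
   proof
    fix kk assume "kk \<in> set (vecf chs l Fs)"
    moreover have Fs: "length Fs = l" "ALL F:set Fs. distinct F & length F = d & set F <= {..<n}"
     using ok that unfolding ok_inst_def by blast+
    ultimately obtain ch where ch: "ch \<in> set chs" "kk = keyc ch Fs"
     using vecf_keyc[of chs l Fs] chs by auto
    have lc: "length ch = length Fs" "set ch <= {0..d}" using chs ch Fs by auto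
    have "map (length \<circ> snd) kk = key_lens d ch"
    proof (rule nth_equalityI)
     show "length (map (length \<circ> snd) kk) = length (key_lens d ch)"
      using lc by (simp add: ch keyc_def key_lens_def)
     fix i assume "i < length (map (length \<circ> snd) kk)"
     then have i: "i < length ch" "i < length Fs" using lc by (auto simp: ch keyc_def)
     have "length (Fs ! i) = d" "ch ! i <= d" using Fs i subsetD[OF lc(2) nth_mem[OF i(1)]] by auto
     then show "map (length \<circ> snd) kk ! i = key_lens d ch ! i"
      using i by (auto simp: ch keyc_def key_lens_def mark_def length_dropn)
    qed
    moreover have "set (snd p) <= {..<n}" if p: "p \<in> set kk" for p
    proof -
     obtain i F where iF: "(i, F) \<in> set (zip ch Fs)" "p = mark i F" using p by (auto simp: ch keyc_def)
     then have "F \<in> set Fs" by (auto dest: set_zip_rightD)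
     moreover have "set (snd p) <= set F"
      using iF(2) by (auto simp: mark_def dropn_def dest: in_set_takeD in_set_dropD)
     ultimately show ?thesis using Fs by blast
    qed
    ultimately show "kk \<in> (\<Union>ch \<in> set chs. ?A ch)"
     using ch keyc_fst[OF lc(1)] by auto
   qed
   have U: "(\<Union>F \<in> set fs. set (vecf chs l F)) <= (\<Union>ch \<in> set chs. ?A ch)" by (rule UN_least) (rule sub)
   have "length B <= card (\<Union>ch \<in> set chs. ?A ch)"
   proof (rule ech_length[OF ec(1)])
    show "set b <= (\<Union>ch \<in> set chs. ?A ch)" if "b \<in> set B" for b by (rule subset_trans[OF ec(4)[OF that] U])
    show "finite (\<Union>ch \<in> set chs. ?A ch)" using card_keys(2)[of _ d n] by (rule finite_UN_I[OF List.finite_set])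
   qed
   also have "... <= (\<Sum>ch \<in> set chs. card (?A ch))" by (rule card_UN_le) simp
   also have "... <= (\<Sum>ch \<in> set chs. n ^ k)"
   proof (rule sum_mono)
    fix ch assume "ch \<in> set chs"
    then have "n ^ sum_list (key_lens d ch) <= n ^ k" using chs(2) False by (intro power_increasing) auto
    then show "card (?A ch) <= n ^ k" using card_keys(1)[where ch = ch and d = d and n = n] by linarith
   qed
   also have "... <= length chs * n ^ k" using card_length[of chs] by simp
   finally show ?thesis using ec(2) by simp
  qed
  ultimately show "ok_inst d l n' es' fs' & (yes_instance d q (inst n' es' fs') = yes_instance d q (inst n es fs)) &
    length es' + length fs' <= n\<^sup>2 + length chs * n ^ k & n' <= n + 0"
   using ok' n' ok_inst_counts(1)[OF ok'] by simp
next
  show "(%n. real (n\<^sup>2 + length chs * n ^ k)) \<in> O(%n. real n ^ k)"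
  proof (rule bigo_const_power[where C = "1 + length chs"])
   fix n :: nat assume "1 <= n"
   then have "n ^ 2 <= n ^ k" using k by (intro power_increasing) auto
   then show "n\<^sup>2 + length chs * n ^ k <= (1 + length chs) * n ^ k" by simp
  qed
qed

lemma sum_list_le_const: "(!!x. x \<in> set xs ==> f x <= (b :: nat)) ==> sum_list (map f xs) <= length xs * b"
  by (induction xs) (simp_all add: add_mono)

corollary kernel_full:
  assumes "l >= 1" "d >= 1" "(d - 1) * l >= 2" "l = 1 \<or> q = d"
  shows "URF_admits_kernel_with_O_constraints d l q (%n. real n ^ ((d - 1) * l))"
proof (rule kernel_linear[OF assms(1,2,3), of "full_choices d l"])
  show "distinct (full_choices d l)" unfolding full_choices_def by (rule distinct_n_lists) simp
  fix ch assume "ch \<in> set (full_choices d l)"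
  then have ch: "length ch = l" "set ch <= {1..<d + 1}"
   unfolding full_choices_def set_n_lists by (auto simp del: upt_Suc)
  have "sum_list (key_lens d ch) <= length ch * (d - 1)"
   unfolding key_lens_def using ch(2) by (intro sum_list_le_const) auto
  then show "length ch = l & set ch <= {0..d} & sum_list (key_lens d ch) <= (d - 1) * l"
   using ch by (auto simp: mult.commute)
qed (rule weights_full[OF assms(2,4)])

corollary kernel_some:
  assumes "l >= 1" "d >= 1" "d * l - 1 >= 2"
  shows "URF_admits_kernel_with_O_constraints d l (d + 1) (%n. real n ^ (d * l - 1))"
proof (rule kernel_linear[OF assms(1,2,3), of "some_choices d l"])
  show "distinct (some_choices d l)" unfolding some_choices_def by (intro distinct_filter distinct_n_lists) simp
  fix ch assume "ch \<in> set (some_choices d l)"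
  then have ch: "length ch = l" "set ch <= {0..<d + 1}" "EX i:set ch. i ~= 0"
   unfolding some_choices_def set_filter set_n_lists by (auto simp del: upt_Suc)
  \<comment> \<open>One nonzero mark already drops a vertex; the other blocks may be
    complete.\<close>
  obtain ys i zs where ys: "ch = ys @ i # zs" "i ~= 0" using ch(3) by (metis split_list)
  have "sum_list (key_lens d xs) <= length xs * d" for xs
   unfolding key_lens_def by (rule sum_list_le_const) auto
  from this[of ys] this[of zs] have "sum_list (key_lens d ch) <= length ys * d + (d - 1) + length zs * d"
   using ys by (simp add: key_lens_def)
  also have "... = d * l - 1"
  proof -
   have l: "l = length ys + 1 + length zs" using ch(1) ys by simp
   show ?thesis unfolding l using assms(2) by (cases d) (simp_all add: algebra_simps)
  qed
  finally show "length ch = l & set ch <= {0..d} & sum_list (key_lens d ch) <= d * l - 1"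
   using ch by auto
qed (use weights_some[OF assms(2,1)] in simp)

subsection \<open>The polynomial-time solvable cases\<close>

text \<open>
  For two colors the constraints are affine: kind 0 demands different colors, kind 1 equal colors,
  and all other kinds are unsatisfiable. The empty key stands for the constant 1.
\<close>

definition kv :: "nat => (nat \<times> nat list) list" where
  "kv u = [(u, [])]"

definition affv :: "nat \<times> nat \<times> nat => (nat \<times> nat list) list list" where
  "affv t = (if fst t = 0 then (if fst (snd t) = snd (snd t) then [[]] else [kv (fst (snd t)), kv (snd (snd t)), []])
    else if fst t = 1 then (if fst (snd t) = snd (snd t) then [] else [kv (fst (snd t)), kv (snd (snd t))])
    else [[]])"

fun aff_sat :: "(nat => bit) => nat \<times> nat \<times> nat => bool" where
  "aff_sat w (k, u, v) = (if k = 0 then w u ~= w v else if k = 1 then w u = w v else False)"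

text \<open>Solvability means that the equation 1 = 0, given by the vector \<open>[[]]\<close>, is
  not in the span of the constraints.\<close>

definition aff_solvable :: "(nat \<times> nat \<times> nat) list => bool" where
  "aff_solvable ts \<longleftrightarrow> reduce [] (fst (elim [] (map (%t. (t, affv t)) ts))) [[]] ~= []"

lemma distinct_affv: "distinct (affv t)"
  by (auto simp: affv_def kv_def)

lemma bit_double: "(b :: bit) + b = 0"
  by (cases b) simp_all

lemma sum_affv:
  assumes "w0 [] = (1 :: bit)"
  shows "sum w0 (set (affv t)) = 0 \<longleftrightarrow> aff_sat (%u. w0 (kv u)) t"
proof -
  obtain k u v where t: "t = (k, u, v)" by (cases t)
  have b: "a + (b + 1) = 0 \<longleftrightarrow> a ~= b" "a + b = 0 \<longleftrightarrow> a = b" for a b :: bit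
   by (cases a; cases b; simp)+
  have "sum w0 {kv u, kv v, []} = w0 (kv u) + (w0 (kv v) + 1)" "sum w0 {kv u, kv v} = w0 (kv u) + w0 (kv v)" if "u ~= v"
   using that assms by (simp_all add: kv_def)
  then show ?thesis using assms b by (simp add: t affv_def)
qed

lemma aff_solvable_iff: "aff_solvable ts \<longleftrightarrow> (EX w. ALL t:set ts. aff_sat w t)"
proof -
  obtain B K where el: "elim [] (map (%t. (t, affv t)) ts) = (B, K)" by fastforce
  note ec = elim_correct[OF distinct_affv el]
  note e0 = elim_correct0[OF bit_double _ el, where g = "%x. x"]
  define r where "r = reduce [] B [[]]"
  have s: "aff_solvable ts \<longleftrightarrow> r ~= []" by (simp add: aff_solvable_def el r_def)
  show ?thesis
  proof
   assume "aff_solvable ts"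
   then have r: "r ~= []" using s by simp
   \<comment> \<open>The nonzero remainder of the constant vector extends the echelon form. A weight
     with value 0 on the basis and 1 on the remainder then gives the constant key the value 1, as an
     assignment must.\<close>
   have "ech [] (B @ [r])"
   proof (rule ech_snoc[OF ec(1) r])
    show "distinct r" unfolding r_def using ech_distinct[OF ec(1)] by (intro reduce_distinct) auto
    show "hdd [] b \<notin> set r" if "b \<in> set B" for b
     unfolding r_def by (rule reduce_pivots[OF ec(1) that])
   qed
   from ech_solve[OF this, of "replicate (length B) 0 @ [1]"]
   obtain w0 :: "(nat \<times> nat list) list => bit"
    where w0: "!!i. i < Suc (length B) ==> sum w0 (set ((B @ [r]) ! i)) = (replicate (length B) 0 @ [1]) ! i"
    by auto
   have B0: "ALL b:set B. sum w0 (set b) = 0"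
   proof
    fix b assume "b \<in> set B"
    then obtain i where "i < length B" "b = B ! i" by (metis in_set_conv_nth)
    then show "sum w0 (set b) = 0" using w0[of i] by (simp add: nth_append)
   qed
   have "sum w0 (set r) = 1" using w0[of "length B"] by (simp add: nth_append)
   moreover have "sum w0 (set r) = sum w0 (set [[]])"
    unfolding r_def using B0 by (intro reduce_sum[OF bit_double]) auto
   ultimately have star: "w0 [] = 1" by simp
   have "ALL t:set ts. sum w0 (set (affv t)) = 0" using e0 B0 distinct_affv by blast
   then show "EX w. ALL t:set ts. aff_sat w t" using sum_affv[of w0, OF star] by blast
  next
   assume "EX w. ALL t:set ts. aff_sat w t"
   then obtain w where w: "ALL t:set ts. aff_sat w t" by blast
   define w0 :: "(nat \<times> nat list) list => bit" where "w0 kk = (case kk of [] => 1 | p # _ => w (fst p))" for kk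
   have star: "w0 [] = 1" "(%u. w0 (kv u)) = w" by (simp_all add: w0_def kv_def)
   have "ALL t:set K. sum w0 (set (affv t)) = 0"
    using sum_affv[of w0, OF star(1)] w ec(3) unfolding star(2) by blast
   then have "ALL b:set B. sum w0 (set b) = 0" using e0 distinct_affv by blast
   then have "sum w0 (set r) = sum w0 (set [[]])"
    unfolding r_def by (intro reduce_sum[OF bit_double]) auto
   then have "sum w0 (set r) = 1" using star by simp
   then show "aff_solvable ts" using s by auto
  qed
qed

abbreviation "aff_e \<equiv> prod_e nat_e (prod_e nat_e nat_e)"

lemma pt_affv: "pt aff_e (list_e key_e) affv"
proof -
  have "pt aff_e (list_e key_e) (%t. affv t)" unfolding affv_def kv_def
   by (rule pt_const pt_if pt_zero' pt_eq[OF inj_nat_e] pt_cons pt_pair pt_fst pt_snd pt_id)+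
  then show ?thesis by simp
qed

lemma pt_aff_solvable: "pt (list_e aff_e) bool_e aff_solvable"
proof -
  have "pt (list_e aff_e) (prod_e (list_e (list_e key_e)) (list_e aff_e)) (%ts. elim [] (map (%t. (t, affv t)) ts))"
   by (rule pt_elim[OF inj_key_e pt_id pt_comp[OF pt_affv pt_snd0] distinct_affv])
  from pt_not[OF pt_null'[OF pt_reduce[OF inj_key_e pt_fst[OF this] pt_const]]]
  have "pt (list_e aff_e) bool_e (%ts. aff_solvable ts)" unfolding aff_solvable_def .
  then show ?thesis by simp
qed

lemma kernel_constant:
  assumes l: "l >= 1" and q: "q = 1 \<or> q = 2" and dec: "pt inst_e bool_e D"
   and D: "!!n es fs. ok_inst d l n es fs ==> D (n, es, fs) \<longleftrightarrow> yes_instance d q (inst n es fs)"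
  shows "URF_admits_kernel_with_O_constraints d l q (%n. real n ^ 0)"
proof -
  \<comment> \<open>The constant no-instance is the complete graph on \<open>q + 1\<close>
    vertices.\<close>
  define no :: "nat \<times> (nat \<times> nat) list \<times> nat list list list"
   where "no = (if q = 1 then (2, [(0, 1)], []) else (3, [(0, 1), (0, 2), (1, 2)], []))"
  show ?thesis
  proof (rule kernel_by_parsing[OF l, where Tr = "%I. if D I then (0, [], []) else no" and m = "%_. 3" and C = 3])
   show "pt inst_e inst_e (%I. if D I then (0, [], []) else no)"
    by (intro pt_if dec pt_const)
   fix n es fs n' es' fs'
   assume ok: "ok_inst d l n es fs" and T: "(if D (n, es, fs) then (0, [], []) else no) = (n', es', fs')"
   show "ok_inst d l n' es' fs' & (yes_instance d q (inst n' es' fs') \<longleftrightarrow> yes_instance d q (inst n es fs)) &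
     length es' + length fs' <= 3 & n' <= n + 3"
   proof (cases "D (n, es, fs)")
    case True
    then show ?thesis using T D[OF ok] by (auto simp: ok_inst_def yes_instance_inst)
   next
    case False
    have no: "(n', es', fs') = no" using T False by simp
    have "~ yes_instance d q (inst n' es' fs')"
    proof
     assume "yes_instance d q (inst n' es' fs')"
     then obtain c where c: "ALL v < n'. c v \<in> {1..q}" "ALL (u, v):set es'. c u ~= c v"
      unfolding yes_instance_inst by blast
     show False
     proof (cases "q = 1")
      case True
      then show ?thesis using c(1)[rule_format, of 0] c(1)[rule_format, of 1] c(2) no by (auto simp: no_def)
     next
      case False
      then show ?thesis using q c(1)[rule_format, of 0] c(1)[rule_format, of 1] c(1)[rule_format, of 2] c(2) no
       by (auto simp: no_def)
     qed
    qed
    moreover have "ok_inst d l n' es' fs'" "length es' + length fs' <= 3" "n' <= 3"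
     using no by (auto simp: no_def ok_inst_def doubleton_eq_iff split: if_splits)
    ultimately show ?thesis using False D[OF ok] by auto
   qed
  qed simp
qed

lemma kernel_one_color:
  assumes "l >= 1"
  shows "URF_admits_kernel_with_O_constraints 1 l 1 (%n. real n ^ 0)"
proof (rule kernel_constant[OF assms, where D = "%I. fst (snd I) = [] & snd (snd I) = []"])
  show "pt inst_e bool_e (%I. fst (snd I) = [] & snd (snd I) = [])"
   by (rule pt_conj pt_null' pt_fst pt_snd pt_id)+
  fix n es fs assume ok: "ok_inst 1 l n es fs"
  have "False" if c: "ALL v < n. c v \<in> {1..1 :: nat}" and e: "ALL (u, v):set es. c u ~= c v"
   and f: "ALL Fs:set fs. ~ uniformly_rainbow 1 c (map set Fs)" and ne: "es ~= [] \<or> fs ~= []" for c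
  proof (cases "es = []")
   case False
   then obtain u v where "(u, v) \<in> set es" by (metis list.set_intros(1) neq_Nil_conv prod.collapse)
   moreover from this have "u < n" "v < n" using ok by (auto simp: ok_inst_def)
   ultimately show False using c e by force
  next
   case True
   then obtain Fs where Fs: "Fs \<in> set fs" using ne by (metis list.set_intros(1) neq_Nil_conv)
   have "c ` set F = {1}" if "F \<in> set Fs" for F
   proof -
    have "length F = 1" "ALL u:set F. u < n" using ok Fs that unfolding ok_inst_def by blast+
    then obtain u where "F = [u]" "u < n" by (auto simp: length_Suc_conv)
    then show ?thesis using c by force
   qed
   then have "uniformly_rainbow 1 c (map set Fs)" by (simp add: uniformly_rainbow_def)
   then show False using f Fs by blast
  qed
  then show "(fst (snd (n, es, fs)) = [] & snd (snd (n, es, fs)) = []) \<longleftrightarrow> yes_instance 1 1 (inst n es fs)"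
   unfolding yes_instance_inst by (auto intro!: exI[of _ "%_. 1"])
qed simp

lemma kernel_two_colors:
  assumes dl: "(d, l) \<in> {(1, 1), (2, 1), (1, 2)}"
  shows "URF_admits_kernel_with_O_constraints d l 2 (%n. real n ^ 0)"
proof -
  \<comment> \<open>A single vertex is always rainbow, so for \<open>d = l = 1\<close> a constraint
    is unsatisfiable; a single pair must be monochromatic; and two singletons must differ.\<close>
  define tc :: "nat list list => nat \<times> nat \<times> nat" where "tc Fs = (if l = 1 then (if d = 1 then (2, 0, 0) else (1, nthd 0 (nthd [] Fs 0) 0, nthd 0 (nthd [] Fs 0) 1))
    else (0, nthd 0 (nthd [] Fs 0) 0, nthd 0 (nthd [] Fs 1) 0))" for Fs :: "nat list list"
  define items where "items I = map (%p. (0, p)) (fst (snd I)) @ map tc (snd (snd I))" for I :: "nat \<times> (nat \<times> nat) list \<times> nat list list list"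
  have l: "l >= 1" using dl by auto
  have ptc: "pt tup_e aff_e (%Fs. tc Fs)"
   unfolding tc_def by (rule pt_const pt_if pt_pair pt_nthd pt_id)+
  have items: "pt inst_e (list_e aff_e) items"
   unfolding items_def by (rule pt_append pt_map pt_comp[OF ptc pt_snd0] pt_const[of _ nat_e 0] pt_pair pt_fst pt_snd pt_id)+
  show ?thesis
  proof (rule kernel_constant[OF l _ pt_comp[OF pt_aff_solvable items]])
   fix n es fs assume ok: "ok_inst d l n es fs"
   have ur: "uniformly_rainbow d c (map set Fs) \<longleftrightarrow> ~ aff_sat w (tc Fs)"
    if Fs: "Fs \<in> set fs" and cw: "!!u v. u < n ==> v < n ==> c u = c v \<longleftrightarrow> w u = w v" for Fs and c :: "nat => nat" and w
   proof -
    have F: "length Fs = l" "!!F. F \<in> set Fs ==> distinct F & length F = d & (ALL u:set F. u < n)"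
     using ok Fs unfolding ok_inst_def by blast+
    consider "d = 1" "l = 1" | "d = 2" "l = 1" | "d = 1" "l = 2" using dl by auto
    then show ?thesis
    proof cases
     case 1
     then obtain F where "Fs = [F]" using F(1) by (auto simp: length_Suc_conv)
     moreover from this obtain u where "F = [u]" using F(2)[of F] 1 by (auto simp: length_Suc_conv)
     ultimately show ?thesis using 1 by (simp add: uniformly_rainbow_def tc_def)
    next
     case 2
     then obtain F where "Fs = [F]" using F(1) by (auto simp: length_Suc_conv)
     moreover from this obtain u v where "F = [u, v]" "u < n" "v < n"
      using F(2)[of F] 2 by (auto simp: length_Suc_conv numeral_2_eq_2)
     ultimately show ?thesis using 2 cw[of u v] by (simp add: uniformly_rainbow_def tc_def nthd_def card_insert_if)
    next
     case 3
     then obtain F G where FG: "Fs = [F, G]" using F(1) by (auto simp: length_Suc_conv numeral_2_eq_2)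
     obtain u v where "F = [u]" "G = [v]" "u < n" "v < n"
      using F(2)[of F] F(2)[of G] FG 3 by (auto simp: length_Suc_conv)
     then show ?thesis using 3 FG cw[of u v] by (auto simp: uniformly_rainbow_def tc_def nthd_def)
    qed
   qed
   have it: "(ALL t:set (items (n, es, fs)). aff_sat w t) \<longleftrightarrow> (ALL (u, v):set es. w u ~= w v) & (ALL Fs:set fs. aff_sat w (tc Fs))" for w
   proof -
    have "aff_sat w (0, p) \<longleftrightarrow> w (fst p) ~= w (snd p)" for p by (cases p) simp
    then show ?thesis by (simp add: items_def ball_Un split_beta)
   qed
   have en: "u < n & v < n" if "(u, v) \<in> set es" for u v using ok that by (auto simp: ok_inst_def)
   show "aff_solvable (items (n, es, fs)) \<longleftrightarrow> yes_instance d 2 (inst n es fs)"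
    unfolding aff_solvable_iff it yes_instance_inst
   proof
    assume "EX w. (ALL (u, v):set es. w u ~= w v) & (ALL Fs:set fs. aff_sat w (tc Fs))"
    then obtain w :: "nat => bit" where w: "ALL (u, v):set es. w u ~= w v" "ALL Fs:set fs. aff_sat w (tc Fs)" by blast
    define c where "c u = (if w u = 0 then 1 else 2 :: nat)" for u
    have cw: "c u = c v \<longleftrightarrow> w u = w v" for u v by (cases "w u"; cases "w v") (simp_all add: c_def)
    show "EX c. (ALL v < n. c v \<in> {1..2}) & (ALL (u, v):set es. c u ~= c v) & (ALL Fs:set fs. ~ uniformly_rainbow d c (map set Fs))"
     using w ur[of _ c w] cw by (intro exI[of _ c]) (auto simp: c_def)
   next
    assume "EX c. (ALL v < n. c v \<in> {1..2}) & (ALL (u, v):set es. c u ~= c v) & (ALL Fs:set fs. ~ uniformly_rainbow d c (map set Fs))"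
    then obtain c where c: "ALL v < n. c v \<in> {1..2 :: nat}" "ALL (u, v):set es. c u ~= c v"
     "ALL Fs:set fs. ~ uniformly_rainbow d c (map set Fs)" by blast
    define w :: "nat => bit" where "w u = (if c u = 1 then 0 else 1)" for u
    have cw: "c u = c v \<longleftrightarrow> w u = w v" if "u < n" "v < n" for u v
    proof -
     have "c u = 1 \<or> c u = 2" "c v = 1 \<or> c v = 2" using c(1) that by force+
     then show ?thesis by (auto simp: w_def)
    qed
    show "EX w. (ALL (u, v):set es. w u ~= w v) & (ALL Fs:set fs. aff_sat w (tc Fs))"
     using c cw ur[of _ c w] en by (intro exI[of _ w]) fastforce
   qed
  qed simp
qed

section \<open>Satisfiability\<close>

type_synonym 'v clause = "('v \<times> bool) list"

definition csat :: "('v => bool) => 'v clause => bool" where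
  "csat av C \<longleftrightarrow> (EX (v, b):set C. av v = b)"

lemma csat_simps [simp]: "csat av [] = False" "csat av ((v, b) # C) = (av v = b \<or> csat av C)"
   "csat av (C @ D) = (csat av C \<or> csat av D)"
  by (auto simp: csat_def)

definition impl :: "'v list => 'v => 'v clause" where
  "impl A v = map (%u. (u, False)) A @ [(v, True)]"

lemma csat_impl: "csat av (impl A v) \<longleftrightarrow> ((ALL u:set A. av u) --> av v)"
  by (auto simp: impl_def csat_def)

text \<open>
  The clauses below are implications that derive all facts about a run from the facts about its
  start. A model therefore contains the facts of some run, and no clause excludes extra facts.
\<close>

datatype fact = Inp nat | State nat nat | Head nat nat int | Cell nat nat int nat

definition run_act :: "tm => nat => nat list => nat \<times> (nat \<times> move) list" where
  "run_act M z rs = (case delta M z rs of None => (z, map (%a. (a, Stay)) rs) | Some x => x)"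

lemma step_run_act: "step M c = (fst (run_act M (fst c) (heads (snd c))),
   map2 (%(t, p) (a, m). (t(p := a), p + offset m)) (snd c) (snd (run_act M (fst c) (heads (snd c)))))"
  using map2_keep[of "snd c"]
  by (cases c) (auto simp: step_def action_heads run_act_def split: option.splits)

definition pre :: "nat => nat => int list => nat list => fact list" where
  "pre i z ps rs = State i z # map (%j. Head i j (ps ! j)) [0..<length ps] @ map (%j. Cell i j (ps ! j) (rs ! j)) [0..<length ps]"

text \<open>The index \<open>j\<close> runs through the consequences of a step: 0 for the state,
  then the heads, then the rewritten cells of all tapes.\<close>

definition post :: "tm => nat => nat => int list => nat list => nat => fact" where
  "post M i z ps rs j = (let (z', as) = run_act M z rs in
    if j = 0 then State (Suc i) z'
    else if j <= length ps then Head (Suc i) (j - 1) (ps ! (j - 1) + offset (snd (as ! (j - 1))))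
    else Cell (Suc i) (j - 1 - length ps) (ps ! (j - 1 - length ps)) (fst (as ! (j - 1 - length ps))))"

text \<open>The first family performs transitions at the head positions; the second is the frame
  rule for the cells away from the head.\<close>

definition run_clauses :: "tm => nat => int set => fact clause set" where
  "run_clauses M T Z =
    (%(i, z, ps, rs, j). impl (pre i z ps rs) (post M i z ps rs j)) `
     ({..<T} \<times> {..<nstates M} \<times> {ps. set ps <= {-int T..int T} & length ps = ntapes M} \<times>
     {rs. set rs <= {..<nsyms M} & length rs = ntapes M} \<times> {..2 * ntapes M}) \<union>
    (%(i, j, p, p', a). impl [Head i j p, Cell i j p' a] (Cell (Suc i) j p' (if p = p' then a else a))) `
     {(i, j, p, p', a). (i, j, p, p', a) \<in> {..<T} \<times> {..<ntapes M} \<times> {-int T..int T} \<times> Z \<times> {..<nsyms M} & p ~= p'}"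

text \<open>Describes the tape content \<open>enc_pair (x, y)\<close>: doubled input bits, the
  separator with symbols 1 and 2, and \<open>w\<close> cells for the witness. The witness cells
  carry any of the three symbols, but a blank is followed by blanks only, so that shorter witnesses
  are covered too.\<close>

definition start_clauses :: "tm => nat => nat => int set => fact clause set" where
  "start_clauses M s w Z =
    {[(State 0 0, True)], [(Cell 0 0 (2 * int s) 1, True)], [(Cell 0 0 (2 * int s + 1) 2, True)]} \<union>
    (%j. [(Head 0 j 0, True)]) ` {..<ntapes M} \<union>
    (%(j, p). [(Cell 0 j p 0, True)]) ` ({1..<ntapes M} \<times> Z) \<union>
    (%p. [(Cell 0 0 p 0, True)]) ` {p \<in> Z. p < 0 \<or> p >= 2 * int s + 2 + int w} \<union>
    (%(i, r, b). [(Inp i, ~ b), (Cell 0 0 (2 * int i + r) (bit_sym b), True)]) ` ({..<s} \<times> {0, 1} \<times> UNIV) \<union>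
    (%i. map (%a. (Cell 0 0 (2 * int s + 2 + int i) a, True)) [0, 1, 2]) ` {..<w} \<union>
    (%i. impl [Cell 0 0 (2 * int s + 2 + int i) 0] (Cell 0 0 (2 * int s + 2 + int (Suc i)) 0)) ` {..<w - 1}"

definition conf_facts :: "(fact => bool) => nat => int set => config => bool" where
  "conf_facts av i Z c \<longleftrightarrow> av (State i (fst c)) &
    (ALL j < length (snd c). av (Head i j (snd (snd c ! j))) & (ALL p:Z. av (Cell i j p (fst (snd c ! j) p))))"

lemma good_heads: "good_conf M i c ==> set (heads (snd c)) <= {..<nsyms M}"
  by (auto simp: good_conf_def heads_def)

lemma conf_facts_step:
  assumes av: "ALL C:run_clauses M T Z. csat av C" and M: "valid_tm M"
   and g: "good_conf M i c" and i: "i < T" and Z: "{-int T..int T} <= Z" and c: "conf_facts av i Z c"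
  shows "conf_facts av (Suc i) Z (step M c)"
proof -
  define ps where "ps = map snd (snd c)"
  define rs where "rs = heads (snd c)"
  define z where "z = fst c"
  obtain z' as where a: "run_act M z rs = (z', as)" by fastforce
  have k: "length (snd c) = ntapes M" "z < nstates M" using g by (auto simp: good_conf_def z_def)
  have rs: "length rs = ntapes M" "set rs <= {..<nsyms M}" using g by (auto simp: good_conf_def rs_def heads_def)
  have bd: "snd tp \<in> {-int T..int T}" if "tp \<in> set (snd c)" for tp
   using g i that by (fastforce simp: good_conf_def)
  have ps: "length ps = ntapes M" "set ps <= {-int T..int T}" using k bd by (auto simp: ps_def)
  have as: "length as = ntapes M"
  proof (cases "delta M z rs")
   case None
   then show ?thesis using a rs by (auto simp: run_act_def)
  next
   case (Some x)
   then show ?thesis using a M k rs unfolding valid_tm_def run_act_def by (auto split: option.splits)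
  qed
  have pre: "ALL u:set (pre i z ps rs). av u"
  proof -
   have "av (Head i j (ps ! j))" "av (Cell i j (ps ! j) (rs ! j))" if "j < ntapes M" for j
   proof -
    have j: "j < length (snd c)" using that k by simp
    show "av (Head i j (ps ! j))" using c j by (auto simp: conf_facts_def ps_def)
    have "ps ! j \<in> Z" using bd[of "snd c ! j"] j Z by (auto simp: ps_def)
    moreover have "rs ! j = fst (snd c ! j) (ps ! j)" using j by (simp add: rs_def ps_def heads_def split_beta)
    ultimately show "av (Cell i j (ps ! j) (rs ! j))" using c j by (auto simp: conf_facts_def)
   qed
   then show ?thesis using c ps by (auto simp: pre_def conf_facts_def z_def)
  qed
  have post: "av (post M i z ps rs j)" if "j <= 2 * ntapes M" for j
  proof -
   have "impl (pre i z ps rs) (post M i z ps rs j) \<in> run_clauses M T Z"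
    unfolding run_clauses_def using i k ps rs that
    by (intro UnI1 image_eqI[of _ _ "(i, z, ps, rs, j)"]) auto
   then have "csat av (impl (pre i z ps rs) (post M i z ps rs j))" using av by blast
   then show ?thesis using pre by (simp add: csat_impl)
  qed
  have sc: "step M c = (z', map2 (%(t, p) (a, m). (t(p := a), p + offset m)) (snd c) as)"
   using step_run_act[of M c] a by (simp add: z_def rs_def)
  show ?thesis unfolding conf_facts_def
  proof (intro conjI allI impI ballI)
   show "av (State (Suc i) (fst (step M c)))" using post[of 0] a by (simp add: post_def sc)
   fix j assume "j < length (snd (step M c))"
   then have j: "j < ntapes M" "j < length (snd c)" "j < length as" using k as by (auto simp: sc)
   obtain t p where tp: "snd c ! j = (t, p)" by fastforce
   obtain b m where am: "as ! j = (b, m)" by fastforce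
   have pj: "ps ! j = p" using j tp by (simp add: ps_def)
   have nj: "snd (step M c) ! j = (t(p := b), p + offset m)" using j tp am by (simp add: sc)
   show "av (Head (Suc i) j (snd (snd (step M c) ! j)))"
    using post[of "Suc j"] j a ps by (simp add: post_def nj pj am)
   fix p' assume p': "p' \<in> Z"
   show "av (Cell (Suc i) j p' (fst (snd (step M c) ! j) p'))"
   proof (cases "p' = p")
    case True
    then show ?thesis using post[of "Suc (ntapes M + j)"] j a ps by (simp add: post_def nj pj am)
   next
    case False
    have mem: "(t, p) \<in> set (snd c)" using j(2) tp nth_mem by metis
    have "p \<in> {-int T..int T}" using bd[OF mem] by simp
    moreover have "t p' < nsyms M" using g mem by (auto simp: good_conf_def)
    ultimately have "impl [Head i j p, Cell i j p' (t p')] (Cell (Suc i) j p' (t p')) \<in> run_clauses M T Z"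
     unfolding run_clauses_def using i j p' False
     by (intro UnI2 image_eqI[of _ _ "(i, j, p, p', t p')"]) auto
    moreover have "av (Head i j p)" "av (Cell i j p' (t p'))" using c j tp p' by (auto simp: conf_facts_def)
    ultimately show ?thesis using av False csat_impl[of av "[Head i j p, Cell i j p' (t p')]"] by (auto simp: nj)
   qed
  qed
qed

definition run_model :: "tm => word => word => fact => bool" where
  "run_model M u x f = (case f of
    Inp i => x ! i
   | State i z => fst ((step M ^^ i) (init_config M u)) = z
   | Head i j p => snd (snd ((step M ^^ i) (init_config M u)) ! j) = p
   | Cell i j p a => fst (snd ((step M ^^ i) (init_config M u)) ! j) p = a)"

lemma run_model_run:
  assumes M: "valid_tm M"
  shows "ALL C:run_clauses M T Z. csat (run_model M u x) C"
proof
  let ?c = "%i. (step M ^^ i) (init_config M u)"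
  have g0: "good_conf M 0 (init_config M u)"
   using M by (auto simp: good_conf_def init_config_def valid_tm_def input_tape_def bit_sym_def)
  have g: "good_conf M i (?c i)" for i using sim_steps_rep(1)[OF M g0, of i i "2 * i + 1"] by simp
  have k: "length (snd (?c i)) = ntapes M" for i using g by (simp add: good_conf_def)
  fix C assume "C \<in> run_clauses M T Z"
  then consider (1) i z ps rs j where "C = impl (pre i z ps rs) (post M i z ps rs j)" "length ps = ntapes M"
    "length rs = ntapes M" "j <= 2 * ntapes M"
   | (2) i j p p' a where "C = impl [Head i j p, Cell i j p' a] (Cell (Suc i) j p' a)" "j < ntapes M" "p ~= p'"
   unfolding run_clauses_def by auto
  then show "csat (run_model M u x) C"
  proof cases
   case 1
   have "run_model M u x (post M i z ps rs j)" if pre: "ALL v:set (pre i z ps rs). run_model M u x v"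
   proof -
    have z: "fst (?c i) = z" using pre by (simp add: pre_def run_model_def)
    have p: "snd (snd (?c i) ! j) = ps ! j" "fst (snd (?c i) ! j) (ps ! j) = rs ! j" if "j < ntapes M" for j
     using bspec[OF pre, of "Head i j (ps ! j)"] bspec[OF pre, of "Cell i j (ps ! j) (rs ! j)"] that 1
     by (auto simp: pre_def run_model_def)
    have rs: "heads (snd (?c i)) = rs"
     using p k 1 by (intro nth_equalityI) (auto simp: heads_def split_beta)
    obtain z' as where a: "run_act M z rs = (z', as)" by fastforce
    have sc: "?c (Suc i) = (z', map2 (%(t, p) (a, m). (t(p := a), p + offset m)) (snd (?c i)) as)"
     using step_run_act[of M "?c i"] a z rs by simp
    have as: "length as = ntapes M" using k[of "Suc i"] k[of i] unfolding sc
    proof (cases "delta M z rs")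
     case None
     then show ?thesis using a 1 by (auto simp: run_act_def)
    next
     case (Some x)
     have "set rs <= {..<nsyms M}" "z < nstates M" using good_heads[OF g[of i]] rs z g[of i] by (auto simp: good_conf_def)
     then show ?thesis using a M 1 Some unfolding valid_tm_def run_act_def by (auto split: option.splits)
    qed
    have nj: "snd (?c (Suc i)) ! j = ((fst (snd (?c i) ! j))(ps ! j := fst (as ! j)), ps ! j + offset (snd (as ! j)))"
     if "j < ntapes M" for j
     using that k[of i] as p[OF that] unfolding sc by (simp add: split_beta)
    show ?thesis
    proof (cases "j = 0 \<or> j <= ntapes M")
     case True
     then show ?thesis using a 1 nj[of "j - 1"] sc by (cases "j = 0") (auto simp: post_def run_model_def simp del: funpow.simps)
    next
     case False
     then have "j - 1 - ntapes M < ntapes M" using 1 by auto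
     from nj[OF this] show ?thesis using False a 1 by (auto simp: post_def run_model_def simp del: funpow.simps)
    qed
   qed
   then show ?thesis using 1 csat_impl by metis
  next
   case 2
   have "run_model M u x (Cell (Suc i) j p' a)" if "run_model M u x (Head i j p)" "run_model M u x (Cell i j p' a)"
   proof -
    obtain z' as where sc: "?c (Suc i) = (z', map2 (%(t, p) (a, m). (t(p := a), p + offset m)) (snd (?c i)) as)"
     using step_run_act[of M "?c i"] by auto
    have "length as >= ntapes M" using k[of "Suc i"] k[of i] unfolding sc by simp
    then have "snd (?c (Suc i)) ! j = ((fst (snd (?c i) ! j))(p := fst (as ! j)), p + offset (snd (as ! j)))"
     using 2 k[of i] that(1) unfolding sc by (simp add: split_beta run_model_def)
    then show ?thesis using that(2) 2(3) by (auto simp: run_model_def simp del: funpow.simps)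
   qed
   then show ?thesis using 2 csat_impl[of "run_model M u x" "[Head i j p, Cell i j p' a]"] by auto
  qed
qed

lemma enc_pair_nth:
  assumes "length x = s"
  shows "i < s ==> r < 2 ==> enc_pair (x, y) ! (2 * i + r) = x ! i" "enc_pair (x, y) ! (2 * s) = False"
   "enc_pair (x, y) ! (2 * s + 1) = True" "enc_pair (x, y) ! (2 * s + 2 + i') = y ! i'"
proof -
  have "(concat (map (%b. [b, b]) x) @ False # True # y) ! (i * 2 + r) = [x ! i, x ! i] ! r" if "i < s" "r < 2"
   using that assms by (intro nth_concat_chunks) auto
  then show "i < s ==> r < 2 ==> enc_pair (x, y) ! (2 * i + r) = x ! i"
   by (auto simp: enc_pair_def mult.commute less_2_cases_iff)
  have n: "enc_pair (x, y) ! (2 * s + m) = (False # True # y) ! m" for m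
   unfolding enc_pair_dbl using nth_append_length_plus[of "dbl x" "False # True # y" m] assms by simp
  show "enc_pair (x, y) ! (2 * s) = False" "enc_pair (x, y) ! (2 * s + 1) = True"
   "enc_pair (x, y) ! (2 * s + 2 + i') = y ! i'"
   using n[of 0] n[of 1] n[of "Suc (Suc i')"] by auto
qed

lemma input_tape_at: "i < length u ==> input_tape u (int i) = bit_sym (u ! i)"
  by (simp add: input_tape_def)

lemma run_model_start:
  assumes M: "valid_tm M" and x: "length x = s" and y: "length y <= w"
  shows "ALL C:start_clauses M s w Z. csat (run_model M (enc_pair (x, y)) x) C"
proof
  let ?u = "enc_pair (x, y)" and ?av = "run_model M (enc_pair (x, y)) x"
  have lu: "length ?u = 2 * s + 2 + length y" using x by simp
  have k: "ntapes M >= 1" using M by (simp add: valid_tm_def)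
  have c0: "?av (Cell 0 0 p a) \<longleftrightarrow> input_tape ?u p = a" for p a by (simp add: run_model_def init_config_def)
  have cj: "?av (Cell 0 j p 0)" if "j \<in> {1..<ntapes M}" for j p
   using that by (auto simp: run_model_def init_config_def nth_Cons')
  have hj: "?av (Head 0 j 0)" if "j < ntapes M" for j
   using that by (auto simp: run_model_def init_config_def nth_Cons')
  have yr: "input_tape ?u (2 * int s + 2 + int i) = (if i < length y then bit_sym (y ! i) else 0)" for i
  proof (cases "i < length y")
   case True
   then have "input_tape ?u (int (2 * s + 2 + i)) = bit_sym (?u ! (2 * s + 2 + i))" by (intro input_tape_at) (simp add: x)
   then show ?thesis using True enc_pair_nth(4)[OF x, of y i] by (simp add: algebra_simps)
  next
   case False
   then show ?thesis using x by (simp add: input_tape_def)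
  qed
  have xr: "input_tape ?u (2 * int i + r) = bit_sym (x ! i)" if "i < s" "r \<in> {0, 1}" for i r
   using input_tape_at[of "2 * i + nat r" ?u] enc_pair_nth(1)[OF x, of i "nat r" y] that x by auto
  have sr: "input_tape ?u (2 * int s) = 1" "input_tape ?u (2 * int s + 1) = 2"
   using input_tape_at[of "2 * s" ?u] input_tape_at[of "2 * s + 1" ?u] enc_pair_nth(2,3)[OF x, of y] x
   by (auto simp: bit_sym_def add.commute)
  fix C assume "C \<in> start_clauses M s w Z"
  then show "csat ?av C" unfolding start_clauses_def
  proof (elim UnE)
   assume "C \<in> {[(State 0 0, True)], [(Cell 0 0 (2 * int s) 1, True)], [(Cell 0 0 (2 * int s + 1) 2, True)]}"
   then show ?thesis using sr c0 by (auto simp: run_model_def init_config_def)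
  next
   assume "C \<in> (%j. [(Head 0 j 0, True)]) ` {..<ntapes M}"
   then show ?thesis using hj by auto
  next
   assume "C \<in> (%(j, p). [(Cell 0 j p 0, True)]) ` ({1..<ntapes M} \<times> Z)"
   then show ?thesis using cj by auto
  next
   assume "C \<in> (%p. [(Cell 0 0 p 0, True)]) ` {p \<in> Z. p < 0 \<or> p >= 2 * int s + 2 + int w}"
   then show ?thesis using c0 lu y by (auto simp: input_tape_def)
  next
   assume "C \<in> (%(i, r, b). [(Inp i, ~ b), (Cell 0 0 (2 * int i + r) (bit_sym b), True)]) ` ({..<s} \<times> {0, 1} \<times> UNIV)"
   then obtain i r b where C: "C = [(Inp i, ~ b), (Cell 0 0 (2 * int i + r) (bit_sym b), True)]" "i < s" "r \<in> {0, 1}" by auto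
   have "?av (Inp i) = x ! i" by (simp add: run_model_def)
   then show ?thesis using C c0 xr[OF C(2,3)] by (cases "x ! i = b") auto
  next
   assume "C \<in> (%i. map (%a. (Cell 0 0 (2 * int s + 2 + int i) a, True)) [0, 1, 2]) ` {..<w}"
   then show ?thesis using c0 yr by (auto simp: bit_sym_def)
  next
   assume "C \<in> (%i. impl [Cell 0 0 (2 * int s + 2 + int i) 0] (Cell 0 0 (2 * int s + 2 + int (Suc i)) 0)) ` {..<w - 1}"
   then obtain i where C: "C = impl [Cell 0 0 (2 * int s + 2 + int i) 0] (Cell 0 0 (2 * int s + 2 + int (Suc i)) 0)" by auto
   have "?av (Cell 0 0 (2 * int s + 2 + int i) 0) ==> ?av (Cell 0 0 (2 * int s + 2 + int (Suc i)) 0)"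
    unfolding c0 yr by (auto simp: bit_sym_def split: if_splits)
   then show ?thesis unfolding C csat_impl by simp
  qed
qed

lemma start_facts:
  assumes M: "valid_tm M" and x: "length x = s" and av: "ALL C:start_clauses M s w Z. csat av C"
   and inp: "ALL i < s. av (Inp i) = x ! i"
  shows "EX y. length y <= w & conf_facts av 0 Z (init_config M (enc_pair (x, y)))"
proof -
  let ?Y = "%i a. av (Cell 0 0 (2 * int s + 2 + int i) a)"
  have any: "?Y i 0 \<or> ?Y i 1 \<or> ?Y i 2" if "i < w" for i
   using av[unfolded start_clauses_def, rule_format, OF UnI1[OF UnI2], OF image_eqI[OF refl], of i] that by auto
  have mono: "?Y i 0 ==> ?Y (Suc i) 0" if "i < w - 1" for i
   using av[unfolded start_clauses_def, rule_format, OF UnI2, OF image_eqI[OF refl], of i] that by (simp add: csat_impl)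
  \<comment> \<open>A model may assert several symbols for one witness cell. The witness is cut off
    at the first cell asserted to be blank, and before it symbol 2 is preferred; every fact about
    the resulting tape is then asserted by the model.\<close>
  define m where "m = (if EX i < w. ?Y i 0 then LEAST i. ?Y i 0 else w)"
  have m: "m <= w" "!!i. i < m ==> ~ ?Y i 0" "m < w ==> ?Y m 0"
  proof -
   show "m <= w" unfolding m_def by (auto intro: Least_le[THEN order_trans] less_imp_le)
   show "~ ?Y i 0" if "i < m" for i
    using that not_less_Least[of i "%i. ?Y i 0"] unfolding m_def by (auto split: if_splits)
   show "?Y m 0" if "m < w" using that LeastI_ex[of "%i. ?Y i 0"] unfolding m_def by (auto split: if_splits)
  qed
  have zero: "?Y i 0" if "m <= i" "i < w" for i
   using that by (induction i rule: dec_induct) (use m(3) mono in auto)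
  define y where "y = map (%i. ?Y i 2) [0..<m]"
  have ly: "length y = m" by (simp add: y_def)
  let ?u = "enc_pair (x, y)"
  have k: "ntapes M >= 1" using M by (simp add: valid_tm_def)
  have single: "av v" if "[(v, True)] \<in> start_clauses M s w Z" for v using av that by fastforce
  have cell: "av (Cell 0 0 p (input_tape ?u p))" if p: "p \<in> Z" for p
  proof -
   consider "p < 0 \<or> p >= 2 * int s + 2 + int w" | i where "p = 2 * int s + 2 + int i" "i < w"
    | "p = 2 * int s \<or> p = 2 * int s + 1" | "0 <= p" "p < 2 * int s"
   proof -
    have "EX i < w. p = 2 * int s + 2 + int i" if "2 * int s + 2 <= p" "p < 2 * int s + 2 + int w"
     using that by (intro exI[of _ "nat (p - 2 * int s - 2)"]) auto
    then show ?thesis using that by fastforce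
   qed
   then show ?thesis
   proof cases
    case 1
    then have "[(Cell 0 0 p 0, True)] \<in> start_clauses M s w Z" unfolding start_clauses_def using p by blast
    moreover have "input_tape ?u p = 0" using 1 x ly m(1) by (auto simp: input_tape_def)
    ultimately show ?thesis using single by simp
   next
    case 2
    show ?thesis
    proof (cases "i < m")
     case True
     then have "input_tape ?u (int (2 * s + 2 + i)) = bit_sym (?u ! (2 * s + 2 + i))" by (intro input_tape_at) (simp add: x ly)
     then have "input_tape ?u p = bit_sym (?Y i 2)" using enc_pair_nth(4)[OF x, of y i] True 2 by (simp add: y_def algebra_simps)
     then show ?thesis using any[OF 2(2)] m(2)[OF True] 2(1) by (auto simp: bit_sym_def)
    next
     case False
     then have "input_tape ?u p = 0" using 2 x ly by (simp add: input_tape_def)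
     then show ?thesis using zero[of i] False 2 by simp
    qed
   next
    case 3
    have "[(Cell 0 0 (2 * int s) 1, True)] \<in> start_clauses M s w Z" "[(Cell 0 0 (2 * int s + 1) 2, True)] \<in> start_clauses M s w Z"
     unfolding start_clauses_def by blast+
    moreover have "input_tape ?u (2 * int s) = 1" "input_tape ?u (2 * int s + 1) = 2"
     using input_tape_at[of "2 * s" ?u] input_tape_at[of "2 * s + 1" ?u] enc_pair_nth(2,3)[OF x, of y] x
     by (auto simp: bit_sym_def add.commute)
    ultimately show ?thesis using 3 single by auto
   next
    case 4
    define i r where "i = nat (p div 2)" and "r = p mod 2"
    have ir: "p = 2 * int i + r" "r \<in> {0, 1}" "i < s" using 4 by (auto simp: i_def r_def)
    have "input_tape ?u p = bit_sym (x ! i)"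
     using input_tape_at[of "2 * i + nat r" ?u] enc_pair_nth(1)[OF x, of i "nat r" y] ir x by auto
    moreover have "[(Inp i, ~ (x ! i)), (Cell 0 0 p (bit_sym (x ! i)), True)] \<in> start_clauses M s w Z"
     unfolding start_clauses_def ir(1) using ir(2,3) by (intro UnI1 UnI2 image_eqI[of _ _ "(i, r, x ! i)"]) auto
    ultimately show ?thesis using av inp ir(3) by fastforce
   qed
  qed
  have "conf_facts av 0 Z (init_config M ?u)"
   unfolding conf_facts_def
  proof (intro conjI allI impI ballI)
   show "av (State 0 (fst (init_config M ?u)))" using single[of "State 0 0"] by (simp add: start_clauses_def init_config_def)
   fix j assume "j < length (snd (init_config M ?u))"
   then have j: "j < ntapes M" using k by (auto simp: init_config_def)
   have "[(Head 0 j 0, True)] \<in> start_clauses M s w Z" unfolding start_clauses_def using j by blast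
   then show "av (Head 0 j (snd (snd (init_config M ?u) ! j)))"
    using single j by (auto simp: init_config_def nth_Cons')
   fix p assume p: "p \<in> Z"
   show "av (Cell 0 j p (fst (snd (init_config M ?u) ! j) p))"
   proof (cases "j = 0")
    case True
    then show ?thesis using cell[OF p] by (simp add: init_config_def)
   next
    case False
    then have "[(Cell 0 j p 0, True)] \<in> start_clauses M s w Z" unfolding start_clauses_def using j p by force
    then show ?thesis using single False j by (auto simp: init_config_def nth_Cons')
   qed
  qed
  then show ?thesis using ly m(1) by blast
qed


section \<open>Number of clauses and the Cook-Levin theorem\<close>

lemma card_run_clauses:
  assumes "finite Z"
  shows "finite (run_clauses M T Z)"
   "card (run_clauses M T Z) <= T * (nstates M * ((2 * T + 1) ^ ntapes M * (nsyms M ^ ntapes M * (2 * ntapes M + 1))))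
     + T * (ntapes M * ((2 * T + 1) * (card Z * nsyms M)))"
   "C \<in> run_clauses M T Z ==> length C <= 2 * ntapes M + 3"
proof -
  let ?A = "{..<T} \<times> {..<nstates M} \<times> {ps. set ps <= {-int T..int T} & length ps = ntapes M} \<times>
     {rs. set rs <= {..<nsyms M} & length rs = ntapes M} \<times> {..2 * ntapes M}"
  let ?B = "{..<T} \<times> {..<ntapes M} \<times> {-int T..int T} \<times> Z \<times> {..<nsyms M}"
  let ?B' = "{(i, j, p, p', a). (i, j, p, p', a) \<in> ?B & p ~= p'}"
  have fA: "finite ?A" by (intro finite_cartesian_product finite_lists_length_eq) auto
  have fB: "finite ?B" using assms by (intro finite_cartesian_product) auto
  have sub: "?B' <= ?B" by auto
  have fB': "finite ?B'" by (rule finite_subset[OF sub fB])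
  have cA: "card ?A = T * (nstates M * ((2 * T + 1) ^ ntapes M * (nsyms M ^ ntapes M * (2 * ntapes M + 1))))"
   by (simp add: card_cartesian_product card_lists_length_eq nat_add_distrib nat_mult_distrib)
  have cB: "card ?B = T * (ntapes M * ((2 * T + 1) * (card Z * nsyms M)))"
   by (simp add: card_cartesian_product nat_add_distrib nat_mult_distrib)
  show "finite (run_clauses M T Z)" unfolding run_clauses_def using fA fB' by blast
  have "card (run_clauses M T Z) <= card ?A + card ?B'"
   unfolding run_clauses_def by (rule order_trans[OF card_Un_le add_mono[OF card_image_le[OF fA] card_image_le[OF fB']]])
  also have "card ?B' <= card ?B" by (rule card_mono[OF fB sub])
  finally show "card (run_clauses M T Z) <= T * (nstates M * ((2 * T + 1) ^ ntapes M * (nsyms M ^ ntapes M * (2 * ntapes M + 1))))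
     + T * (ntapes M * ((2 * T + 1) * (card Z * nsyms M)))"
   unfolding cA cB by simp
  show "C \<in> run_clauses M T Z ==> length C <= 2 * ntapes M + 3"
   unfolding run_clauses_def by (auto simp: impl_def pre_def)
qed

lemma card_start_clauses:
  assumes "finite Z"
  shows "finite (start_clauses M s w Z)"
   "card (start_clauses M s w Z) <= 3 + ntapes M + ntapes M * card Z + card Z + s * 4 + w + w"
   "C \<in> start_clauses M s w Z ==> length C <= 3"
proof -
  have f: "finite ({1..<ntapes M} \<times> Z)" "finite {p \<in> Z. p < 0 \<or> p >= 2 * int s + 2 + int w}"
   "finite ({..<s} \<times> {0, 1 :: int} \<times> (UNIV :: bool set))" using assms by auto
  show "finite (start_clauses M s w Z)" unfolding start_clauses_def using f by blast
  have c: "card ({1..<ntapes M} \<times> Z) <= ntapes M * card Z" "card {p \<in> Z. p < 0 \<or> p >= 2 * int s + 2 + int w} <= card Z"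
   "card ({..<s} \<times> {0, 1 :: int} \<times> (UNIV :: bool set)) <= s * 4" "card {..<ntapes M} <= ntapes M"
   "card {..<w} <= w" "card {..<w - 1} <= w"
   using assms by (auto simp: card_cartesian_product card_UNIV_bool intro: card_mono)
  have "card {[(State 0 0, True)], [(Cell 0 0 (2 * int s) 1, True)], [(Cell 0 0 (2 * int s + 1) 2, True)]} <= 3"
   by (simp add: card_insert_if)
  then show "card (start_clauses M s w Z) <= 3 + ntapes M + ntapes M * card Z + card Z + s * 4 + w + w"
   unfolding start_clauses_def
   by (intro order_trans[OF card_Un_le add_mono] order_trans[OF card_image_le c(1)] order_trans[OF card_image_le c(2)]
     order_trans[OF card_image_le c(3)] order_trans[OF card_image_le c(4)] order_trans[OF card_image_le c(5)]
     order_trans[OF card_image_le c(6)] f finite_lessThan)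
  show "C \<in> start_clauses M s w Z ==> length C <= 3"
   unfolding start_clauses_def by (auto simp: impl_def)
qed

text \<open>The clauses depend on the length only, and the word enters through the variables
  \<open>Inp i\<close> alone. The composition relies on this: one copy of the clauses serves all
  words of the same length.\<close>

theorem cook_levin:
  assumes "L \<in> NP"
  shows "EX K. ALL s. EX Cl :: fact clause set. finite Cl & card Cl <= (s + 2) ^ K & (ALL C:Cl. length C <= K) &
   (ALL x. length x = s --> (x \<in> L \<longleftrightarrow> (EX av. (ALL i < s. av (Inp i) = x ! i) & (ALL C:Cl. csat av C))))"
proof -
  obtain R pw where R: "polytime enc_pair (%b. [b]) R"
   and L: "!!x. x \<in> L \<longleftrightarrow> (EX y. length y <= poly pw (length x) & R (x, y))"
   using assms unfolding NP_def by blast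
  obtain M p where M: "valid_tm M"
   and run: "!!a. EX t <= poly p (length (enc_pair a)). tm_computes M (enc_pair a) t [R a]"
   using R unfolding polytime_def by blast
  obtain k where k: "!!n. poly p n <= (n + 2) ^ k" using polyb_poly_bound[of p] unfolding polyb_def by blast
  define w where "w s = poly pw s" for s :: nat
  define N where "N s = 2 * s + 2 + w s" for s
  define T where "T s = (N s + 2) ^ k" for s
  define Z where "Z s = {-int (T s)..int (T s + N s)}" for s
  \<comment> \<open>Symbol 1 is the bit \<open>False\<close>. Besides the derivation of facts the
    only demand is that a rejecting output is not derived at time \<open>T s\<close>.\<close>
  define Cl where "Cl s = start_clauses M s (w s) (Z s) \<union> run_clauses M (T s) (Z s) \<union> {[(Cell (T s) 0 0 1, False)]}" for s
  have fZ: "finite (Z s)" and cZ: "card (Z s) = 2 * T s + N s + 1" for s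
   by (simp_all add: Z_def nat_add_distrib nat_mult_distrib)
  have fin: "finite (Cl s)" for s
   unfolding Cl_def using card_run_clauses(1)[OF fZ] card_start_clauses(1)[OF fZ] by blast
  have pw: "polyb (%s. s) w" unfolding w_def by (rule polyb_poly_bound)
  have pN: "polyb (%s. s) N" unfolding N_def by (intro polyb_intros pw)
  have pT: "polyb (%s. s) T" unfolding T_def by (intro polyb_intros pN)
  have "polyb (%s. s) (%s. card (Cl s))"
  proof (rule polyb_mono)
   show "card (Cl s) <= 3 + ntapes M + ntapes M * card (Z s) + card (Z s) + s * 4 + w s + w s
     + (T s * (nstates M * ((2 * T s + 1) ^ ntapes M * (nsyms M ^ ntapes M * (2 * ntapes M + 1))))
     + T s * (ntapes M * ((2 * T s + 1) * (card (Z s) * nsyms M)))) + 1" for s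
    unfolding Cl_def
    by (rule order_trans[OF card_Un_le add_mono[OF order_trans[OF card_Un_le add_mono[OF card_start_clauses(2)[OF fZ] card_run_clauses(2)[OF fZ]]]]]) simp
   show "polyb (%s. s) (%s. 3 + ntapes M + ntapes M * card (Z s) + card (Z s) + s * 4 + w s + w s
     + (T s * (nstates M * ((2 * T s + 1) ^ ntapes M * (nsyms M ^ ntapes M * (2 * ntapes M + 1))))
     + T s * (ntapes M * ((2 * T s + 1) * (card (Z s) * nsyms M)))) + 1)"
    unfolding cZ by (intro polyb_intros pw pN pT)
  qed
  then obtain K0 where K0: "!!s. card (Cl s) <= (s + 2) ^ K0" unfolding polyb_def by blast
  define K where "K = K0 + 2 * ntapes M + 3"
  have res: "finite (Cl s) & card (Cl s) <= (s + 2) ^ K & (ALL C:Cl s. length C <= K) &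
   (ALL x. length x = s --> (x \<in> L \<longleftrightarrow> (EX av. (ALL i < s. av (Inp i) = x ! i) & (ALL C:Cl s. csat av C))))" for s
  proof (intro conjI allI impI ballI)
   show "finite (Cl s)" by (rule fin)
   have "(s + 2) ^ K0 <= (s + 2) ^ K" by (rule power_increasing) (auto simp: K_def)
   then show "card (Cl s) <= (s + 2) ^ K" using K0[of s] by linarith
   show "length C <= K" if "C \<in> Cl s" for C
    using that card_run_clauses(3)[OF fZ, of C M "T s" s] card_start_clauses(3)[OF fZ, of C M s "w s" s]
    unfolding Cl_def K_def by auto
   fix x :: word assume x: "length x = s"
   have ne: "ntapes M >= 1" using M by (simp add: valid_tm_def)
   have out: "fst (snd ((step M ^^ T s) (init_config M (enc_pair (x, y)))) ! 0) 0 = bit_sym (R (x, y))" if "length y <= w s" for y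
   proof -
    let ?u = "enc_pair (x, y)"
    obtain t where t: "t <= poly p (length ?u)" "tm_computes M ?u t [R (x, y)]" using run[of "(x, y)"] by blast
    have "poly p (length ?u) <= (length ?u + 2) ^ k" by (rule k)
    also have "... <= T s" unfolding T_def N_def using x that by (intro power_mono) auto
    finally have "t <= T s" using t(1) by simp
    then obtain j where j: "T s = j + t" by (metis le_add_diff_inverse2)
    have c: "(step M ^^ T s) (init_config M ?u) = (step M ^^ t) (init_config M ?u)"
     using halted_stays[of M "(step M ^^ t) (init_config M ?u)" j] t(2)
     by (simp add: j funpow_add tm_computes_def Let_def)
    have g0: "good_conf M 0 (init_config M ?u)"
     using M by (auto simp: good_conf_def init_config_def valid_tm_def input_tape_def bit_sym_def)
    have "good_conf M (T s) ((step M ^^ T s) (init_config M ?u))"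
     using sim_steps_rep(1)[OF M g0, of "T s" "T s" "2 * T s + 1"] by simp
    then have "snd ((step M ^^ T s) (init_config M ?u)) ~= []" using ne by (auto simp: good_conf_def)
    then have "hd (snd ((step M ^^ T s) (init_config M ?u))) = snd ((step M ^^ T s) (init_config M ?u)) ! 0"
     by (rule hd_conv_nth)
    moreover have "has_output ((step M ^^ T s) (init_config M ?u)) [R (x, y)]"
     using t(2) c by (simp add: tm_computes_def Let_def)
    ultimately show ?thesis by (simp add: has_output_def)
   qed
   show "x \<in> L \<longleftrightarrow> (EX av. (ALL i < s. av (Inp i) = x ! i) & (ALL C:Cl s. csat av C))"
   proof
    assume "x \<in> L"
    then obtain y where y: "length y <= w s" "R (x, y)" using L[of x] x by (auto simp: w_def)
    let ?av = "run_model M (enc_pair (x, y)) x"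
    have "~ ?av (Cell (T s) 0 0 1)" using out[OF y(1)] y(2) by (simp add: run_model_def bit_sym_def)
    then have "ALL C:Cl s. csat ?av C"
     unfolding Cl_def using run_model_run[OF M, of "T s" "Z s" "enc_pair (x, y)" x] run_model_start[OF M x y(1), of "Z s"] by auto
    moreover have "ALL i < s. ?av (Inp i) = x ! i" by (simp add: run_model_def)
    ultimately show "EX av. (ALL i < s. av (Inp i) = x ! i) & (ALL C:Cl s. csat av C)" by blast
   next
    assume "EX av. (ALL i < s. av (Inp i) = x ! i) & (ALL C:Cl s. csat av C)"
    then obtain av where av: "ALL i < s. av (Inp i) = x ! i" "ALL C:Cl s. csat av C" by blast
    have "ALL C:start_clauses M s (w s) (Z s). csat av C" "ALL C:run_clauses M (T s) (Z s). csat av C"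
     and fin: "~ av (Cell (T s) 0 0 1)" using av(2) unfolding Cl_def by auto
    from start_facts[OF M x this(1) av(1)] obtain y where y: "length y <= w s"
     "conf_facts av 0 (Z s) (init_config M (enc_pair (x, y)))" by blast
    let ?c = "%i. (step M ^^ i) (init_config M (enc_pair (x, y)))"
    have g0: "good_conf M 0 (?c 0)"
     using M by (auto simp: good_conf_def init_config_def valid_tm_def input_tape_def bit_sym_def)
    have g: "good_conf M i (?c i)" for i using sim_steps_rep(1)[OF M g0, of i i "2 * i + 1"] by simp
    have "conf_facts av i (Z s) (?c i)" if "i <= T s" for i
     using that
    proof (induction i)
     case (Suc i)
     then show ?case
      using conf_facts_step[OF \<open>ALL C:run_clauses M (T s) (Z s). csat av C\<close> M g[of i]] by (simp add: Z_def)
    qed (use y in simp)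
    from this[of "T s"] have "av (Cell (T s) 0 0 (fst (snd (?c (T s)) ! 0) 0))"
     using g[of "T s"] ne by (auto simp: conf_facts_def good_conf_def Z_def)
    then have "R (x, y)" using fin out[OF y(1)] by (auto simp: bit_sym_def split: if_splits)
    then show "x \<in> L" using L[of x] y(1) x by (auto simp: w_def)
   qed
  qed
  show ?thesis by (rule exI[of _ K], rule allI, rule exI[of _ "Cl _"]) (rule res)
qed

section \<open>Gadgets\<close>

type_synonym 'x tri = "('x \<times> bool) \<times> ('x \<times> bool) \<times> ('x \<times> bool)"

definition ltrue :: "('x => bool) => 'x \<times> bool => bool" where
  "ltrue av a \<longleftrightarrow> av (fst a) = snd a"

definition tlit :: "'x tri => nat => 'x \<times> bool" where
  "tlit tr j = (if j = 0 then fst tr else if j = 1 then fst (snd tr) else snd (snd tr))"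

definition tsat :: "('x => bool) => 'x tri => bool" where
  "tsat av tr \<longleftrightarrow> (EX j < 3. ltrue av (tlit tr j))"

lemma tsat_alt: "tsat av tr \<longleftrightarrow> ltrue av (tlit tr 0) \<or> ltrue av (tlit tr 1) \<or> ltrue av (tlit tr 2)"
  unfolding tsat_def by (auto simp: numeral_3_eq_3 less_Suc_eq numeral_2_eq_2)

text \<open>
  \<open>Pal i\<close> is the palette vertex of color \<open>i\<close>; \<open>Lit x True\<close> carries the value of the variable \<open>x\<close>,
  and \<open>Lit x False\<close> its negation.
\<close>

datatype 'x gv = Pal nat | Lit 'x bool | Aux "'x tri" nat nat

abbreviation "graph V E Tu \<equiv> \<lparr>verts = V, edges = E, tuples = Tu\<rparr>"

text \<open>Colors can be read only up to the renaming \<open>\<pi>\<close> given by the palette.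
  The two conditions with \<open>range\<close> keep the constraints of the gadget apart from those
  that a composition adds later on palette and literal vertices, so that no constraint occurs
  twice.\<close>

definition gadget :: "nat => nat => nat => 'x set => 'x tri set => ('x => nat) => ('x => nat) =>
   'x gv set => 'x gv set set => 'x gv set list set => bool" where
  "gadget d l q X Tri f t V E Tu \<longleftrightarrow>
    finite V & (ALL e:E. e <= V & card e = 2) &
    (ALL Fs:Tu. length Fs = l & (ALL F:set Fs. F <= V & card F = d)) &
    Pal ` {1..q} <= V & (%x. Lit x True) ` X <= V & card V <= q + 2 * card X + 10 * card Tri &
    (ALL e:E. ~ e <= range (%x. Lit x True)) &
    (ALL Fs:Tu. EX F:set Fs. ~ F <= range Pal \<union> range (%x. Lit x True)) &
    (ALL c. proper_coloring q (graph V E Tu) c & (ALL Fs:Tu. ~ uniformly_rainbow d c Fs) -->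
     (EX av \<pi>. (ALL tr:Tri. tsat av tr) & inj_on \<pi> {1..q} & (ALL i:{1..q}. c (Pal i) = \<pi> i) &
       (ALL x:X. c (Lit x True) = \<pi> (if av x then t x else f x)))) &
    (ALL av. (ALL tr:Tri. tsat av tr) --> (EX c. proper_coloring q (graph V E Tu) c & (ALL Fs:Tu. ~ uniformly_rainbow d c Fs) &
     (ALL i:{1..q}. c (Pal i) = i) & (ALL x:X. c (Lit x True) = (if av x then t x else f x))))"

subsection \<open>Three or more colors\<close>

text \<open>
  A path through three vertices with two allowed colors each forbids exactly one combination of
  colors at its end points, here \<open>a\<close> and \<open>b\<close>.
\<close>

lemma nogood_sound:
  "y0 \<in> {a, c1} ==> y1 \<in> {c1, c2} ==> y2 \<in> {c2, b} ==> u ~= y0 ==> y0 ~= y1 ==> y1 ~= y2 ==> y2 ~= w ==>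
   ~ (u = a & w = b)"
  by auto

text \<open>If \<open>u = a\<close>, the colors \<open>c1\<close>, \<open>c2\<close>,
  \<open>b\<close> work because then \<open>w ~= b\<close>. Otherwise the path may start with
  \<open>a\<close>, \<open>c1\<close>, which leaves both \<open>c2\<close> and \<open>b\<close> for
  its last vertex.\<close>

lemma nogood_complete:
  assumes "c1 ~= a" "c1 ~= b" "c2 ~= c1" "c2 ~= b" "~ (u = a & w = b)"
  shows "EX y :: nat => nat. y 0 \<in> {a, c1} & y 1 \<in> {c1, c2} & y 2 \<in> {c2, b} & u ~= y 0 & y 0 ~= y 1 & y 1 ~= y 2 & y 2 ~= w"
proof -
  have ex: ?thesis if "p \<in> {a, c1}" "r \<in> {c1, c2}" "s \<in> {c2, b}" "u ~= p" "p ~= r" "r ~= s" "s ~= w" for p r s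
   using that by (intro exI[of _ "%i. if i = 0 then p else if i = 1 then r else s"]) simp
  show ?thesis
  proof (cases "u = a")
   case True
   then show ?thesis using assms by (intro ex[of c1 c2 b]) auto
  next
   case False
   show ?thesis
   proof (cases "w = c2")
    case True
    then show ?thesis
    proof (cases "a = c2")
     case True
     then show ?thesis using assms False \<open>w = c2\<close> by (intro ex[of a c1 b]) auto
    next
     case False
     then show ?thesis using assms \<open>u ~= a\<close> \<open>w = c2\<close> by (intro ex[of a c1 b]) auto
    qed
   next
    case False
    then show ?thesis using assms \<open>u ~= a\<close> by (intro ex[of a c1 c2]) auto
   qed
  qed
qed

lemma third_color: "EX c. c \<in> {1, 2, 3 :: nat} & c ~= a & c ~= b"
proof -
  have "{1, 2, 3} - {a, b} ~= {}"
  proof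
   assume "{1, 2, 3} - {a, b} = {}"
   then have "{1, 2, 3 :: nat} <= {a, b}" by blast
   then have "card {1, 2, 3 :: nat} <= card {a, b}" by (intro card_mono) auto
   also have "... <= 2" by (simp add: card_insert_if)
   finally show False by simp
  qed
  then show ?thesis by blast
qed

locale many_colors =
  fixes q :: nat and X :: "'x set" and Tri :: "'x tri set" and f t :: "'x => nat"
  assumes q: "q >= 3" and fin: "finite X" "finite Tri"
   and vars: "!!tr j. tr \<in> Tri ==> fst (tlit tr j) \<in> X"
   and ft: "!!x. x \<in> X ==> f x \<in> {1..q} & t x \<in> {1..q} & f x ~= t x"
begin

text \<open>The color of the variable under which literal \<open>j\<close> is false.\<close>

definition bad :: "'x tri => nat => nat" where
  "bad tr j = (let a = tlit tr j in if snd a then f (fst a) else t (fst a))"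

text \<open>The inner colors of the path, chosen to meet the premises of
  \<open>nogood_complete\<close>. Each of \<open>c1\<close> and \<open>c2\<close> has to avoid two
  colors, so three colors suffice.\<close>

definition c1 :: "'x tri => nat => nat" where
  "c1 tr j = (SOME c. c \<in> {1, 2, 3} & c ~= j + 1 & c ~= bad tr j)"

definition c2 :: "'x tri => nat => nat" where
  "c2 tr j = (SOME c. c \<in> {1, 2, 3} & c ~= c1 tr j & c ~= bad tr j)"

lemma c1: "c1 tr j \<in> {1, 2, 3}" "c1 tr j ~= j + 1" "c1 tr j ~= bad tr j"
  using someI_ex[OF third_color[of "j + 1" "bad tr j"]] unfolding c1_def by (simp_all only: simp_thms)

lemma c2: "c2 tr j \<in> {1, 2, 3}" "c2 tr j ~= c1 tr j" "c2 tr j ~= bad tr j"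
  using someI_ex[OF third_color[of "c1 tr j" "bad tr j"]] unfolding c2_def by (simp_all only: simp_thms)

text \<open>\<open>Aux tr 3 0\<close> selects the literal that has to be true: its color
  \<open>j + 1\<close> points to literal \<open>j\<close>, and the path numbered \<open>j\<close>
  forbids this color together with the falsifying color of the variable.\<close>

fun allowed :: "'x gv => nat set" where
  "allowed (Pal i) = {i}"
| "allowed (Lit x b) = {f x, t x}"
| "allowed (Aux tr j i) = (if j = 3 then {1, 2, 3} else if i = 0 then {j + 1, c1 tr j}
    else if i = 1 then {c1 tr j, c2 tr j} else {c2 tr j, bad tr j})"

definition inner :: "'x gv set" where
  "inner = (%x. Lit x True) ` X \<union> (%tr. Aux tr 3 0) ` Tri \<union> (%(tr, j, i). Aux tr j i) ` (Tri \<times> {..<3} \<times> {..<3})"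

definition links :: "('x gv \<times> 'x gv) set" where
  "links = (\<Union>tr \<in> Tri. \<Union>j \<in> {..<3}. {(Aux tr 3 0, Aux tr j 0), (Aux tr j 0, Aux tr j 1), (Aux tr j 1, Aux tr j 2),
    (Aux tr j 2, Lit (fst (tlit tr j)) True)})"

definition E :: "'x gv set set" where
  "E = {{Pal a, Pal b} | a b. a \<in> {1..q} & b \<in> {1..q} & a ~= b} \<union>
    {{v, Pal c} | v c. v \<in> inner & c \<in> {1..q} & c \<notin> allowed v} \<union> (%(u, v). {u, v}) ` links"

definition V :: "'x gv set" where
  "V = Pal ` {1..q} \<union> inner"

lemma bad_in: "tr \<in> Tri ==> bad tr j \<in> {1..q}"
  using vars[of tr j] ft by (auto simp: bad_def Let_def)

lemma innerE:
  assumes "v \<in> inner"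
  obtains x where "v = Lit x True" "x \<in> X" | tr where "v = Aux tr 3 0" "tr \<in> Tri"
   | tr j i where "v = Aux tr j i" "tr \<in> Tri" "j < 3" "i < 3"
  using assms unfolding inner_def by auto

lemma innerI: "x \<in> X ==> Lit x True \<in> inner" "tr \<in> Tri ==> Aux tr 3 0 \<in> inner"
  "tr \<in> Tri ==> j < 3 ==> i < 3 ==> Aux tr j i \<in> inner"
  unfolding inner_def by force+

lemma allowed_in: assumes "v \<in> inner" shows "allowed v <= {1..q}"
  using assms
proof (cases rule: innerE)
  case (3 tr j i)
  then have "bad tr j \<in> {1..q}" "c1 tr j \<in> {1..q}" "c2 tr j \<in> {1..q}" "j + 1 \<in> {1..q}"
   using bad_in[of tr j] c1(1)[of tr j] c2(1)[of tr j] q by auto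
  then show ?thesis unfolding 3(1) allowed.simps using q by simp
qed (use q ft in auto)

lemma linksI: assumes "tr \<in> Tri" "j < 3"
  shows "(Aux tr 3 0, Aux tr j 0) \<in> links" "(Aux tr j 0, Aux tr j 1) \<in> links" "(Aux tr j 1, Aux tr j 2) \<in> links"
   "(Aux tr j 2, Lit (fst (tlit tr j)) True) \<in> links"
  unfolding links_def using assms by (intro UN_I[of tr] UN_I[of j]; simp)+

lemma linksE:
  assumes "(u, v) \<in> links"
  obtains tr j where "tr \<in> Tri" "j < 3" "(u, v) \<in> {(Aux tr 3 0, Aux tr j 0), (Aux tr j 0, Aux tr j 1), (Aux tr j 1, Aux tr j 2),
    (Aux tr j 2, Lit (fst (tlit tr j)) True)}"
  using assms unfolding links_def by blast

lemma links_inner: assumes "(u, v) \<in> links" shows "u \<in> inner & v \<in> inner & u ~= v"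
  using assms
proof (cases rule: linksE)
  case (1 tr j)
  then show ?thesis using vars[of tr j] by (auto intro: innerI)
qed

lemma Pal_inner: "Pal i \<notin> inner"
  by (auto simp: inner_def)

lemma proper_iff: "proper_coloring q (graph V E {}) c \<longleftrightarrow> (ALL v:V. c v \<in> {1..q}) &
   (ALL a:{1..q}. ALL b:{1..q}. a ~= b --> c (Pal a) ~= c (Pal b)) &
   (ALL v:inner. ALL a:{1..q}. a \<notin> allowed v --> c v ~= c (Pal a)) & (ALL (u, v):links. c u ~= c v)"
proof -
  have "(ALL u v. {u, v} \<in> E --> c u ~= c v) \<longleftrightarrow> (ALL a:{1..q}. ALL b:{1..q}. a ~= b --> c (Pal a) ~= c (Pal b)) &
   (ALL v:inner. ALL a:{1..q}. a \<notin> allowed v --> c v ~= c (Pal a)) & (ALL (u, v):links. c u ~= c v)" (is "?l \<longleftrightarrow> ?r")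
  proof
   assume l: ?l
   have "c (Pal a) ~= c (Pal b)" if "a \<in> {1..q}" "b \<in> {1..q}" "a ~= b" for a b
   proof -
    have "{Pal a, Pal b} \<in> E" unfolding E_def using that by blast
    then show ?thesis using l by blast
   qed
   moreover have "c v ~= c (Pal a)" if "v \<in> inner" "a \<in> {1..q}" "a \<notin> allowed v" for v a
   proof -
    have "{v, Pal a} \<in> E" unfolding E_def using that by blast
    then show ?thesis using l by blast
   qed
   moreover have "c u ~= c v" if "(u, v) \<in> links" for u v
   proof -
    have "{u, v} \<in> E" unfolding E_def using that by force
    then show ?thesis using l by blast
   qed
   ultimately show ?r by blast
  next
   assume r: ?r
   show ?l
   proof (intro allI impI)
    fix u v assume "{u, v} \<in> E"
    then consider a b where "{u, v} = {Pal a, Pal b}" "a \<in> {1..q}" "b \<in> {1..q}" "a ~= b"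
     | x a where "{u, v} = {x, Pal a}" "x \<in> inner" "a \<in> {1..q}" "a \<notin> allowed x"
     | x y where "{u, v} = {x, y}" "(x, y) \<in> links"
     unfolding E_def by auto
    then show "c u ~= c v"
    proof cases
     case 2
     then have "c x ~= c (Pal a)" using r by blast
     then show ?thesis using 2(1) by (auto simp: doubleton_eq_iff)
    qed (use r in \<open>auto simp: doubleton_eq_iff\<close>)
   qed
  qed
  then show ?thesis unfolding proper_coloring_def by (auto simp: Pi_iff)
qed

lemma gadget_many: "gadget d l q X Tri f t V E {}"
  unfolding gadget_def
proof (intro conjI allI impI)
  show finV: "finite V" using fin by (auto simp: V_def inner_def)
  show "ALL e:E. e <= V & card e = 2"
  proof
   fix e assume "e \<in> E"
   then consider a b where "e = {Pal a, Pal b}" "a \<in> {1..q}" "b \<in> {1..q}" "a ~= b"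
    | v c where "e = {v, Pal c}" "v \<in> inner" "c \<in> {1..q}" | u v where "e = {u, v}" "(u, v) \<in> links"
    unfolding E_def by auto
   then show "e <= V & card e = 2"
    by cases (use Pal_inner links_inner in \<open>auto simp: V_def card_insert_if\<close>)
  qed
  show "Pal ` {1..q} <= V" "(%x. Lit x True) ` X <= V" by (auto simp: V_def inner_def)
  have "card inner <= card X + card Tri + card (Tri \<times> {..<3 :: nat} \<times> {..<3 :: nat})"
   unfolding inner_def using fin
   by (intro order_trans[OF card_Un_le add_mono] card_image_le order_refl) auto
  then have "card inner <= card X + 10 * card Tri" by (simp add: card_cartesian_product)
  moreover have "card V <= q + card inner"
  proof -
   have "card ((Pal :: nat => 'x gv) ` {1..q}) <= q" using card_image_le[of "{1..q}" "Pal :: nat => 'x gv"] by simp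
   then show ?thesis unfolding V_def using card_Un_le[of "Pal ` {1..q}" inner] by linarith
  qed
  ultimately show "card V <= q + 2 * card X + 10 * card Tri" by simp
  show "ALL e:E. ~ e <= range (%x. Lit x True)"
  proof
   fix e assume "e \<in> E"
   then consider a where "Pal a \<in> e" | u v where "e = {u, v}" "(u, v) \<in> links"
    unfolding E_def by auto
   then show "~ e <= range (%x. Lit x True)"
   proof cases
    case 2
    from 2(2) show ?thesis
    proof (cases rule: linksE)
     case (1 tr j)
     then have "Aux tr 3 0 \<in> e \<or> Aux tr j 0 \<in> e \<or> Aux tr j 1 \<in> e \<or> Aux tr j 2 \<in> e" using 2(1) by auto
     then show ?thesis by auto
    qed
   qed blast
  qed
next
  fix c assume "proper_coloring q (graph V E {}) c & (ALL Fs:{}. ~ uniformly_rainbow d c Fs)"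
  then have cV: "!!v. v \<in> V ==> c v \<in> {1..q}"
   and pal: "!!a b. a \<in> {1..q} ==> b \<in> {1..q} ==> a ~= b ==> c (Pal a) ~= c (Pal b)"
   and al: "!!v a. v \<in> inner ==> a \<in> {1..q} ==> a \<notin> allowed v ==> c v ~= c (Pal a)"
   and lk: "!!u v. (u, v) \<in> links ==> c u ~= c v"
   unfolding proper_iff by auto
  define \<pi> where "\<pi> i = c (Pal i)" for i
  have inj: "inj_on \<pi> {1..q}" using pal unfolding inj_on_def \<pi>_def by blast
  \<comment> \<open>An injective palette uses all \<open>q\<close> colors, so each vertex shares its
    color with a palette vertex, and the edges to the palette confine it to its allowed
    list.\<close>
  have "\<pi> ` {1..q} <= {1..q}" using cV by (auto simp: \<pi>_def V_def)
  then have surj: "\<pi> ` {1..q} = {1..q}" using inj by (intro endo_inj_surj) auto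
  have ex: "EX a:allowed v. c v = \<pi> a" if "v \<in> inner" for v
  proof -
   have "c v \<in> \<pi> ` {1..q}" using cV[of v] that surj by (auto simp: V_def)
   then obtain a where a: "a \<in> {1..q}" "c v = \<pi> a" by auto
   then show ?thesis using al[OF that a(1)] by (auto simp: \<pi>_def)
  qed
  define n where "n v = (SOME a. a \<in> allowed v & c v = \<pi> a)" for v
  have n: "n v \<in> allowed v" "c v = \<pi> (n v)" if "v \<in> inner" for v
   using someI_ex[of "%a. a \<in> allowed v & c v = \<pi> a"] ex[OF that] unfolding n_def by auto
  have nl: "n u ~= n v" if "(u, v) \<in> links" for u v
   using lk[OF that] n links_inner[OF that] by metis
  define av where "av x \<longleftrightarrow> n (Lit x True) = t x" for x
  have lit: "n (Lit x True) = (if av x then t x else f x)" if "x \<in> X" for x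
   using n(1)[of "Lit x True"] that by (auto simp: av_def inner_def)
  have "tsat av tr" if tr: "tr \<in> Tri" for tr
  proof -
   have "Aux tr 3 0 \<in> inner" using tr by (auto simp: inner_def)
   from n(1)[OF this] obtain j where j: "j < 3" "n (Aux tr 3 0) = j + 1"
    by (auto simp: numeral_3_eq_3)
   have ai: "Aux tr j i \<in> inner" if "i < 3" for i
    using innerI(3)[OF tr j(1) that] .
   note lks = linksI[OF tr j(1)]
   have "~ (n (Aux tr 3 0) = j + 1 & n (Lit (fst (tlit tr j)) True) = bad tr j)"
    using n(1)[OF ai[of 0]] n(1)[OF ai[of 1]] n(1)[OF ai[of 2]] nl[OF lks(1)] nl[OF lks(2)] nl[OF lks(3)] nl[OF lks(4)] j(1)
    by (intro nogood_sound[of "n (Aux tr j 0)" _ "c1 tr j" "n (Aux tr j 1)" "c2 tr j" "n (Aux tr j 2)"]) auto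
   then have "n (Lit (fst (tlit tr j)) True) ~= bad tr j" using j by simp
   then have "ltrue av (tlit tr j)"
    using lit[OF vars[OF tr]] by (auto simp: bad_def Let_def ltrue_def split: if_splits)
   then show ?thesis using j tsat_def by blast
  qed
  moreover have "c (Lit x True) = \<pi> (if av x then t x else f x)" if "x \<in> X" for x
   using n(2)[of "Lit x True"] lit[OF that] that by (auto simp: inner_def)
  ultimately show "EX av \<pi>. (ALL tr:Tri. tsat av tr) & inj_on \<pi> {1..q} & (ALL i:{1..q}. c (Pal i) = \<pi> i) &
       (ALL x:X. c (Lit x True) = \<pi> (if av x then t x else f x))"
   by (intro exI[of _ av] exI[of _ \<pi>]) (use inj in \<open>simp add: \<pi>_def\<close>)
next
  fix av assume av: "ALL tr:Tri. tsat av tr"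
  define v where "v x = (if av x then t x else f x)" for x
  define Y where "Y tr = (SOME j. j < 3 & ltrue av (tlit tr j))" for tr
  have Y: "Y tr < 3" "ltrue av (tlit tr (Y tr))" if "tr \<in> Tri" for tr
   using someI_ex[of "%j. j < 3 & ltrue av (tlit tr j)"] av that unfolding Y_def tsat_def by blast+
  have "EX y :: nat => nat. y 0 \<in> {j + 1, c1 tr j} & y 1 \<in> {c1 tr j, c2 tr j} & y 2 \<in> {c2 tr j, bad tr j} &
    Y tr + 1 ~= y 0 & y 0 ~= y 1 & y 1 ~= y 2 & y 2 ~= v (fst (tlit tr j))" if tr: "tr \<in> Tri" for tr j
  proof (rule nogood_complete[OF c1(2,3) c2(2,3)])
   have "v (fst (tlit tr j)) ~= bad tr j" if "Y tr = j"
    using Y(2)[OF tr] that ft[OF vars[OF tr, of j]] by (auto simp: v_def bad_def Let_def ltrue_def)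
   then show "~ (Y tr + 1 = j + 1 & v (fst (tlit tr j)) = bad tr j)" by auto
  qed
  then obtain y :: "'x tri => nat => nat => nat" where y: "!!tr j. tr \<in> Tri ==> y tr j 0 \<in> {j + 1, c1 tr j} &
    y tr j 1 \<in> {c1 tr j, c2 tr j} & y tr j 2 \<in> {c2 tr j, bad tr j} &
    Y tr + 1 ~= y tr j 0 & y tr j 0 ~= y tr j 1 & y tr j 1 ~= y tr j 2 & y tr j 2 ~= v (fst (tlit tr j))"
   by metis
  define c where "c u = (case u of Pal i => i | Lit x b => v x | Aux tr j i => if j = 3 then Y tr + 1 else y tr j i)" for u
  have call: "c u \<in> allowed u" if u: "u \<in> inner" for u
  proof -
   from u consider x where "u = Lit x True" "x \<in> X" | tr where "u = Aux tr 3 0" "tr \<in> Tri"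
    | tr j i where "u = Aux tr j i" "tr \<in> Tri" "j < 3" "i < 3"
    unfolding inner_def by auto
   then show ?thesis
   proof cases
    case 1
    then show ?thesis by (simp add: c_def v_def)
   next
    case 2
    then show ?thesis using Y(1)[OF 2(2)] by (auto simp: c_def)
   next
    case 3
    then have "i = 0 \<or> i = 1 \<or> i = 2" by auto
    then show ?thesis using y[OF 3(2), of j] 3 by (auto simp: c_def)
   qed
  qed
  have "proper_coloring q (graph V E {}) c"
   unfolding proper_iff
  proof (intro conjI ballI impI)
   show "c u \<in> {1..q}" if "u \<in> V" for u
   proof (cases "u \<in> inner")
    case True
    then show ?thesis using call[OF True] allowed_in[OF True] by blast
   next
    case False
    then show ?thesis using that by (auto simp: V_def c_def)
   qed
   show "c (Pal a) ~= c (Pal b)" if "a ~= b" for a b using that by (simp add: c_def)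
   show "c u ~= c (Pal a)" if "u \<in> inner" "a \<notin> allowed u" for u a
    using call[OF that(1)] that(2) by (auto simp: c_def)
   show "case p of (u, w) => c u ~= c w" if p: "p \<in> links" for p
   proof -
    from p obtain tr j where "tr \<in> Tri" "j < 3" "p \<in> {(Aux tr 3 0, Aux tr j 0), (Aux tr j 0, Aux tr j 1), (Aux tr j 1, Aux tr j 2),
     (Aux tr j 2, Lit (fst (tlit tr j)) True)}" unfolding links_def by blast
    then show ?thesis using y[of tr j] by (auto simp: c_def)
   qed
  qed
  then show "EX c. proper_coloring q (graph V E {}) c & (ALL Fs:{}. ~ uniformly_rainbow d c Fs) &
     (ALL i:{1..q}. c (Pal i) = i) & (ALL x:X. c (Lit x True) = (if av x then t x else f x))"
   by (intro exI[of _ c]) (auto simp: c_def v_def)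
qed auto

end

subsection \<open>Two colors\<close>

text \<open>
  With two colors a 3-clause is expressed by tuples over its literals and three fresh vertices, the
  last two of which have different colors.
\<close>

definition V2 :: "'x set => 'x tri set => 'x gv set" where
  "V2 X Tri = Pal ` {1, 2} \<union> (%(x, b). Lit x b) ` (X \<times> UNIV) \<union> (%(tr, i). Aux tr 0 i) ` (Tri \<times> {..<3})"

definition E2 :: "'x set => 'x tri set => 'x gv set set" where
  "E2 X Tri = {{Pal 1, Pal 2}} \<union> (%x. {Lit x True, Lit x False}) ` X \<union> (%tr. {Aux tr 0 1, Aux tr 0 2}) ` Tri"

definition lv :: "'x tri => nat => 'x gv" where
  "lv tr j = (let a = tlit tr j in Lit (fst a) (snd a))"

text \<open>\<open>B\<close> is the condition that the tuples of a clause impose on its three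
  literals and two free bits. It has to be satisfiable in the free bits exactly if the clause is
  true; nothing else about the tuples matters.\<close>

lemma gadget_two:
  assumes fin: "finite X" "finite Tri" and vars: "!!tr j. tr \<in> Tri ==> fst (tlit tr j) \<in> X"
   and shape: "!!tr Fs. tr \<in> Tri ==> Fs \<in> tu tr ==> length Fs = l & (ALL F:set Fs. card F = d &
     F <= {Pal 1, Pal 2, lv tr 0, lv tr 1, lv tr 2, Aux tr 0 0, Aux tr 0 1, Aux tr 0 2}) &
     (EX F:set Fs. EX i. Aux tr 0 i \<in> F)"
   and sem: "!!tr val p1 p2. p1 ~= p2 ==> ~ val (Pal 1) ==> val (Pal 2) ==> val (Aux tr 0 2) = (~ val (Aux tr 0 1)) ==>
     (ALL Fs:tu tr. ~ uniformly_rainbow d (%v. if val v then p2 else p1) Fs) \<longleftrightarrow>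
     B (val (lv tr 0)) (val (lv tr 1)) (val (lv tr 2)) (val (Aux tr 0 0)) (val (Aux tr 0 1))"
   and B: "!!a0 a1 a2. (EX x y. B a0 a1 a2 x y) \<longleftrightarrow> a0 \<or> a1 \<or> a2"
  shows "gadget d l 2 X Tri (%_. 1) (%_. 2) (V2 X Tri) (E2 X Tri) (\<Union>tr \<in> Tri. tu tr)"
  unfolding gadget_def
proof (intro conjI allI impI)
  let ?V = "V2 X Tri" and ?E = "E2 X Tri" and ?T = "\<Union>tr \<in> Tri. tu tr"
  have lvV: "lv tr j \<in> ?V" if "tr \<in> Tri" for tr j
   using vars[OF that, of j] by (force simp: V2_def lv_def Let_def)
  have auxV: "Aux tr 0 i \<in> ?V" if "tr \<in> Tri" "i < 3" for tr i using that by (auto simp: V2_def)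
  show "finite ?V" using fin by (auto simp: V2_def)
  show "ALL e:?E. e <= ?V & card e = 2" using auxV by (auto simp: E2_def V2_def)
  show "ALL Fs:?T. length Fs = l & (ALL F:set Fs. F <= ?V & card F = d)"
  proof (intro ballI conjI)
   fix Fs assume "Fs \<in> ?T"
   then obtain tr where tr: "tr \<in> Tri" "Fs \<in> tu tr" by blast
   show "length Fs = l" using shape[OF tr] by blast
   fix F assume F: "F \<in> set Fs"
   show "card F = d" using shape[OF tr] F by blast
   have "{Pal 1, Pal 2, lv tr 0, lv tr 1, lv tr 2, Aux tr 0 0, Aux tr 0 1, Aux tr 0 2} <= ?V"
    using lvV[OF tr(1)] auxV[OF tr(1)] by (auto simp: V2_def)
   then show "F <= ?V" using shape[OF tr] F by blast
  qed
  show "Pal ` {1..2} <= ?V" "(%x. Lit x True) ` X <= ?V"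
  proof -
   have "{1..2 :: nat} = {1, 2}" by auto
   then show "Pal ` {1..2} <= ?V" by (auto simp: V2_def)
  qed (auto simp: V2_def)
  have "card ?V <= 2 + card (X \<times> (UNIV :: bool set)) + card (Tri \<times> {..<3 :: nat})"
   unfolding V2_def using fin
   by (intro order_trans[OF card_Un_le add_mono] card_image_le order_trans[OF card_image_le]) auto
  then show "card ?V <= 2 + 2 * card X + 10 * card Tri" by (simp add: card_cartesian_product card_UNIV_bool)
  show "ALL e:?E. ~ e <= range (%x. Lit x True)" by (auto simp: E2_def)
  show "ALL Fs:?T. EX F:set Fs. ~ F <= range Pal \<union> range (%x. Lit x True)"
  proof
   fix Fs assume "Fs \<in> ?T"
   then obtain tr where tr: "tr \<in> Tri" "Fs \<in> tu tr" by blast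
   then obtain F i where "F \<in> set Fs" "Aux tr 0 i \<in> F" using shape[OF tr] by blast
   then show "EX F:set Fs. ~ F <= range Pal \<union> range (%x. Lit x True)" by (intro bexI[of _ F]) auto
  qed
  have proper: "proper_coloring 2 (graph ?V ?E ?T) c \<longleftrightarrow> (ALL v:?V. c v \<in> {1..2}) & c (Pal 1) ~= c (Pal 2) &
    (ALL x:X. c (Lit x True) ~= c (Lit x False)) & (ALL tr:Tri. c (Aux tr 0 1) ~= c (Aux tr 0 2))" for c
  proof -
   have "(ALL u v. {u, v} \<in> ?E --> c u ~= c v) \<longleftrightarrow> c (Pal 1) ~= c (Pal 2) &
    (ALL x:X. c (Lit x True) ~= c (Lit x False)) & (ALL tr:Tri. c (Aux tr 0 1) ~= c (Aux tr 0 2))" (is "?l \<longleftrightarrow> ?r")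
   proof
    assume l: ?l
    show ?r using l unfolding E2_def by blast
   next
    assume r: ?r
    show ?l
    proof (intro allI impI)
     fix u v assume "{u, v} \<in> ?E"
     then consider "{u, v} = {Pal 1, Pal 2}" | x where "x \<in> X" "{u, v} = {Lit x True, Lit x False}"
      | tr where "tr \<in> Tri" "{u, v} = {Aux tr 0 1, Aux tr 0 2}" unfolding E2_def by blast
     then show "c u ~= c v" by cases (use r in \<open>auto simp: doubleton_eq_iff\<close>)
    qed
   qed
   then show ?thesis unfolding proper_coloring_def by (auto simp: Pi_iff)
  qed
  {
   fix c assume c: "proper_coloring 2 (graph ?V ?E ?T) c & (ALL Fs:?T. ~ uniformly_rainbow d c Fs)"
   define val where "val v \<longleftrightarrow> c v = c (Pal 2)" for v
   have c12: "c v = 1 \<or> c v = 2" if "v \<in> ?V" for v using c that unfolding proper by force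
   have P: "Pal 1 \<in> ?V" "Pal 2 \<in> ?V" by (auto simp: V2_def)
   have pp: "c (Pal 1) ~= c (Pal 2)" using c unfolding proper by blast
   have cv: "c v = (if val v then c (Pal 2) else c (Pal 1))" if "v \<in> ?V" for v
    using c12[OF that] c12[OF P(1)] c12[OF P(2)] pp by (auto simp: val_def)
   define av where "av x = val (Lit x True)" for x
   have neg: "val (Lit x b) \<longleftrightarrow> av x = b" if "x \<in> X" for x b
   proof -
    have "c (Lit x True) ~= c (Lit x False)" using c that unfolding proper by blast
    moreover have "Lit x True \<in> ?V" "Lit x False \<in> ?V" using that by (auto simp: V2_def)
    ultimately show ?thesis using c12[of "Lit x True"] c12[of "Lit x False"] c12[OF P(1)] c12[OF P(2)] pp
     by (cases b) (auto simp: av_def val_def)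
   qed
   have "tsat av tr" if tr: "tr \<in> Tri" for tr
   proof -
    have "~ uniformly_rainbow d (%v. if val v then c (Pal 2) else c (Pal 1)) Fs" if Fs: "Fs \<in> tu tr" for Fs
    proof -
     have "F <= ?V" if "F \<in> set Fs" for F
      using \<open>ALL Fs:?T. length Fs = l & (ALL F:set Fs. F <= ?V & card F = d)\<close> tr Fs that by blast
     then have "(%v. if val v then c (Pal 2) else c (Pal 1)) ` F = c ` F" if "F \<in> set Fs" for F
      using that cv by (intro image_cong refl) (metis subsetD)
     moreover have "~ uniformly_rainbow d c Fs" using c tr Fs by blast
     ultimately show ?thesis unfolding uniformly_rainbow_def by auto
    qed
    moreover have "val (Aux tr 0 2) = (~ val (Aux tr 0 1))"
    proof -
     have "c (Aux tr 0 1) ~= c (Aux tr 0 2)" using c tr unfolding proper by blast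
     then show ?thesis using c12[OF auxV[OF tr, of 1]] c12[OF auxV[OF tr, of 2]] c12[OF P(2)] by (auto simp: val_def)
    qed
    ultimately have "B (val (lv tr 0)) (val (lv tr 1)) (val (lv tr 2)) (val (Aux tr 0 0)) (val (Aux tr 0 1))"
     using sem[of "c (Pal 1)" "c (Pal 2)" val tr] pp by (auto simp: val_def)
    then have "val (lv tr 0) \<or> val (lv tr 1) \<or> val (lv tr 2)" using B by blast
    then show ?thesis using neg[OF vars[OF tr]] by (auto simp: tsat_alt ltrue_def lv_def Let_def)
   qed
   moreover have "inj_on (%i. c (Pal i)) {1..2}"
   proof -
    have "{1..2 :: nat} = {1, 2}" by auto
    then show ?thesis using pp by (auto simp: inj_on_def)
   qed
   moreover have "c (Lit x True) = c (Pal (if av x then 2 else 1))" if "x \<in> X" for x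
   proof -
    have "Lit x True \<in> ?V" using that by (auto simp: V2_def)
    from cv[OF this] show ?thesis by (simp add: av_def)
   qed
   ultimately show "EX av \<pi>. (ALL tr:Tri. tsat av tr) & inj_on \<pi> {1..2} & (ALL i:{1..2}. c (Pal i) = \<pi> i) &
       (ALL x:X. c (Lit x True) = \<pi> (if av x then 2 else 1))"
    by (intro exI[of _ av] exI[of _ "%i. c (Pal i)"]) auto
  next
   fix av assume av: "ALL tr:Tri. tsat av tr"
   have "EX x y. B (ltrue av (tlit tr 0)) (ltrue av (tlit tr 1)) (ltrue av (tlit tr 2)) x y" if "tr \<in> Tri" for tr
    using av that B unfolding tsat_alt by blast
   then obtain x y where xy: "!!tr. tr \<in> Tri ==> B (ltrue av (tlit tr 0)) (ltrue av (tlit tr 1)) (ltrue av (tlit tr 2)) (x tr) (y tr)"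
    by metis
   define val where "val v = (case v of Pal i => i = 2 | Lit z b => av z = b |
     Aux tr j i => if i = 0 then x tr else if i = 1 then y tr else ~ y tr)" for v
   define c where "c v = (if val v then 2 else 1 :: nat)" for v
   have "~ uniformly_rainbow d c Fs" if Fs: "Fs \<in> ?T" for Fs
   proof -
    obtain tr where tr: "tr \<in> Tri" "Fs \<in> tu tr" using Fs by blast
    have "val (lv tr j) = ltrue av (tlit tr j)" for j by (simp add: val_def lv_def Let_def ltrue_def)
    then have "B (val (lv tr 0)) (val (lv tr 1)) (val (lv tr 2)) (val (Aux tr 0 0)) (val (Aux tr 0 1))"
     using xy[OF tr(1)] by (simp add: val_def)
    then show ?thesis using sem[of 1 2 val tr] tr(2) unfolding c_def by (auto simp: val_def)
   qed
   moreover have "proper_coloring 2 (graph ?V ?E ?T) c"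
    unfolding proper by (auto simp: c_def val_def)
   ultimately show "EX c. proper_coloring 2 (graph ?V ?E ?T) c & (ALL Fs:?T. ~ uniformly_rainbow d c Fs) &
     (ALL i:{1..2}. c (Pal i) = i) & (ALL x:X. c (Lit x True) = (if av x then 2 else 1))"
    by (intro exI[of _ c]) (auto simp: c_def val_def)
  }
qed

lemma uniformly_rainbow_pair: "set Fs = {A, B} ==> uniformly_rainbow d c Fs \<longleftrightarrow> c ` A = c ` B & card (c ` A) = d"
  unfolding uniformly_rainbow_def by auto

lemma uniformly_rainbow_triple:
  "set Fs = {A, B, C} ==> uniformly_rainbow d c Fs \<longleftrightarrow> c ` A = c ` B & c ` B = c ` C & card (c ` A) = d"
  unfolding uniformly_rainbow_def by (simp only: ball_simps) metis

lemma gadget_nae: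
  assumes "finite X" "finite Tri" "!!tr j. tr \<in> Tri ==> fst (tlit tr j) \<in> X" "l >= 3"
  shows "EX V E Tu. gadget 1 l 2 X Tri (%_. 1) (%_. 2) V E Tu"
proof -
  \<comment> \<open>For \<open>d = 1\<close> a tuple forbids that its vertices are all equal. The
    clause is split into not-all-equal constraints on the first two literals and \<open>y\<close>,
    and on the negation of \<open>y\<close>, the third literal and the false palette vertex, padded
    by repetition to length \<open>l\<close>.\<close>
  define tu where "tu tr = {[{lv tr 0}, {lv tr 1}] @ replicate (l - 2) {Aux tr 0 1}, [{Aux tr 0 2}, {lv tr 2}] @ replicate (l - 2) {Pal 1}}"
   for tr :: "'a tri"
  have l2: "l - 2 ~= 0" using assms(4) by simp
  have "gadget 1 l 2 X Tri (%_. 1) (%_. 2) (V2 X Tri) (E2 X Tri) (\<Union>tr \<in> Tri. tu tr)"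
  proof (rule gadget_two[OF assms(1-3), where B = "%a0 a1 a2 x y. ~ (a0 = a1 & a1 = y) & ~ ((~ y) = a2 & ~ a2)"])
   show "length Fs = l & (ALL F:set Fs. card F = 1 &
     F <= {Pal 1, Pal 2, lv tr 0, lv tr 1, lv tr 2, Aux tr 0 0, Aux tr 0 1, Aux tr 0 2}) &
     (EX F:set Fs. EX i. Aux tr 0 i \<in> F)" if "Fs \<in> tu tr" for tr Fs
    using that assms(4) l2 by (auto simp: tu_def)
   show "(ALL Fs:tu tr. ~ uniformly_rainbow 1 (%v. if val v then p2 else p1) Fs) \<longleftrightarrow>
     ~ (val (lv tr 0) = val (lv tr 1) & val (lv tr 1) = val (Aux tr 0 1)) &
     ~ ((~ val (Aux tr 0 1)) = val (lv tr 2) & ~ val (lv tr 2))"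
    if "p1 ~= p2" "~ val (Pal 1)" "val (Pal 2)" "val (Aux tr 0 2) = (~ val (Aux tr 0 1))" for tr val and p1 p2 :: nat
   proof -
    let ?c = "%v. if val v then p2 else p1"
    have im: "?c ` {a} = {?c a}" for a by auto
    have ur: "uniformly_rainbow 1 ?c ([{a}, {b}] @ replicate (l - 2) {e}) \<longleftrightarrow> val a = val b & val b = val e" for a b e
    proof -
     have "set ([{a}, {b}] @ replicate (l - 2) {e}) = {{a}, {b}, {e}}"
      using l2 by (simp only: set_append list.set set_replicate_conv_if if_False) blast
     from uniformly_rainbow_triple[OF this, of 1 ?c] show ?thesis
      using that(1) by (simp only: im) (simp split: if_splits)
    qed
    show ?thesis using that(2-) unfolding tu_def by (simp only: ball_simps ur) auto
   qed
   show "(EX x y. ~ (a0 = a1 & a1 = y) & ~ ((~ y) = a2 & ~ a2)) \<longleftrightarrow> a0 \<or> a1 \<or> a2" for a0 a1 a2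
    by auto
  qed
  then show ?thesis by blast
qed

lemma card_image_if: "a ~= b ==> p1 ~= p2 ==> (%v. if val v then p2 else p1) ` {a, b} = (if val a = val b then {if val a then p2 else p1} else {p1, p2})"
  by auto

lemma two_colors_iff:
  "p1 ~= p2 ==> ((if P then {x} else {p1, p2}) = (if Q then {y} else {p1, p2}) & card (if P then {x} else {p1, p2}) = 2)
   \<longleftrightarrow> ~ P & ~ Q"
  by (cases P; cases Q) (auto simp: card_insert_if)

lemma gadget_eq:
  assumes "finite X" "finite Tri" "!!tr j. tr \<in> Tri ==> fst (tlit tr j) \<in> X" "l >= 2"
  shows "EX V E Tu. gadget 2 l 2 X Tri (%_. 1) (%_. 2) V E Tu"
proof -
  \<comment> \<open>For \<open>d = 2\<close> and two colors a tuple demands that one of its pairs is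
    monochromatic. With the true palette vertex this expresses disjunctions: the first literal or
    \<open>x\<close>, the second or not \<open>y\<close>, the third or \<open>x = y\<close>.\<close>
  define tu where "tu tr = {{lv tr 0, Pal 2} # replicate (l - 1) {Aux tr 0 0, Pal 2}, {lv tr 1, Pal 2} # replicate (l - 1) {Aux tr 0 2, Pal 2},
    {Aux tr 0 0, Aux tr 0 1} # replicate (l - 1) {lv tr 2, Pal 2}}"
   for tr :: "'a tri"
  have l1: "l - 1 ~= 0" using assms(4) by simp
  have lvP: "lv tr j ~= Pal i" for tr j i by (simp add: lv_def Let_def)
  have "gadget 2 l 2 X Tri (%_. 1) (%_. 2) (V2 X Tri) (E2 X Tri) (\<Union>tr \<in> Tri. tu tr)"
  proof (rule gadget_two[OF assms(1-3), where B = "%a0 a1 a2 x y. (a0 \<or> x) & (a1 \<or> ~ y) & (x = y \<or> a2)"])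
   show "length Fs = l & (ALL F:set Fs. card F = 2 &
     F <= {Pal 1, Pal 2, lv tr 0, lv tr 1, lv tr 2, Aux tr 0 0, Aux tr 0 1, Aux tr 0 2}) &
     (EX F:set Fs. EX i. Aux tr 0 i \<in> F)" if "Fs \<in> tu tr" for tr Fs
    using that assms(4) l1 lvP[of tr 0 2] lvP[of tr 1 2] lvP[of tr 2 2] by (auto simp: tu_def card_insert_if)
   show "(ALL Fs:tu tr. ~ uniformly_rainbow 2 (%v. if val v then p2 else p1) Fs) \<longleftrightarrow>
     (val (lv tr 0) \<or> val (Aux tr 0 0)) & (val (lv tr 1) \<or> ~ val (Aux tr 0 1)) &
     (val (Aux tr 0 0) = val (Aux tr 0 1) \<or> val (lv tr 2))"
    if p: "p1 ~= p2" and v: "~ val (Pal 1)" "val (Pal 2)" "val (Aux tr 0 2) = (~ val (Aux tr 0 1))" for tr val and p1 p2 :: nat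
   proof -
    let ?c = "%v. if val v then p2 else p1"
    have ur: "uniformly_rainbow 2 ?c ({a, b} # replicate (l - 1) {a', b'}) \<longleftrightarrow> val a ~= val b & val a' ~= val b'"
     if "a ~= b" "a' ~= b'" for a b a' b'
    proof -
     have "set ({a, b} # replicate (l - 1) {a', b'}) = {{a, b}, {a', b'}}"
      using l1 by (simp only: list.set set_replicate_conv_if if_False)
     then show ?thesis
      by (simp only: uniformly_rainbow_pair card_image_if[OF that(1) p] card_image_if[OF that(2) p] two_colors_iff[OF p])
    qed
    have n: "Aux tr 0 0 ~= Pal 2" "Aux tr 0 2 ~= Pal 2" "Aux tr 0 0 ~= Aux tr 0 1" by simp_all
    note ur' = ur[OF lvP[of tr 0 2] n(1)] ur[OF lvP[of tr 1 2] n(2)] ur[OF n(3) lvP[of tr 2 2]]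
    show ?thesis unfolding tu_def using v by (simp only: ball_simps ur') auto
   qed
   show "(EX x y. (a0 \<or> x) & (a1 \<or> ~ y) & (x = y \<or> a2)) \<longleftrightarrow> a0 \<or> a1 \<or> a2" for a0 a1 a2
    by auto
  qed
  then show ?thesis by blast
qed

lemma gadget_exists:
  assumes "finite X" "finite Tri" "!!tr j. tr \<in> Tri ==> fst (tlit tr j) \<in> X"
   and "!!x. x \<in> X ==> f x \<in> {1..q} & t x \<in> {1..q} & f x ~= t x"
   and "q >= 3 \<or> (q = 2 & f = (%_. 1) & t = (%_. 2) & (d = 1 & l >= 3 \<or> d = 2 & l >= 2))"
  shows "EX V E Tu. gadget d l q X Tri f t V E Tu"
  using assms(5)
proof (elim disjE conjE)
  assume "q >= 3"
  then interpret many_colors q X Tri f t using assms by unfold_locales auto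
  show ?thesis by (intro exI) (rule gadget_many)
next
  assume *: "q = 2" "f = (%_. 1)" "t = (%_. 2)" "d = 1" "l >= 3"
  show ?thesis using gadget_nae[OF assms(1-3) *(5)] unfolding *(1-4) by simp
next
  assume *: "q = 2" "f = (%_. 1)" "t = (%_. 2)" "d = 2" "l >= 2"
  show ?thesis using gadget_eq[OF assms(1-3) *(5)] unfolding *(1-4) by simp
qed

section \<open>Composition on the level of clauses\<close>

datatype 'v ext = Orig 'v | Chain "'v clause" nat

text \<open>\<open>Chain C i\<close> asserts that one of the first \<open>i\<close> literals of \<open>C\<close> is true.\<close>

definition tri_clauses :: "'v clause => 'v ext tri set" where
  "tri_clauses C = {((Chain C 0, False), (Chain C 0, False), (Chain C 0, False)),
     ((Chain C (length C), True), (Chain C (length C), True), (Chain C (length C), True))} \<union>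
    (%i. ((Chain C (Suc i), False), (Chain C i, True), (Orig (fst (C ! i)), snd (C ! i)))) ` {..<length C}"

definition tri_set :: "'v clause set => 'v ext tri set" where
  "tri_set \<Phi> = (\<Union>C \<in> \<Phi>. tri_clauses C)"

lemma tsat_triple: "tsat av ((x, a), (y, b), (z, c)) \<longleftrightarrow> av x = a \<or> av y = b \<or> av z = c"
  by (simp add: tsat_alt tlit_def ltrue_def)

lemma finite_tri_clauses: "finite (tri_clauses C)"
  by (simp add: tri_clauses_def)

lemma card_tri_clauses: "card (tri_clauses C) <= length C + 2"
proof -
  have "card (tri_clauses C) <= 2 + card {..<length C}"
   unfolding tri_clauses_def
   by (intro order_trans[OF card_Un_le add_mono] card_image_le) (auto simp: card_insert_if)
  then show ?thesis by simp
qed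

lemma finite_tri_set: "finite \<Phi> ==> finite (tri_set \<Phi>)"
  by (simp add: tri_set_def finite_tri_clauses)

lemma card_tri_set:
  assumes "finite \<Phi>" "!!C. C \<in> \<Phi> ==> length C <= m"
  shows "card (tri_set \<Phi>) <= card \<Phi> * (m + 2)"
proof -
  have "card (tri_set \<Phi>) <= (\<Sum>C \<in> \<Phi>. card (tri_clauses C))"
   unfolding tri_set_def using assms(1) by (rule card_UN_le)
  also have "... <= (\<Sum>C \<in> \<Phi>. m + 2)"
   using assms(2) by (intro sum_mono order_trans[OF card_tri_clauses]) simp
  finally show ?thesis by simp
qed

lemma tri_sound:
  assumes "ALL tr:tri_clauses C. tsat bv tr"
  shows "csat (%v. bv (Orig v)) C"
proof (rule ccontr)
  assume n: "~ csat (%v. bv (Orig v)) C"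
  have lits: "bv (Orig (fst (C ! i))) ~= snd (C ! i)" if "i < length C" for i
   using n nth_mem[OF that] unfolding csat_def by (auto simp: case_prod_beta)
  have chain: "~ bv (Chain C i)" if "i <= length C" for i
   using that
  proof (induction i)
   case 0
   have "tsat bv ((Chain C 0, False), (Chain C 0, False), (Chain C 0, False))"
    using assms unfolding tri_clauses_def by simp
   then show ?case by (simp add: tsat_triple)
  next
   case (Suc i)
   then have "tsat bv ((Chain C (Suc i), False), (Chain C i, True), (Orig (fst (C ! i)), snd (C ! i)))"
    using assms unfolding tri_clauses_def by simp
   then show ?case using Suc lits[of i] by (simp add: tsat_triple)
  qed
  have "tsat bv ((Chain C (length C), True), (Chain C (length C), True), (Chain C (length C), True))"
   using assms unfolding tri_clauses_def by simp
  then show False using chain[of "length C"] by (simp add: tsat_triple)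
qed

lemma tri_complete:
  assumes "ALL C:\<Phi>. csat av C"
  shows "EX bv. (ALL v. bv (Orig v) = av v) & (ALL tr:tri_set \<Phi>. tsat bv tr)"
proof -
  define bv where "bv x = (case x of Orig v => av v | Chain C i => csat av (take i C))" for x
  have single: "csat av [x] \<longleftrightarrow> av (fst x) = snd x" for x by (cases x) simp
  have "tsat bv tr" if "C \<in> \<Phi>" "tr \<in> tri_clauses C" for C tr
   using that assms unfolding tri_clauses_def
   by (auto simp: tsat_triple bv_def take_Suc_conv_app_nth single)
  then have "ALL tr:tri_set \<Phi>. tsat bv tr" by (auto simp: tri_set_def)
  moreover have "ALL v. bv (Orig v) = av v" by (simp add: bv_def)
  ultimately show ?thesis by blast
qed

lemma csat_map: "csat \<gamma> (map (%(v, b). (h v, b)) C) \<longleftrightarrow> csat (%v. \<gamma> (h v)) C"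
  by (induction C) auto

text \<open>
  The literals \<open>NSel a i\<close> deselect the digit \<open>i\<close> at position \<open>a\<close>, and \<open>Last j\<close> selects the last
  digit. The variable \<open>Ent k b j\<close> allows the \<open>k\<close>-th input bit to be forced to \<open>b\<close> once \<open>j\<close> is
  selected.
\<close>

datatype cvar = Fact fact | NSel nat nat | Last nat | Ent nat bool nat

text \<open>The position that a slot variable serves. It decides which pair of colors the vertex of
  the variable may use; variables that fill no slot are assigned to the last position.\<close>

definition cls :: "nat => cvar ext => nat" where
  "cls \<eta> x = (case x of Orig (NSel a i) => a | _ => \<eta> - 1)"

definition has_block :: "word set => nat => nat => word => bool" where
  "has_block L s N Y \<longleftrightarrow> (EX m < N. take s (drop (m * s) Y) \<in> L)"

text \<open>The formula is independent of \<open>Y\<close>. Each bit of \<open>Y\<close> contributes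
  only one positive clause over \<open>\<eta>\<close> variables, one for each position, and this is
  the shape that a single constraint can express. Injectivity of the slots keeps these constraints
  distinct.\<close>

definition sat_comp :: "word set => nat => nat => nat => nat => cvar ext set => cvar ext tri set =>
   (nat => bool => nat => cvar ext) => bool" where
  "sat_comp L \<eta> s T B X Tri slot \<longleftrightarrow> finite X & finite Tri & card X <= B & card Tri <= B &
    (ALL tr:Tri. ALL j. fst (tlit tr j) \<in> X) &
    (ALL p < T ^ \<eta> * s. ALL b. ALL a < \<eta>. slot p b a \<in> X & cls \<eta> (slot p b a) = a) &
    (ALL p < T ^ \<eta> * s. ALL p' < T ^ \<eta> * s. ALL b b'. (ALL a < \<eta>. slot p b a = slot p' b' a) --> p = p' & b = b') &
    (ALL Y. length Y = T ^ \<eta> * s -->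
     ((EX av. (ALL tr:Tri. tsat av tr) & (ALL p < T ^ \<eta> * s. EX a < \<eta>. av (slot p (Y ! p) a))) \<longleftrightarrow> has_block L s (T ^ \<eta>) Y))"

lemma length_block: "length Y = N * s ==> m < N ==> length (take s (drop (m * s) Y)) = s"
proof -
  assume "length Y = N * s" "m < N"
  then have "(m + 1) * s <= length Y" by (metis Suc_eq_plus1 Suc_leI mult_le_mono1)
  then show ?thesis by simp
qed

lemma nth_block: "length Y = N * s ==> m < N ==> k < s ==> take s (drop (m * s) Y) ! k = Y ! (m * s + k) & m * s + k < N * s"
proof -
  assume a: "length Y = N * s" "m < N" "k < s"
  then have "(m + 1) * s <= length Y" by (metis Suc_eq_plus1 Suc_leI mult_le_mono1)
  then show ?thesis using a by simp
qed

lemma sat_composition: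
  assumes "L \<in> NP" "\<eta> >= 1"
  shows "EX c a. ALL s T. T >= 1 --> (EX X Tri slot. sat_comp L \<eta> s T (c * T * (s + 2) ^ a) X Tri slot)"
proof -
  obtain K where K: "!!s. EX Cl :: fact clause set. finite Cl & card Cl <= (s + 2) ^ K & (ALL C:Cl. length C <= K) &
    (ALL x. length x = s --> (x \<in> L \<longleftrightarrow> (EX av. (ALL i < s. av (Inp i) = x ! i) & (ALL C:Cl. csat av C))))"
   using cook_levin[OF assms(1)] by blast
  \<comment> \<open>The summands \<open>K + 2\<close>, \<open>3 * \<eta>\<close> and
    \<open>10\<close> count the 3-clauses from the machine, the selectors and the entries; each has
    three variables, and \<open>\<eta> + 2\<close> accounts for the slot variables.\<close>
  have main: "EX X Tri slot. sat_comp L \<eta> s T ((3 * (K + 2 + 3 * \<eta> + 10) + \<eta> + 2) * T * (s + 2) ^ (K + 1)) X Tri slot" if T: "T >= 1" for s T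
  proof -
   obtain Cl :: "fact clause set" where Cl: "finite Cl" "card Cl <= (s + 2) ^ K" "!!C. C \<in> Cl ==> length C <= K"
    and sem: "!!x. length x = s ==> x \<in> L \<longleftrightarrow> (EX av. (ALL i < s. av (Inp i) = x ! i) & (ALL C:Cl. csat av C))"
    using K[of s] by blast
   define N where "N = T ^ \<eta>"
   have "card (PiE {..<\<eta>} (%_. {..<T})) = N" by (simp add: card_PiE N_def)
   moreover have "finite (PiE {..<\<eta>} (%_. {..<T}))" by (intro finite_PiE) auto
   ultimately obtain D where D: "bij_betw D {..<N} (PiE {..<\<eta>} (%_. {..<T}))"
    using ex_bij_betw_nat_finite by (metis atLeast0LessThan)
   have Din: "D m a < T" if "m < N" "a < \<eta>" for m a
    using bij_betwE[OF D] that by (auto simp: PiE_iff)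
   have Deq: "m = m'" if "m < N" "m' < N" "!!a. a < \<eta> ==> D m a = D m' a" for m m'
   proof -
    have "D m \<in> PiE {..<\<eta>} (%_. {..<T})" "D m' \<in> PiE {..<\<eta>} (%_. {..<T})"
     using bij_betwE[OF D] that(1,2) by auto
    then have "D m = D m'" using that(3) by (intro PiE_ext) auto
    then show ?thesis using D that(1,2) by (auto simp: bij_betw_def inj_on_def)
   qed
   define emb :: "fact clause => cvar clause" where "emb = map (%(v, b). (Fact v, b))"
   \<comment> \<open>At each position some digit is selected. Deselection is the positive literal
     because a constraint can only demand that some slot variable is true.\<close>
   define NS where "NS = (%a. map (%i. (NSel a i, False)) [0..<T]) ` {..<\<eta> - 1} \<union> {map (%j. (Last j, True)) [0..<T]}"
   define EE where "EE = (%(j, k, b). [(Last j, False), (Ent k b j, False), (Fact (Inp k), b)]) ` ({..<T} \<times> {..<s} \<times> UNIV)"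
   define \<Phi> where "\<Phi> = emb ` Cl \<union> NS \<union> EE"
   define Tri where "Tri = tri_set \<Phi>"
   define X where "X = (\<Union>tr \<in> Tri. {fst (tlit tr 0), fst (tlit tr 1), fst (tlit tr 2)}) \<union>
    (%(a, i). Orig (NSel a i)) ` ({..<\<eta>} \<times> {..<T}) \<union> (%(j, k, b). Orig (Ent k b j)) ` ({..<T} \<times> {..<s} \<times> UNIV)"
   \<comment> \<open>For the selected block the first \<open>\<eta> - 1\<close> variables are false,
     so its clause forces \<open>Ent\<close>, which together with \<open>Last\<close> fixes the
     input bit. For every other block a deselected digit, or an \<open>Ent\<close> with an
     unselected last digit, makes the clause harmless.\<close>
   define slot where "slot p b a = (if a < \<eta> - 1 then Orig (NSel a (D (p div s) a)) else Orig (Ent (p mod s) b (D (p div s) (\<eta> - 1))))"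
    for p b a
   have finN: "finite NS" "finite EE" "finite (emb ` Cl)" using Cl(1) by (auto simp: NS_def EE_def)
   have finT: "finite Tri" unfolding Tri_def \<Phi>_def using finN by (intro finite_tri_set) auto
   have dm: "p div s < N" "p mod s < s" if "p < N * s" for p
    using that by (auto simp: less_mult_imp_div_less) (metis less_nat_zero_code mod_less_divisor mult_0_right not_gr_zero)
   have TriU: "Tri = tri_set (emb ` Cl) \<union> tri_set NS \<union> tri_set EE"
    unfolding Tri_def \<Phi>_def tri_set_def by blast
   define M where "M = (s + 2) ^ (K + 1)"
   have "card NS <= card {..<\<eta> - 1} + 1"
    unfolding NS_def by (intro order_trans[OF card_Un_le add_mono] card_image_le) auto
   then have cNS: "card NS <= \<eta>" using assms(2) by simp
   have "card EE <= card ({..<T} \<times> {..<s} \<times> (UNIV :: bool set))" unfolding EE_def by (intro card_image_le) simp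
   then have cEE: "card EE <= T * (2 * s)" by (simp add: card_cartesian_product card_UNIV_bool)
   have M1: "(s + 2) ^ K <= M" "s <= M" "1 <= M"
   proof -
    show "(s + 2) ^ K <= M" unfolding M_def by (intro power_increasing) auto
    have "(s + 2) ^ 1 <= M" unfolding M_def by (intro power_increasing) auto
    then show "s <= M" "1 <= M" by simp_all
   qed
   have "card (tri_set (emb ` Cl)) <= card (emb ` Cl) * (K + 2)"
    using finN Cl(3) by (intro card_tri_set) (auto simp: emb_def)
   also have "... <= M * (K + 2)" using card_image_le[OF Cl(1), of emb] Cl(2) M1(1) by (intro mult_right_mono) linarith+
   also have "... <= T * M * (K + 2)" using T by (intro mult_right_mono) auto
   finally have t1: "card (tri_set (emb ` Cl)) <= T * M * (K + 2)" .
   have "card (tri_set NS) <= card NS * (T + 2)" using finN by (intro card_tri_set) (auto simp: NS_def)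
   also have "... <= \<eta> * (T * M * 3)"
   proof (intro mult_mono cNS)
    have "T * 1 <= T * M" using M1(3) by (intro mult_left_mono) auto
    then show "T + 2 <= T * M * 3" using T by linarith
   qed auto
   finally have t2: "card (tri_set NS) <= \<eta> * (T * M * 3)" .
   have "card (tri_set EE) <= card EE * (3 + 2)" using finN by (intro card_tri_set) (auto simp: EE_def)
   also have "... <= T * (2 * M) * 5" using cEE M1(2) by (intro mult_mono order_trans[OF cEE]) auto
   finally have t3: "card (tri_set EE) <= T * M * 10" by simp
   have "card Tri <= T * M * (K + 2) + \<eta> * (T * M * 3) + T * M * 10"
    unfolding TriU using t1 t2 t3 by (intro order_trans[OF card_Un_le add_mono])
   also have "... = T * M * (K + 2 + 3 * \<eta> + 10)" by (simp add: algebra_simps)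
   finally have cT: "card Tri <= T * M * (K + 2 + 3 * \<eta> + 10)" .
   have "card (\<Union>tr \<in> Tri. {fst (tlit tr 0), fst (tlit tr 1), fst (tlit tr 2)}) <= (\<Sum>tr \<in> Tri. 3)"
    by (intro order_trans[OF card_UN_le[OF finT] sum_mono]) (simp add: card_insert_if)
   moreover have "card ((%(a, i). Orig (NSel a i)) ` ({..<\<eta>} \<times> {..<T})) <= \<eta> * T"
    by (rule order_trans[OF card_image_le]) (auto simp: card_cartesian_product)
   moreover have "card ((%(j, k, b). Orig (Ent k b j)) ` ({..<T} \<times> {..<s} \<times> UNIV)) <= T * (2 * s)"
    by (rule order_trans[OF card_image_le]) (auto simp: card_cartesian_product card_UNIV_bool)
   ultimately have "card X <= (\<Sum>tr \<in> Tri. 3) + \<eta> * T + T * (2 * s)"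
    unfolding X_def by (intro order_trans[OF card_Un_le add_mono])
   also have "... <= 3 * (T * M * (K + 2 + 3 * \<eta> + 10)) + \<eta> * (T * M) + T * (2 * M)"
    using cT M1 by (intro add_mono mult_mono) (auto simp: mult.commute)
   also have "... = (3 * (K + 2 + 3 * \<eta> + 10) + \<eta> + 2) * T * M" by (simp add: algebra_simps)
   finally have cX: "card X <= (3 * (K + 2 + 3 * \<eta> + 10) + \<eta> + 2) * T * M" .
   have cT': "card Tri <= (3 * (K + 2 + 3 * \<eta> + 10) + \<eta> + 2) * T * M"
   proof (rule order_trans[OF cT])
    have "T * M * (K + 2 + 3 * \<eta> + 10) <= T * M * (3 * (K + 2 + 3 * \<eta> + 10) + \<eta> + 2)" by (intro mult_left_mono) auto
    then show "T * M * (K + 2 + 3 * \<eta> + 10) <= (3 * (K + 2 + 3 * \<eta> + 10) + \<eta> + 2) * T * M" by (simp only: mult.assoc mult.commute mult.left_commute)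
   qed
   have kvX: "slot p b a \<in> X & cls \<eta> (slot p b a) = a" if "p < N * s" "a < \<eta>" for p b a
   proof (cases "a < \<eta> - 1")
    case True
    then have "(a, D (p div s) a) \<in> {..<\<eta>} \<times> {..<T}" using Din dm that by auto
    then have "slot p b a \<in> (%(a, i). Orig (NSel a i)) ` ({..<\<eta>} \<times> {..<T})" using True unfolding slot_def by (auto intro!: image_eqI)
    then show ?thesis using True by (auto simp: X_def slot_def cls_def)
   next
    case False
    then have a: "a = \<eta> - 1" using that by linarith
    have "(D (p div s) (\<eta> - 1), p mod s, b) \<in> {..<T} \<times> {..<s} \<times> UNIV" using Din dm that by auto
    then have "slot p b a \<in> (%(j, k, b). Orig (Ent k b j)) ` ({..<T} \<times> {..<s} \<times> UNIV)"
     using False unfolding slot_def by (intro image_eqI[of _ _ "(D (p div s) (\<eta> - 1), p mod s, b)"]) auto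
    then show ?thesis using a by (auto simp: X_def slot_def cls_def)
   qed
   have kvinj: "p = p' & b = b'" if p: "p < N * s" "p' < N * s" and eq: "!!a. a < \<eta> ==> slot p b a = slot p' b' a" for p p' b b'
   proof -
    have last: "p mod s = p' mod s" "b = b'" "D (p div s) (\<eta> - 1) = D (p' div s) (\<eta> - 1)"
     using eq[of "\<eta> - 1"] assms(2) by (auto simp: slot_def)
    have "D (p div s) a = D (p' div s) a" if "a < \<eta>" for a
    proof (cases "a < \<eta> - 1")
     case True
     then show ?thesis using eq[OF that] by (simp add: slot_def)
    next
     case False
     then have "a = \<eta> - 1" using that by linarith
     then show ?thesis using last(3) by simp
    qed
    then have "p div s = p' div s" using Deq dm(1) p by blast
    then show ?thesis using last(1,2) by (metis div_mult_mod_eq)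
   qed
   have semY: "(EX av. (ALL tr:Tri. tsat av tr) & (ALL p < N * s. EX a < \<eta>. av (slot p (Y ! p) a))) \<longleftrightarrow> has_block L s N Y"
    if Y: "length Y = N * s" for Y
   proof
    assume "EX av. (ALL tr:Tri. tsat av tr) & (ALL p < N * s. EX a < \<eta>. av (slot p (Y ! p) a))"
    then obtain av where av: "!!tr. tr \<in> Tri ==> tsat av tr" and al: "!!p. p < N * s ==> EX a < \<eta>. av (slot p (Y ! p) a)" by blast
    define \<gamma> where "\<gamma> v = av (Orig v)" for v
    have \<gamma>: "csat \<gamma> C" if "C \<in> \<Phi>" for C
     unfolding \<gamma>_def
    proof (rule tri_sound, rule ballI)
     fix tr assume "tr \<in> tri_clauses C"
     then have "tr \<in> Tri" using that unfolding Tri_def tri_set_def by blast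
     then show "tsat av tr" by (rule av)
    qed
    have "EX i < T. ~ \<gamma> (NSel a i)" if "a < \<eta> - 1" for a
    proof -
     have "map (%i. (NSel a i, False)) [0..<T] \<in> \<Phi>" using that by (auto simp: \<Phi>_def NS_def)
     from \<gamma>[OF this] show ?thesis by (auto simp: csat_def)
    qed
    \<comment> \<open>A model may select several digits at a position; any one per position names a
      block whose word the model certifies to be in \<open>L\<close>.\<close>
    then obtain I where I: "!!a. a < \<eta> - 1 ==> I a < T & ~ \<gamma> (NSel a (I a))" by metis
    have "map (%j. (Last j, True)) [0..<T] \<in> \<Phi>" by (auto simp: \<Phi>_def NS_def)
    from \<gamma>[OF this] obtain j where j: "j < T" "\<gamma> (Last j)" by (auto simp: csat_def)
    define \<phi> where "\<phi> = restrict (%a. if a < \<eta> - 1 then I a else j) {..<\<eta>}"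
    have "\<phi> \<in> PiE {..<\<eta>} (%_. {..<T})" using I j by (auto simp: \<phi>_def)
    then have "\<phi> \<in> D ` {..<N}" using D by (simp add: bij_betw_def)
    then obtain m where m: "m < N" "D m = \<phi>" by auto
    let ?x = "take s (drop (m * s) Y)"
    have lx: "length ?x = s" by (rule length_block[OF Y m(1)])
    have "\<gamma> (Fact (Inp k)) = ?x ! k" if k: "k < s" for k
    proof -
     have p: "m * s + k < N * s" and xk: "?x ! k = Y ! (m * s + k)" using nth_block[OF Y m(1) k] by auto
     have d: "(m * s + k) div s = m" "(m * s + k) mod s = k" using k by auto
     obtain a where a: "a < \<eta>" "av (slot (m * s + k) (Y ! (m * s + k)) a)" using al[OF p] by blast
     have "~ a < \<eta> - 1" using a(2) I by (auto simp: slot_def d m(2) \<phi>_def \<gamma>_def split: if_splits)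
     then have E: "\<gamma> (Ent k (Y ! (m * s + k)) j)" using a assms(2) k by (simp add: slot_def d m(2) \<phi>_def \<gamma>_def)
     have "[(Last j, False), (Ent k (Y ! (m * s + k)) j, False), (Fact (Inp k), Y ! (m * s + k))] \<in> EE"
      unfolding EE_def using j k by (intro image_eqI[of _ _ "(j, k, Y ! (m * s + k))"]) auto
     then have "[(Last j, False), (Ent k (Y ! (m * s + k)) j, False), (Fact (Inp k), Y ! (m * s + k))] \<in> \<Phi>" by (simp add: \<Phi>_def)
     from \<gamma>[OF this] show ?thesis using E j xk by simp
    qed
    moreover have "csat (%v. \<gamma> (Fact v)) C" if "C \<in> Cl" for C
    proof -
     have "emb C \<in> \<Phi>" using that by (simp add: \<Phi>_def)
     from \<gamma>[OF this] show ?thesis by (simp only: emb_def csat_map)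
    qed
    ultimately have "?x \<in> L" unfolding sem[OF lx] by (intro exI[of _ "%v. \<gamma> (Fact v)"]) auto
    then show "has_block L s N Y" using m unfolding has_block_def by blast
   next
    assume "has_block L s N Y"
    then obtain m where m: "m < N" "take s (drop (m * s) Y) \<in> L" unfolding has_block_def by blast
    let ?x = "take s (drop (m * s) Y)"
    have lx: "length ?x = s" by (rule length_block[OF Y m(1)])
    obtain av0 where a0': "(ALL i < s. av0 (Inp i) = ?x ! i) & (ALL C:Cl. csat av0 C)"
     using iffD1[OF sem[OF lx] m(2)] by (rule exE)
    have a0: "!!i. i < s ==> av0 (Inp i) = ?x ! i" "!!C. C \<in> Cl ==> csat av0 C"
     by (rule a0'[THEN conjunct1, rule_format], assumption, rule a0'[THEN conjunct2, rule_format])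
    \<comment> \<open>Entries for unselected last digits are allowed freely; for the selected one
      the entry \<open>b\<close> is allowed exactly if it agrees with the chosen block.\<close>
    define \<gamma> where "\<gamma> v = (case v of Fact u => av0 u | NSel a i => i ~= D m a | Last j => j = D m (\<eta> - 1)
     | Ent k b j => j = D m (\<eta> - 1) --> b = ?x ! k)" for v
    have "csat \<gamma> C" if "C \<in> \<Phi>" for C
    proof -
     from that consider C' where "C' \<in> Cl" "C = emb C'" | a where "a < \<eta> - 1" "C = map (%i. (NSel a i, False)) [0..<T]"
      | "C = map (%j. (Last j, True)) [0..<T]"
      | j k b where "j < T" "k < s" "C = [(Last j, False), (Ent k b j, False), (Fact (Inp k), b)]"
      unfolding \<Phi>_def NS_def EE_def by auto
     then show ?thesis
     proof cases
      case 1
      have "(%v. \<gamma> (Fact v)) = av0" by (auto simp: \<gamma>_def)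
      then show ?thesis using a0(2)[OF 1(1)] by (simp add: 1(2) emb_def csat_map)
     next
      case 2
      then have "D m a < T" using Din m(1) by simp
      then show ?thesis unfolding 2(2) csat_def by (auto simp: \<gamma>_def)
     next
      case 3
      have "D m (\<eta> - 1) < T" using Din m(1) assms(2) by simp
      then show ?thesis unfolding 3 csat_def by (auto simp: \<gamma>_def)
     next
      case 4
      then show ?thesis using a0(1)[of k] by (auto simp: \<gamma>_def)
     qed
    qed
    then obtain bv where bv: "!!v. bv (Orig v) = \<gamma> v" "!!tr. tr \<in> Tri ==> tsat bv tr"
     using tri_complete[of \<Phi> \<gamma>] unfolding Tri_def by blast
    have "EX a < \<eta>. bv (slot p (Y ! p) a)" if p: "p < N * s" for p
    proof (rule ccontr)
     assume n: "~ (EX a < \<eta>. bv (slot p (Y ! p) a))"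
     have last: "D (p div s) (\<eta> - 1) = D m (\<eta> - 1)" "Y ! p ~= ?x ! (p mod s)"
      using n assms(2) by (auto simp: slot_def bv(1) \<gamma>_def dest!: spec[of _ "\<eta> - 1"])
     have "D (p div s) a = D m a" if "a < \<eta>" for a
     proof (cases "a < \<eta> - 1")
      case True
      then show ?thesis using n that by (auto simp: slot_def bv(1) \<gamma>_def dest!: spec[of _ a])
     next
      case False
      then have "a = \<eta> - 1" using that by linarith
      then show ?thesis using last(1) by simp
     qed
     then have "p div s = m" using Deq dm(1)[OF p] m(1) by blast
     then have "p = m * s + p mod s" using div_mult_mod_eq[of p s] by simp
     then show False using last(2) nth_block[OF Y m(1) dm(2)[OF p]] by simp
    qed
    then show "EX av. (ALL tr:Tri. tsat av tr) & (ALL p < N * s. EX a < \<eta>. av (slot p (Y ! p) a))" using bv(2) by blast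
   qed
   have finX: "finite X" unfolding X_def using finT by auto
   have varX: "fst (tlit tr j) \<in> X" if "tr \<in> Tri" for tr j
   proof -
    have "fst (tlit tr j) \<in> {fst (tlit tr 0), fst (tlit tr 1), fst (tlit tr 2)}" by (simp add: tlit_def)
    then show ?thesis unfolding X_def by (intro UnI1 UN_I[OF that])
   qed
   show ?thesis
   proof (intro exI)
    have "ALL tr:Tri. ALL j. fst (tlit tr j) \<in> X" using varX by simp
    moreover have "ALL p < N * s. ALL b. ALL a < \<eta>. slot p b a \<in> X & cls \<eta> (slot p b a) = a" using kvX by simp
    moreover have "ALL p < N * s. ALL p' < N * s. ALL b b'. (ALL a < \<eta>. slot p b a = slot p' b' a) --> p = p' & b = b'"
     by (intro allI impI kvinj) simp_all
    moreover have "ALL Y. length Y = N * s --> ((EX av. (ALL tr:Tri. tsat av tr) &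
      (ALL p < N * s. EX a < \<eta>. av (slot p (Y ! p) a))) \<longleftrightarrow> has_block L s N Y)"
     by (intro allI impI semY)
    ultimately show "sat_comp L \<eta> s T ((3 * (K + 2 + 3 * \<eta> + 10) + \<eta> + 2) * T * (s + 2) ^ (K + 1)) X Tri slot"
     unfolding sat_comp_def N_def[symmetric] M_def[symmetric] using finX finT cX cT' by (intro conjI)
   qed
  qed
  show ?thesis
   by (intro exI[of _ "3 * (K + 2 + 3 * \<eta> + 10) + \<eta> + 2"] exI[of _ "K + 1"] allI impI) (rule main)
qed

section \<open>Composition on the level of instances\<close>

subsection \<open>Patterns of forbidden colorings\<close>

text \<open>
  The vertices of an \<open>l\<close>-tuple of \<open>d\<close>-sets are indexed by cells \<open>(j, i)\<close>. The cells in \<open>S\<close> carry a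
  variable and have color \<open>i + 1\<close> or \<open>g (j, i)\<close> according to its value; the other cells have the
  fixed color \<open>i + 1\<close>. In a pattern the tuple is uniformly rainbow only if all variables are false.
\<close>

definition pcol :: "(nat \<times> nat) set => (nat \<times> nat => nat) => (nat \<times> nat => bool) => nat \<times> nat => nat" where
  "pcol S g bv x = (if x \<in> S & bv x then g x else snd x + 1)"

definition pattern :: "nat => nat => nat => (nat \<times> nat) set => (nat \<times> nat => nat) => bool" where
  "pattern d l q S g \<longleftrightarrow> d <= q & S <= {..<l} \<times> {..<d} & (ALL x:S. g x \<in> {1..q} & g x ~= snd x + 1) &
    (ALL bv. (ALL j < l. card ((%i. pcol S g bv (j, i)) ` {..<d}) = d) &
     (ALL j < l. ALL j' < l. (%i. pcol S g bv (j, i)) ` {..<d} = (%i. pcol S g bv (j', i)) ` {..<d}) -->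
     (ALL x:S. ~ bv x))"

lemma patternI:
  assumes "d <= q" "S <= {..<l} \<times> {..<d}" "!!x. x \<in> S ==> g x \<in> {1..q} & g x ~= snd x + 1"
   and "!!bv j i. (!!j. j < l ==> inj_on (%i. pcol S g bv (j, i)) {..<d}) ==>
    (!!j j' i. j < l ==> j' < l ==> i < d ==> EX i' < d. pcol S g bv (j, i) = pcol S g bv (j', i')) ==>
    (j, i) \<in> S ==> bv (j, i) ==> False"
  shows "pattern d l q S g"
  unfolding pattern_def
proof (intro conjI allI impI ballI notI)
  fix bv x
  assume a: "(ALL j < l. card ((%i. pcol S g bv (j, i)) ` {..<d}) = d) &
     (ALL j < l. ALL j' < l. (%i. pcol S g bv (j, i)) ` {..<d} = (%i. pcol S g bv (j', i)) ` {..<d})"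
   and x: "x \<in> S" "bv x"
  show False
  proof (rule assms(4)[of bv "fst x" "snd x"])
   show "inj_on (%i. pcol S g bv (j, i)) {..<d}" if "j < l" for j
   proof -
    have "card ((%i. pcol S g bv (j, i)) ` {..<d}) = d" using a[THEN conjunct1] that by simp
    then show ?thesis by (intro eq_card_imp_inj_on) simp_all
   qed
   show "EX i' < d. pcol S g bv (j, i) = pcol S g bv (j', i')" if "j < l" "j' < l" "i < d" for j j' i
   proof -
    have "pcol S g bv (j, i) \<in> (%i. pcol S g bv (j, i)) ` {..<d}" using that by blast
    also have "... = (%i. pcol S g bv (j', i)) ` {..<d}" using a[THEN conjunct2] that by blast
    finally show ?thesis by auto
   qed
  qed (use x in auto)
qed (use assms in auto)

text \<open>Color \<open>d + 1\<close> occurs in block 0 only, and color \<open>d + 2\<close> only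
  in the other blocks, so a true cell makes the color set of its block differ from that of another
  block.\<close>

lemma pattern_all:
  assumes "l >= 2" "q >= d + 2"
  shows "pattern d l q ({..<l} \<times> {..<d}) (%(j, i). if j = 0 then d + 1 else d + 2)"
proof (rule patternI)
  let ?S = "{..<l} \<times> {..<d}" and ?g = "%(j :: nat, i :: nat). if j = 0 then d + 1 else d + 2"
  fix bv j i
  assume ex: "!!j j' i. j < l ==> j' < l ==> i < d ==> EX i' < d. pcol ?S ?g bv (j, i) = pcol ?S ?g bv (j', i')"
   and S: "(j, i) \<in> ?S" "bv (j, i)"
  show False
  proof (cases "j = 0")
   case True
   then obtain i' where "i' < d" "pcol ?S ?g bv (0, i) = pcol ?S ?g bv (1, i')" using ex[of 0 1 i] S assms by auto
   then show False using S True by (auto simp: pcol_def split: if_splits)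
  next
   case False
   then obtain i' where "i' < d" "pcol ?S ?g bv (j, i) = pcol ?S ?g bv (0, i')" using ex[of j 0 i] S assms by auto
   then show False using S False by (auto simp: pcol_def split: if_splits)
  qed
qed (use assms in \<open>auto split: if_splits\<close>)

text \<open>A true cell of block 0 repeats color 1 of the fixed cell \<open>(0, 0)\<close>, so block
  0 is not rainbow. A true cell elsewhere has color \<open>d + 1\<close>, which block 0 never
  uses.\<close>

lemma pattern_all_but_one:
  assumes "d >= 1" "l >= 2" "q = d + 1"
  shows "pattern d l q ({..<l} \<times> {..<d} - {(0, 0)}) (%(j, i). if j = 0 then 1 else d + 1)"
proof (rule patternI)
  let ?S = "{..<l} \<times> {..<d} - {(0, 0)}" and ?g = "%(j :: nat, i :: nat). if j = 0 then 1 else d + 1"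
  fix bv j i
  assume ex: "!!j j' i. j < l ==> j' < l ==> i < d ==> EX i' < d. pcol ?S ?g bv (j, i) = pcol ?S ?g bv (j', i')"
   and inj: "!!j. j < l ==> inj_on (%i. pcol ?S ?g bv (j, i)) {..<d}"
   and S: "(j, i) \<in> ?S" "bv (j, i)"
  show False
  proof (cases "j = 0")
   case True
   have "pcol ?S ?g bv (0, i) = pcol ?S ?g bv (0, 0)" using S True by (auto simp: pcol_def)
   then have "i = 0" using inj_onD[OF inj[of 0], of i 0] S assms by auto
   then show False using S True by simp
  next
   case False
   then obtain i' where "i' < d" "pcol ?S ?g bv (j, i) = pcol ?S ?g bv (0, i')" using ex[of j 0 i] S assms by auto
   then show False using S False by (auto simp: pcol_def split: if_splits)
  qed
qed (use assms in \<open>auto split: if_splits\<close>)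

text \<open>The last cell of each block is fixed to color \<open>d\<close>, which every true cell of
  the block repeats.\<close>

lemma pattern_but_last:
  assumes "d >= 1" "d <= q"
  shows "pattern d l q ({..<l} \<times> {..<d - 1}) (%_. d)"
proof (rule patternI)
  let ?S = "{..<l} \<times> {..<d - 1}"
  fix bv j i
  assume inj: "!!j. j < l ==> inj_on (%i. pcol ?S (%_. d) bv (j, i)) {..<d}"
   and S: "(j, i) \<in> ?S" "bv (j, i)"
  have "pcol ?S (%_. d) bv (j, i) = pcol ?S (%_. d) bv (j, d - 1)" using S assms by (simp add: pcol_def)
  moreover have "j < l" "i \<in> {..<d}" "d - 1 \<in> {..<d}" using S assms by auto
  ultimately have "i = d - 1" using inj_onD[OF inj] by blast
  then show False using S by simp
qed (use assms in auto)

lemma two_colors_pattern: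
  fixes d l :: nat
  shows "d = 1 ==> ALL x:{..<l} \<times> {..<d} - {(0, 0)}. snd x = 0 & (%(j, i). if j = 0 then 1 else d + 1) x = (2 :: nat)"
   "d = 2 ==> ALL x:{..<l} \<times> {..<d - 1}. snd x = 0 & (%_. d) x = 2"
  by (auto split: if_splits)

subsection \<open>Composition of graphs\<close>

lemma tuple_composition:
  assumes pat: "pattern d l q S g" and \<eta>: "card S = \<eta>" and sc: "sat_comp L \<eta> s T B X Tri slot"
   and q: "q >= 3 \<or> (q = 2 & (ALL x:S. snd x = 0 & g x = 2) & (d = 1 & l >= 3 \<or> d = 2 & l >= 2))"
  shows "\<exists>(V :: cvar ext gv set) E Tu K. finite V & card V <= q + 12 * B & (ALL e:E. e <= V & card e = 2) &
   (ALL Fs:Tu. length Fs = l & (ALL F:set Fs. F <= V & card F = d)) &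
   (ALL p < T ^ \<eta> * s. ALL b. (length (K p b) = l & (ALL F:set (K p b). F <= V & card F = d)) & K p b \<notin> Tu) &
   (ALL p < T ^ \<eta> * s. ALL p' < T ^ \<eta> * s. ALL b b'. K p b = K p' b' --> p = p') &
   (ALL Y. length Y = T ^ \<eta> * s -->
    (yes_instance d q (graph V E (Tu \<union> (%p. K p (Y ! p)) ` {..<T ^ \<eta> * s})) \<longleftrightarrow> has_block L s (T ^ \<eta>) Y))"
proof -
  define P where "P = T ^ \<eta> * s"
  have dq: "d <= q" and S: "S <= {..<l} \<times> {..<d}" and g: "!!x. x \<in> S ==> g x \<in> {1..q} & g x ~= snd x + 1"
   using pat unfolding pattern_def by blast+
  have fS: "finite S" using S by (rule finite_subset) simp
  obtain h where h: "bij_betw h {..<\<eta>} S" using ex_bij_betw_nat_finite[OF fS] \<eta> by (auto simp: atLeast0LessThan)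
  define hi where "hi = inv_into {..<\<eta>} h"
  have hi: "hi x < \<eta>" "h (hi x) = x" if "x \<in> S" for x
   using that bij_betwE[OF bij_betw_inv_into[OF h]] bij_betw_inv_into_right[OF h] unfolding hi_def by auto
  have h2: "h a \<in> S" "hi (h a) = a" if "a < \<eta>" for a
   using that bij_betwE[OF h] bij_betw_inv_into_left[OF h] unfolding hi_def by auto
  note sc' = sc[unfolded sat_comp_def P_def[symmetric]]
  have fin: "finite X" "finite Tri" and B: "card X <= B" "card Tri <= B" using sc' by - (elim conjE, assumption)+
  have vars: "!!tr j. tr \<in> Tri ==> fst (tlit tr j) \<in> X"
  proof -
   have "ALL tr:Tri. ALL j. fst (tlit tr j) \<in> X" using sc' by (elim conjE)
   then show "!!tr j. tr \<in> Tri ==> fst (tlit tr j) \<in> X" by blast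
  qed
  have sX': "ALL p < P. ALL b. ALL a < \<eta>. slot p b a \<in> X & cls \<eta> (slot p b a) = a" using sc' by (elim conjE)
  have sX: "slot p b a \<in> X" "cls \<eta> (slot p b a) = a" if "p < P" "a < \<eta>" for p b a
   using sX' that by blast+
  have sinj': "ALL p < P. ALL p' < P. ALL b b'. (ALL a < \<eta>. slot p b a = slot p' b' a) --> p = p' & b = b'" using sc' by (elim conjE)
  have sinj: "p = p'" if "p < P" "p' < P" "!!a. a < \<eta> ==> slot p b a = slot p' b' a" for p p' b b'
   using sinj' that by blast
  have sem': "ALL Y. length Y = P --> ((EX av. (ALL tr:Tri. tsat av tr) & (ALL p < P. EX a < \<eta>. av (slot p (Y ! p) a))) \<longleftrightarrow> has_block L s (T ^ \<eta>) Y)"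
   using sc' by (elim conjE)
  have sem: "(EX av. (ALL tr:Tri. tsat av tr) & (ALL p < P. EX a < \<eta>. av (slot p (Y ! p) a))) \<longleftrightarrow> has_block L s (T ^ \<eta>) Y"
   if "length Y = P" for Y by (rule sem'[rule_format, OF that])
  \<comment> \<open>A slot variable at position \<open>a\<close> belongs to cell \<open>h a\<close>
    of the pattern: false is the rainbow color of that cell, and true is the color given by
    \<open>g\<close>.\<close>
  define f where "f x = (if cls \<eta> x < \<eta> then snd (h (cls \<eta> x)) + 1 else 1)" for x
  define t where "t x = (if cls \<eta> x < \<eta> then g (h (cls \<eta> x)) else 2)" for x
  have "EX V E Tu. gadget d l q X Tri f t V E Tu"
  proof (rule gadget_exists[OF fin vars])
   fix x assume "x \<in> X"
   show "f x \<in> {1..q} & t x \<in> {1..q} & f x ~= t x"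
   proof (cases "cls \<eta> x < \<eta>")
    case True
    then have "h (cls \<eta> x) \<in> S" by (rule h2)
    moreover from this have "snd (h (cls \<eta> x)) < d" using S by auto
    ultimately show ?thesis using g[of "h (cls \<eta> x)"] dq True by (auto simp: f_def t_def)
   qed (use q in \<open>auto simp: f_def t_def\<close>)
  next
   show "q >= 3 \<or> (q = 2 & f = (%_. 1) & t = (%_. 2) & (d = 1 & l >= 3 \<or> d = 2 & l >= 2))"
    using q h2(1) by (auto simp: f_def t_def fun_eq_iff)
  qed
  then obtain V E Tu where gd: "gadget d l q X Tri f t V E Tu" by blast
  have V: "finite V" "ALL e:E. e <= V & card e = 2" "ALL Fs:Tu. length Fs = l & (ALL F:set Fs. F <= V & card F = d)"
   "Pal ` {1..q} <= V" "(%x. Lit x True) ` X <= V" "card V <= q + 2 * card X + 10 * card Tri"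
   and sep: "ALL Fs:Tu. EX F:set Fs. ~ F <= range Pal \<union> range (%x. Lit x True)"
   using gd unfolding gadget_def by - (elim conjE, assumption)+
  have sound: "ALL c. proper_coloring q (graph V E Tu) c & (ALL Fs:Tu. ~ uniformly_rainbow d c Fs) -->
     (EX av \<pi>. (ALL tr:Tri. tsat av tr) & inj_on \<pi> {1..q} & (ALL i:{1..q}. c (Pal i) = \<pi> i) &
       (ALL x:X. c (Lit x True) = \<pi> (if av x then t x else f x)))"
   and complete: "ALL av. (ALL tr:Tri. tsat av tr) --> (EX c. proper_coloring q (graph V E Tu) c & (ALL Fs:Tu. ~ uniformly_rainbow d c Fs) &
     (ALL i:{1..q}. c (Pal i) = i) & (ALL x:X. c (Lit x True) = (if av x then t x else f x)))"
   using gd unfolding gadget_def by - (elim conjE, assumption)+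
  define cell where "cell p b x = (if x \<in> S then Lit (slot p b (hi x)) True else Pal (snd x + 1))" for p b x
  define K where "K p b = map (%j. (%i. cell p b (j, i)) ` {..<d}) [0..<l]" for p b
  \<comment> \<open>\<open>cls\<close> recovers the position of a slot variable and hence its
    cell.\<close>
  have slot_eq: "x = x'" if "p < P" "p' < P" "x \<in> S" "x' \<in> S" "slot p b (hi x) = slot p' b' (hi x')" for p p' b b' x x'
  proof -
   have e: "hi x = hi x'" using sX(2)[OF that(1) hi(1)[OF that(3)], of b] sX(2)[OF that(2) hi(1)[OF that(4)], of b'] that(5) by simp
   have "x = h (hi x)" by (rule hi(2)[OF that(3), symmetric])
   also have "... = x'" unfolding e by (rule hi(2)[OF that(4)])
   finally show ?thesis .
  qed
  have cell_inj: "i = i'" if "p < P" "p' < P" "cell p b (j, i) = cell p' b' (j, i')" for p p' b b' j i i'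
  proof (cases "(j, i) \<in> S")
   case True
   then have S': "(j, i') \<in> S" using that(3) unfolding cell_def by (simp split: if_splits)
   then have "slot p b (hi (j, i)) = slot p' b' (hi (j, i'))" using True that(3) unfolding cell_def by simp
   from slot_eq[OF that(1,2) True S' this] show ?thesis by simp
  next
   case False
   then show ?thesis using that(3) unfolding cell_def by (simp split: if_splits)
  qed
  have cellV: "cell p b (j, i) \<in> V" if "p < P" "i < d" for p b j i
  proof (cases "(j, i) \<in> S")
   case True
   have "Lit (slot p b (hi (j, i))) True \<in> V" using V(5) sX(1)[OF that(1) hi(1)[OF True]] by blast
   then show ?thesis using True by (simp add: cell_def)
  next
   case False
   have "i + 1 \<in> {1..q}" using that dq by simp
   then have "Pal (i + 1) \<in> V" using V(4) by blast
   then show ?thesis using False by (simp add: cell_def)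
  qed
  have Kval: "length (K p b) = l & (ALL F:set (K p b). F <= V & card F = d)" if "p < P" for p b
  proof (intro conjI ballI)
   fix F assume "F \<in> set (K p b)"
   then obtain j where F: "F = (%i. cell p b (j, i)) ` {..<d}" by (auto simp: K_def)
   show "F <= V" using F cellV[OF that] by auto
   have "inj_on (%i. cell p b (j, i)) {..<d}" using cell_inj[OF that that] by (auto simp: inj_on_def)
   then show "card F = d" by (simp add: F card_image)
  qed (simp add: K_def)
  have KTu: "K p b \<notin> Tu" if "p < P" for p b
  proof
   assume "K p b \<in> Tu"
   then obtain F where "F \<in> set (K p b)" "~ F <= range Pal \<union> range (%x. Lit x True)" using sep by blast
   then show False by (auto simp: K_def cell_def split: if_splits)
  qed
  have Kinj: "p = p'" if p: "p < P" "p' < P" and eq: "K p b = K p' b'" for p p' b b'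
  proof (rule sinj[OF p])
   fix a assume a: "a < \<eta>"
   obtain j i where ji: "h a = (j, i)" by fastforce
   then have jiS: "(j, i) \<in> S" using h2(1)[OF a] by simp
   then have "j < l" "i < d" using S by auto
   have "K p b ! j = K p' b' ! j" by (simp only: eq)
   then have "(%i. cell p b (j, i)) ` {..<d} = (%i. cell p' b' (j, i)) ` {..<d}" using \<open>j < l\<close> by (simp add: K_def)
   then obtain i' where "cell p b (j, i) = cell p' b' (j, i')" using \<open>i < d\<close> by blast
   moreover from this have "i = i'" by (rule cell_inj[OF p])
   ultimately have "slot p b (hi (j, i)) = slot p' b' (hi (j, i))" using jiS by (simp add: cell_def)
   then show "slot p b a = slot p' b' a" using h2(2)[OF a] ji by simp
  qed
  have ur: "uniformly_rainbow d c (K p b) \<longleftrightarrow> ~ (EX a < \<eta>. av (slot p b a))"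
   if p: "p < P" and \<pi>: "inj_on \<pi> {1..q}" "ALL i:{1..q}. c (Pal i) = \<pi> i" "ALL x:X. c (Lit x True) = \<pi> (if av x then t x else f x)"
   for c \<pi> av p b
  proof -
   define bv where "bv x = av (slot p b (hi x))" for x
   define A where "A j = (%i. pcol S g bv (j, i)) ` {..<d}" for j
   have col: "c (cell p b x) = \<pi> (pcol S g bv x)" if x: "x \<in> {..<l} \<times> {..<d}" for x
   proof (cases "x \<in> S")
    case True
    have "c (Lit (slot p b (hi x)) True) = \<pi> (if av (slot p b (hi x)) then t (slot p b (hi x)) else f (slot p b (hi x)))"
     using \<pi>(3) sX(1)[OF p hi(1)[OF True]] by blast
    moreover have "t (slot p b (hi x)) = g x" "f (slot p b (hi x)) = snd x + 1"
     using sX(2)[OF p hi(1)[OF True]] hi[OF True] by (simp_all add: f_def t_def)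
    ultimately show ?thesis using True by (simp add: cell_def pcol_def bv_def)
   next
    case False
    have "snd x + 1 \<in> {1..q}" using x dq by auto
    then show ?thesis using False \<pi>(2) by (simp add: cell_def pcol_def)
   qed
   have im: "c ` (%i. cell p b (j, i)) ` {..<d} = \<pi> ` A j" if "j < l" for j
    unfolding A_def image_image using that by (intro image_cong refl col) auto
   have Aq: "A j <= {1..q}" if "j < l" for j
   proof -
    have "pcol S g bv x \<in> {1..q}" if "x \<in> {..<l} \<times> {..<d}" for x using that g dq by (auto simp: pcol_def)
    then show ?thesis using that by (auto simp: A_def)
   qed
   have "uniformly_rainbow d c (K p b) \<longleftrightarrow> (ALL j < l. ALL j' < l. \<pi> ` A j = \<pi> ` A j') & (ALL j < l. card (\<pi> ` A j) = d)"
    unfolding uniformly_rainbow_def K_def using im by (simp, simp add: Ball_def)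
   also have "... \<longleftrightarrow> (ALL j < l. ALL j' < l. A j = A j') & (ALL j < l. card (A j) = d)"
    using inj_on_image_eq_iff[OF \<pi>(1) Aq Aq] card_image[OF inj_on_subset[OF \<pi>(1) Aq]] by simp
   also have "... \<longleftrightarrow> (ALL x:S. ~ bv x)"
   proof
    assume "(ALL j < l. ALL j' < l. A j = A j') & (ALL j < l. card (A j) = d)"
    moreover have "(ALL j < l. card (A j) = d) & (ALL j < l. ALL j' < l. A j = A j') --> (ALL x:S. ~ bv x)"
     using pat unfolding pattern_def A_def by (elim conjE) (erule allE[of _ bv])
    ultimately show "ALL x:S. ~ bv x" by (elim conjE mp) (intro conjI)
   next
    assume n: "ALL x:S. ~ bv x"
    have "pcol S g bv (j, i) = Suc i" for j i using n by (auto simp: pcol_def)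
    then have "A j = Suc ` {..<d}" for j by (simp add: A_def)
    then show "(ALL j < l. ALL j' < l. A j = A j') & (ALL j < l. card (A j) = d)" by (simp add: card_image)
   qed
   also have "... \<longleftrightarrow> ~ (EX a < \<eta>. av (slot p b a))"
   proof
    assume n: "ALL x:S. ~ bv x"
    have "~ av (slot p b a)" if "a < \<eta>" for a using n h2[OF that] by (auto simp: bv_def)
    then show "~ (EX a < \<eta>. av (slot p b a))" by simp
   next
    assume "~ (EX a < \<eta>. av (slot p b a))"
    then show "ALL x:S. ~ bv x" using hi(1) by (simp add: bv_def)
   qed
   finally show ?thesis .
  qed
  have yes: "yes_instance d q (graph V E (Tu \<union> (%p. K p (Y ! p)) ` {..<P})) \<longleftrightarrow> has_block L s (T ^ \<eta>) Y"
   if Y: "length Y = P" for Y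
   unfolding sem[OF Y, symmetric]
  proof
   assume "yes_instance d q (graph V E (Tu \<union> (%p. K p (Y ! p)) ` {..<P}))"
   then obtain c where c: "proper_coloring q (graph V E Tu) c" "ALL Fs:Tu. ~ uniformly_rainbow d c Fs"
    "!!p. p < P ==> ~ uniformly_rainbow d c (K p (Y ! p))"
   proof -
    assume *: "!!c. proper_coloring q (graph V E Tu) c ==> ALL Fs:Tu. ~ uniformly_rainbow d c Fs ==>
     (!!p. p < P ==> ~ uniformly_rainbow d c (K p (Y ! p))) ==> thesis"
    assume "yes_instance d q (graph V E (Tu \<union> (%p. K p (Y ! p)) ` {..<P}))"
    then obtain c where "proper_coloring q (graph V E (Tu \<union> (%p. K p (Y ! p)) ` {..<P})) c"
     "ALL Fs:Tu \<union> (%p. K p (Y ! p)) ` {..<P}. ~ uniformly_rainbow d c Fs"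
     unfolding yes_instance_def by auto
    then show thesis by (intro *[of c]) (simp_all add: proper_coloring_def)
   qed
   from mp[OF spec[OF sound] conjI[OF c(1,2)]]
   obtain av \<pi> where av: "ALL tr:Tri. tsat av tr" and \<pi>: "inj_on \<pi> {1..q}" "ALL i:{1..q}. c (Pal i) = \<pi> i"
    "ALL x:X. c (Lit x True) = \<pi> (if av x then t x else f x)" by blast
   have "EX a < \<eta>. av (slot p (Y ! p) a)" if "p < P" for p using ur[OF that \<pi>, of "Y ! p"] c(3)[OF that] by simp
   then show "EX av. (ALL tr:Tri. tsat av tr) & (ALL p < P. EX a < \<eta>. av (slot p (Y ! p) a))" using av by blast
  next
   assume "EX av. (ALL tr:Tri. tsat av tr) & (ALL p < P. EX a < \<eta>. av (slot p (Y ! p) a))"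
   then obtain av where av: "ALL tr:Tri. tsat av tr" "!!p. p < P ==> EX a < \<eta>. av (slot p (Y ! p) a)" by blast
   from mp[OF spec[OF complete] av(1)]
   obtain c where c: "proper_coloring q (graph V E Tu) c" "ALL Fs:Tu. ~ uniformly_rainbow d c Fs"
    and cp: "ALL i:{1..q}. c (Pal i) = i" "ALL x:X. c (Lit x True) = (if av x then t x else f x)"
    by blast
   have "~ uniformly_rainbow d c (K p (Y ! p))" if "p < P" for p
    using ur[OF that, of "%i. i" c av "Y ! p"] cp av(2)[OF that] by simp
   then have "ALL Fs:Tu \<union> (%p. K p (Y ! p)) ` {..<P}. ~ uniformly_rainbow d c Fs" using c(2) by auto
   then show "yes_instance d q (graph V E (Tu \<union> (%p. K p (Y ! p)) ` {..<P}))"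
    unfolding yes_instance_def using c(1) by (intro exI[of _ c] conjI) (simp_all add: proper_coloring_def)
  qed
  have "card V <= q + 12 * B" using V(6) B by linarith
  then show ?thesis
   unfolding P_def[symmetric] using V(1-3) Kval KTu Kinj yes
   by (intro exI[of _ V] exI[of _ E] exI[of _ Tu] exI[of _ K] conjI allI impI) simp_all
qed

text \<open>False is color 1 at both positions, so an edge forbids that both variables are false.
  True is color 2 at one position and 3 at the other, so that all other combinations are
  allowed.\<close>

lemma edge_composition:
  assumes sc: "sat_comp L 2 s T B X Tri slot" and q: "q >= 3"
  shows "\<exists>(V :: cvar ext gv set) E Tu K. finite V & card V <= q + 12 * B & (ALL e:E. e <= V & card e = 2) &
   (ALL Fs:Tu. length Fs = l & (ALL F:set Fs. F <= V & card F = d)) &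
   (ALL p < T ^ 2 * s. ALL b. (K p b <= V & card (K p b) = 2) & K p b \<notin> E) &
   (ALL p < T ^ 2 * s. ALL p' < T ^ 2 * s. ALL b b'. K p b = K p' b' --> p = p') &
   (ALL Y. length Y = T ^ 2 * s -->
    (yes_instance d q (graph V (E \<union> (%p. K p (Y ! p)) ` {..<T ^ 2 * s}) Tu) \<longleftrightarrow> has_block L s (T ^ 2) Y))"
proof -
  define P where "P = T ^ 2 * s"
  note sc' = sc[unfolded sat_comp_def P_def[symmetric]]
  have fin: "finite X" "finite Tri" and B: "card X <= B" "card Tri <= B" using sc' by - (elim conjE, assumption)+
  have vars: "!!tr j. tr \<in> Tri ==> fst (tlit tr j) \<in> X"
  proof -
   have "ALL tr:Tri. ALL j. fst (tlit tr j) \<in> X" using sc' by (elim conjE)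
   then show "!!tr j. tr \<in> Tri ==> fst (tlit tr j) \<in> X" by blast
  qed
  have sX': "ALL p < P. ALL b. ALL a < 2. slot p b a \<in> X & cls 2 (slot p b a) = a" using sc' by (elim conjE)
  have sX: "slot p b a \<in> X" "cls 2 (slot p b a) = a" if "p < P" "a < 2" for p b a
   using sX' that by blast+
  have sinj': "ALL p < P. ALL p' < P. ALL b b'. (ALL a < 2. slot p b a = slot p' b' a) --> p = p' & b = b'" using sc' by (elim conjE)
  have sinj: "p = p'" if "p < P" "p' < P" "!!a. a < 2 ==> slot p b a = slot p' b' a" for p p' b b'
   using sinj' that by blast
  have sem': "ALL Y. length Y = P --> ((EX av. (ALL tr:Tri. tsat av tr) & (ALL p < P. EX a < 2. av (slot p (Y ! p) a))) \<longleftrightarrow> has_block L s (T ^ 2) Y)"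
   using sc' by (elim conjE)
  have sem: "(EX av. (ALL tr:Tri. tsat av tr) & (ALL p < P. EX a < 2. av (slot p (Y ! p) a))) \<longleftrightarrow> has_block L s (T ^ 2) Y"
   if "length Y = P" for Y by (rule sem'[rule_format, OF that])
  define f where "f x = (1 :: nat)" for x :: "cvar ext"
  define t where "t x = (if cls 2 x = 0 then 2 else 3 :: nat)" for x
  have "EX V E Tu. gadget d l q X Tri f t V E Tu"
   by (rule gadget_exists[OF fin vars]) (use q in \<open>auto simp: f_def t_def\<close>)
  then obtain V E Tu where gd: "gadget d l q X Tri f t V E Tu" by blast
  have V: "finite V" "ALL e:E. e <= V & card e = 2" "ALL Fs:Tu. length Fs = l & (ALL F:set Fs. F <= V & card F = d)"
   "(%x. Lit x True) ` X <= V" "card V <= q + 2 * card X + 10 * card Tri"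
   and sep: "ALL e:E. ~ e <= range (%x. Lit x True)"
   using gd unfolding gadget_def by - (elim conjE, assumption)+
  have sound: "ALL c. proper_coloring q (graph V E Tu) c & (ALL Fs:Tu. ~ uniformly_rainbow d c Fs) -->
     (EX av \<pi>. (ALL tr:Tri. tsat av tr) & inj_on \<pi> {1..q} & (ALL i:{1..q}. c (Pal i) = \<pi> i) &
       (ALL x:X. c (Lit x True) = \<pi> (if av x then t x else f x)))"
   and complete: "ALL av. (ALL tr:Tri. tsat av tr) --> (EX c. proper_coloring q (graph V E Tu) c & (ALL Fs:Tu. ~ uniformly_rainbow d c Fs) &
     (ALL i:{1..q}. c (Pal i) = i) & (ALL x:X. c (Lit x True) = (if av x then t x else f x)))"
   using gd unfolding gadget_def by - (elim conjE, assumption)+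
  define K where "K p b = {Lit (slot p b 0) True, Lit (slot p b 1) True}" for p b
  have s01: "slot p b 0 ~= slot p' b' 1" if "p < P" "p' < P" for p b p' b'
   using sX(2)[OF that(1), of 0 b] sX(2)[OF that(2), of 1 b'] by auto
  have Kval: "K p b <= V & card (K p b) = 2" if "p < P" for p b
   using sX(1)[OF that, of 0 b] sX(1)[OF that, of 1 b] s01[OF that that, of b b] V(4) by (auto simp: K_def)
  have KE: "K p b \<notin> E" for p b using sep by (auto simp: K_def)
  have Kinj: "p = p'" if p: "p < P" "p' < P" and eq: "K p b = K p' b'" for p p' b b'
  proof (rule sinj[OF p])
   fix a :: nat assume "a < 2"
   have "slot p b 0 = slot p' b' 0" "slot p b 1 = slot p' b' 1"
    using eq s01[OF p] s01[OF p(2,1)] unfolding K_def by (auto simp: doubleton_eq_iff)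
   then show "slot p b a = slot p' b' a" using \<open>a < 2\<close> by (auto simp: less_2_cases_iff)
  qed
  have ne: "c (Lit (slot p b 0) True) ~= c (Lit (slot p b 1) True) \<longleftrightarrow> (EX a < 2. av (slot p b a))"
   if p: "p < P" and \<pi>: "inj_on \<pi> {1..q}" "ALL x:X. c (Lit x True) = \<pi> (if av x then t x else f x)"
   for c :: "cvar ext gv => nat" and \<pi> av p b
  proof -
   have "c (Lit (slot p b 0) True) = \<pi> (if av (slot p b 0) then 2 else 1)" "c (Lit (slot p b 1) True) = \<pi> (if av (slot p b 1) then 3 else 1)"
    using \<pi>(2) sX[OF p, of 0 b] sX[OF p, of 1 b] by (auto simp: t_def f_def)
   moreover have "\<pi> i = \<pi> j \<longleftrightarrow> i = j" if "i \<in> {1, 2, 3}" "j \<in> {1, 2, 3}" for i j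
    using that q by (intro inj_on_eq_iff[OF \<pi>(1)]) auto
   ultimately show ?thesis by (simp add: less_2_cases_iff ex_disj_distrib conj_disj_distribR)
  qed
  have proper: "proper_coloring q (graph V (E \<union> (%p. K p (Y ! p)) ` {..<P}) Tu) c \<longleftrightarrow> proper_coloring q (graph V E Tu) c &
    (ALL p < P. c (Lit (slot p (Y ! p) 0) True) ~= c (Lit (slot p (Y ! p) 1) True))" for Y c
  proof
   assume p: "proper_coloring q (graph V (E \<union> (%p. K p (Y ! p)) ` {..<P}) Tu) c"
   then have "ALL u v. {u, v} \<in> E \<union> (%p. K p (Y ! p)) ` {..<P} --> c u ~= c v"
    unfolding proper_coloring_def by (simp only: urf_instance.select_convs) (elim conjE)
   then have e: "c u ~= c v" if "{u, v} \<in> E \<union> (%p. K p (Y ! p)) ` {..<P}" for u v using that by blast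
   have "c (Lit (slot p (Y ! p) 0) True) ~= c (Lit (slot p (Y ! p) 1) True)" if "p < P" for p
    by (rule e, rule UnI2, rule image_eqI[of _ _ p]) (use that in \<open>simp_all add: K_def\<close>)
   moreover have "proper_coloring q (graph V E Tu) c" using p e unfolding proper_coloring_def by simp
   ultimately show "proper_coloring q (graph V E Tu) c &
    (ALL p < P. c (Lit (slot p (Y ! p) 0) True) ~= c (Lit (slot p (Y ! p) 1) True))" by simp
  next
   assume a: "proper_coloring q (graph V E Tu) c &
    (ALL p < P. c (Lit (slot p (Y ! p) 0) True) ~= c (Lit (slot p (Y ! p) 1) True))"
   have "c u ~= c v" if "{u, v} = K p (Y ! p)" "p < P" for u v p
   proof -
    have "c (Lit (slot p (Y ! p) 0) True) ~= c (Lit (slot p (Y ! p) 1) True)" using a that(2) by simp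
    then show ?thesis using that(1) unfolding K_def doubleton_eq_iff by metis
   qed
   then show "proper_coloring q (graph V (E \<union> (%p. K p (Y ! p)) ` {..<P}) Tu) c"
    using a unfolding proper_coloring_def by auto
  qed
  have yes: "yes_instance d q (graph V (E \<union> (%p. K p (Y ! p)) ` {..<P}) Tu) \<longleftrightarrow> has_block L s (T ^ 2) Y"
   if Y: "length Y = P" for Y
   unfolding sem[OF Y, symmetric]
  proof
   assume "yes_instance d q (graph V (E \<union> (%p. K p (Y ! p)) ` {..<P}) Tu)"
   then obtain c where c: "proper_coloring q (graph V E Tu) c" "ALL Fs:Tu. ~ uniformly_rainbow d c Fs"
    "!!p. p < P ==> c (Lit (slot p (Y ! p) 0) True) ~= c (Lit (slot p (Y ! p) 1) True)"
    unfolding yes_instance_def proper by auto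
   from mp[OF spec[OF sound] conjI[OF c(1,2)]]
   obtain av \<pi> where av: "ALL tr:Tri. tsat av tr" and \<pi>: "inj_on \<pi> {1..q}"
    "ALL x:X. c (Lit x True) = \<pi> (if av x then t x else f x)" by blast
   have "EX a < 2. av (slot p (Y ! p) a)" if "p < P" for p using ne[OF that \<pi>, of "Y ! p"] c(3)[OF that] by simp
   then show "EX av. (ALL tr:Tri. tsat av tr) & (ALL p < P. EX a < 2. av (slot p (Y ! p) a))" using av by blast
  next
   assume "EX av. (ALL tr:Tri. tsat av tr) & (ALL p < P. EX a < 2. av (slot p (Y ! p) a))"
   then obtain av where av: "ALL tr:Tri. tsat av tr" "!!p. p < P ==> EX a < 2. av (slot p (Y ! p) a)" by blast
   from mp[OF spec[OF complete] av(1)]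
   obtain c where c: "proper_coloring q (graph V E Tu) c" "ALL Fs:Tu. ~ uniformly_rainbow d c Fs"
    and cp: "ALL x:X. c (Lit x True) = (if av x then t x else f x)"
    by blast
   have "c (Lit (slot p (Y ! p) 0) True) ~= c (Lit (slot p (Y ! p) 1) True)" if "p < P" for p
    using ne[OF that, of "%i. i" c av "Y ! p"] cp av(2)[OF that] by simp
   then show "yes_instance d q (graph V (E \<union> (%p. K p (Y ! p)) ` {..<P}) Tu)"
    unfolding yes_instance_def proper by (intro exI[of _ c] conjI) (use c in auto)
  qed
  have "card V <= q + 12 * B" using V(5) B by linarith
  then show ?thesis
   unfolding P_def[symmetric] using V(1-3) Kval KE Kinj yes
   by (intro exI[of _ V] exI[of _ E] exI[of _ Tu] exI[of _ K] conjI allI impI) simp_all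
qed

section \<open>Composition on the level of words\<close>

lemma uniformly_rainbow_map: "uniformly_rainbow d c (map ((`) g) Fs) \<longleftrightarrow> uniformly_rainbow d (%v. c (g v)) Fs"
  by (simp add: uniformly_rainbow_def image_image)

lemma uniformly_rainbow_cong:
  assumes "!!F v. F \<in> set Fs ==> v \<in> F ==> c v = c' v"
  shows "uniformly_rainbow d c Fs \<longleftrightarrow> uniformly_rainbow d c' Fs"
proof -
  have "c ` F = c' ` F" if "F \<in> set Fs" for F using assms[OF that] by (intro image_cong refl)
  then show ?thesis unfolding uniformly_rainbow_def by simp
qed

lemma yes_graph: "yes_instance d q (graph V E Tu) \<longleftrightarrow>
   (EX c. (ALL v:V. c v \<in> {1..q}) & (ALL u v. {u, v} \<in> E --> c u ~= c v) & (ALL Fs:Tu. ~ uniformly_rainbow d c Fs))"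
  by (simp add: yes_instance_def proper_coloring_def Pi_iff)

lemma yes_instance_image:
  assumes inj: "inj_on g V" and E: "ALL e:E. e <= V & card e = 2" and Tu: "ALL Fs:Tu. ALL F:set Fs. F <= V"
  shows "yes_instance d q (graph (g ` V) ((`) g ` E) (map ((`) g) ` Tu)) \<longleftrightarrow> yes_instance d q (graph V E Tu)"
  unfolding yes_graph
proof
  assume "EX c. (ALL v:g ` V. c v \<in> {1..q}) & (ALL u v. {u, v} \<in> (`) g ` E --> c u ~= c v) &
   (ALL Fs:map ((`) g) ` Tu. ~ uniformly_rainbow d c Fs)"
  then obtain c where c: "ALL v:g ` V. c v \<in> {1..q}" "ALL u v. {u, v} \<in> (`) g ` E --> c u ~= c v"
   "ALL Fs:map ((`) g) ` Tu. ~ uniformly_rainbow d c Fs" by (elim exE conjE)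
  have "c (g u) ~= c (g v)" if "{u, v} \<in> E" for u v
  proof -
   have "{g u, g v} \<in> (`) g ` E" by (rule image_eqI[OF _ that]) simp
   then show ?thesis using c(2) by blast
  qed
  moreover have "~ uniformly_rainbow d (%v. c (g v)) Fs" if "Fs \<in> Tu" for Fs
   using c(3) that unfolding uniformly_rainbow_map[symmetric] by blast
  ultimately show "EX c. (ALL v:V. c v \<in> {1..q}) & (ALL u v. {u, v} \<in> E --> c u ~= c v) & (ALL Fs:Tu. ~ uniformly_rainbow d c Fs)"
   using c(1) by (intro exI[of _ "%v. c (g v)"]) simp
next
  assume "EX c. (ALL v:V. c v \<in> {1..q}) & (ALL u v. {u, v} \<in> E --> c u ~= c v) & (ALL Fs:Tu. ~ uniformly_rainbow d c Fs)"
  then obtain c where c: "ALL v:V. c v \<in> {1..q}" "ALL u v. {u, v} \<in> E --> c u ~= c v"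
   "ALL Fs:Tu. ~ uniformly_rainbow d c Fs" by (elim exE conjE)
  define c' where "c' w = c (inv_into V g w)" for w
  have c': "c' (g v) = c v" if "v \<in> V" for v using inj that by (simp add: c'_def)
  have "c' u ~= c' v" if uv: "{u, v} \<in> (`) g ` E" for u v
  proof -
   obtain e where e: "e \<in> E" "{u, v} = g ` e" using uv by blast
   then obtain a b where ab: "e = {a, b}" using E by (meson card_2_iff)
   then have "a \<in> V" "b \<in> V" "c a ~= c b" using e(1) E c(2) by auto
   then have "c' (g a) ~= c' (g b)" using c' by simp
   moreover have "{u, v} = {g a, g b}" using e(2) ab by simp
   ultimately show ?thesis unfolding doubleton_eq_iff by auto
  qed
  moreover have "~ uniformly_rainbow d c' Fs" if Fs: "Fs \<in> map ((`) g) ` Tu" for Fs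
  proof -
   obtain Gs where Gs: "Gs \<in> Tu" "Fs = map ((`) g) Gs" using Fs by blast
   have "uniformly_rainbow d (%v. c' (g v)) Gs \<longleftrightarrow> uniformly_rainbow d c Gs"
    by (rule uniformly_rainbow_cong) (use Tu Gs(1) c' in blast)
   then show ?thesis using c(3) Gs unfolding Gs(2) uniformly_rainbow_map by simp
  qed
  ultimately show "EX c. (ALL v:g ` V. c v \<in> {1..q}) & (ALL u v. {u, v} \<in> (`) g ` E --> c u ~= c v) &
   (ALL Fs:map ((`) g) ` Tu. ~ uniformly_rainbow d c Fs)"
   using c(1) c' by (intro exI[of _ c']) simp
qed

text \<open>The decoder shows that the encoding is injective on valid instances, so a word
  determines whether its instance is solvable.\<close>

lemma URF_enc_inst:
  assumes "l >= 1" "ok_inst d l n es fs"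
  shows "(enc_inst n es fs, n) \<in> URF_coloring d l q \<longleftrightarrow> yes_instance d q (inst n es fs)"
proof
  assume "(enc_inst n es fs, n) \<in> URF_coloring d l q"
  then obtain es' fs' where *: "enc_inst n es fs = enc_inst n es' fs'" "ok_inst d l n es' fs'" "yes_instance d q (inst n es' fs')"
   unfolding URF_iff by blast
  have "es' = es" using decode_correct(2)[OF assms refl] decode_correct(2)[OF assms(1) *(2) refl] *(1) by simp
  moreover have "fs' = fs" using decode_correct(3)[OF assms refl] decode_correct(3)[OF assms(1) *(2) refl] *(1) by simp
  ultimately show "yes_instance d q (inst n es fs)" using *(3) by simp
qed (use assms URF_iff in blast)

text \<open>The numbering of the vertices is fixed before the lists of constraints are given. Each
  constraint therefore has a word of its own, and instances that share \<open>V\<close> are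
  concatenations of such words.\<close>

lemma graph_words:
  fixes V :: "'v set"
  assumes l: "l >= 1" and V: "finite V"
  shows "\<exists>(pr :: 'v set => nat \<times> nat) (lst :: 'v set => nat list). ALL el fl. distinct el & distinct fl &
    (ALL e:set el. e <= V & card e = 2) & (ALL Fs:set fl. length Fs = l & (ALL F:set Fs. F <= V & card F = d)) -->
    length (enc_inst (card V) (map pr el) (map (map lst) fl)) <= inst_bound d l (card V) &
    ((enc_inst (card V) (map pr el) (map (map lst) fl), card V) \<in> URF_coloring d l q \<longleftrightarrow>
     yes_instance d q (graph V (set el) (set fl)))"
proof -
  obtain g where "bij_betw g V {0..<card V}" using ex_bij_betw_finite_nat[OF V] by blast
  then have inj: "inj_on g V" and gV: "g ` V = {..<card V}" by (auto simp: bij_betw_def)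
  define pr where "pr e = (SOME r. {fst r, snd r} = g ` e)" for e
  define lst where "lst F = sorted_list_of_set (g ` F)" for F
  have pr: "(case pr e of (u, v) => {u, v}) = g ` e" if e2: "card e = 2" for e
  proof -
   obtain a b where "e = {a, b}" using e2 by (meson card_2_iff)
   then have "{fst (g a, g b), snd (g a, g b)} = g ` e" by simp
   from someI[of "%r. {fst r, snd r} = g ` e", OF this] show ?thesis unfolding pr_def by (simp add: case_prod_beta)
  qed
  have lst: "set (lst F) = g ` F" if "F <= V" for F using finite_subset[OF that V] by (simp add: lst_def)
  have main: "length (enc_inst (card V) (map pr el) (map (map lst) fl)) <= inst_bound d l (card V) &
    ((enc_inst (card V) (map pr el) (map (map lst) fl), card V) \<in> URF_coloring d l q \<longleftrightarrow>
     yes_instance d q (graph V (set el) (set fl)))"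
   if dist: "distinct el" "distinct fl" and el: "ALL e:set el. e <= V & card e = 2"
    and fl: "ALL Fs:set fl. length Fs = l & (ALL F:set Fs. F <= V & card F = d)" for el fl
  proof -
   have m1: "map (%(u, v). {u, v}) (map pr el) = map ((`) g) el"
    unfolding map_map comp_def using el pr by (intro map_cong refl) (auto simp: case_prod_beta)
   have m2: "map (map set) (map (map lst) fl) = map (map ((`) g)) fl"
    unfolding map_map comp_def using fl lst by (intro map_cong refl) auto
   have i1: "inj_on ((`) g) (Pow V)" using inj by (rule inj_on_image_Pow)
   have d1: "distinct (map ((`) g) el)" unfolding distinct_map
    using dist(1) el by (intro conjI inj_on_subset[OF i1]) auto
   have "inj_on (map ((`) g)) (set fl)"
   proof (rule inj_onI)
    fix Fs Gs assume "Fs \<in> set fl" "Gs \<in> set fl" "map ((`) g) Fs = map ((`) g) Gs"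
    then show "Fs = Gs" using fl by (intro map_inj_on[of "(`) g" Fs Gs] inj_on_subset[OF i1]) auto
   qed
   then have d2: "distinct (map (map ((`) g)) fl)" using dist(2) by (simp add: distinct_map)
   have ok: "ok_inst d l (card V) (map pr el) (map (map lst) fl)"
    unfolding ok_inst_def m1 m2
   proof (intro conjI d1 d2)
    show "ALL (u, v):set (map pr el). u < card V & v < card V & u ~= v"
    proof
     fix r assume "r \<in> set (map pr el)"
     then obtain e where e: "e \<in> set el" "r = pr e" by auto
     then have eV: "e <= V" "card e = 2" using el by auto
     have r: "{fst r, snd r} = g ` e" using pr[OF eV(2)] e(2) by (simp add: case_prod_beta)
     have "g ` e <= {..<card V}" using eV gV by blast
     then have "{fst r, snd r} <= {..<card V}" by (simp only: r)
     then have "fst r < card V" "snd r < card V" by simp_all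
     moreover have "card (g ` e) = 2" using eV card_image[OF inj_on_subset[OF inj]] by metis
     then have "fst r ~= snd r" unfolding r[symmetric] by auto
     ultimately show "case r of (u, v) => u < card V & v < card V & u ~= v" by (simp add: case_prod_beta)
    qed
    show "ALL Fs:set (map (map lst) fl). length Fs = l & (ALL F:set Fs. distinct F & length F = d & (ALL u:set F. u < card V))"
    proof
     fix Fs assume "Fs \<in> set (map (map lst) fl)"
     then obtain Gs where Gs: "Gs \<in> set fl" "Fs = map lst Gs" by auto
     have "distinct (lst G) & length (lst G) = d & (ALL u:set (lst G). u < card V)" if "G \<in> set Gs" for G
     proof -
      have G: "G <= V" "card G = d" using fl Gs(1) that by auto
      have "card (g ` G) = d" using G card_image[OF inj_on_subset[OF inj]] by metis
      moreover have "g ` G <= {..<card V}" using G gV by blast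
      ultimately show ?thesis using lst[OF G(1)] by (auto simp: lst_def)
     qed
     then show "length Fs = l & (ALL F:set Fs. distinct F & length F = d & (ALL u:set F. u < card V))"
      using Gs fl by auto
    qed
   qed
   have "inst (card V) (map pr el) (map (map lst) fl) = graph (g ` V) ((`) g ` set el) (map ((`) g) ` set fl)"
    unfolding inst_def m1 m2 gV by simp
   then have "yes_instance d q (inst (card V) (map pr el) (map (map lst) fl)) \<longleftrightarrow> yes_instance d q (graph V (set el) (set fl))"
    using yes_instance_image[OF inj el, of "set fl"] fl by simp
   then show ?thesis using URF_enc_inst[OF l ok] length_enc_inst[OF ok] by simp
  qed
  show ?thesis by (intro exI[of _ pr] exI[of _ lst] allI impI) (elim conjE, rule main)
qed

text \<open>Each bit of \<open>Y\<close> picks one of two fixed words. This product form allows a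
  short advice to describe the exponentially many composed instances at once.\<close>

definition sel :: "word => (nat => bool => word) => word => word => word" where
  "sel pfx W sfx Y = pfx @ concat (map (%p. W p (Y ! p)) [0..<length Y]) @ sfx"

definition word_comp :: "word set => nat => nat => nat => nat => nat => nat => word => (nat => bool => word) => word => bool" where
  "word_comp L d l q s N n pfx W sfx \<longleftrightarrow> (ALL Y. length Y = N * s --> length (sel pfx W sfx Y) <= inst_bound d l n &
    ((sel pfx W sfx Y, n) \<in> URF_coloring d l q \<longleftrightarrow> has_block L s N Y))"

section \<open>Composed graphs as selections of words\<close>

lemma finite_tuples: "finite V ==> ALL Fs:Tu. length Fs = l & (ALL F:set Fs. F <= V & card F = d) ==> finite Tu"
  by (rule finite_subset[of _ "{Fs. set Fs <= Pow V & length Fs = l}"]) (auto intro: finite_lists_length_eq)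

lemma finite_edges: "finite V ==> ALL e:E. e <= V & card e = 2 ==> finite E"
  by (rule finite_subset[of _ "Pow V"]) auto

lemma distinct_new:
  assumes "distinct xs" "!!p p'. p < P ==> p' < P ==> k p = k p' ==> p = p'" "!!p. p < P ==> k p \<notin> set xs"
  shows "distinct (xs @ map k [0..<P])"
  using assms by (auto simp: distinct_map inj_on_def)

lemma word_comp_tuples:
  assumes l: "l >= 1" and V: "finite (V :: 'v set)" "ALL e:E. e <= V & card e = 2"
    "ALL Fs:Tu. length Fs = l & (ALL F:set Fs. F <= V & card F = d)"
   and K: "ALL p < N * s. ALL b. (length (K p b) = l & (ALL F:set (K p b). F <= V & card F = d)) & K p b \<notin> Tu"
    "ALL p < N * s. ALL p' < N * s. ALL b b'. K p b = K p' b' --> p = p'"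
   and yes: "ALL Y. length Y = N * s -->
    (yes_instance d q (graph V E (Tu \<union> (%p. K p (Y ! p)) ` {..<N * s})) \<longleftrightarrow> has_block L s N Y)"
  shows "EX pfx W sfx. word_comp L d l q s N (card V) pfx W sfx"
proof -
  obtain el where el: "set el = E" "distinct el" using finite_distinct_list[OF finite_edges[OF V(1,2)]] by blast
  obtain tl where tl: "set tl = Tu" "distinct tl" using finite_distinct_list[OF finite_tuples[OF V(1,3)]] by blast
  obtain pr lst where gw: "ALL el fl. distinct el & distinct fl &
    (ALL e:set el. e <= V & card e = 2) & (ALL Fs:set fl. length Fs = l & (ALL F:set Fs. F <= V & card F = d)) -->
    length (enc_inst (card V) (map pr el) (map (map lst) fl)) <= inst_bound d l (card V) &
    ((enc_inst (card V) (map pr el) (map (map lst) fl), card V) \<in> URF_coloring d l q \<longleftrightarrow>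
     yes_instance d q (graph V (set el) (set fl)))" using graph_words[OF l V(1), of d q] by (elim exE)
  let ?e3 = "enc_list (enc_list enc_nat)"
  define pfx where "pfx = enc_nat (card V) @ enc_list (%(u, v). enc_nat u @ enc_nat v) (map pr el) @
    concat (map (%Fs. True # ?e3 (map lst Fs)) tl)"
  define W where "W p b = True # ?e3 (map lst (K p b))" for p b
  have "length (sel pfx W [False] Y) <= inst_bound d l (card V) &
    ((sel pfx W [False] Y, card V) \<in> URF_coloring d l q \<longleftrightarrow> has_block L s N Y)" if Y: "length Y = N * s" for Y
  proof -
   let ?fl = "tl @ map (%p. K p (Y ! p)) [0..<N * s]"
   have "sel pfx W [False] Y = enc_inst (card V) (map pr el) (map (map lst) ?fl)"
    by (simp add: sel_def enc_inst_def enc_list_def pfx_def W_def Y comp_def)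
   moreover have "distinct el & distinct ?fl &
    (ALL e:set el. e <= V & card e = 2) & (ALL Fs:set ?fl. length Fs = l & (ALL F:set Fs. F <= V & card F = d))"
   proof (intro conjI)
    show "distinct ?fl" by (rule distinct_new[OF tl(2)]) (use K tl(1) in blast)+
    show "ALL Fs:set ?fl. length Fs = l & (ALL F:set Fs. F <= V & card F = d)"
     unfolding set_append ball_Un using V(3) K(1) tl(1) by simp
   qed (use el V(2) in auto)
   moreover have "set ?fl = Tu \<union> (%p. K p (Y ! p)) ` {..<N * s}" using tl(1) by (simp add: atLeast0LessThan)
   ultimately show ?thesis using gw[rule_format, of el ?fl] yes Y el(1) by simp
  qed
  then show ?thesis unfolding word_comp_def by blast
qed

lemma word_comp_edges:
  assumes l: "l >= 1" and V: "finite (V :: 'v set)" "ALL e:E. e <= V & card e = 2"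
    "ALL Fs:Tu. length Fs = l & (ALL F:set Fs. F <= V & card F = d)"
   and K: "ALL p < N * s. ALL b. (K p b <= V & card (K p b) = 2) & K p b \<notin> E"
    "ALL p < N * s. ALL p' < N * s. ALL b b'. K p b = K p' b' --> p = p'"
   and yes: "ALL Y. length Y = N * s -->
    (yes_instance d q (graph V (E \<union> (%p. K p (Y ! p)) ` {..<N * s}) Tu) \<longleftrightarrow> has_block L s N Y)"
  shows "EX pfx W sfx. word_comp L d l q s N (card V) pfx W sfx"
proof -
  obtain el where el: "set el = E" "distinct el" using finite_distinct_list[OF finite_edges[OF V(1,2)]] by blast
  obtain tl where tl: "set tl = Tu" "distinct tl" using finite_distinct_list[OF finite_tuples[OF V(1,3)]] by blast
  obtain pr lst where gw: "ALL el fl. distinct el & distinct fl &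
    (ALL e:set el. e <= V & card e = 2) & (ALL Fs:set fl. length Fs = l & (ALL F:set Fs. F <= V & card F = d)) -->
    length (enc_inst (card V) (map pr el) (map (map lst) fl)) <= inst_bound d l (card V) &
    ((enc_inst (card V) (map pr el) (map (map lst) fl), card V) \<in> URF_coloring d l q \<longleftrightarrow>
     yes_instance d q (graph V (set el) (set fl)))" using graph_words[OF l V(1), of d q] by (elim exE)
  let ?e2 = "%(u, v). enc_nat u @ enc_nat v"
  define pfx where "pfx = enc_nat (card V) @ concat (map (%e. True # ?e2 (pr e)) el)"
  define W where "W p b = True # ?e2 (pr (K p b))" for p b
  \<comment> \<open>The edge list comes before the tuples, so the suffix starts with the
    \<open>False\<close> that closes it.\<close>
  define sfx where "sfx = [False] @ enc_list (enc_list (enc_list enc_nat)) (map (map lst) tl)"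
  have "length (sel pfx W sfx Y) <= inst_bound d l (card V) &
    ((sel pfx W sfx Y, card V) \<in> URF_coloring d l q \<longleftrightarrow> has_block L s N Y)" if Y: "length Y = N * s" for Y
  proof -
   let ?el = "el @ map (%p. K p (Y ! p)) [0..<N * s]"
   have "sel pfx W sfx Y = enc_inst (card V) (map pr ?el) (map (map lst) tl)"
    by (simp add: sel_def enc_inst_def enc_list_def pfx_def W_def sfx_def Y comp_def)
   moreover have "distinct ?el & distinct tl &
    (ALL e:set ?el. e <= V & card e = 2) & (ALL Fs:set tl. length Fs = l & (ALL F:set Fs. F <= V & card F = d))"
   proof (intro conjI)
    show "distinct ?el" by (rule distinct_new[OF el(2)]) (use K el(1) in blast)+
    show "ALL e:set ?el. e <= V & card e = 2"
     unfolding set_append ball_Un using V(2) K(1) el(1) by simp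
   qed (use tl V(3) in auto)
   moreover have "set ?el = E \<union> (%p. K p (Y ! p)) ` {..<N * s}" using el(1) by (simp add: atLeast0LessThan)
   ultimately show ?thesis using gw[rule_format, of ?el tl] yes Y tl(1) by simp
  qed
  then show ?thesis unfolding word_comp_def by blast
qed

theorem word_composition:
  assumes L: "L \<in> NP" and l: "l >= 1" and \<eta>: "\<eta> >= 1"
   and cs: "(EX S g. pattern d l q S g & card S = \<eta> &
     (q >= 3 \<or> (q = 2 & (ALL x:S. snd x = 0 & g x = 2) & (d = 1 & l >= 3 \<or> d = 2 & l >= 2)))) \<or> (\<eta> = 2 & q >= 3)"
  shows "EX c a. ALL s T. T >= 1 --> (EX n pfx W sfx. n <= c * T * (s + 2) ^ a & word_comp L d l q s (T ^ \<eta>) n pfx W sfx)"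
proof -
  obtain c a where ca: "!!s T. T >= 1 ==> EX X Tri slot. sat_comp L \<eta> s T (c * T * (s + 2) ^ a) X Tri slot"
   using sat_composition[OF L \<eta>] by blast
  have main: "EX n pfx W sfx. n <= (q + 12 * c) * T * (s + 2) ^ a & word_comp L d l q s (T ^ \<eta>) n pfx W sfx" if T: "T >= 1" for s T
  proof -
   obtain X Tri slot where sc: "sat_comp L \<eta> s T (c * T * (s + 2) ^ a) X Tri slot" using ca[OF T] by blast
   have "EX n pfx W sfx. n <= q + 12 * (c * T * (s + 2) ^ a) & word_comp L d l q s (T ^ \<eta>) n pfx W sfx"
   proof (rule disjE[OF cs])
    assume "EX S g. pattern d l q S g & card S = \<eta> &
     (q >= 3 \<or> (q = 2 & (ALL x:S. snd x = 0 & g x = 2) & (d = 1 & l >= 3 \<or> d = 2 & l >= 2)))"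
    then obtain S g where S: "pattern d l q S g" "card S = \<eta>" and
     qc: "q >= 3 \<or> (q = 2 & (ALL x:S. snd x = 0 & g x = 2) & (d = 1 & l >= 3 \<or> d = 2 & l >= 2))" by (elim exE conjE)
    obtain V E Tu K where *: "finite V" "card V <= q + 12 * (c * T * (s + 2) ^ a)" "ALL e:E. e <= (V :: cvar ext gv set) & card e = 2"
     "ALL Fs:Tu. length Fs = l & (ALL F:set Fs. F <= V & card F = d)"
     "ALL p < T ^ \<eta> * s. ALL b. (length (K p b) = l & (ALL F:set (K p b). F <= V & card F = d)) & K p b \<notin> Tu"
     "ALL p < T ^ \<eta> * s. ALL p' < T ^ \<eta> * s. ALL b b'. K p b = K p' b' --> p = p'"
     "ALL Y. length Y = T ^ \<eta> * s -->
      (yes_instance d q (graph V E (Tu \<union> (%p. K p (Y ! p)) ` {..<T ^ \<eta> * s})) \<longleftrightarrow> has_block L s (T ^ \<eta>) Y)"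
     using tuple_composition[OF S sc qc] by (elim exE conjE)
    from word_comp_tuples[OF l *(1,3-7)] *(2) show ?thesis by (elim exE) (intro exI conjI)
   next
    assume "\<eta> = 2 & q >= 3"
    then have e: "\<eta> = 2" and qc: "q >= 3" by simp_all
    obtain V E Tu K where *: "finite V" "card V <= q + 12 * (c * T * (s + 2) ^ a)" "ALL e:E. e <= (V :: cvar ext gv set) & card e = 2"
     "ALL Fs:Tu. length Fs = l & (ALL F:set Fs. F <= V & card F = d)"
     "ALL p < T ^ 2 * s. ALL b. (K p b <= V & card (K p b) = 2) & K p b \<notin> E"
     "ALL p < T ^ 2 * s. ALL p' < T ^ 2 * s. ALL b b'. K p b = K p' b' --> p = p'"
     "ALL Y. length Y = T ^ 2 * s -->
      (yes_instance d q (graph V (E \<union> (%p. K p (Y ! p)) ` {..<T ^ 2 * s}) Tu) \<longleftrightarrow> has_block L s (T ^ 2) Y)"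
     using edge_composition[OF sc[unfolded e] qc, of l d] by (elim exE conjE)
    from word_comp_edges[OF l *(1,3-7)] *(2) show ?thesis unfolding e by (elim exE) (intro exI conjI)
   qed
   then obtain n pfx W sfx where n: "n <= q + 12 * (c * T * (s + 2) ^ a)" "word_comp L d l q s (T ^ \<eta>) n pfx W sfx"
    by (elim exE conjE)
   have "1 <= T * (s + 2) ^ a" using T by simp
   then have "q * 1 <= q * (T * (s + 2) ^ a)" by (rule mult_left_mono) simp
   then have "n <= q * (T * (s + 2) ^ a) + 12 * (c * T * (s + 2) ^ a)" using n(1) by linarith
   then have "n <= (q + 12 * c) * T * (s + 2) ^ a" by (simp only: distrib_right mult.assoc)
   then show ?thesis using n(2) by (intro exI conjI)
  qed
  show ?thesis by (rule exI, rule exI, rule allI, rule allI, rule impI, rule main)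
qed

section \<open>Compressions and advice\<close>

subsection \<open>Covering by fibres\<close>

text \<open>Otherwise every projection of every fibre has at most \<open>M / 2\<close> elements,
  where \<open>M = card S - 1\<close>. A fibre then has at most \<open>(M / 2) ^ N\<close> elements,
  and the at most \<open>2 ^ N\<close> fibres cover at most \<open>M ^ N\<close> of the
  \<open>card S ^ N\<close> tuples.\<close>

lemma large_projection:
  fixes F :: "'a list => 'z"
  assumes S: "finite S" "S ~= {}" and N: "N >= 1"
   and im: "F ` {ys. set ys <= S & length ys = N} <= Z" "finite Z" "card Z <= 2 ^ N"
  shows "EX z. EX j < N. card S <= 2 * card {ys ! j | ys. set ys <= S & length ys = N & F ys = z}"
proof (rule ccontr)
  assume neg: "~ ?thesis"
  define A where "A = {ys. set ys <= S & length ys = N}"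
  define P where "P z j = {ys ! j | ys. set ys <= S & length ys = N & F ys = z}" for z j
  define M where "M = card S - 1"
  have "card S ~= 0" using S by simp
  then have M: "card S = M + 1" by (simp add: M_def)
  have small: "2 * card (P z j) <= M" if "j < N" for z j
  proof -
   have "~ card S <= 2 * card (P z j)" using neg that unfolding P_def by blast
   then show ?thesis using M by linarith
  qed
  have finA: "finite A" "card A = card S ^ N"
   unfolding A_def using S(1) by (simp_all add: finite_lists_length_eq card_lists_length_eq)
  have PS: "P z j <= S" if "j < N" for z j
   using that unfolding P_def by (auto dest: nth_mem)
  have fib: "2 ^ N * card {ys \<in> A. F ys = z} <= M ^ N" for z
  proof -
   let ?r = "%ys. restrict (nth ys) {..<N}"
   have "inj_on ?r {ys \<in> A. F ys = z}"
   proof (rule inj_onI)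
    fix ys ys' assume a: "ys \<in> {ys \<in> A. F ys = z}" "ys' \<in> {ys \<in> A. F ys = z}" "?r ys = ?r ys'"
    show "ys = ys'"
    proof (rule nth_equalityI)
     show "length ys = length ys'" using a(1,2) by (simp add: A_def)
     fix i assume "i < length ys"
     then have "i < N" using a(1) by (simp add: A_def)
     then show "ys ! i = ys' ! i" using fun_cong[OF a(3), of i] by simp
    qed
   qed
   moreover have "?r ` {ys \<in> A. F ys = z} <= PiE {..<N} (P z)"
    unfolding A_def P_def by (intro image_subsetI PiE_I) auto
   moreover have "finite (PiE {..<N} (P z))"
    by (intro finite_PiE) (use finite_subset[OF PS S(1)] in auto)
   ultimately have "card {ys \<in> A. F ys = z} <= card (PiE {..<N} (P z))" by (rule card_inj_on_le)
   also have "... = (\<Prod>j < N. card (P z j))" by (simp add: card_PiE)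
   finally have "2 ^ N * card {ys \<in> A. F ys = z} <= 2 ^ N * (\<Prod>j < N. card (P z j))" by simp
   also have "... = (\<Prod>j < N. 2 * card (P z j))" by (simp add: prod.distrib)
   also have "... <= (\<Prod>j < N. M)" by (intro prod_mono) (use small in auto)
   finally show ?thesis by simp
  qed
  have "A <= (\<Union>z \<in> Z. {ys \<in> A. F ys = z})" using im(1) by (auto simp: A_def)
  then have "card A <= card (\<Union>z \<in> Z. {ys \<in> A. F ys = z})" using im(2) finA by (intro card_mono) auto
  also have "... <= (\<Sum>z \<in> Z. card {ys \<in> A. F ys = z})" by (rule card_UN_le[OF im(2)])
  finally have "2 ^ N * card A <= (\<Sum>z \<in> Z. 2 ^ N * card {ys \<in> A. F ys = z})" by (simp add: sum_distrib_left[symmetric])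
  also have "... <= (\<Sum>z \<in> Z. M ^ N)" by (intro sum_mono fib)
  also have "... = card Z * M ^ N" by simp
  also have "... <= 2 ^ N * M ^ N" using im(3) by (intro mult_right_mono) auto
  finally have "card S ^ N <= M ^ N" using finA(2) by simp
  moreover have "M ^ N < (M + 1) ^ N" using N by (intro power_strict_mono) auto
  ultimately show False using M by simp
qed

text \<open>Greedy halving: the pair found by \<open>large_projection\<close> covers at least half
  of the remaining set, so a set of fewer than \<open>2 ^ r\<close> elements is exhausted after at
  most \<open>r\<close> pairs. The covering tuples may use all of \<open>U\<close>, which stays
  fixed in the induction.\<close>

lemma projection_cover:
  fixes F :: "'a list => 'z"
  assumes N: "N >= 1" and im: "F ` {ys. set ys <= U & length ys = N} <= Z" "finite Z" "card Z <= 2 ^ N"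
   and S: "finite S" "S <= U" "card S < 2 ^ r"
  shows "EX I :: ('z \<times> nat) list. length I <= r &
   (ALL it:set I. snd it < N & (EX ys. set ys <= U & length ys = N & F ys = fst it)) &
   (ALL x:S. EX it:set I. EX ys. set ys <= U & length ys = N & F ys = fst it & ys ! snd it = x)"
  using S
proof (induction r arbitrary: S)
  case 0
  then show ?case by (intro exI[of _ "[]"]) simp
next
  case (Suc r)
  show ?case
  proof (cases "S = {}")
   case True
   then show ?thesis by (intro exI[of _ "[]"]) simp
  next
   case False
   have "F ` {ys. set ys <= S & length ys = N} <= Z" using im(1) Suc.prems(2) by blast
   from large_projection[OF Suc.prems(1) False N this im(2,3)]
   obtain z j where j: "j < N" and c: "card S <= 2 * card {ys ! j | ys. set ys <= S & length ys = N & F ys = z}" by blast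
   define C where "C = {ys ! j | ys. set ys <= S & length ys = N & F ys = z}"
   have CS: "C <= S" using j unfolding C_def by (auto dest: nth_mem)
   then have "card (S - C) = card S - card C" using Suc.prems(1) finite_subset by (intro card_Diff_subset) auto
   then have "card (S - C) < 2 ^ r" using c Suc.prems(3) unfolding C_def[symmetric] by simp
   then obtain I :: "('z \<times> nat) list" where I: "length I <= r"
    "ALL it:set I. snd it < N & (EX ys. set ys <= U & length ys = N & F ys = fst it)"
    "ALL x:S - C. EX it:set I. EX ys. set ys <= U & length ys = N & F ys = fst it & ys ! snd it = x"
    using Suc.IH[of "S - C"] Suc.prems by blast
   have "card S ~= 0" using False Suc.prems(1) by simp
   then have "C ~= {}" using c unfolding C_def[symmetric] by auto
   then have zU: "EX ys. set ys <= U & length ys = N & F ys = z" using Suc.prems(2) unfolding C_def by blast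
   have xC: "EX ys. set ys <= U & length ys = N & F ys = z & ys ! j = x" if "x \<in> C" for x
    using that Suc.prems(2) unfolding C_def by blast
   show ?thesis
   proof (intro exI[of _ "(z, j) # I"] conjI ballI)
    show "length ((z, j) # I) <= Suc r" using I(1) by simp
    fix it assume "it \<in> set ((z, j) # I)"
    then have "it = (z, j) \<or> it \<in> set I" by simp
    then show "snd it < N" "EX ys. set ys <= U & length ys = N & F ys = fst it" using I(2) j zU by auto
   next
    fix x assume x: "x \<in> S"
    show "EX it:set ((z, j) # I). EX ys. set ys <= U & length ys = N & F ys = fst it & ys ! snd it = x"
    proof (cases "x \<in> C")
     case True
     show ?thesis by (rule bexI[of _ "(z, j)"]) (use xC[OF True] in simp_all)
    next
     case False
     then have "EX it:set I. EX ys. set ys <= U & length ys = N & F ys = fst it & ys ! snd it = x" using I(3) x by blast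
     then show ?thesis by (elim bexE) (rule bexI, assumption, simp)
    qed
   qed
  qed
qed

lemma sum_power2_le: "(\<Sum>i \<le> H. (2 :: nat) ^ i) <= 2 ^ (H + 1)"
  by (induction H) auto

lemma card_outputs:
  "finite {z :: word \<times> nat. length (fst z) + snd z <= H} & card {z :: word \<times> nat. length (fst z) + snd z <= H} <= 2 ^ (2 * H + 1)"
proof -
  let ?B = "{w :: word. set w <= UNIV & length w <= H} \<times> {..H}"
  have sub: "{z :: word \<times> nat. length (fst z) + snd z <= H} <= ?B" by auto
  have finw: "finite {w :: word. set w <= UNIV & length w <= H}" by (rule finite_lists_length_le) simp
  then have fin: "finite ?B" by (rule finite_cartesian_product) simp
  have "card ?B = (\<Sum>i \<le> H. 2 ^ i) * (H + 1)"
   unfolding card_cartesian_product by (subst card_lists_length_le) (simp_all add: card_UNIV_bool)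
  also have "... <= 2 ^ (H + 1) * 2 ^ H"
   using sum_power2_le[of H] by (intro mult_mono) (auto simp: Suc_leI)
  also have "... = 2 ^ (2 * H + 1)" unfolding power_add[symmetric] by (rule arg_cong[of _ _ "power 2"]) simp
  finally have "card ?B <= 2 ^ (2 * H + 1)" .
  then show ?thesis using card_mono[OF fin sub] finite_subset[OF sub fin] by linarith
qed

subsection \<open>The verifier\<close>

definition unlist_step :: "word \<times> word list => bool => word \<times> word list" where
  "unlist_step r b = (if fst r = [] then r else (snd (usplit (fst r)), snd r @ [fst (usplit (fst r))]))"

text \<open>A total inverse of the list encoding; each step consumes at least one letter.\<close>

definition unlist :: "word => word list" where
  "unlist u = snd (foldl unlist_step (u, []) u)"

lemma enc_pair_not_Nil: "enc_pair (x, y) ~= []"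
  by (simp add: enc_pair_def)

lemma foldl_unlist: "length xs <= length ys ==> foldl unlist_step (list_e raw xs, acc) ys = ([], acc @ xs)"
proof (induction ys arbitrary: xs acc)
  case (Cons y ys)
  show ?case
  proof (cases xs)
   case Nil
   then show ?thesis using Cons.IH[of "[]" acc] by (simp add: unlist_step_def)
  next
   case (Cons x xs')
   then show ?thesis using Cons.IH[of xs' "acc @ [x]"] Cons.prems by (simp add: unlist_step_def raw_def enc_pair_not_Nil)
  qed
qed simp

lemma unlist_list_e [simp]: "unlist (list_e raw xs) = xs"
proof -
  have "length xs <= length (list_e raw xs)" by (induction xs) (auto simp: raw_def)
  from foldl_unlist[OF this, of "[]"] show ?thesis by (simp add: unlist_def)
qed

lemma foldl_unlist_bound:
  "length u <= n ==> ALL w:set acc. length w <= n ==>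
   length (fst (foldl unlist_step (u, acc) bs)) <= n & length (snd (foldl unlist_step (u, acc) bs)) <= length acc + length bs &
   (ALL w:set (snd (foldl unlist_step (u, acc) bs)). length w <= n)"
proof (induction bs arbitrary: u acc)
  case (Cons b bs)
  show ?case
  proof (cases "u = []")
   case True
   then have st: "foldl unlist_step (u, acc) (b # bs) = foldl unlist_step (u, acc) bs" by (simp add: unlist_step_def)
   have "length acc + length bs <= length acc + length (b # bs)" by simp
   then show ?thesis unfolding st using Cons.IH[OF Cons.prems] order_trans by blast
  next
   case False
   have "length (snd (usplit u)) <= n" "length (fst (usplit u)) <= n" using length_usplit[of u] Cons.prems(1) by auto
   moreover from this have "ALL w:set (acc @ [fst (usplit u)]). length w <= n" using Cons.prems(2) by simp
   ultimately have ih: "length (fst (foldl unlist_step (snd (usplit u), acc @ [fst (usplit u)]) bs)) <= n &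
    length (snd (foldl unlist_step (snd (usplit u), acc @ [fst (usplit u)]) bs)) <= length (acc @ [fst (usplit u)]) + length bs &
    (ALL w:set (snd (foldl unlist_step (snd (usplit u), acc @ [fst (usplit u)]) bs)). length w <= n)"
    by (intro Cons.IH)
   have "unlist_step (u, acc) b = (snd (usplit u), acc @ [fst (usplit u)])" using False by (simp add: unlist_step_def)
   then have st: "foldl unlist_step (u, acc) (b # bs) = foldl unlist_step (snd (usplit u), acc @ [fst (usplit u)]) bs"
    by (simp only: foldl_Cons)
   have e: "length (acc @ [fst (usplit u)]) + length bs = length acc + length (b # bs)" by simp
   show ?thesis unfolding st using ih unfolding e .
  qed
qed simp

lemma pt_unlist: "pt c raw f ==> pt c (list_e raw) (%x. unlist (f x))"
proof (rule pt_comp[where f = f])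
  let ?b = "prod_e raw (list_e raw)"
  have "pt raw ?b (%u. foldl unlist_step (u, []) u)"
  proof (rule pt_foldl[where stp = "%_. unlist_step" and a = bool_e and
     G = "%u. 2 * length u + 2 + length u * (2 * length u + 2)"])
   let ?X = "prod_e raw (prod_e ?b bool_e)"
   have R: "pt ?X ?b (%p. fst (snd p))" by (rule pt_fst, rule pt_snd, rule pt_id)
   show "pt ?X ?b (%p. unlist_step (fst (snd p)) (snd (snd p)))"
    unfolding unlist_step_def
    by (rule pt_if[OF pt_null'[OF pt_bools[OF pt_fst[OF R]]] R pt_pair[OF pt_comp[OF pt_usplit(2) pt_fst[OF R]]
      pt_append[OF pt_snd[OF R] pt_cons[OF pt_comp[OF pt_usplit(1) pt_fst[OF R]] pt_const]]]])
   show "pt raw ?b (%u. (u, []))" by (rule pt_pair[OF pt_id pt_const])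
   show "pt raw (list_e bool_e) (%u. u)" by (rule pt_bools[OF pt_id])
   show "polyb (%u. length (raw u)) (%u. 2 * length u + 2 + length u * (2 * length u + 2))"
    unfolding raw_def by (intro polyb_intros)
   fix u :: word and j assume j: "j <= length u"
   let ?r = "foldl unlist_step (u, []) (take j u)"
   have r: "length (fst ?r) <= length u" "length (snd ?r) <= length u" "ALL w:set (snd ?r). length w <= length u"
    using foldl_unlist_bound[of u "length u" "[]" "take j u"] j by auto
   have "length (list_e raw (snd ?r)) <= length (snd ?r) * (2 * length u + 2)"
    by (rule length_list_e_le) (use r(3) in \<open>simp add: raw_def\<close>)
   also have "... <= length u * (2 * length u + 2)" using r(2) by (intro mult_right_mono) auto
   finally show "length (?b ?r) <= 2 * length u + 2 + length u * (2 * length u + 2)"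
    using r(1) by (simp add: prod_e_def raw_def)
  qed
  from pt_snd[OF this] show "pt raw (list_e raw) unlist" unfolding unlist_def .
qed

text \<open>The advice consists of five words: the number of vertices in unary, the prefix, the
  suffix, the pairs of words for the bits, and the items.\<close>

definition v_ws :: "word \<times> word => word list" where
  "v_ws p = unlist (snd (usplit (fst p)))"

definition v_ents :: "word \<times> word => word list" where
  "v_ents p = unlist (nthd [] (v_ws p) 3)"

definition v_word :: "word \<times> word => word" where
  "v_word p = nthd [] (v_ws p) 1 @ concat (map (%i. if nthd False (snd p) i then snd (usplit (nthd [] (v_ents p) i))
    else fst (usplit (nthd [] (v_ents p) i))) [0..<length (snd p)]) @ nthd [] (v_ws p) 2"

definition v_out :: "(word \<times> nat => word \<times> nat) => word \<times> word => word" where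
  "v_out f p = enc_param (f (v_word p, length (nthd [] (v_ws p) 0)))"

text \<open>
  On input \<open>(x, adv)\<close> and witness \<open>Y\<close>, the advice describes the composed instance of \<open>Y\<close> and a list
  of items, each consisting of an output of the compression on a no-instance and a position in \<open>Y\<close>.
  The verifier accepts if for some item \<open>x\<close> occurs in \<open>Y\<close> at that position and the
  compression maps the composed instance to that output, which shows that \<open>x\<close> is a no-instance.
\<close>

definition verif :: "(word \<times> nat => word \<times> nat) => word \<times> word => bool" where
  "verif f p \<longleftrightarrow> (EX it:set (unlist (nthd [] (v_ws p) 4)).
    (length (snd p) = length (v_ents p) & fst (usplit it) = v_out f p) &
    (ALL k:set [0..<length (fst (usplit (fst p)))].
     nthd False (snd p) (length (snd (usplit it)) + k) = nthd False (fst (usplit (fst p))) k))"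

lemma pt_verif:
  assumes f: "pt enc_param enc_param f"
  shows "pt (prod_e raw raw) bool_e (verif f)"
proof -
  let ?C = "prod_e raw raw"
  have W: "pt ?C raw (%p. fst p)" and Y: "pt ?C raw (%p. snd p)" by (rule pt_fst[OF pt_id], rule pt_snd[OF pt_id])
  have x: "pt ?C raw (%p. fst (usplit (fst p)))" by (rule pt_comp[OF pt_usplit(1) W])
  have ws: "pt ?C (list_e raw) v_ws" unfolding v_ws_def by (rule pt_unlist[OF pt_comp[OF pt_usplit(2) W]])
  have wi: "pt ?C raw (%p. nthd [] (v_ws p) i)" for i by (rule pt_nthd[OF pt_const ws])
  have ents: "pt ?C (list_e raw) v_ents" unfolding v_ents_def by (rule pt_unlist[OF wi])
  let ?D = "prod_e ?C nat_e"
  have e: "pt ?D raw (%r. nthd [] (v_ents (fst r)) (snd r))"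
   by (rule pt_nthd[OF pt_snd[OF pt_id] pt_comp[OF ents pt_fst[OF pt_id]]])
  have "pt ?D raw (%r. if nthd False (snd (fst r)) (snd r) then snd (usplit (nthd [] (v_ents (fst r)) (snd r)))
    else fst (usplit (nthd [] (v_ents (fst r)) (snd r))))"
   by (rule pt_if[OF pt_nthd[OF pt_snd[OF pt_id] pt_bools[OF pt_comp[OF Y pt_fst[OF pt_id]]]]
     pt_comp[OF pt_usplit(2) e] pt_comp[OF pt_usplit(1) e]])
  from pt_raw_of_bools[OF pt_concat_map[OF pt_bools[OF this] pt_upt0[OF pt_length_list[OF pt_bools[OF Y]]]]]
  have m: "pt ?C raw (%p. concat (map (%i. if nthd False (snd p) i then snd (usplit (nthd [] (v_ents p) i))
    else fst (usplit (nthd [] (v_ents p) i))) [0..<length (snd p)]))" .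
  have word: "pt ?C raw v_word" unfolding v_word_def by (rule pt_append_raw[OF wi pt_append_raw[OF m wi]])
  have "pt ?C enc_param (%p. (v_word p, length (nthd [] (v_ws p) 0)))"
   unfolding enc_param_prod_e by (rule pt_pair[OF word pt_length_list[OF pt_bools[OF wi]]])
  from pt_raw[OF pt_comp[OF f this]] have out: "pt ?C raw (v_out f)" unfolding v_out_def .
  let ?I = "prod_e ?C raw" and ?J = "prod_e (prod_e ?C raw) nat_e"
  have c: "pt ?I ?C fst" by (rule pt_fst[OF pt_id])
  have it: "pt ?I raw snd" by (rule pt_snd[OF pt_id])
  have cJ: "pt ?J ?C (%r. fst (fst r))" and itJ: "pt ?J raw (%r. snd (fst r))" and kJ: "pt ?J nat_e (%r. snd r)"
   by (rule pt_fst[OF pt_fst[OF pt_id]], rule pt_snd[OF pt_fst[OF pt_id]], rule pt_snd[OF pt_id])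
  have "pt ?J bool_e (%r. nthd False (snd (fst (fst r))) (length (snd (usplit (snd (fst r)))) + snd r) =
    nthd False (fst (usplit (fst (fst (fst r))))) (snd r))"
   by (rule pt_eq[OF inj_bool_e pt_nthd[OF pt_add[OF pt_length_list[OF pt_bools[OF pt_comp[OF pt_usplit(2) itJ]]] kJ]
     pt_bools[OF pt_comp[OF Y cJ]]] pt_nthd[OF kJ pt_bools[OF pt_comp[OF x cJ]]]])
  from pt_list_all[OF this pt_upt0[OF pt_length_list[OF pt_bools[OF pt_comp[OF x c]]]]]
  have all: "pt ?I bool_e (%r. ALL k:set [0..<length (fst (usplit (fst (fst r))))].
     nthd False (snd (fst r)) (length (snd (usplit (snd r))) + k) = nthd False (fst (usplit (fst (fst r)))) k)" .
  have "pt ?I bool_e (%r. (length (snd (fst r)) = length (v_ents (fst r)) & fst (usplit (snd r)) = v_out f (fst r)) &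
    (ALL k:set [0..<length (fst (usplit (fst (fst r))))].
     nthd False (snd (fst r)) (length (snd (usplit (snd r))) + k) = nthd False (fst (usplit (fst (fst r)))) k))"
   by (rule pt_conj[OF pt_conj[OF pt_eq[OF inj_nat_e pt_length_list[OF pt_bools[OF pt_comp[OF Y c]]] pt_length_list[OF pt_comp[OF ents c]]]
     pt_eq[OF inj_raw pt_comp[OF pt_usplit(1) it] pt_comp[OF out c]]] all])
  from pt_list_ex[OF this pt_unlist[OF wi[of 4]]] show ?thesis unfolding verif_def .
qed

lemma block_concat:
  "ALL y:set ys. length y = s ==> m < length ys ==> take s (drop (m * s) (concat ys)) = ys ! m"
proof (induction ys arbitrary: m)
  case (Cons y ys)
  then show ?case by (cases m) auto
qed simp

lemma length_concat_blocks: "ALL y:set ys. length y = s ==> length (concat ys) = length ys * s"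
  by (induction ys) auto

section \<open>Advice for one input length\<close>

definition adv_bound :: "nat => nat => nat => nat => nat" where
  "adv_bound B n N s = 5 * (2 * (n + B + N * s * (6 * B + 6) + (s + 1) * (4 * N + 2 * (N * s) + 10)) + 2)"

lemma adv_bound_mono: "B <= B' ==> n <= n' ==> adv_bound B n N s <= adv_bound B' n' N s"
  unfolding adv_bound_def by (intro mult_left_mono add_mono order_refl) auto

text \<open>The premise \<open>2 * h n + 1 <= N\<close> limits the possible outputs to
  \<open>2 ^ N\<close>, which is what the covering of the no-instances by fibres needs.\<close>

lemma advice_for_length:
  assumes comp: "is_compression (URF_coloring d l q) Q' h f" and wc: "word_comp L d l q s N n pfx W sfx"
   and hN: "2 * h n + 1 <= N"
  shows "EX A. length A <= adv_bound (inst_bound d l n) n N s &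
   (ALL x Y. length x = s --> verif f (enc_pair (x, A), Y) --> length Y = N * s) &
   (ALL x. length x = s --> (x \<in> L \<longleftrightarrow> ~ (EX Y. verif f (enc_pair (x, A), Y))))"
proof -
  let ?B = "inst_bound d l n"
  define F where "F Y = f (sel pfx W sfx Y, n)" for Y
  have wc': "length (sel pfx W sfx Y) <= ?B" "(sel pfx W sfx Y, n) \<in> URF_coloring d l q \<longleftrightarrow> has_block L s N Y" if "length Y = N * s" for Y
   using wc that unfolding word_comp_def by blast+
  have f: "(x, k) \<in> URF_coloring d l q \<longleftrightarrow> f (x, k) \<in> Q'" "length (fst (f (x, k))) + snd (f (x, k)) <= h k" for x k
   using comp unfolding is_compression_def by blast+
  define S where "S = {x. length x = s} - L"
  have finS: "finite {x :: word. length x = s}" "card {x :: word. length x = s} = 2 ^ s"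
   using finite_lists_length_eq[of "UNIV :: bool set" s] card_lists_length_eq[of "UNIV :: bool set" s] by (simp_all add: card_UNIV_bool)
  have "card S <= 2 ^ s" unfolding S_def finS(2)[symmetric] using finS(1) by (intro card_mono) auto
  \<comment> \<open>This makes \<open>s + 1\<close> items sufficient for all no-instances of length
    \<open>s\<close>.\<close>
  then have cS: "card S < 2 ^ (s + 1)" by (rule order_le_less_trans) simp
  define Z where "Z = {z :: word \<times> nat. length (fst z) + snd z <= h n}"
  have Z: "finite Z" "card Z <= 2 ^ N"
  proof -
   show "finite Z" using card_outputs unfolding Z_def by blast
   have "card Z <= 2 ^ (2 * h n + 1)" using card_outputs unfolding Z_def by blast
   also have "... <= 2 ^ N" using hN by (intro power_increasing) auto
   finally show "card Z <= 2 ^ N" .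
  qed
  have FZ: "F Y \<in> Z" for Y unfolding F_def Z_def using f(2) by simp
  have "N >= 1" using hN by simp
  have imZ: "(%ys. F (concat ys)) ` {ys. set ys <= S & length ys = N} <= Z" using FZ by auto
  have "finite S" unfolding S_def using finS(1) by (rule finite_Diff)
  from projection_cover[where F = "%ys. F (concat ys)", OF \<open>N >= 1\<close> imZ Z this order_refl cS]
  obtain I where I: "length I <= s + 1"
   "ALL it:set I. snd it < N & (EX ys. set ys <= S & length ys = N & F (concat ys) = fst it)"
   "ALL x:S. EX it:set I. EX ys. set ys <= S & length ys = N & F (concat ys) = fst it & ys ! snd it = x"
   by (elim exE conjE)
  define ents where "ents = map (%p. enc_pair (W p False, W p True)) [0..<N * s]"
  define items where "items = map (%it. enc_pair (enc_param (fst it), replicate (snd it * s) True)) I"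
  define ws where "ws = [replicate n True, pfx, sfx, list_e raw ents, list_e raw items]"
  define A where "A = list_e raw ws"
  have vws: "v_ws (enc_pair (x, A), Y) = ws" for x Y by (simp add: v_ws_def A_def)
  have vents: "v_ents (enc_pair (x, A), Y) = ents" for x Y by (simp add: v_ents_def vws ws_def nthd_def)
  have vword: "v_word (enc_pair (x, A), Y) = sel pfx W sfx Y" if Y: "length Y = N * s" for x Y
  proof -
   have "(if nthd False Y i then snd (usplit (nthd [] ents i)) else fst (usplit (nthd [] ents i))) = W i (Y ! i)"
    if "i \<in> set [0..<length Y]" for i
   proof -
    have i: "i < length Y" "i < length ents" using that Y by (auto simp: ents_def)
    then have "nthd [] ents i = enc_pair (W i False, W i True)" by (simp add: nthd_nth ents_def)
    then show ?thesis using i by (simp add: nthd_nth)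
   qed
   then have m: "map (%i. if nthd False Y i then snd (usplit (nthd [] ents i)) else fst (usplit (nthd [] ents i))) [0..<length Y]
     = map (%p. W p (Y ! p)) [0..<length Y]" by (intro map_cong refl)
   have "nthd [] ws 1 = pfx" "nthd [] ws 2 = sfx" by (simp_all add: ws_def nthd_def)
   then show ?thesis unfolding v_word_def vws vents sel_def snd_conv m by simp
  qed
  have inj: "enc_param z = enc_param z' \<longleftrightarrow> z = z'" for z z'
   using inj_prod_e[OF inj_raw inj_nat_e] unfolding enc_param_prod_e by (auto dest: injD)
  have verif: "verif f (enc_pair (x, A), Y) \<longleftrightarrow> length Y = N * s &
    (EX it:set I. fst it = F Y & take s (drop (snd it * s) Y) = x)" if x: "length x = s" for x Y
  proof (cases "length Y = N * s")
   case True
   have out: "v_out f (enc_pair (x, A), Y) = enc_param (F Y)"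
    unfolding v_out_def vword[OF True] vws F_def by (simp add: ws_def nthd_def)
   have len: "length Y = length ents" using True by (simp add: ents_def)
   have blk: "(ALL k:set [0..<s]. nthd False Y (snd it * s + k) = nthd False x k) \<longleftrightarrow> take s (drop (snd it * s) Y) = x"
    if "it \<in> set I" for it
   proof -
    have j: "snd it < N" using I(2) that by blast
    have "nthd False Y (snd it * s + k) = take s (drop (snd it * s) Y) ! k" "nthd False x k = x ! k" if "k < s" for k
     using nth_block[OF True j that] True x that by (simp_all add: nthd_nth)
    then have "(ALL k:set [0..<s]. nthd False Y (snd it * s + k) = nthd False x k) \<longleftrightarrow>
      (ALL k < s. take s (drop (snd it * s) Y) ! k = x ! k)" by (simp, simp add: Ball_def)
    also have "... \<longleftrightarrow> take s (drop (snd it * s) Y) = x"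
     unfolding list_eq_iff_nth_eq[of "take s (drop (snd it * s) Y)"] length_block[OF True j] x by simp
    finally show ?thesis .
   qed
   have it4: "unlist (nthd [] ws 4) = items" by (simp add: ws_def nthd_def)
   have "verif f (enc_pair (x, A), Y) \<longleftrightarrow> (EX it:set I. enc_param (fst it) = enc_param (F Y) &
     (ALL k:set [0..<s]. nthd False Y (snd it * s + k) = nthd False x k))"
    unfolding verif_def vws vents out it4 items_def using len x by simp
   then show ?thesis using True blk inj by simp
  next
   case False
   then have "length Y ~= length ents" by (simp add: ents_def)
   then show ?thesis using False unfolding verif_def vents by simp
  qed
  have sound: "x \<in> L \<longleftrightarrow> ~ (EX Y. verif f (enc_pair (x, A), Y))" if x: "length x = s" for x
  proof
   assume xL: "x \<in> L"
   show "~ (EX Y. verif f (enc_pair (x, A), Y))"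
   proof
    assume "EX Y. verif f (enc_pair (x, A), Y)"
    then obtain Y it where Y: "length Y = N * s" and it: "it \<in> set I" "fst it = F Y" "take s (drop (snd it * s) Y) = x"
     unfolding verif[OF x] by blast
    obtain ys where ys: "set ys <= S" "length ys = N" "F (concat ys) = fst it" and j: "snd it < N" using I(2) it(1) by blast
    have ylen: "ALL y:set ys. length y = s" using ys(1) by (auto simp: S_def)
    have lc: "length (concat ys) = N * s" using length_concat_blocks[OF ylen] ys(2) by simp
    have "~ has_block L s N (concat ys)"
    proof
     assume "has_block L s N (concat ys)"
     then obtain i where i: "i < N" "take s (drop (i * s) (concat ys)) \<in> L" unfolding has_block_def by blast
     have "ys ! i \<in> S" using i(1) ys(1,2) nth_mem by blast
     then show False using i block_concat[OF ylen, of i] ys(2) by (simp add: S_def)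
    qed
    then have "F (concat ys) \<notin> Q'" using wc'(2)[OF lc] f(1) unfolding F_def by blast
    moreover have "has_block L s N Y" unfolding has_block_def using j it(3) xL by blast
    then have "F Y \<in> Q'" using wc'(2)[OF Y] f(1) unfolding F_def by blast
    ultimately show False using ys(3) it(2) by simp
   qed
  next
   assume n: "~ (EX Y. verif f (enc_pair (x, A), Y))"
   show "x \<in> L"
   proof (rule ccontr)
    assume "x \<notin> L"
    then have "x \<in> S" using x by (simp add: S_def)
    then obtain it ys where it: "it \<in> set I" and ys: "set ys <= S" "length ys = N" "F (concat ys) = fst it" "ys ! snd it = x"
     using I(3) by blast
    have j: "snd it < N" using I(2) it by blast
    have ylen: "ALL y:set ys. length y = s" using ys(1) by (auto simp: S_def)
    have lc: "length (concat ys) = N * s" using length_concat_blocks[OF ylen] ys(2) by simp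
    have "take s (drop (snd it * s) (concat ys)) = x" using block_concat[OF ylen, of "snd it"] j ys(2,4) by simp
    then have "verif f (enc_pair (x, A), concat ys)" unfolding verif[OF x] using lc it ys(3) by (intro conjI bexI[of _ it]) simp_all
    then show False using n by blast
   qed
  qed
  have pB: "length pfx <= ?B" "length sfx <= ?B" using wc'(1)[of "replicate (N * s) False"] by (auto simp: sel_def)
  \<comment> \<open>\<open>W p b\<close> is part of the composed instance for the constant word of
    letters \<open>b\<close>, whose length is bounded.\<close>
  have WB: "length (W p b) <= ?B" if "p < N * s" for p b
  proof -
   have "length (W p b) <= length (concat (map (%p. W p (replicate (N * s) b ! p)) [0..<N * s]))"
   proof -
    have "length (W p b) \<in> set (map length (map (%p. W p (replicate (N * s) b ! p)) [0..<N * s]))"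
     unfolding map_map using that by (auto simp: image_iff intro!: bexI[of _ p])
    then show ?thesis unfolding length_concat by (rule member_le_sum_list) simp
   qed
   also have "... <= length (sel pfx W sfx (replicate (N * s) b))" by (simp add: sel_def)
   also have "... <= ?B" by (rule wc'(1)) simp
   finally show ?thesis .
  qed
  define a1 where "a1 = N * s * (6 * ?B + 6)"
  define a2 where "a2 = (s + 1) * (4 * N + 2 * (N * s) + 10)"
  define m where "m = n + ?B + a1 + a2"
  have "length (list_e raw ents) <= length ents * (2 * (3 * ?B + 2) + 2)"
  proof (rule length_list_e_le)
   fix e assume "e \<in> set ents"
   then obtain p where p: "p < N * s" "e = enc_pair (W p False, W p True)" by (auto simp: ents_def)
   then show "length (raw e) <= 3 * ?B + 2" using WB[OF p(1), of False] WB[OF p(1), of True] by (simp add: raw_def)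
  qed
  also have "... = N * s * (6 * ?B + 6)" by (simp add: ents_def algebra_simps)
  finally have l1: "length (list_e raw ents) <= a1" unfolding a1_def .
  have "length (list_e raw items) <= length items * (2 * (2 * N + 4 + N * s) + 2)"
  proof (rule length_list_e_le)
   fix e assume "e \<in> set items"
   then obtain it where it: "it \<in> set I" "e = enc_pair (enc_param (fst it), replicate (snd it * s) True)" by (auto simp: items_def)
   then obtain ys where "F (concat ys) = fst it" "snd it < N" using I(2) by blast
   then have "length (fst (fst it)) + snd (fst it) <= h n" using FZ[of "concat ys"] by (simp add: Z_def)
   then have "length (enc_param (fst it)) <= N + 1" using hN by (simp add: enc_param_def enc_unary_def case_prod_beta)
   moreover have "snd it * s <= N * s" using \<open>snd it < N\<close> by (intro mult_right_mono) auto
   ultimately show "length (raw e) <= 2 * N + 4 + N * s"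
    unfolding raw_def it(2) length_enc_pair length_replicate by linarith
  qed
  also have "... <= (s + 1) * (2 * (2 * N + 4 + N * s) + 2)" using I(1) by (intro mult_right_mono) (simp_all add: items_def)
  also have "... = (s + 1) * (4 * N + 2 * (N * s) + 10)" by (simp add: algebra_simps)
  finally have l2: "length (list_e raw items) <= a2" unfolding a2_def .
  have "length A <= length ws * (2 * m + 2)" unfolding A_def
  proof (rule length_list_e_le)
   fix w assume "w \<in> set ws"
   then consider "w = replicate n True" | "w = pfx" | "w = sfx" | "w = list_e raw ents" | "w = list_e raw items"
    by (auto simp: ws_def)
   then show "length (raw w) <= m" by cases (use pB l1 l2 in \<open>simp_all add: raw_def m_def\<close>)
  qed
  moreover have "length ws = 5" by (simp add: ws_def)
  ultimately have "length A <= 5 * (2 * m + 2)" by (simp only:)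
  then have "length A <= adv_bound ?B n N s" by (simp only: adv_bound_def m_def a1_def a2_def)
  moreover have "length Y = N * s" if "length x = s" "verif f (enc_pair (x, A), Y)" for x Y using verif[OF that(1)] that(2) by blast
  ultimately show ?thesis using sound by (intro exI[of _ A]) simp
qed

subsection \<open>Collapse\<close>

text \<open>An estimate for all \<open>n\<close>: the additive constant pays for the finitely many
  exceptions of the asymptotic bound.\<close>

lemma bigo_powr_bound:
  assumes "(%n. real (h n)) \<in> O(%n. real n powr r)" "r <= e"
  shows "EX C H. C > 0 & H >= 0 & (ALL n. real (h n) <= C * real n powr e + H)"
proof -
  obtain C where C: "C > 0" "eventually (%n. norm (real (h n)) <= C * norm (real n powr r)) at_top"
   using landau_o.bigE[OF assms(1)] by blast
  then obtain n0 where n0: "!!n. n >= n0 ==> real (h n) <= C * real n powr r"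
   unfolding eventually_at_top_linorder by auto
  define H where "H = (\<Sum>n \<le> n0. real (h n))"
  have "real (h n) <= C * real n powr e + H" for n
  proof (cases "n <= n0")
   case True
   have "real (h n) <= H" unfolding H_def using True by (intro member_le_sum) auto
   moreover have "0 <= C * real n powr e" using C(1) by simp
   ultimately show ?thesis by linarith
  next
   case False
   then have "real (h n) <= C * real n powr r" by (intro n0) simp
   also have "... <= C * real n powr e" using C(1) False assms(2) by (intro mult_left_mono powr_mono) auto
   finally show ?thesis by (simp add: H_def sum_nonneg add_increasing2)
  qed
  moreover have "H >= 0" by (simp add: H_def sum_nonneg)
  ultimately show ?thesis using C(1) by blast
qed

lemma nat_le_power: "2 <= t ==> c <= (t :: nat) ^ c"
proof -
  assume "2 <= t"
  then have "2 ^ c <= t ^ c" by (rule power_mono) simp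
  moreover have "c < 2 ^ c" by (rule less_exp)
  ultimately show ?thesis by linarith
qed

text \<open>With \<open>t = s + 2\<close> there are at most \<open>t ^ (a + b + c)\<close> vertices,
  so the compressed size is at most of order \<open>t\<close> to the power
  \<open>(a + b + c) * e\<close> with \<open>e = \<eta> - \<delta>\<close>. Compared with
  \<open>b * \<eta>\<close> this leaves a surplus of \<open>b * \<delta>\<close> in the exponent,
  which outweighs \<open>(a + c) * e\<close> and the constants once \<open>b\<close> is
  large.\<close>

lemma composed_size:
  assumes h: "(%n. real (h n)) \<in> O(%n. real n powr (real \<eta> - \<epsilon>))" and \<epsilon>: "\<epsilon> > 0" and \<eta>: "\<eta> >= 1"
  shows "EX b. ALL s n. n <= c * (s + 2) ^ b * (s + 2) ^ a --> 2 * h n + 1 <= ((s + 2) ^ b) ^ \<eta>"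
proof -
  \<comment> \<open>The cap at 1/2 keeps the exponent \<open>e\<close> nonnegative, as monotonicity
    of the power in its base requires.\<close>
  define \<delta> where "\<delta> = min \<epsilon> (1 / 2)"
  define e where "e = real \<eta> - \<delta>"
  have \<delta>: "\<delta> > 0" "\<delta> <= \<epsilon>" "\<delta> <= 1 / 2" using \<epsilon> by (auto simp: \<delta>_def)
  have e: "e >= 0" using \<eta> \<delta>(3) by (simp add: e_def)
  obtain C H where C: "C > 0" "H >= 0" "!!n. real (h n) <= C * real n powr e + H"
   using bigo_powr_bound[OF h, of e] \<delta>(2) by (auto simp: e_def)
  obtain G :: nat where "2 * C + 2 * H + 1 <= real G" using real_arch_simple by blast
  then have G: "2 * C + 2 * H + 1 <= real t ^ G" if "2 <= t" for t :: nat
   using nat_le_power[OF that, of G] by (metis of_nat_le_iff of_nat_power order_trans)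
  obtain b :: nat where "(real G + (real a + real c) * e) / \<delta> <= real b" using real_arch_simple by blast
  then have b: "real G + (real a + real c) * e <= real b * \<delta>" using \<delta>(1) by (simp add: field_simps)
  have "2 * h n + 1 <= ((s + 2) ^ b) ^ \<eta>" if n: "n <= c * (s + 2) ^ b * (s + 2) ^ a" for s n
  proof -
   define t where "t = s + 2"
   have t: "2 <= t" "real t > 0" "1 <= real t" by (auto simp: t_def)
   have "n <= t ^ c * t ^ b * t ^ a"
    using n nat_le_power[OF t(1), of c] unfolding t_def[symmetric] by (meson mult_le_mono1 order_trans)
   then have "n <= t ^ (c + b + a)" by (simp add: power_add)
   then have "real n <= real t ^ (c + b + a)" by (metis of_nat_le_iff of_nat_power)
   then have "real n <= real t powr real (c + b + a)" unfolding powr_realpow[OF t(2)] .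
   then have "real n powr e <= (real t powr real (c + b + a)) powr e" using e by (intro powr_mono2) auto
   also have "... = real t powr (real (c + b + a) * e)" by (simp add: powr_powr)
   finally have np: "real n powr e <= real t powr (real (c + b + a) * e)" .
   define T where "T = real t powr (real (c + b + a) * e)"
   have T: "1 <= T" unfolding T_def using t(3) e by (intro ge_one_powr_ge_zero) auto
   have "C * real n powr e <= C * T" using np C(1) unfolding T_def by (intro mult_left_mono) auto
   then have "2 * real (h n) + 1 <= 2 * C * T + (2 * H + 1)" using C(3)[of n] by linarith
   also have "... <= 2 * C * T + (2 * H + 1) * T" using T C(2) mult_left_mono[of 1 T "2 * H + 1"] by simp
   also have "... = (2 * C + 2 * H + 1) * T" by (simp add: algebra_simps)
   also have "... <= real t ^ G * T" using G[OF t(1)] T by (intro mult_right_mono) auto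
   also have "... = real t powr (real G + real (c + b + a) * e)" unfolding T_def using t(2) by (simp add: powr_add powr_realpow)
   also have "... <= real t powr (real b * real \<eta>)"
   proof (intro powr_mono t(3))
    have "real G + real (c + b + a) * e = (real G + (real a + real c) * e) + real b * e" by (simp add: algebra_simps)
    also have "... <= real b * \<delta> + real b * e" using b by simp
    also have "... = real b * real \<eta>" by (simp add: e_def algebra_simps)
    finally show "real G + real (c + b + a) * e <= real b * real \<eta>" .
   qed
   also have "... = real ((t ^ b) ^ \<eta>)" using powr_realpow[OF t(2), of "b * \<eta>"] by (simp add: power_mult)
   finally have "real (2 * h n + 1) <= real ((t ^ b) ^ \<eta>)" by simp
   then show ?thesis unfolding t_def by (simp only: of_nat_le_iff)
  qed
  then show ?thesis by blast
qed

lemma compression_collapse: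
  assumes comp: "!!L. L \<in> NP ==> EX c a. ALL s T. T >= 1 --> (EX n pfx W sfx. n <= c * T * (s + 2) ^ a & word_comp L d l q s (T ^ \<eta>) n pfx W sfx)"
   and \<eta>: "\<eta> >= 1" and \<epsilon>: "\<epsilon> > 0"
   and ac: "admits_compression_of_size_O (URF_coloring d l q) (%n. real n powr (real \<eta> - \<epsilon>))"
  shows "NP <= with_poly_advice coNP"
proof
  fix L assume L: "L \<in> NP"
  obtain h Q' f where f: "is_compression (URF_coloring d l q) Q' h f"
   and h: "(%n. real (h n)) \<in> O(%n. real n powr (real \<eta> - \<epsilon>))"
   using ac unfolding admits_compression_of_size_O_def admits_compression_def by blast
  obtain c a where ca: "!!s T. T >= 1 ==> EX n pfx W sfx. n <= c * T * (s + 2) ^ a & word_comp L d l q s (T ^ \<eta>) n pfx W sfx"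
   using comp[OF L] by blast
  obtain b where b: "!!s n. n <= c * (s + 2) ^ b * (s + 2) ^ a ==> 2 * h n + 1 <= ((s + 2) ^ b) ^ \<eta>"
   using composed_size[OF h \<epsilon> \<eta>] by blast
  define N where "N s = ((s + 2) ^ b) ^ \<eta>" for s :: nat
  define n' where "n' s = c * (s + 2) ^ b * (s + 2) ^ a" for s :: nat
  have "polyb (%s. s) (%s. adv_bound (inst_bound d l (n' s)) (n' s) (N s) s)"
   unfolding adv_bound_def inst_bound_def n'_def N_def by (intro polyb_intros)
  then obtain k where k: "!!s. adv_bound (inst_bound d l (n' s)) (n' s) (N s) s <= (s + 2) ^ k" unfolding polyb_def by blast
  have adv: "EX A. length A <= (s + 2) ^ k &
   (ALL x Y. length x = s --> verif f (enc_pair (x, A), Y) --> length Y = N s * s) &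
   (ALL x. length x = s --> (x \<in> L \<longleftrightarrow> ~ (EX Y. verif f (enc_pair (x, A), Y))))" for s
  proof -
   obtain n pfx W sfx where n: "n <= n' s" and wc: "word_comp L d l q s (N s) n pfx W sfx"
    using ca[of "(s + 2) ^ b" s] unfolding n'_def N_def by auto
   have "2 * h n + 1 <= N s" using b n unfolding n'_def N_def by blast
   from advice_for_length[OF f wc this] obtain A where A: "length A <= adv_bound (inst_bound d l n) n (N s) s"
    "(ALL x Y. length x = s --> verif f (enc_pair (x, A), Y) --> length Y = N s * s) &
     (ALL x. length x = s --> (x \<in> L \<longleftrightarrow> ~ (EX Y. verif f (enc_pair (x, A), Y))))" by (elim exE conjE[where P = "length _ <= _"])
   have "length A <= (s + 2) ^ k"
    using A(1) adv_bound_mono[OF inst_bound_mono[OF n] n] k order_trans by meson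
   then show ?thesis using A(2) by (rule exI[of _ A, OF conjI])
  qed
  then obtain adv where adv: "!!s. length (adv s) <= (s + 2) ^ k"
   "!!x Y. verif f (enc_pair (x, adv (length x)), Y) ==> length Y = N (length x) * length x"
   "!!x. x \<in> L \<longleftrightarrow> ~ (EX Y. verif f (enc_pair (x, adv (length x)), Y))"
   by metis
  \<comment> \<open>A witness has length \<open>N s * s\<close> with
    \<open>N s = (s + 2) ^ (b * \<eta>)\<close>, hence the exponent.\<close>
  define p :: "nat poly" where "p = [:2, 1:] ^ (b * \<eta> + 1)"
  define L' where "L' = {w. EX Y. length Y <= poly p (length w) & verif f (w, Y)}"
  have "prod_e raw raw = enc_pair" "bool_e = (%b. [b])" by (auto simp: prod_e_def raw_def bool_e_def fun_eq_iff)
  moreover have "polytime (prod_e raw raw) bool_e (verif f)"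
   using f pt_of_polytime unfolding is_compression_def by (intro polytime_of_pt pt_verif) blast
  ultimately have "polytime enc_pair (%b. [b]) (verif f)" by simp
  then have "L' \<in> NP" unfolding NP_def L'_def by blast
  then have co: "- L' \<in> coNP" by (simp add: coNP_def)
  have "x \<in> L \<longleftrightarrow> enc_pair (x, adv (length x)) \<in> - L'" for x
  proof -
   have "length Y <= poly p (length (enc_pair (x, adv (length x))))" if "verif f (enc_pair (x, adv (length x)), Y)" for Y
   proof -
    have "length Y = (length x + 2) ^ (b * \<eta>) * length x" using adv(2)[OF that] by (simp add: N_def power_mult)
    also have "... <= (length x + 2) ^ (b * \<eta>) * (length x + 2)" by (intro mult_left_mono) auto
    also have "... = (length x + 2) ^ (b * \<eta> + 1)" by simp
    also have "... <= (length (enc_pair (x, adv (length x))) + 2) ^ (b * \<eta> + 1)" by (intro power_mono) auto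
    also have "... = poly p (length (enc_pair (x, adv (length x))))" by (simp add: p_def polyb_poly)
    finally show ?thesis .
   qed
   then show ?thesis using adv(3)[of x] unfolding L'_def by blast
  qed
  moreover have "length (adv s) <= poly ([:2, 1:] ^ k) s" for s using adv(1)[of s] by (simp add: polyb_poly)
  ultimately show "L \<in> with_poly_advice coNP" unfolding with_poly_advice_def using co by blast
qed

subsection \<open>Problems decided by their size\<close>

lemma complete_graph_not_colorable:
  assumes "q < k"
  shows "EX es. ok_inst d l k es [] & ~ yes_instance d q (inst k es [])"
proof -
  define es where "es = [(u, v). u \<leftarrow> [0..<k], v \<leftarrow> [0..<u]]"
  have mem: "(u, v) \<in> set es \<longleftrightarrow> v < u & u < k" for u v by (force simp: es_def)
  have "distinct es" unfolding es_def by (induction k) (auto simp: distinct_map inj_on_def)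
  moreover have "inj_on (%(u, v). {u, v}) (set es)"
   using mem by (auto simp: inj_on_def doubleton_eq_iff)
  ultimately have "ok_inst d l k es []" using mem by (auto simp: ok_inst_def distinct_map)
  moreover have "~ yes_instance d q (inst k es [])"
  proof
   assume "yes_instance d q (inst k es [])"
   then obtain c where c: "ALL v < k. c v \<in> {1..q}" "ALL (u, v):set es. c u ~= c v" unfolding yes_instance_inst by blast
   have "inj_on c {..<k}"
   proof (rule linorder_inj_onI)
    fix u v assume "u < v" "u \<in> {..<k}" "v \<in> {..<k}"
    then have "(v, u) \<in> set es" by (simp add: mem)
    then show "c u ~= c v" using c(2) by fastforce
   qed auto
   moreover have "c ` {..<k} <= {1..q}" using c(1) by auto
   ultimately have "card {..<k} <= card {1..q}" by (rule card_inj_on_le) simp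
   then show False using assms by simp
  qed
  ultimately show ?thesis by blast
qed

text \<open>For large \<open>k\<close> the size bound is below 1, so every input with parameter
  \<open>k\<close> is mapped to \<open>([], 0)\<close>. But for \<open>k > q\<close> the edgeless
  graph is a yes-instance and the complete graph a no-instance.\<close>

lemma no_compression_of_vanishing_size:
  assumes "l >= 1" "q >= 1" "\<epsilon> > 0"
  shows "~ admits_compression_of_size_O (URF_coloring d l q) (%n. real n powr (0 - \<epsilon>))"
proof
  assume "admits_compression_of_size_O (URF_coloring d l q) (%n. real n powr (0 - \<epsilon>))"
  then obtain h Q' f where f: "is_compression (URF_coloring d l q) Q' h f" and h: "(%n. real (h n)) \<in> O(%n. real n powr (0 - \<epsilon>))"
   unfolding admits_compression_of_size_O_def admits_compression_def by blast
  obtain C where C: "C > 0" "eventually (%n. norm (real (h n)) <= C * norm (real n powr (0 - \<epsilon>))) at_top"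
   using landau_o.bigE[OF h] by blast
  have "((%n. C * real n powr (- \<epsilon>)) \<longlongrightarrow> C * 0) at_top"
   using assms(3) by (intro tendsto_intros tendsto_neg_powr filterlim_real_sequentially) simp
  then have "eventually (%n. C * real n powr (- \<epsilon>) < 1) at_top" by (rule order_tendstoD) simp
  from eventually_conj[OF eventually_conj[OF C(2) this] eventually_gt_at_top[of q]]
  obtain k where k: "norm (real (h k)) <= C * norm (real k powr (0 - \<epsilon>))" "C * real k powr (- \<epsilon>) < 1" "q < k"
   by (auto simp: eventually_at_top_linorder)
  then have hk: "h k = 0" by simp
  have fk: "f (x, k) = ([], 0)" for x
  proof -
   have "length (fst (f (x, k))) + snd (f (x, k)) <= h k" using f unfolding is_compression_def by blast
   then show ?thesis using hk by (cases "f (x, k)") simp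
  qed
  have same: "(x, k) \<in> URF_coloring d l q \<longleftrightarrow> (y, k) \<in> URF_coloring d l q" for x y
   using f fk unfolding is_compression_def by metis
  have ok: "ok_inst d l k [] []" by (simp add: ok_inst_def)
  have "yes_instance d q (inst k [] [])" unfolding yes_instance_inst using assms(2) by (intro exI[of _ "%_. 1"]) simp
  then have "(enc_inst k [] [], k) \<in> URF_coloring d l q" using URF_enc_inst[OF assms(1) ok] by simp
  moreover obtain es where "ok_inst d l k es []" "~ yes_instance d q (inst k es [])"
   using complete_graph_not_colorable[OF k(3)] by blast
  then have "(enc_inst k es [], k) \<notin> URF_coloring d l q" using URF_enc_inst[OF assms(1)] by simp
  ultimately show False using same by blast
qed

section \<open>The dichotomy\<close>

lemma card_less_times: "card ({..<a} \<times> {..<b :: nat}) = a * (b :: nat)" for a :: nat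
  by (simp add: card_cartesian_product)

theorem theorem1p6:
  fixes d l q :: nat
  assumes "d \<ge> 1" and "l \<ge> 1" and "q \<ge> 1" and "q \<ge> d"
  shows "URF_admits_kernel_with_O_constraints d l q (\<lambda>n. real n ^ eta d l q) \<and>
    (\<not> NP \<subseteq> with_poly_advice coNP \<longrightarrow>
      (\<forall>\<epsilon>::real. \<epsilon> > 0 \<longrightarrow>
        \<not> admits_compression_of_size_O (URF_coloring d l q)
            (\<lambda>n. real n powr (real (eta d l q) - \<epsilon>))))"
proof -
  have lower: "~ NP <= with_poly_advice coNP --> (ALL \<epsilon>::real. \<epsilon> > 0 -->
     ~ admits_compression_of_size_O (URF_coloring d l q) (%n. real n powr (real \<eta> - \<epsilon>)))"
   if "\<eta> >= 1" "(EX S g. pattern d l q S g & card S = \<eta> &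
     (q >= 3 \<or> (q = 2 & (ALL x:S. snd x = 0 & g x = 2) & (d = 1 & l >= 3 \<or> d = 2 & l >= 2)))) \<or> (\<eta> = 2 & q >= 3)" for \<eta>
   using compression_collapse[OF word_composition[OF _ assms(2) that] that(1)] by blast
  consider (all) "l >= 2" "q >= d + 2" | (but_one) "l >= 2" "q = d + 1" "(d, l) ~= (1, 2)"
   | (full) "(l >= 2 & q = d & d >= 2) \<or> (l = 1 & d >= 3)" | (edges) "l = 1" "d <= 2" "q >= 3"
   | (zero) "(q = 1 & d = 1) \<or> (q = 2 & ((d = 1 & l = 1) \<or> (d = 2 & l = 1) \<or> (d = 1 & l = 2)))"
   using assms by (cases "l = 1"; cases "q = d"; cases "q = d + 1"; force)
  then show ?thesis
  proof cases
   case all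
   have eta: "eta d l q = d * l" using all by (simp add: eta_def)
   have ge: "d * l >= 2" using all(1) assms(1) mult_le_mono[of 1 d 2 l] by simp
   have "card ({..<l} \<times> {..<d}) = d * l" by (simp add: card_less_times mult.commute)
   moreover have "q >= 3" using all(2) assms(1) by linarith
   ultimately have "(EX S g. pattern d l q S g & card S = d * l &
     (q >= 3 \<or> (q = 2 & (ALL x:S. snd x = 0 & g x = 2) & (d = 1 & l >= 3 \<or> d = 2 & l >= 2))))"
    using pattern_all[OF all] by (intro exI conjI disjI1)
   moreover have "URF_admits_kernel_with_O_constraints d l q (%n. real n ^ (d * l))" using ge by (intro kernel_trivial) auto
   moreover have "d * l >= 1" using ge by linarith
   ultimately show ?thesis unfolding eta by (intro conjI lower disjI1)
  next
   case but_one
   have eta: "eta d l q = d * l - 1" using but_one by (auto simp: eta_def)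
   have ge: "d * l - 1 >= 2"
   proof (cases "d = 1")
    case True
    then show ?thesis using but_one by auto
   next
    case False
    then have "2 * 2 <= d * l" using assms but_one by (intro mult_le_mono) auto
    then show ?thesis by simp
   qed
   have "card ({..<l} \<times> {..<d} - {(0, 0)}) = d * l - 1"
    using but_one assms by (subst card_Diff_singleton) (auto simp: card_less_times mult.commute)
   moreover have "q >= 3 \<or> (q = 2 & (ALL x:{..<l} \<times> {..<d} - {(0, 0)}. snd x = 0 & (%(j, i). if j = 0 then 1 else d + 1) x = 2) &
     (d = 1 & l >= 3 \<or> d = 2 & l >= 2))"
   proof (cases "d = 1")
    \<comment> \<open>Here \<open>(d, l) ~= (1, 2)\<close> enters: the not-all-equal gadget for two
      colors needs \<open>l >= 3\<close>.\<close>
    case True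
    then have "l >= 3" "q = 2" using but_one by auto
    then show ?thesis using True two_colors_pattern(1)[OF True, of l] by blast
   qed (use but_one assms in simp)
   ultimately have "(EX S g. pattern d l q S g & card S = d * l - 1 &
     (q >= 3 \<or> (q = 2 & (ALL x:S. snd x = 0 & g x = 2) & (d = 1 & l >= 3 \<or> d = 2 & l >= 2))))"
    using pattern_all_but_one[OF assms(1) but_one(1,2)] by (intro exI conjI)
   moreover have "URF_admits_kernel_with_O_constraints d l q (%n. real n ^ (d * l - 1))"
    unfolding but_one(2) by (rule kernel_some[OF assms(2,1) ge])
   moreover have "d * l - 1 >= 1" using ge by linarith
   ultimately show ?thesis unfolding eta by (intro conjI lower disjI1)
  next
   case full
   have eta: "eta d l q = (d - 1) * l" using full assms by (auto simp: eta_def)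
   have ge: "(d - 1) * l >= 2" using full
   proof
    assume "l >= 2 & q = d & d >= 2"
    then have "1 * 2 <= (d - 1) * l" by (intro mult_le_mono) auto
    then show ?thesis by simp
   qed auto
   have "card ({..<l} \<times> {..<d - 1}) = (d - 1) * l" by (simp add: card_less_times mult.commute)
   moreover have "q >= 3 \<or> (q = 2 & (ALL x:{..<l} \<times> {..<d - 1}. snd x = 0 & (%_. d) x = 2) & (d = 1 & l >= 3 \<or> d = 2 & l >= 2))"
   proof (cases "d = 2")
    case True
    then have "l >= 2" "q = 2" using full by auto
    then show ?thesis using True two_colors_pattern(2)[OF True, of l] by blast
   qed (use full assms in auto)
   ultimately have "(EX S g. pattern d l q S g & card S = (d - 1) * l &
     (q >= 3 \<or> (q = 2 & (ALL x:S. snd x = 0 & g x = 2) & (d = 1 & l >= 3 \<or> d = 2 & l >= 2))))"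
    using pattern_but_last[OF assms(1,4), of l] by (intro exI conjI)
   moreover have "URF_admits_kernel_with_O_constraints d l q (%n. real n ^ ((d - 1) * l))"
    by (rule kernel_full[OF assms(2,1) ge]) (use full in blast)
   moreover have "(d - 1) * l >= 1" using ge by linarith
   ultimately show ?thesis unfolding eta by (intro conjI lower disjI1)
  next
   \<comment> \<open>The tuples are too small to determine the exponent; the lower bound comes from
     the edges.\<close>
   case edges
   have eta: "eta d l q = 2" using edges by (simp add: eta_def)
   have "URF_admits_kernel_with_O_constraints d l q (%n. real n ^ 2)" using edges by (intro kernel_trivial) auto
   then show ?thesis unfolding eta using edges by (intro conjI lower disjI2) auto
  next
   case zero
   have eta: "eta d l q = 0" using zero by (auto simp: eta_def)
   have "URF_admits_kernel_with_O_constraints d l q (%n. real n ^ 0)"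
    using zero kernel_one_color[of l] kernel_two_colors[of d l] assms by (elim disjE) auto
   then show ?thesis unfolding eta using no_compression_of_vanishing_size[OF assms(2,3)] by simp
  qed
qed

end
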